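(* Fix integers $P\ge 1$ and $N_y\ge 1$ and two $P\times P$ real symmetric positive semi-definite matrices $C^{in}$ and $C^{out}$ with all diagonal entries equal to $1$. For integers $N_s, N_x$ with $N_x\ge N_s$, generate random matrices $A_1,\dots,A_P\in\mathbb{R}^{N_x\times N_s}$ and $B_1,\dots,B_P\in\mathbb{R}^{N_y\times N_s}$ as follows: for every index pair $(i,j)$, the vector $(A_{1,ij},\dots,A_{P,ij})^T$ is drawn from $\mathcal{N}(\mathbf{0},\tfrac{1}{N_s}C^{in})$, independently over $(i,j)$; for every index pair $(i,j)$, the vector $(B_{1,ij},\dots,B_{P,ij})^T$ is drawn from $\mathcal{N}(\mathbf{0},\tfrac{1}{N_s}C^{out})$, independently over $(i,j)$ and independently of the $A$'s. Define $W_0=0\in\mathbb{R}^{N_y\times N_x}$ and, for $\mu=1,\dots,P$, $$W_\mu = W_{\mu-1}\,(I-U_\mu U_\mu^T) + B_\mu A_\mu^+,$$ where $A_\mu=U_\mu\Lambda_\mu V_\mu^T$ is a (compact) singular value decomposition of $A_\mu$ (so $U_\mu U_\mu^T$ is the orthogonal projector onto the column space of $A_\mu$) and $A_\mu^+$ is the Moore–Penrose pseudo-inverse; equivalently, $W_\mu$ is the limit of the gradient flow $\tfrac{dW}{dt}=(B_\mu-WA_\mu)A_\mu^T$ started at $W_{\mu-1}$. Let $$\epsilon_f=\frac{1}{N_y}\sum_{\mu=1}^P\left\lVert B_\mu - W_P A_\mu\right\rVert_F^2,\qquad \bar\epsilon_f=\mathbb{E}_{\{A_\mu,B_\mu\}}[\epsilon_f].$$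 Then, in the limit $N_s/N_x\to 0$ (with $P$, $N_y$, $C^{in}$, $C^{out}$ fixed), $\bar\epsilon_f$ asymptotically satisfies $$\bar{\epsilon}_f = \left\lVert (C^{out})^{1/2}\left(I-(I+C^{in,U})^{-1}C^{in}\right)\right\rVert_F^2,$$ where $C^{in,U}$ is the strictly upper-triangular part of $C^{in}$, i.e. $C^{in,U}_{\mu\nu}=C^{in}_{\mu\nu}$ if $\mu<\nu$ and $0$ otherwise, and $(C^{out})^{1/2}$ is the positive semi-definite square root of $C^{out}$.
   Context: This models task-incremental continual learning of $P$ linear regression tasks by a linear network $\mathbf{y}=W\mathbf{x}$: in task $\mu$, a latent $\mathbf{s}\sim\mathcal{N}(0,I_{N_s})$ generates input $\mathbf{x}=A_\mu\mathbf{s}$ and target $\mathbf{y}^*=B_\mu\mathbf{s}$, and the per-task error is $\mathbb{E}_{\mathbf{s}}\lVert\mathbf{y}^*-W\mathbf{x}\rVert^2=\lVert B_\mu-WA_\mu\rVert_F^2$. Tasks are learned in the order $1,2,\dots,P$, each trained to convergence, starting from zero weights. $\lVert\cdot\rVert_F$ is the Frobenius norm. *)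

theory Defs
  imports "HOL-Probability.Probability" "Jordan_Normal_Form.Matrix"
begin

(* All matrices are Jordan_Normal_Form matrices (real mat) with explicit dimensions.
   Tasks and components of P-vectors are indexed 0..P-1 (paper: 1..P). *)

definition frob_sq :: "real mat \<Rightarrow> real" where
  "frob_sq M = (\<Sum>i<dim_row M. \<Sum>j<dim_col M. (M $$ (i,j))^2)"

definition psd :: "real mat \<Rightarrow> bool" where
  "psd M \<longleftrightarrow> M \<in> carrier_mat (dim_row M) (dim_row M) \<and> transpose_mat M = M \<and>
     (\<forall>v \<in> carrier_vec (dim_row M). 0 \<le> v \<bullet> (M *\<^sub>v v))"

definition psd_sqrt :: "real mat \<Rightarrow> real mat" where
  "psd_sqrt M = (THE S. psd S \<and> dim_row S = dim_row M \<and> S * S = M)"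

definition mat_inv :: "real mat \<Rightarrow> real mat" where
  "mat_inv M = (THE X. X \<in> carrier_mat (dim_row M) (dim_row M) \<and>
      M * X = 1\<^sub>m (dim_row M) \<and> X * M = 1\<^sub>m (dim_row M))"

definition pinv :: "real mat \<Rightarrow> real mat" where
  "pinv A = (THE X. X \<in> carrier_mat (dim_col A) (dim_row A) \<and>
      A * X * A = A \<and> X * A * X = X \<and>
      transpose_mat (A * X) = A * X \<and> transpose_mat (X * A) = X * A)"

text \<open>Column space and the orthogonal projector onto it (= U U^T for a compact SVD A = U Lambda V^T).\<close>
definition col_space :: "real mat \<Rightarrow> real vec set" where
  "col_space A = {A *\<^sub>v x | x. x \<in> carrier_vec (dim_col A)}"

definition col_proj :: "real mat \<Rightarrow> real mat" where
  "col_proj A = (THE Q. Q \<in> carrier_mat (dim_row A) (dim_row A) \<and> transpose_mat Q = Q \<and>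
      Q * Q = Q \<and> {Q *\<^sub>v y | y. y \<in> carrier_vec (dim_row A)} = col_space A)"

primrec cl_weights :: "nat \<Rightarrow> nat \<Rightarrow> (nat \<Rightarrow> real mat) \<Rightarrow> (nat \<Rightarrow> real mat) \<Rightarrow> nat \<Rightarrow> real mat" where
  "cl_weights Ny Nx As Bs 0 = 0\<^sub>m Ny Nx"
| "cl_weights Ny Nx As Bs (Suc k) =
     cl_weights Ny Nx As Bs k * (1\<^sub>m Nx - col_proj (As k)) + Bs k * pinv (As k)"

definition final_error :: "nat \<Rightarrow> nat \<Rightarrow> nat \<Rightarrow> (nat \<Rightarrow> real mat) \<Rightarrow> (nat \<Rightarrow> real mat) \<Rightarrow> real" where
  "final_error P Ny Nx As Bs =
     (1 / real Ny) * (\<Sum>\<mu><P. frob_sq (Bs \<mu> - cl_weights Ny Nx As Bs P * As \<mu>))"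

text \<open>Multivariate normal N(0, Sigma) on R^n (vectors as functions on {..<n}), defined as the
  law of Sigma^(1/2) Z with Z a vector of n i.i.d. standard normals (covers singular Sigma).\<close>
definition mvnormal :: "nat \<Rightarrow> real mat \<Rightarrow> (nat \<Rightarrow> real) measure" where
  "mvnormal n \<Sigma> = distr (PiM {..<n} (\<lambda>_. std_normal_distribution)) (PiM {..<n} (\<lambda>_. borel))
      (\<lambda>z. \<lambda>i\<in>{..<n}. \<Sum>k<n. psd_sqrt \<Sigma> $$ (i,k) * z k)"

text \<open>Joint law of the task matrices: a(i,j) = (A_{1,ij},...,A_{P,ij}) i.i.d. over (i,j) with law
  N(0, C_in / Ns); b(i,j) likewise with C_out; the two families independent.\<close>
definition task_law :: "nat \<Rightarrow> nat \<Rightarrow> nat \<Rightarrow> nat \<Rightarrow> real mat \<Rightarrow> real mat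
    \<Rightarrow> ((nat \<times> nat \<Rightarrow> nat \<Rightarrow> real) \<times> (nat \<times> nat \<Rightarrow> nat \<Rightarrow> real)) measure" where
  "task_law P Ny Ns Nx Cin Cout =
     PiM ({..<Nx} \<times> {..<Ns}) (\<lambda>_. mvnormal P ((1 / real Ns) \<cdot>\<^sub>m Cin))
     \<Otimes>\<^sub>M PiM ({..<Ny} \<times> {..<Ns}) (\<lambda>_. mvnormal P ((1 / real Ns) \<cdot>\<^sub>m Cout))"

definition task_mat :: "nat \<Rightarrow> nat \<Rightarrow> (nat \<times> nat \<Rightarrow> nat \<Rightarrow> real) \<Rightarrow> nat \<Rightarrow> real mat" where
  "task_mat nr nc a \<mu> = mat nr nc (\<lambda>(i,j). a (i,j) \<mu>)"

definition mean_final_error :: "nat \<Rightarrow> nat \<Rightarrow> nat \<Rightarrow> nat \<Rightarrow> real mat \<Rightarrow> real mat \<Rightarrow> real" where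
  "mean_final_error P Ny Ns Nx Cin Cout =
     (\<integral>ab. final_error P Ny Nx (task_mat Nx Ns (fst ab)) (task_mat Ny Ns (snd ab))
        \<partial>task_law P Ny Ns Nx Cin Cout)"

definition strict_upper :: "real mat \<Rightarrow> real mat" where
  "strict_upper C = mat (dim_row C) (dim_col C) (\<lambda>(i,j). if i < j then C $$ (i,j) else 0)"

end

theory Submission
  imports Defs "Jordan_Normal_Form.Determinant" "HOL-Real_Asymp.Real_Asymp"
begin

text \<open>Write \<open>Q\<^sub>\<kappa>\<close> for the projector onto the column space of \<open>A\<^sub>\<kappa>\<close>. The expectation over the \<open>B\<close>'s is a quadratic form
  in the matrices \<open>R\<^sub>\<nu>\<^sub>\<mu> = \<delta>\<^sub>\<nu>\<^sub>\<mu> - A\<^sub>\<nu>\<^sup>+ (\<Prod>\<^sub>\<kappa>\<^sub>>\<^sub>\<nu> (1 - Q\<^sub>\<kappa>)) A\<^sub>\<mu>\<close>. If \<open>Q\<^sub>\<kappa> A\<^sub>\<lambda>\<close> were exactly \<open>C\<^sub>\<kappa>\<^sub>\<lambda> A\<^sub>\<kappa>\<close>, then backward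
  recursion over the tasks would make \<open>R\<^sub>\<nu>\<^sub>\<mu>\<close> the scalar matrix with the \<open>(\<nu>,\<mu>)\<close> entry of
  \<open>1 - (1 + C\<^sup>U)\<^sup>-\<^sup>1 C\<close>. The defects \<open>Q\<^sub>\<kappa> (A\<^sub>\<lambda> - C\<^sub>\<kappa>\<^sub>\<lambda> A\<^sub>\<kappa>)\<close> are projections, onto a space of dimension at most \<open>N\<^sub>s\<close>, of
  a Gaussian matrix independent of \<open>A\<^sub>\<kappa>\<close>, and they reach \<open>R\<^sub>\<nu>\<^sub>\<mu>\<close> through contractions and \<open>A\<^sub>\<nu>\<^sup>+\<close> only. By
  Cauchy--Schwarz the normalised error is thus controlled by the fourth moments of the defects and the second
  moment of the inverse Gram matrices \<open>(A\<^sub>\<nu>\<^sup>T A\<^sub>\<nu>)\<^sup>-\<^sup>1\<close>, and it is of order \<open>N\<^sub>s / N\<^sub>x\<close>. The inverse moments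
  are bounded without the Wishart density: Gaussian integration by parts bounds the mean of the resolvent, and
  splitting the rows into two independent halves reduces the second moment to the first.\<close>

section \<open>Frobenius inner product and contractions\<close>

text \<open>\<open>Ns\<close> may stay bounded or grow along the sequence, so every estimate has to
  be uniform in it, and this dictates the norms. With entries of variance \<open>1/Ns\<close> the
  inverse Gram matrix has size \<open>Ns/Nx\<close> in each of \<open>Ns\<close> directions, and a
  defect has size one in each of them. Bounding the squared norm of pseudo-inverse times defect by
  the product of their squared Frobenius norms would lose a factor \<open>Ns\<close>; pairing the
  Frobenius norms of their Gram matrices gives \<open>Ns^2/Nx\<close>, and dividing by the squared
  norm \<open>Ns\<close> of the identity leaves \<open>Ns/Nx\<close>. The second obstacle is that
  inverse and pseudo-inverse are unbounded and discontinuous. The resolvent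
  \<open>(G + \<delta>)^-1\<close> is smooth, bounded and measurable, and \<delta> tends to 0 only
  after moment bounds that are uniform in \<delta>. Integration by parts closes because the
  derivative terms reproduce the resolvent itself, at the price of \<open>Ns + 1\<close> rows. The
  cross terms of the quadratic form are linear in the deviation from scalar matrices, so the rate
  finally obtained is the square root of \<open>Ns/Nx\<close>.\<close>

definition fip :: "real mat \<Rightarrow> real mat \<Rightarrow> real" where
  "fip A B = (\<Sum>i<dim_row A. \<Sum>j<dim_col A. A $$ (i,j) * B $$ (i,j))"

lemma index_mat_mult:
  "i < dim_row A \<Longrightarrow> j < dim_col B \<Longrightarrow> dim_col A = dim_row B \<Longrightarrow>
    (A * B) $$ (i,j) = (\<Sum>k<dim_col A. A $$ (i,k) * B $$ (k,j))"
  by (simp add: scalar_prod_def atLeast0LessThan)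

lemma fip_self: "fip A A = frob_sq A"
  by (simp add: fip_def frob_sq_def power2_eq_square)

lemma fip_one_one: "fip (1\<^sub>m m) (1\<^sub>m m) = real m"
proof -
  have "fip (1\<^sub>m m) (1\<^sub>m m) = (\<Sum>i<m. \<Sum>j<m. if j = i then 1 else 0)"
    unfolding fip_def by (auto intro!: sum.cong simp del: sum.delta)
  then show ?thesis by simp
qed

lemma frob_sq_nonneg [simp]: "0 \<le> frob_sq A"
  by (simp add: frob_sq_def sum_nonneg)

lemma fip_transpose: "A \<in> carrier_mat n m \<Longrightarrow> B \<in> carrier_mat n m \<Longrightarrow>
    fip (transpose_mat A) (transpose_mat B) = fip A B"
  unfolding fip_def by (simp, subst sum.swap, simp)

lemma fip_comm: "A \<in> carrier_mat n m \<Longrightarrow> B \<in> carrier_mat n m \<Longrightarrow> fip A B = fip B A"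
  by (auto simp: fip_def mult.commute)

lemma fip_add_left: "A \<in> carrier_mat n m \<Longrightarrow> B \<in> carrier_mat n m \<Longrightarrow>
    fip (A + B) C = fip A C + fip B C"
  by (simp add: fip_def sum.distrib algebra_simps)

lemma fip_add_right: "A \<in> carrier_mat n m \<Longrightarrow> B \<in> carrier_mat n m \<Longrightarrow> C \<in> carrier_mat n m \<Longrightarrow>
    fip A (B + C) = fip A B + fip A C"
  by (simp add: fip_def sum.distrib algebra_simps)

lemma fip_minus_left: "A \<in> carrier_mat n m \<Longrightarrow> B \<in> carrier_mat n m \<Longrightarrow>
    fip (A - B) C = fip A C - fip B C"
  by (simp add: fip_def sum_subtractf algebra_simps)

lemma fip_minus_right: "A \<in> carrier_mat n m \<Longrightarrow> B \<in> carrier_mat n m \<Longrightarrow> C \<in> carrier_mat n m \<Longrightarrow>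
    fip A (B - C) = fip A B - fip A C"
  by (simp add: fip_def sum_subtractf algebra_simps)

lemma fip_smult_left: "fip (c \<cdot>\<^sub>m A) B = c * fip A B"
  by (simp add: fip_def sum_distrib_left mult.assoc)

lemma fip_smult_right: "A \<in> carrier_mat n m \<Longrightarrow> B \<in> carrier_mat n m \<Longrightarrow> fip A (c \<cdot>\<^sub>m B) = c * fip A B"
  by (simp add: fip_def sum_distrib_left mult.left_commute)

text \<open>\<open>fip A B\<close> is the trace of the transpose of A times B; this and
  \<open>fip_mult_right\<close> are cyclicity of the trace, and they move factors between the two
  slots.\<close>

lemma fip_mult_left:
  assumes "A \<in> carrier_mat n k" "B \<in> carrier_mat k m" "C \<in> carrier_mat n m"
  shows "fip (A * B) C = fip B (transpose_mat A * C)"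
proof -
  have "fip (A * B) C = (\<Sum>i<n. \<Sum>j<m. \<Sum>l<k. A $$ (i,l) * B $$ (l,j) * C $$ (i,j))"
    using assms by (simp add: fip_def scalar_prod_def atLeast0LessThan sum_distrib_right)
  also have "\<dots> = (\<Sum>l<k. \<Sum>j<m. \<Sum>i<n. A $$ (i,l) * B $$ (l,j) * C $$ (i,j))"
    by (subst sum.swap, subst (2) sum.swap, subst sum.swap) (rule refl)
  also have "\<dots> = fip B (transpose_mat A * C)"
    using assms by (simp add: fip_def scalar_prod_def atLeast0LessThan sum_distrib_left mult_ac)
  finally show ?thesis .
qed

lemma fip_mult_right:
  assumes "A \<in> carrier_mat n k" "B \<in> carrier_mat k m" "C \<in> carrier_mat n m"
  shows "fip (A * B) C = fip A (C * transpose_mat B)"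
proof -
  have "fip (A * B) C = fip (transpose_mat B * transpose_mat A) (transpose_mat C)"
    using assms by (metis fip_transpose mult_carrier_mat transpose_mult)
  also have "\<dots> = fip (transpose_mat A) (B * transpose_mat C)"
    using assms fip_mult_left[of "transpose_mat B" m k "transpose_mat A" n "transpose_mat C"] by simp
  also have "\<dots> = fip A (transpose_mat (B * transpose_mat C))"
    using assms by (metis fip_transpose mult_carrier_mat transpose_carrier_mat transpose_transpose)
  also have "transpose_mat (B * transpose_mat C) = C * transpose_mat B"
    using assms transpose_mult[of B k m "transpose_mat C" n] by simp
  finally show ?thesis .
qed

lemma fip_Cauchy_Schwarz:
  assumes "A \<in> carrier_mat n m" "B \<in> carrier_mat n m"
  shows "(fip A B)\<^sup>2 \<le> frob_sq A * frob_sq B"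
proof -
  have "(\<Sum>p\<in>{..<n}\<times>{..<m}. A $$ p * B $$ p)\<^sup>2
      \<le> (\<Sum>p\<in>{..<n}\<times>{..<m}. (A $$ p)\<^sup>2) * (\<Sum>p\<in>{..<n}\<times>{..<m}. (B $$ p)\<^sup>2)"
    by (rule Cauchy_Schwarz_ineq_sum)
  then show ?thesis
    using assms by (simp add: fip_def frob_sq_def sum.cartesian_product case_prod_unfold)
qed

lemma frob_sq_add:
  assumes "A \<in> carrier_mat n m" "B \<in> carrier_mat n m"
  shows "frob_sq (A + B) = frob_sq A + 2 * fip A B + frob_sq B"
  using assms by (simp add: fip_self[symmetric] fip_add_left[of _ n m] fip_add_right[of _ n m] fip_comm[of B n m A])

lemma frob_sq_smult: "frob_sq (c \<cdot>\<^sub>m A) = c\<^sup>2 * frob_sq A"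
  by (simp add: frob_sq_def sum_distrib_left power_mult_distrib)

lemma sqrt_frob_add:
  assumes "A \<in> carrier_mat n m" "B \<in> carrier_mat n m"
  shows "sqrt (frob_sq (A + B)) \<le> sqrt (frob_sq A) + sqrt (frob_sq B)"
proof (rule real_le_lsqrt)
  have "fip A B \<le> sqrt (frob_sq A) * sqrt (frob_sq B)"
    using fip_Cauchy_Schwarz[OF assms] by (metis real_le_rsqrt real_sqrt_mult)
  then show "frob_sq (A + B) \<le> (sqrt (frob_sq A) + sqrt (frob_sq B))\<^sup>2"
    using assms by (simp add: frob_sq_add power2_sum)
qed simp

section \<open>Positive semidefinite matrices and the trace form\<close>

lemma psd_iff: "M \<in> carrier_mat n n \<Longrightarrow> psd M \<longleftrightarrow>
    transpose_mat M = M \<and> (\<forall>v \<in> carrier_vec n. 0 \<le> v \<bullet> (M *\<^sub>v v))"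
  unfolding psd_def by auto

lemma gram_scalar_prod: "B \<in> carrier_mat k n \<Longrightarrow> v \<in> carrier_vec n \<Longrightarrow>
    v \<bullet> ((transpose_mat B * B) *\<^sub>v v) = (B *\<^sub>v v) \<bullet> (B *\<^sub>v v)" for v :: "real vec"
  by (metis assoc_mult_mat_vec mult_mat_vec_carrier transpose_carrier_mat transpose_transpose
      transpose_vec_mult_scalar)

lemma scalar_prod_self_nonneg: "0 \<le> v \<bullet> (v :: real vec)"
  by (simp add: scalar_prod_def sum_nonneg)

lemma scalar_prod_self_zero: "(v \<bullet> v = 0) = (v = 0\<^sub>v n)" if "v \<in> carrier_vec n" for v :: "real vec"
proof
  assume "v \<bullet> v = 0"
  then have "\<forall>i\<in>{0..<n}. v $ i * v $ i = 0"
    using that by (subst (asm) scalar_prod_def, subst (asm) sum_nonneg_eq_0_iff) auto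
  then show "v = 0\<^sub>v n" using that by auto
qed (use that in simp)

lemma psd_gram: "psd (transpose_mat B * B)" for B :: "real mat"
proof -
  have B: "B \<in> carrier_mat (dim_row B) (dim_col B)" by simp
  show ?thesis
    unfolding psd_iff[OF mult_carrier_mat[OF transpose_carrier_mat[THEN iffD2, OF B] B]]
    using gram_scalar_prod[OF B] scalar_prod_self_nonneg transpose_mult[of "transpose_mat B" _ _ B] B
    by (metis transpose_carrier_mat transpose_transpose)
qed

lemma psd_add:
  assumes "M \<in> carrier_mat n n" "N \<in> carrier_mat n n" "psd M" "psd N"
  shows "psd (M + N)"
proof -
  have "v \<bullet> ((M + N) *\<^sub>v v) = v \<bullet> (M *\<^sub>v v) + v \<bullet> (N *\<^sub>v v)" if "v \<in> carrier_vec n" for v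
    using assms that by (simp add: add_mult_distrib_mat_vec[of _ n n] scalar_prod_add_distrib[of _ n])
  then show ?thesis
    using assms by (auto simp: psd_iff[of _ n] transpose_add[of _ n n])
qed

lemma psd_smult:
  assumes "M \<in> carrier_mat n n" "psd M" "0 \<le> c"
  shows "psd (c \<cdot>\<^sub>m M)"
proof -
  have "v \<bullet> ((c \<cdot>\<^sub>m M) *\<^sub>v v) = c * (v \<bullet> (M *\<^sub>v v))" if "v \<in> carrier_vec n" for v
  proof -
    have "(c \<cdot>\<^sub>m M) *\<^sub>v v = c \<cdot>\<^sub>v (M *\<^sub>v v)"
      using assms that by (intro eq_vecI) (auto simp: row_smult)
    then show ?thesis using assms that by simp
  qed
  moreover have "transpose_mat (c \<cdot>\<^sub>m M) = c \<cdot>\<^sub>m transpose_mat M"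
    by (intro eq_matI) auto
  ultimately show ?thesis
    using assms by (auto simp: psd_iff[of _ n])
qed

lemma psd_one: "psd (1\<^sub>m n)"
  by (auto simp: psd_iff[of _ n] scalar_prod_self_nonneg)

text \<open>Expanded along the rows of B, the pairing is a sum of values of the quadratic form of D
  at these rows. This is how Loewner inequalities become inequalities between numbers.\<close>

lemma fip_psd_gram:
  assumes D: "D \<in> carrier_mat n n" "psd D" and B: "B \<in> carrier_mat k n"
  shows "0 \<le> fip D (transpose_mat B * B)"
proof -
  have sym: "transpose_mat D = D" using D by (simp add: psd_iff)
  have "fip D (transpose_mat B * B) = fip (transpose_mat B * B) D"
    using D B by (intro fip_comm[of _ n n]) auto
  also have "\<dots> = fip B (B * D)"
    using fip_mult_left[of "transpose_mat B" n k B n D] D B by simp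
  also have "\<dots> = (\<Sum>i<k. row B i \<bullet> (D *\<^sub>v row B i))"
  proof -
    have "(\<Sum>j<n. B $$ (i,j) * (B * D) $$ (i,j)) = row B i \<bullet> (D *\<^sub>v row B i)" if "i < k" for i
    proof -
      have "(B * D) $$ (i,j) = (D *\<^sub>v row B i) $ j" if "j < n" for j
      proof -
        have "(B * D) $$ (i,j) = row B i \<bullet> col D j" using B D \<open>i < k\<close> \<open>j < n\<close> by simp
        also have "col D j = row D j" using sym D \<open>j < n\<close> by (metis carrier_matD(2) row_transpose)
        finally show ?thesis using B D \<open>i < k\<close> \<open>j < n\<close> by (simp add: comm_scalar_prod[of _ n])
      qed
      then show ?thesis using B D that by (simp add: scalar_prod_def atLeast0LessThan)
    qed
    then show ?thesis using B by (simp add: fip_def)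
  qed
  also have "\<dots> \<ge> 0"
    using D B by (intro sum_nonneg) (auto simp: psd_iff[of _ n])
  finally show ?thesis .
qed

text \<open>By cyclicity the left side pairs the Gram matrix of A with
  \<open>B * transpose_mat B\<close>, and Cauchy--Schwarz splits the pair. The matrices on the right
  are those whose moments are available: the inverse Gram matrix of the data and the Gram matrix of
  a defect.\<close>

lemma frob_sq_mult_le:
  assumes A: "A \<in> carrier_mat n k" and B: "B \<in> carrier_mat k m"
  shows "frob_sq (A * B) \<le> sqrt (frob_sq (A * transpose_mat A)) * sqrt (frob_sq (transpose_mat B * B))"
proof -
  \<comment> \<open>Both sides are the trace of the square of \<open>transpose_mat C * C\<close>;
    this exchanges the two Gram matrices of C.\<close>
  have gram: "frob_sq (transpose_mat C * C) = frob_sq (C * transpose_mat C)"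
    if C: "C \<in> carrier_mat p q" for C p q
  proof -
    have "frob_sq (transpose_mat C * C) = fip C (C * (transpose_mat C * C))"
      using fip_mult_left[of "transpose_mat C" q p C q "transpose_mat C * C"] C by (simp add: fip_self)
    also have "\<dots> = fip ((C * transpose_mat C) * C) C"
      using C by (subst fip_comm[of _ p q]) auto
    also have "\<dots> = frob_sq (C * transpose_mat C)"
      using fip_mult_right[of "C * transpose_mat C" p p C q C] C by (simp add: fip_self)
    finally show ?thesis .
  qed
  have "frob_sq (A * B) = fip B (transpose_mat A * (A * B))"
    using fip_mult_left[OF A B, of "A * B"] A B by (simp add: fip_self)
  also have "\<dots> = fip ((transpose_mat A * A) * B) B"
    using A B by (subst fip_comm[of _ k m]) auto
  also have "\<dots> = fip (transpose_mat A * A) (B * transpose_mat B)"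
    using fip_mult_right[of "transpose_mat A * A" k k B m B] A B by simp
  also have "\<dots> \<le> sqrt (frob_sq (transpose_mat A * A) * frob_sq (B * transpose_mat B))"
    using fip_Cauchy_Schwarz[of "transpose_mat A * A" k k "B * transpose_mat B"] A B
    by (intro real_le_rsqrt) auto
  finally show ?thesis using gram[OF A] gram[OF B] by (simp add: real_sqrt_mult)
qed

section \<open>Contractions: operator norm at most one, expressed on vectors\<close>

definition contraction :: "nat \<Rightarrow> real mat \<Rightarrow> bool" where
  "contraction n T \<longleftrightarrow> T \<in> carrier_mat n n \<and>
     (\<forall>v \<in> carrier_vec n. (T *\<^sub>v v) \<bullet> (T *\<^sub>v v) \<le> v \<bullet> v)"

lemma contraction_one: "contraction n (1\<^sub>m n)"
  by (simp add: contraction_def)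

lemma contraction_mult: "contraction n S \<Longrightarrow> contraction n T \<Longrightarrow> contraction n (S * T)"
  unfolding contraction_def
  by (smt (verit) assoc_mult_mat_vec mult_carrier_mat mult_mat_vec_carrier)

text \<open>Pythagoras: v is the sum of the orthogonal vectors \<open>Q *\<^sub>v v\<close> and its
  complement, so dropping the first cannot lengthen it.\<close>

lemma contraction_complement:
  assumes "Q \<in> carrier_mat n n" "transpose_mat Q = Q" "Q * Q = Q"
  shows "contraction n (1\<^sub>m n - Q)"
  unfolding contraction_def
proof (intro conjI ballI)
  fix v :: "real vec" assume v: "v \<in> carrier_vec n"
  define w where "w = Q *\<^sub>v v"
  have w: "w \<in> carrier_vec n" using assms v by (auto simp: w_def)
  have "w \<bullet> w = v \<bullet> w"
    using gram_scalar_prod[OF assms(1) v] assms by (simp add: w_def)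
  moreover have "(1\<^sub>m n - Q) *\<^sub>v v = v - w"
    using assms v by (simp add: w_def minus_mult_distrib_mat_vec[of _ n n])
  moreover have "(v - w) \<bullet> (v - w) = v \<bullet> v - 2 * (v \<bullet> w) + w \<bullet> w"
    using v w by (simp add: minus_scalar_prod_distrib[of _ n] scalar_prod_minus_distrib[of _ n] comm_scalar_prod[of w n v])
  ultimately show "((1\<^sub>m n - Q) *\<^sub>v v) \<bullet> ((1\<^sub>m n - Q) *\<^sub>v v) \<le> v \<bullet> v"
    using scalar_prod_self_nonneg[of w] by simp
qed (use assms in auto)

text \<open>A contraction lowers the Gram matrix in the Loewner order, and the Frobenius norm is
  monotone there: for X below Y, \<open>frob_sq X \<le> fip Y X\<close> and
  \<open>fip X Y \<le> frob_sq Y\<close>. This allows products of complementary projectors to be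
  dropped from the error terms.\<close>

lemma frob_sq_gram_contraction:
  assumes T: "contraction n T" and R: "R \<in> carrier_mat n m"
  shows "frob_sq (transpose_mat (T * R) * (T * R)) \<le> frob_sq (transpose_mat R * R)"
proof -
  have Tc: "T \<in> carrier_mat n n" using T by (simp add: contraction_def)
  define X where "X = transpose_mat (T * R) * (T * R)"
  define Y where "Y = transpose_mat R * R"
  have X: "X \<in> carrier_mat m m" and Y: "Y \<in> carrier_mat m m" using Tc R by (auto simp: X_def Y_def)
  have psdX: "psd X" and psdY: "psd Y" by (auto simp: X_def Y_def psd_gram)
  have *: "0 \<le> v \<bullet> ((Y - X) *\<^sub>v v)" if v: "v \<in> carrier_vec m" for v
  proof -
    have "v \<bullet> ((Y - X) *\<^sub>v v) = v \<bullet> (Y *\<^sub>v v) - v \<bullet> (X *\<^sub>v v)"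
      using X Y v by (simp add: minus_mult_distrib_mat_vec[of _ m m] scalar_prod_minus_distrib[of _ m])
    moreover have "v \<bullet> (X *\<^sub>v v) = (T *\<^sub>v (R *\<^sub>v v)) \<bullet> (T *\<^sub>v (R *\<^sub>v v))"
      unfolding X_def using gram_scalar_prod[of "T * R" n m v] Tc R v by simp
    moreover have "v \<bullet> (Y *\<^sub>v v) = (R *\<^sub>v v) \<bullet> (R *\<^sub>v v)"
      unfolding Y_def using gram_scalar_prod[OF R v] .
    ultimately show ?thesis using T R v by (auto simp: contraction_def)
  qed
  have "transpose_mat (Y - X) = Y - X"
    unfolding transpose_minus[OF Y X] using psdX psdY psd_iff[OF X] psd_iff[OF Y] by metis
  then have D: "psd (Y - X)"
    using psd_iff[OF minus_carrier_mat[OF X], of Y] * by metis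
  have "0 \<le> fip (Y - X) X"
    using fip_psd_gram[OF minus_carrier_mat[OF X] D mult_carrier_mat[OF Tc R]] unfolding X_def[symmetric] .
  then have 1: "frob_sq X \<le> fip Y X" using X Y by (simp add: fip_minus_left[of _ m m] fip_self)
  have "0 \<le> fip (Y - X) Y"
    using fip_psd_gram[OF minus_carrier_mat[OF X] D R] unfolding Y_def[symmetric] .
  then have 2: "fip X Y \<le> frob_sq Y" using X Y by (simp add: fip_minus_left[of _ m m] fip_self)
  show ?thesis using 1 2 fip_comm[OF X Y] unfolding X_def[symmetric] Y_def[symmetric] by linarith
qed

section \<open>Orthogonal projectors and the pseudo-inverse\<close>

lemma mat_assoc: "dim_col A = dim_row B \<Longrightarrow> dim_col B = dim_row C \<Longrightarrow> A * B * C = A * (B * C)"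
  for A B C :: "real mat"
  by (rule assoc_mult_mat[of _ "dim_row A" "dim_col A" _ "dim_col B" _ "dim_col C"]) auto

lemma transpose_mult': "dim_col A = dim_row B \<Longrightarrow>
    transpose_mat (A * B) = transpose_mat B * transpose_mat A" for A B :: "real mat"
  by (rule transpose_mult[of _ "dim_row A" "dim_col A" _ "dim_col B"]) auto

section \<open>Rank-one matrices, and matrix identities checked on vectors\<close>

definition outer :: "real vec \<Rightarrow> real vec \<Rightarrow> real mat" where
  "outer u v = mat (dim_vec u) (dim_vec v) (\<lambda>(i,j). u $ i * v $ j)"

lemma outer_carrier [simp]: "u \<in> carrier_vec n \<Longrightarrow> v \<in> carrier_vec m \<Longrightarrow> outer u v \<in> carrier_mat n m"
  by (auto simp: outer_def)

lemma dim_outer [simp]: "dim_row (outer u v) = dim_vec u" "dim_col (outer u v) = dim_vec v"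
  by (auto simp: outer_def)

lemma index_outer [simp]: "i < dim_vec u \<Longrightarrow> j < dim_vec v \<Longrightarrow> outer u v $$ (i,j) = u $ i * v $ j"
  by (auto simp: outer_def)

lemma transpose_outer: "transpose_mat (outer u v) = outer v u"
  by (intro eq_matI) (auto simp: mult.commute)

lemma mult_outer: "A \<in> carrier_mat n m \<Longrightarrow> u \<in> carrier_vec m \<Longrightarrow> A * outer u v = outer (A *\<^sub>v u) v"
  by (intro eq_matI) (auto simp: scalar_prod_def sum_distrib_right mult.assoc)

lemma outer_mult_vec: "v \<in> carrier_vec m \<Longrightarrow> x \<in> carrier_vec m \<Longrightarrow>
    outer u v *\<^sub>v x = (v \<bullet> x) \<cdot>\<^sub>v u"
  by (intro eq_vecI) (auto simp: scalar_prod_def sum_distrib_left mult_ac sum_distrib_right)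

lemma smult_mult_mat_vec: "x \<in> carrier_vec (dim_col A) \<Longrightarrow> (c \<cdot>\<^sub>m A) *\<^sub>v x = c \<cdot>\<^sub>v (A *\<^sub>v x)"
  for A :: "real mat"
  by (intro eq_vecI) (auto simp: row_smult)

lemma mat_eq_by_vec:
  assumes "A \<in> carrier_mat n m" "B \<in> carrier_mat n m" "\<And>v. v \<in> carrier_vec m \<Longrightarrow> A *\<^sub>v v = B *\<^sub>v v"
  shows "A = (B :: real mat)"
proof (intro eq_matI)
  fix i j assume ij: "i < dim_row B" "j < dim_col B"
  have "C $$ (i,j) = (C *\<^sub>v unit_vec m j) $ i" if "C \<in> carrier_mat n m" for C :: "real mat"
    using that ij assms by (simp add: scalar_prod_right_unit)
  then show "A $$ (i,j) = B $$ (i,j)"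
    using assms by (metis unit_vec_carrier)
qed (use assms in auto)

lemma col_mult_vec: "A \<in> carrier_mat n m \<Longrightarrow> B \<in> carrier_mat m k \<Longrightarrow> j < k \<Longrightarrow>
    col (A * B) j = A *\<^sub>v col B j" for A :: "real mat"
  by (intro eq_vecI) auto

text \<open>Gram--Schmidt on the columns: \<open>W\<close> is chosen so that \<open>A * W\<close> is the orthogonal projector
  onto the span of the columns treated so far.\<close>

lemma partial_projector:
  fixes A :: "real mat"
  assumes A: "A \<in> carrier_mat n m" and "k \<le> m"
  shows "\<exists>W \<in> carrier_mat m n. transpose_mat (A * W) = A * W \<and> (A * W) * (A * W) = A * W \<and>
    (\<forall>j<k. (A * W) *\<^sub>v col A j = col A j)"
  using \<open>k \<le> m\<close>
proof (induction k)
  case 0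
  have "A * 0\<^sub>m m n = 0\<^sub>m n n" using A by simp
  then show ?case
    by (intro bexI[of _ "0\<^sub>m m n"]) auto
next
  case (Suc k)
  then obtain W where W: "W \<in> carrier_mat m n" and sym: "transpose_mat (A * W) = A * W"
    and idem: "(A * W) * (A * W) = A * W" and fix_cols: "\<And>j. j < k \<Longrightarrow> (A * W) *\<^sub>v col A j = col A j"
    by auto
  define Q where "Q = A * W"
  define a where "a = col A k"
  define r where "r = a - Q *\<^sub>v a"
  have Q: "Q \<in> carrier_mat n n" and a: "a \<in> carrier_vec n"
    using A W by (auto simp: Q_def a_def)
  have r: "r \<in> carrier_vec n" using Q a by (simp add: r_def)
  show ?case
  proof (cases "r = 0\<^sub>v n")
    \<comment> \<open>The new column already lies in the range of Q, so W is kept.\<close>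
    case True
    have "Q *\<^sub>v a = a"
    proof (intro eq_vecI)
      fix i assume "i < dim_vec a"
      then have "r $ i = 0" using True a by auto
      then show "(Q *\<^sub>v a) $ i = a $ i" using Q a \<open>i < dim_vec a\<close> by (simp add: r_def)
    qed (use Q a in auto)
    then show ?thesis
      using W sym idem fix_cols by (intro bexI[of _ W]) (auto simp: Q_def a_def less_Suc_eq)
  next
    case False
    define c where "c = 1 / (r \<bullet> r)"
    have rr: "r \<bullet> r \<noteq> 0" using False scalar_prod_self_zero[OF r] by simp
    \<comment> \<open>A maps \<open>unit_vec m k - W *\<^sub>v a\<close> to the residual r, so this
      update of W adds to Q the orthogonal projector onto the line of r; c normalises it.\<close>
    define W' where "W' = W + c \<cdot>\<^sub>m outer (unit_vec m k - W *\<^sub>v a) r"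
    define Q' where "Q' = Q + c \<cdot>\<^sub>m outer r r"
    have Q': "Q' \<in> carrier_mat n n" using Q r by (simp add: Q'_def)
    have W': "W' \<in> carrier_mat m n" using W a r by (simp add: W'_def)
    have vc: "unit_vec m k - W *\<^sub>v a \<in> carrier_vec m" using W a by simp
    have "A *\<^sub>v unit_vec m k = a"
      using A \<open>Suc k \<le> m\<close> by (intro eq_vecI) (auto simp: a_def)
    then have "A *\<^sub>v (unit_vec m k - W *\<^sub>v a) = r"
      using A W a by (simp add: mult_minus_distrib_mat_vec[of _ n m] r_def Q_def assoc_mult_mat_vec[of _ n m _ n])
    then have AW': "A * W' = Q'"
      using A W vc r by (simp add: W'_def Q'_def Q_def mult_add_distrib_mat[of _ n m _ n]
          mult_smult_distrib[of _ n m _ n] mult_outer[of _ n m])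
    have Qr: "Q *\<^sub>v r = 0\<^sub>v n"
      using Q a idem by (simp add: r_def mult_minus_distrib_mat_vec[of _ n n]
          assoc_mult_mat_vec[symmetric, of _ n n _ n] Q_def[symmetric])
    have symv: "(Q *\<^sub>v x) \<bullet> y = x \<bullet> (Q *\<^sub>v y)" if "x \<in> carrier_vec n" "y \<in> carrier_vec n" for x y
      using transpose_vec_mult_scalar[of Q n n y x] Q sym that by (simp add: Q_def)
    have ra: "r \<bullet> a = r \<bullet> r"
    proof -
      have "r \<bullet> (Q *\<^sub>v a) = 0" using symv[OF r a] Qr a by simp
      moreover have "r \<bullet> r = r \<bullet> a - r \<bullet> (Q *\<^sub>v a)"
        using r a Q by (subst (2) r_def) (simp add: scalar_prod_minus_distrib[of _ n])
      ultimately show ?thesis by simp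
    qed
    have Q'v: "Q' *\<^sub>v x = Q *\<^sub>v x + (c * (r \<bullet> x)) \<cdot>\<^sub>v r" if "x \<in> carrier_vec n" for x
      using Q r that by (simp add: Q'_def add_mult_distrib_mat_vec[of _ n n] smult_mult_mat_vec
          outer_mult_vec[of _ n] smult_smult_assoc)
    have "transpose_mat Q' = Q'"
    proof -
      have "transpose_mat (c \<cdot>\<^sub>m outer r r) = c \<cdot>\<^sub>m outer r r" by (intro eq_matI) auto
      then show ?thesis using Q r sym by (simp add: Q'_def transpose_add[of _ n n] Q_def[symmetric])
    qed
    moreover have "Q' * Q' = Q'"
    proof (rule mat_eq_by_vec[of _ n n])
      fix x :: "real vec" assume x: "x \<in> carrier_vec n"
      have QQ: "Q *\<^sub>v (Q *\<^sub>v x) = Q *\<^sub>v x"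
        using idem x Q by (metis Q_def assoc_mult_mat_vec)
      have rQx: "r \<bullet> (Q *\<^sub>v x) = 0" using symv[OF r x] Qr x by simp
      have "Q' *\<^sub>v r = r" using Q'v[OF r] Qr r rr by (simp add: c_def)
      moreover have "Q' *\<^sub>v (Q *\<^sub>v x) = Q *\<^sub>v x"
      proof -
        have "0 \<cdot>\<^sub>v r = 0\<^sub>v n" using r by (intro eq_vecI) auto
        then show ?thesis using Q'v[of "Q *\<^sub>v x"] Q x rQx QQ by simp
      qed
      moreover have "(Q' * Q') *\<^sub>v x = Q' *\<^sub>v (Q' *\<^sub>v x)"
        using Q' x by (simp add: assoc_mult_mat_vec[of _ n n _ n])
      moreover have "Q' *\<^sub>v (Q *\<^sub>v x + (c * (r \<bullet> x)) \<cdot>\<^sub>v r) =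
          Q' *\<^sub>v (Q *\<^sub>v x) + (c * (r \<bullet> x)) \<cdot>\<^sub>v (Q' *\<^sub>v r)"
        using Q' Q x r by (simp add: mult_add_distrib_mat_vec[of _ n n] mult_mat_vec[of _ n n])
      ultimately show "(Q' * Q') *\<^sub>v x = Q' *\<^sub>v x" using Q'v[OF x] by simp
    qed (use Q' in auto)
    moreover have "Q' *\<^sub>v col A j = col A j" if "j < Suc k" for j
    proof (cases "j = k")
      case True
      have "Q' *\<^sub>v a = Q *\<^sub>v a + r" using Q'v[OF a] ra rr by (simp add: c_def)
      also have "\<dots> = a" using Q a by (intro eq_vecI) (auto simp: r_def)
      finally show ?thesis using True by (simp add: a_def)
    next
      case False
      then have j: "j < k" using that by simp
      have aj: "col A j \<in> carrier_vec n" using A by auto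
      have "r \<bullet> col A j = 0"
      proof -
        have "(Q *\<^sub>v a) \<bullet> col A j = a \<bullet> col A j"
          using symv[OF a aj] fix_cols[OF j] by (simp add: Q_def)
        then show ?thesis using a aj Q by (simp add: r_def minus_scalar_prod_distrib[of _ n])
      qed
      moreover have "0 \<cdot>\<^sub>v r = 0\<^sub>v n" using r by (intro eq_vecI) auto
      ultimately show ?thesis using Q'v[OF aj] fix_cols[OF j] aj by (simp add: Q_def)
    qed
    ultimately show ?thesis using AW' W' by (intro bexI[of _ W']) auto
  qed
qed

lemma projector_exists:
  fixes A :: "real mat"
  assumes A: "A \<in> carrier_mat n m"
  obtains W where "W \<in> carrier_mat m n" "transpose_mat (A * W) = A * W"
    "(A * W) * (A * W) = A * W" "(A * W) * A = A"
proof -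
  obtain W where W: "W \<in> carrier_mat m n" "transpose_mat (A * W) = A * W"
    "(A * W) * (A * W) = A * W" "\<And>j. j < m \<Longrightarrow> (A * W) *\<^sub>v col A j = col A j"
    using partial_projector[OF A order_refl] by auto
  have "(A * W) * A = A"
  proof (intro eq_matI)
    fix i j assume ij: "i < dim_row A" "j < dim_col A"
    have "((A * W) * A) $$ (i,j) = ((A * W) *\<^sub>v col A j) $ i"
      using ij A W(1) by simp
    then show "((A * W) * A) $$ (i,j) = A $$ (i,j)" using W(4)[of j] ij A by simp
  qed (use A W in auto)
  with W that show ?thesis by blast
qed

definition is_pinv :: "real mat \<Rightarrow> real mat \<Rightarrow> bool" where
  "is_pinv A X \<longleftrightarrow> X \<in> carrier_mat (dim_col A) (dim_row A) \<and>
      A * X * A = A \<and> X * A * X = X \<and>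
      transpose_mat (A * X) = A * X \<and> transpose_mat (X * A) = X * A"

text \<open>\<open>A * X\<close> and \<open>A * Y\<close> are symmetric idempotents with the same
  range and hence coincide, and so do \<open>X * A\<close> and \<open>Y * A\<close>; then X = X A X
  = Y A Y.\<close>

lemma is_pinv_unique:
  assumes X: "is_pinv A X" and Y: "is_pinv A Y"
  shows "X = Y"
proof -
  note d = X[unfolded is_pinv_def] Y[unfolded is_pinv_def]
  have dims: "dim_row X = dim_col A" "dim_col X = dim_row A" "dim_row Y = dim_col A" "dim_col Y = dim_row A"
    using d by auto
  have "A * X = (A * Y) * (A * X)"
    using d dims by (metis index_mult_mat(2,3) mat_assoc)
  then have "transpose_mat (A * X) = transpose_mat (A * X) * transpose_mat (A * Y)"
    using dims by (metis index_mult_mat(2,3) transpose_mult')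
  then have "A * X = (A * X) * (A * Y)" using d by simp
  also have "\<dots> = A * Y"
    using d dims by (metis index_mult_mat(2,3) mat_assoc)
  finally have 1: "A * X = A * Y" .
  have "X * A = (X * A) * (Y * A)"
    using d dims by (metis index_mult_mat(2,3) mat_assoc)
  then have "transpose_mat (X * A) = transpose_mat (Y * A) * transpose_mat (X * A)"
    using dims by (metis index_mult_mat(2,3) transpose_mult')
  then have "X * A = (Y * A) * (X * A)" using d by simp
  also have "\<dots> = Y * A"
    using d dims by (metis index_mult_mat(2,3) mat_assoc)
  finally have 2: "X * A = Y * A" .
  have "X = X * A * X" using d by simp
  also have "\<dots> = Y * A * Y" using 1 2 dims by (metis mat_assoc)
  finally show ?thesis using d by simp
qed

text \<open>The witness combines two projectors: P onto the row space, from
  \<open>projector_exists\<close> for the transpose, and \<open>A * W\<close> onto the column space.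
  For X = P W one gets A X = A W and X A = P, and the four Penrose equations follow.\<close>

lemma pinv_is_pinv: "is_pinv A (pinv A)"
proof -
  define n m where "n = dim_row A" and "m = dim_col A"
  have A: "A \<in> carrier_mat n m" by (simp add: n_def m_def)
  have At: "transpose_mat A \<in> carrier_mat m n" using A by simp
  obtain W where W: "W \<in> carrier_mat m n" "transpose_mat (A * W) = A * W"
    "(A * W) * (A * W) = A * W" "(A * W) * A = A" using projector_exists[OF A] .
  obtain V where V: "V \<in> carrier_mat n m" "transpose_mat (transpose_mat A * V) = transpose_mat A * V"
    "(transpose_mat A * V) * (transpose_mat A * V) = transpose_mat A * V"
    "(transpose_mat A * V) * transpose_mat A = transpose_mat A" using projector_exists[OF At] .
  define P where "P = transpose_mat A * V"
  have P: "P \<in> carrier_mat m m" using A V by (auto simp: P_def)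
  have P': "P = transpose_mat V * A"
  proof -
    have "P = transpose_mat P" using V by (simp add: P_def)
    also have "\<dots> = transpose_mat V * A" using A V by (simp add: P_def transpose_mult')
    finally show ?thesis .
  qed
  have AP: "A * P = A"
  proof -
    have "A * transpose_mat P = transpose_mat (P * transpose_mat A)"
      using P A by (simp add: transpose_mult')
    then show ?thesis using V(2,4) unfolding P_def[symmetric] by simp
  qed
  define X where "X = P * W"
  have X: "X \<in> carrier_mat m n" using P W by (simp add: X_def)
  have AX: "A * X = A * W"
  proof -
    have "A * X = (A * P) * W" using A P W by (simp add: X_def)
    then show ?thesis unfolding AP .
  qed
  have XA: "X * A = P"
  proof -
    have "X * A = transpose_mat V * (A * W * A)"
      using A V W P by (simp add: X_def P' mat_assoc)
    then show ?thesis using W(4) P' by simp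
  qed
  have "is_pinv A X"
    unfolding is_pinv_def
  proof (intro conjI)
    show "A * X * A = A" using AX W(4) by simp
    have "P * X = (P * P) * W" using P W(1) by (simp add: X_def)
    then show "X * A * X = X"
      unfolding XA using V(3) by (simp add: X_def P_def[symmetric])
    show "transpose_mat (A * X) = A * X" using AX W(2) by simp
    show "transpose_mat (X * A) = X * A" using XA V(2) by (simp add: P_def)
    show "X \<in> carrier_mat (dim_col A) (dim_row A)" using X by (simp add: n_def m_def)
  qed
  then show ?thesis
    unfolding pinv_def is_pinv_def[symmetric] by (rule theI) (use \<open>is_pinv A X\<close> is_pinv_unique in blast)
qed

lemma pinv:
  assumes "A \<in> carrier_mat n m"
  shows "pinv A \<in> carrier_mat m n" "A * pinv A * A = A" "pinv A * A * pinv A = pinv A"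
    "transpose_mat (A * pinv A) = A * pinv A" "transpose_mat (pinv A * A) = pinv A * A"
  using pinv_is_pinv[of A] assms by (auto simp: is_pinv_def)

text \<open>An orthogonal projector is determined by its range: symmetric idempotents with equal
  range absorb each other from the left, and transposing one of the two relations identifies
  them.\<close>

lemma col_proj_eq:
  assumes A: "A \<in> carrier_mat n m"
  shows "col_proj A = A * pinv A"
  unfolding col_proj_def
proof (rule the_equality)
  note X = pinv[OF A]
  have dim: "dim_row A = n" "dim_col A = m" using A by auto
  define Q where "Q = A * pinv A"
  have Q: "Q \<in> carrier_mat n n" using A X by (simp add: Q_def)
  have QQ: "Q * Q = Q" using A X(1,3) by (simp add: Q_def mat_assoc)
  have range: "{Q *\<^sub>v y | y. y \<in> carrier_vec n} = col_space A"
  proof (intro equalityI subsetI)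
    fix z assume "z \<in> {Q *\<^sub>v y | y. y \<in> carrier_vec n}"
    then obtain y where y: "y \<in> carrier_vec n" "z = Q *\<^sub>v y" by auto
    then have "z = A *\<^sub>v (pinv A *\<^sub>v y)" using A X by (simp add: Q_def assoc_mult_mat_vec[of _ n m _ n])
    then show "z \<in> col_space A" using y X(1) A by (auto simp: col_space_def)
  next
    fix z assume "z \<in> col_space A"
    then obtain x where x: "x \<in> carrier_vec m" "z = A *\<^sub>v x" using A by (auto simp: col_space_def)
    then have "z = Q *\<^sub>v (A *\<^sub>v x)"
      using X(2) A Q by (metis Q_def assoc_mult_mat_vec)
    then show "z \<in> {Q *\<^sub>v y | y. y \<in> carrier_vec n}" using A x by auto
  qed
  show "A * pinv A \<in> carrier_mat (dim_row A) (dim_row A) \<and> transpose_mat (A * pinv A) = A * pinv A \<and>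
      A * pinv A * (A * pinv A) = A * pinv A \<and>
      {A * pinv A *\<^sub>v y | y. y \<in> carrier_vec (dim_row A)} = col_space A"
    using Q QQ range X(4) dim by (simp add: Q_def)
  fix R assume R0: "R \<in> carrier_mat (dim_row A) (dim_row A) \<and> transpose_mat R = R \<and>
      R * R = R \<and> {R *\<^sub>v y | y. y \<in> carrier_vec (dim_row A)} = col_space A"
  then have R: "R \<in> carrier_mat n n" "transpose_mat R = R" "R * R = R"
    "{R *\<^sub>v y | y. y \<in> carrier_vec n} = col_space A" using dim by auto
  have absorb: "S * T = T" if "S \<in> carrier_mat n n" "T \<in> carrier_mat n n" "S * S = S"
      "{S *\<^sub>v y | y. y \<in> carrier_vec n} = col_space A" "{T *\<^sub>v y | y. y \<in> carrier_vec n} = col_space A"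
    for S T :: "real mat"
  proof (rule mat_eq_by_vec[of _ n n])
    fix v :: "real vec" assume v: "v \<in> carrier_vec n"
    then have "T *\<^sub>v v \<in> {S *\<^sub>v y | y. y \<in> carrier_vec n}" using that by auto
    then obtain y where y: "y \<in> carrier_vec n" "T *\<^sub>v v = S *\<^sub>v y" by auto
    have "(S * T) *\<^sub>v v = S *\<^sub>v (S *\<^sub>v y)" unfolding y(2)[symmetric] by (rule assoc_mult_mat_vec) (use that v in auto)
    also have "\<dots> = (S * S) *\<^sub>v y" by (rule assoc_mult_mat_vec[symmetric]) (use that y in auto)
    finally show "(S * T) *\<^sub>v v = T *\<^sub>v v" unfolding that(3) y(2)[symmetric] .
  qed (use that in auto)
  have "R * Q = Q" "Q * R = R" using absorb R Q QQ range by blast+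
  then have "transpose_mat R * transpose_mat Q = transpose_mat R"
    using R Q by (metis carrier_matD transpose_mult')
  then show "R = A * pinv A" using \<open>R * Q = Q\<close> R X(4) by (simp add: Q_def)
qed

text \<open>The adjugate form makes the entries of the inverse rational functions of the entries of
  M, which is what the measurability proof uses.\<close>

lemma mat_inv:
  assumes M: "M \<in> carrier_mat n n" and det: "det M \<noteq> 0"
  shows "mat_inv M \<in> carrier_mat n n" "M * mat_inv M = 1\<^sub>m n" "mat_inv M * M = 1\<^sub>m n"
    "mat_inv M = (1 / det M) \<cdot>\<^sub>m adj_mat M"
proof -
  note adj = adj_mat[OF M]
  define X where "X = (1 / det M) \<cdot>\<^sub>m adj_mat M"
  have X: "X \<in> carrier_mat n n" using adj by (simp add: X_def)
  have one: "(1 / det M) \<cdot>\<^sub>m (det M \<cdot>\<^sub>m 1\<^sub>m n) = 1\<^sub>m n"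
    using det by (intro eq_matI) auto
  have X1: "M * X = 1\<^sub>m n" using M adj one by (simp add: X_def mult_smult_distrib[of _ n n _ n])
  have X2: "X * M = 1\<^sub>m n" using M adj one by (simp add: X_def mult_smult_assoc_mat[of _ n n _ n])
  have "mat_inv M = X"
    unfolding mat_inv_def
  proof (rule the_equality)
    fix Y assume "Y \<in> carrier_mat (dim_row M) (dim_row M) \<and> M * Y = 1\<^sub>m (dim_row M) \<and> Y * M = 1\<^sub>m (dim_row M)"
    then have Y: "Y \<in> carrier_mat n n" "Y * M = 1\<^sub>m n" using M by auto
    have "Y = Y * (M * X)" using X1 Y(1) by simp
    also have "\<dots> = (Y * M) * X" using X Y(1) M by (simp add: mat_assoc)
    finally show "Y = X" using Y X by simp
  qed (use M X X1 X2 in auto)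
  then show "mat_inv M \<in> carrier_mat n n" "M * mat_inv M = 1\<^sub>m n" "mat_inv M * M = 1\<^sub>m n"
    "mat_inv M = (1 / det M) \<cdot>\<^sub>m adj_mat M" using X X1 X2 by (auto simp: X_def)
qed

lemma mat_inv_unique:
  assumes M: "M \<in> carrier_mat n n" and Y: "Y \<in> carrier_mat n n" and YM: "Y * M = 1\<^sub>m n"
  shows "det M \<noteq> 0" "mat_inv M = Y"
proof -
  have "det Y * det M = 1" using det_mult[OF Y M] YM by simp
  then show det: "det M \<noteq> 0" by auto
  note X = mat_inv[OF M det]
  have "Y = Y * (M * mat_inv M)" using X(2) Y by simp
  also have "\<dots> = (Y * M) * mat_inv M" using X(1) Y M by (simp add: mat_assoc)
  finally show "mat_inv M = Y" using YM X(1) by simp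
qed

lemma mat_inv_symmetric:
  assumes M: "M \<in> carrier_mat n n" and det: "det M \<noteq> 0" and sym: "transpose_mat M = M"
  shows "transpose_mat (mat_inv M) = mat_inv M"
proof -
  note X = mat_inv[OF M det]
  have "transpose_mat (mat_inv M) * M = transpose_mat (M * mat_inv M)"
    using M X(1) sym by (simp add: transpose_mult')
  then have "transpose_mat (mat_inv M) * M = 1\<^sub>m n" using X(2) by simp
  then show ?thesis using mat_inv_unique(2)[OF M, of "transpose_mat (mat_inv M)"] X(1) by simp
qed

section \<open>Quadratic forms and Cauchy--Schwarz bounds\<close>

lemma quad_form: "M \<in> carrier_mat n n \<Longrightarrow> v \<in> carrier_vec n \<Longrightarrow>
    v \<bullet> (M *\<^sub>v v) = (\<Sum>i<n. \<Sum>j<n. v $ i * v $ j * M $$ (i,j))" for v :: "real vec"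
  by (simp add: scalar_prod_def atLeast0LessThan sum_distrib_left mult_ac)

lemma scalar_prod_Cauchy_Schwarz:
  "u \<in> carrier_vec n \<Longrightarrow> v \<in> carrier_vec n \<Longrightarrow> (u \<bullet> v)\<^sup>2 \<le> (u \<bullet> u) * (v \<bullet> v)" for u v :: "real vec"
  using Cauchy_Schwarz_ineq_sum[of "\<lambda>i. u $ i" "\<lambda>i. v $ i" "{0..<n}"]
  by (simp add: scalar_prod_def power2_eq_square)

lemma frob_sq_cols: "A \<in> carrier_mat n m \<Longrightarrow> frob_sq A = (\<Sum>j<m. col A j \<bullet> col A j)"
  unfolding frob_sq_def scalar_prod_def
  by (simp add: power2_eq_square atLeast0LessThan, subst sum.swap, simp)

lemma frob_sq_contraction_mult:
  assumes T: "contraction n T" and R: "R \<in> carrier_mat n m"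
  shows "frob_sq (T * R) \<le> frob_sq R"
proof -
  have Tc: "T \<in> carrier_mat n n" using T by (simp add: contraction_def)
  have "(\<Sum>j<m. col (T * R) j \<bullet> col (T * R) j) \<le> (\<Sum>j<m. col R j \<bullet> col R j)"
    using T R by (intro sum_mono) (simp add: col_mult_vec[OF Tc R] contraction_def)
  then show ?thesis using frob_sq_cols[OF R] frob_sq_cols[of "T * R" n m] Tc R by simp
qed

lemma frob_sq_mult_vec_le:
  assumes M: "M \<in> carrier_mat n m" and v: "v \<in> carrier_vec m"
  shows "(M *\<^sub>v v) \<bullet> (M *\<^sub>v v) \<le> frob_sq M * (v \<bullet> v)"
proof -
  have "(M *\<^sub>v v) \<bullet> (M *\<^sub>v v) = (\<Sum>i<n. (row M i \<bullet> v)\<^sup>2)"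
    using M by (simp add: scalar_prod_def[of "M *\<^sub>v v"] atLeast0LessThan power2_eq_square)
  also have "\<dots> \<le> (\<Sum>i<n. (row M i \<bullet> row M i) * (v \<bullet> v))"
    using M v by (intro sum_mono scalar_prod_Cauchy_Schwarz) auto
  also have "\<dots> = (\<Sum>i<n. row M i \<bullet> row M i) * (v \<bullet> v)"
    by (simp add: sum_distrib_right)
  also have "(\<Sum>i<n. row M i \<bullet> row M i) = frob_sq M"
    using M by (simp add: frob_sq_def scalar_prod_def atLeast0LessThan power2_eq_square)
  finally show ?thesis .
qed

lemma entry_le_frob: "A \<in> carrier_mat n m \<Longrightarrow> i < n \<Longrightarrow> j < m \<Longrightarrow> (A $$ (i,j))\<^sup>2 \<le> frob_sq A"
proof -
  assume A: "A \<in> carrier_mat n m" and i: "i < n" and j: "j < m"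
  have "(A $$ (i,j))\<^sup>2 \<le> (\<Sum>j<m. (A $$ (i,j))\<^sup>2)"
    using j by (intro member_le_sum) auto
  also have "\<dots> \<le> (\<Sum>i<n. \<Sum>j<m. (A $$ (i,j))\<^sup>2)"
    using i by (intro member_le_sum[of i _ "\<lambda>i. \<Sum>j<m. (A $$ (i,j))\<^sup>2"]) (auto intro: sum_nonneg)
  finally show ?thesis using A by (simp add: frob_sq_def)
qed

section \<open>Resolvents\<close>

lemma shift_mult_vec:
  assumes "G \<in> carrier_mat m m" "v \<in> carrier_vec m"
  shows "(G + \<delta> \<cdot>\<^sub>m 1\<^sub>m m) *\<^sub>v v = G *\<^sub>v v + \<delta> \<cdot>\<^sub>v (v :: real vec)"
  using assms by (simp add: add_mult_distrib_mat_vec[of _ m m] smult_mult_mat_vec)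

lemma det_shift:
  assumes G: "G \<in> carrier_mat m m" "psd G" and \<delta>: "0 < \<delta>"
  shows "det (G + \<delta> \<cdot>\<^sub>m 1\<^sub>m m) \<noteq> 0"
proof
  assume "det (G + \<delta> \<cdot>\<^sub>m 1\<^sub>m m) = 0"
  then obtain v where v: "v \<in> carrier_vec m" "v \<noteq> 0\<^sub>v m" "(G + \<delta> \<cdot>\<^sub>m 1\<^sub>m m) *\<^sub>v v = 0\<^sub>v m"
    using G by (subst (asm) det_0_iff_vec_prod_zero[of _ m]) auto
  then have "0 = v \<bullet> (G *\<^sub>v v + \<delta> \<cdot>\<^sub>v v)" using shift_mult_vec[OF G(1) v(1)] by simp
  also have "\<dots> = v \<bullet> (G *\<^sub>v v) + \<delta> * (v \<bullet> v)"
    using G v by (simp add: scalar_prod_add_distrib[of _ m])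
  finally have "\<delta> * (v \<bullet> v) \<le> 0" using G v by (auto simp: psd_iff[of _ m])
  then have "v \<bullet> v = 0" using \<delta> scalar_prod_self_nonneg[of v] by (simp add: mult_le_0_iff)
  then show False using v scalar_prod_self_zero by auto
qed

text \<open>A regularised inverse of a Gram matrix, defined also at singular G. As \<delta> tends to
  0 it recovers the inverse and, applied to the transposed data, the pseudo-inverse; at singular G
  it blows up.\<close>

definition resolvent :: "real \<Rightarrow> real mat \<Rightarrow> real mat" where
  "resolvent \<delta> G = mat_inv (G + \<delta> \<cdot>\<^sub>m 1\<^sub>m (dim_row G))"

lemma resolvent:
  assumes G: "G \<in> carrier_mat m m" "psd G" and \<delta>: "0 < \<delta>"
  shows "resolvent \<delta> G \<in> carrier_mat m m"
    "(G + \<delta> \<cdot>\<^sub>m 1\<^sub>m m) * resolvent \<delta> G = 1\<^sub>m m"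
    "resolvent \<delta> G * (G + \<delta> \<cdot>\<^sub>m 1\<^sub>m m) = 1\<^sub>m m"
    "transpose_mat (resolvent \<delta> G) = resolvent \<delta> G"
proof -
  have M: "G + \<delta> \<cdot>\<^sub>m 1\<^sub>m m \<in> carrier_mat m m" using G by simp
  have sym: "transpose_mat (G + \<delta> \<cdot>\<^sub>m 1\<^sub>m m) = G + \<delta> \<cdot>\<^sub>m 1\<^sub>m m"
  proof -
    have "transpose_mat (\<delta> \<cdot>\<^sub>m 1\<^sub>m m) = \<delta> \<cdot>\<^sub>m 1\<^sub>m m" by (intro eq_matI) auto
    then show ?thesis using G by (simp add: transpose_add[of _ m m] psd_iff[of _ m])
  qed
  show "resolvent \<delta> G \<in> carrier_mat m m"
    "(G + \<delta> \<cdot>\<^sub>m 1\<^sub>m m) * resolvent \<delta> G = 1\<^sub>m m"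
    "resolvent \<delta> G * (G + \<delta> \<cdot>\<^sub>m 1\<^sub>m m) = 1\<^sub>m m"
    "transpose_mat (resolvent \<delta> G) = resolvent \<delta> G"
    using mat_inv(1-3)[OF M det_shift[OF assms]] mat_inv_symmetric[OF M det_shift[OF assms] sym] G(1)
    unfolding resolvent_def by auto
qed

lemma mat_eq_minusI: "A + B = C \<Longrightarrow> A \<in> carrier_mat n m \<Longrightarrow> B \<in> carrier_mat n m \<Longrightarrow> A = C - B"
  for A B C :: "real mat"
  by (intro eq_matI) auto

lemma resolvent_mult:
  assumes G: "G \<in> carrier_mat m m" "psd G" and \<delta>: "0 < \<delta>"
  shows "resolvent \<delta> G * G = 1\<^sub>m m - \<delta> \<cdot>\<^sub>m resolvent \<delta> G"
    "G * resolvent \<delta> G = 1\<^sub>m m - \<delta> \<cdot>\<^sub>m resolvent \<delta> G"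
proof -
  note H = resolvent[OF assms]
  have "resolvent \<delta> G * G + \<delta> \<cdot>\<^sub>m resolvent \<delta> G = 1\<^sub>m m"
    using H(1,3) G by (simp add: mult_add_distrib_mat[of _ m m _ m] mult_smult_distrib[of _ m m _ m])
  then show "resolvent \<delta> G * G = 1\<^sub>m m - \<delta> \<cdot>\<^sub>m resolvent \<delta> G"
    by (intro mat_eq_minusI) (use H(1) G(1) in auto)
  have "G * resolvent \<delta> G + \<delta> \<cdot>\<^sub>m resolvent \<delta> G = 1\<^sub>m m"
    using H(1,2) G by (simp add: add_mult_distrib_mat[of _ m m _ _ m] mult_smult_assoc_mat[of _ m m _ m])
  then show "G * resolvent \<delta> G = 1\<^sub>m m - \<delta> \<cdot>\<^sub>m resolvent \<delta> G"
    by (intro mat_eq_minusI) (use H(1) G(1) in auto)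
qed

lemma resolvent_psd:
  assumes G: "G \<in> carrier_mat m m" "psd G" and \<delta>: "0 < \<delta>"
  shows "psd (resolvent \<delta> G)"
proof -
  note H = resolvent[OF assms]
  have "0 \<le> v \<bullet> (resolvent \<delta> G *\<^sub>v v)" if v: "v \<in> carrier_vec m" for v
  proof -
    define w where "w = resolvent \<delta> G *\<^sub>v v"
    have w: "w \<in> carrier_vec m" using H v by (simp add: w_def)
    have "v = (G + \<delta> \<cdot>\<^sub>m 1\<^sub>m m) *\<^sub>v w"
      unfolding w_def using assoc_mult_mat_vec[of "G + \<delta> \<cdot>\<^sub>m 1\<^sub>m m" m m "resolvent \<delta> G" m v] H G v by simp
    then have "w \<bullet> v = w \<bullet> (G *\<^sub>v w + \<delta> \<cdot>\<^sub>v w)"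
      using shift_mult_vec[OF G(1) w] by simp
    then have "v \<bullet> w = w \<bullet> (G *\<^sub>v w) + \<delta> * (w \<bullet> w)"
      using G w comm_scalar_prod[OF v w] by (simp add: scalar_prod_add_distrib[of _ m])
    then show ?thesis using G w \<delta> scalar_prod_self_nonneg[of w] by (auto simp: psd_iff[of _ m] w_def)
  qed
  then show ?thesis using H by (auto simp: psd_iff[of _ m])
qed

text \<open>For w = H v one has v = G w + \<delta> w. In the expanded squared norm of v the two
  terms containing G are nonnegative, and what remains is the squared norm of \<delta> w.\<close>

lemma resolvent_contraction:
  assumes G: "G \<in> carrier_mat m m" "psd G" and \<delta>: "0 < \<delta>"
  shows "contraction m (\<delta> \<cdot>\<^sub>m resolvent \<delta> G)"
  unfolding contraction_def
proof (intro conjI ballI)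
  note H = resolvent[OF assms]
  fix v :: "real vec" assume v: "v \<in> carrier_vec m"
  define w where "w = resolvent \<delta> G *\<^sub>v v"
  have w: "w \<in> carrier_vec m" using H v by (simp add: w_def)
  have Gw: "G *\<^sub>v w \<in> carrier_vec m" using G w by simp
  have "v = (G + \<delta> \<cdot>\<^sub>m 1\<^sub>m m) *\<^sub>v w"
    unfolding w_def using assoc_mult_mat_vec[of "G + \<delta> \<cdot>\<^sub>m 1\<^sub>m m" m m "resolvent \<delta> G" m v] H G v by simp
  then have "v = G *\<^sub>v w + \<delta> \<cdot>\<^sub>v w" using shift_mult_vec[OF G(1) w] by simp
  then have "v \<bullet> v = (G *\<^sub>v w) \<bullet> (G *\<^sub>v w) + 2 * \<delta> * (w \<bullet> (G *\<^sub>v w)) + \<delta>\<^sup>2 * (w \<bullet> w)"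
    using w Gw comm_scalar_prod[OF Gw w]
    by (simp add: scalar_prod_add_distrib[of _ m] add_scalar_prod_distrib[of _ m] power2_eq_square algebra_simps)
  moreover have "0 \<le> w \<bullet> (G *\<^sub>v w)" using G w by (auto simp: psd_iff[of _ m])
  ultimately have "\<delta>\<^sup>2 * (w \<bullet> w) \<le> v \<bullet> v"
    using scalar_prod_self_nonneg[of "G *\<^sub>v w"] \<delta> by simp
  moreover have "(\<delta> \<cdot>\<^sub>m resolvent \<delta> G) *\<^sub>v v = \<delta> \<cdot>\<^sub>v w"
    using H v by (simp add: w_def smult_mult_mat_vec)
  ultimately show "((\<delta> \<cdot>\<^sub>m resolvent \<delta> G) *\<^sub>v v) \<bullet> ((\<delta> \<cdot>\<^sub>m resolvent \<delta> G) *\<^sub>v v) \<le> v \<bullet> v"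
    using w by (simp add: power2_eq_square mult.assoc)
qed (use resolvent(1)[OF assms] in auto)

text \<open>On the range of G the resolvent H inverts G up to order \<delta>: for X = G Z, H G X - X
  = -\<delta> H X = -\<delta> (Z - \<delta> H Z), and \<delta> H is a contraction. Taking X in the
  range of G is what covers the singular case.\<close>

lemma resolvent_limit:
  assumes G: "G \<in> carrier_mat m m" "psd G" and Z: "Z \<in> carrier_mat m n" and XG: "X = G * Z"
    and ij: "i < m" "j < n"
  shows "(\<lambda>k. (resolvent (1 / real (Suc k)) G * (G * X)) $$ (i,j)) \<longlonglongrightarrow> X $$ (i,j)"
proof -
  have X: "X \<in> carrier_mat m n" using G Z by (simp add: XG)
  have main: "\<bar>(resolvent \<delta> G * (G * X)) $$ (i,j) - X $$ (i,j)\<bar> \<le> \<delta> * (2 * sqrt (frob_sq Z))"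
    if \<delta>: "0 < \<delta>" for \<delta>
  proof -
    define H where "H = resolvent \<delta> G"
    note H = resolvent[OF G \<delta>, folded H_def] and HG = resolvent_mult(1)[OF G \<delta>, folded H_def]
    have HZ: "H * Z \<in> carrier_mat m n" using H(1) Z by simp
    have GY: "H * (G * Y) = Y - \<delta> \<cdot>\<^sub>m (H * Y)" if "Y \<in> carrier_mat m n" for Y
    proof -
      have "H * (G * Y) = (H * G) * Y" using H(1) G(1) that by (simp add: mat_assoc)
      also have "\<dots> = (1\<^sub>m m - \<delta> \<cdot>\<^sub>m H) * Y" unfolding HG ..
      also have "\<dots> = Y - \<delta> \<cdot>\<^sub>m (H * Y)"
        using H(1) that by (simp add: minus_mult_distrib_mat[of _ m m _ _ n] mult_smult_assoc_mat[of _ m m _ n])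
      finally show ?thesis .
    qed
    have "H * (G * X) = X - \<delta> \<cdot>\<^sub>m (H * X)" using GY X by simp
    moreover have "H * X = Z - \<delta> \<cdot>\<^sub>m (H * Z)" by (subst XG) (rule GY[OF Z])
    ultimately have "(H * (G * X)) $$ (i,j) - X $$ (i,j) = - \<delta> * (Z $$ (i,j) - (\<delta> \<cdot>\<^sub>m (H * Z)) $$ (i,j))"
      using ij X Z HZ H(1) by (simp add: algebra_simps)
    then have "\<bar>(H * (G * X)) $$ (i,j) - X $$ (i,j)\<bar> \<le> \<delta> * (\<bar>Z $$ (i,j)\<bar> + \<bar>(\<delta> \<cdot>\<^sub>m (H * Z)) $$ (i,j)\<bar>)"
      using \<delta> by (simp add: abs_mult)
    also have "\<dots> \<le> \<delta> * (sqrt (frob_sq Z) + sqrt (frob_sq Z))"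
    proof -
      have "\<bar>Z $$ (i,j)\<bar> \<le> sqrt (frob_sq Z)" using entry_le_frob[OF Z ij] real_le_rsqrt[of "\<bar>Z $$ (i,j)\<bar>"] by simp
      moreover have "\<bar>(\<delta> \<cdot>\<^sub>m (H * Z)) $$ (i,j)\<bar> \<le> sqrt (frob_sq Z)"
      proof -
        have "frob_sq (\<delta> \<cdot>\<^sub>m (H * Z)) \<le> frob_sq Z"
          using frob_sq_contraction_mult[OF resolvent_contraction[OF G \<delta>] Z] H(1) Z
          by (simp add: H_def[symmetric] mult_smult_assoc_mat[of _ m m _ n])
        then have "((\<delta> \<cdot>\<^sub>m (H * Z)) $$ (i,j))\<^sup>2 \<le> frob_sq Z"
          using entry_le_frob[of "\<delta> \<cdot>\<^sub>m (H * Z)" m n i j] HZ ij by simp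
        then show ?thesis using real_le_rsqrt[of "\<bar>(\<delta> \<cdot>\<^sub>m (H * Z)) $$ (i,j)\<bar>"] by simp
      qed
      ultimately show ?thesis using \<delta> by (intro mult_left_mono) auto
    qed
    finally show ?thesis by (simp add: H_def)
  qed
  have "(\<lambda>k. 1 / real (Suc k) * (2 * sqrt (frob_sq Z))) \<longlonglongrightarrow> 0 * (2 * sqrt (frob_sq Z))"
    by (intro tendsto_mult tendsto_const LIMSEQ_Suc lim_1_over_n)
  then have lim: "(\<lambda>k. 1 / real (Suc k) * (2 * sqrt (frob_sq Z))) \<longlonglongrightarrow> 0" by simp
  have "\<bar>(resolvent (1 / real (Suc k)) G * (G * X)) $$ (i,j) - X $$ (i,j)\<bar>
      \<le> 1 / real (Suc k) * (2 * sqrt (frob_sq Z))" for k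
    by (rule main) simp
  then have "(\<lambda>k. (resolvent (1 / real (Suc k)) G * (G * X)) $$ (i,j) - X $$ (i,j)) \<longlonglongrightarrow> 0"
    using Lim_null_comparison[OF _ lim, of "\<lambda>k. (resolvent (1 / real (Suc k)) G * (G * X)) $$ (i,j) - X $$ (i,j)"]
    by (simp del: of_nat_Suc)
  then show ?thesis using LIM_zero_cancel by auto
qed

lemma pinv_normal_eq:
  assumes A: "A \<in> carrier_mat n m"
  shows "transpose_mat A * A * pinv A = transpose_mat A"
proof -
  define X where "X = pinv A"
  note X = pinv[OF A, folded X_def]
  have "transpose_mat (A * X * A) = transpose_mat A * transpose_mat (A * X)"
    using A X(1) by (simp add: transpose_mult')
  then have "transpose_mat A = transpose_mat A * (A * X)" using X(2,4) by simp
  then show ?thesis using A X(1) by (simp add: X_def[symmetric] mat_assoc)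
qed

text \<open>Both the transpose of A and \<open>pinv A\<close> lie in the range of G, singular or
  not, so \<open>resolvent_limit\<close> applies. The pseudo-inverse jumps where the rank drops; as
  a pointwise limit of resolvent expressions it is nevertheless measurable.\<close>

lemma resolvent_pinv_limit:
  assumes A: "A \<in> carrier_mat n m" and ij: "i < m" "j < n"
  shows "(\<lambda>k. (resolvent (1 / real (Suc k)) (transpose_mat A * A) * transpose_mat A) $$ (i,j))
    \<longlonglongrightarrow> pinv A $$ (i,j)"
proof -
  define G where "G = transpose_mat A * A"
  define X where "X = pinv A"
  \<comment> \<open>Comes from X = (X A) X with X A symmetric, so that X is
    \<open>transpose_mat A * transpose_mat X * X\<close>, in which the first factor is G X.\<close>
  define Z where "Z = X * transpose_mat X * X"
  note X = pinv[OF A, folded X_def]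
  have G: "G \<in> carrier_mat m m" "psd G" using A psd_gram by (auto simp: G_def)
  have Z: "Z \<in> carrier_mat m n" using X(1) by (simp add: Z_def)
  have At: "transpose_mat A = G * X" using pinv_normal_eq[OF A] by (simp add: G_def X_def)
  have "X = transpose_mat (X * A) * X" using X(3,5) by simp
  also have "\<dots> = transpose_mat A * transpose_mat X * X" using A X(1) by (simp add: transpose_mult')
  also have "\<dots> = G * Z" unfolding At using A X(1) G(1) by (simp add: Z_def mat_assoc)
  finally have "X = G * Z" .
  from resolvent_limit[OF G Z this ij] show ?thesis
    unfolding At[symmetric] by (simp add: G_def X_def)
qed

lemma resolvent_inverse_limit:
  assumes G: "G \<in> carrier_mat m m" "psd G" and det: "det G \<noteq> 0" and ij: "i < m" "j < m"
  shows "(\<lambda>k. resolvent (1 / real (Suc k)) G $$ (i,j)) \<longlonglongrightarrow> mat_inv G $$ (i,j)"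
proof -
  note Y = mat_inv[OF G(1) det]
  have YY: "mat_inv G * mat_inv G \<in> carrier_mat m m" using Y(1) by simp
  have "mat_inv G = (G * mat_inv G) * mat_inv G" using left_mult_one_mat[OF Y(1)] Y(2) by simp
  also have "\<dots> = G * (mat_inv G * mat_inv G)" by (rule assoc_mult_mat[OF G(1) Y(1) Y(1)])
  finally have "mat_inv G = G * (mat_inv G * mat_inv G)" .
  from resolvent_limit[OF G YY this ij]
  have "(\<lambda>k. (resolvent (1 / real (Suc k)) G * 1\<^sub>m m) $$ (i,j)) \<longlonglongrightarrow> mat_inv G $$ (i,j)"
    by (simp only: Y(2))
  moreover have "resolvent (1 / real (Suc k)) G * 1\<^sub>m m = resolvent (1 / real (Suc k)) G" for k
    using resolvent(1)[OF G, of "1 / real (Suc k)"] by simp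
  ultimately show ?thesis by (simp only:)
qed

text \<open>A kernel vector of G is multiplied by \<open>1 / \<delta>\<close>. A bound on the mean
  of the left-hand norm that is uniform in \<delta> therefore makes singular Gram matrices a null
  event.\<close>

lemma resolvent_singular:
  assumes G: "G \<in> carrier_mat m m" "psd G" and det: "det G = 0" and \<delta>: "0 < \<delta>"
  shows "1 / \<delta>\<^sup>2 \<le> frob_sq (resolvent \<delta> G)"
proof -
  note H = resolvent[OF G \<delta>]
  obtain v where v: "v \<in> carrier_vec m" "v \<noteq> 0\<^sub>v m" "G *\<^sub>v v = 0\<^sub>v m"
    using det G by (subst (asm) det_0_iff_vec_prod_zero[of _ m]) auto
  define u where "u = (1 / \<delta>) \<cdot>\<^sub>v v"
  have u: "u \<in> carrier_vec m" using v by (simp add: u_def)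
  have "(G + \<delta> \<cdot>\<^sub>m 1\<^sub>m m) *\<^sub>v u = v"
    unfolding shift_mult_vec[OF G(1) u] using v \<delta> mult_mat_vec[OF G(1) v(1), of "1 / \<delta>"]
    by (intro eq_vecI) (auto simp: u_def)
  then have "resolvent \<delta> G *\<^sub>v v = (resolvent \<delta> G * (G + \<delta> \<cdot>\<^sub>m 1\<^sub>m m)) *\<^sub>v u"
    using assoc_mult_mat_vec[of "resolvent \<delta> G" m m "G + \<delta> \<cdot>\<^sub>m 1\<^sub>m m" m u] H(1) G u by simp
  then have "resolvent \<delta> G *\<^sub>v v = u" using H(3) u by simp
  then have "u \<bullet> u \<le> frob_sq (resolvent \<delta> G) * (v \<bullet> v)"
    using frob_sq_mult_vec_le[OF H(1) v(1)] by simp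
  moreover have "u \<bullet> u = (1 / \<delta>\<^sup>2) * (v \<bullet> v)"
    using v(1) by (simp add: u_def power2_eq_square)
  moreover have "0 < v \<bullet> v"
    using scalar_prod_self_nonneg[of v] scalar_prod_self_zero[OF v(1)] v(2) by linarith
  ultimately show ?thesis by (metis mult_le_cancel_right_pos)
qed

section \<open>The positive semi-definite square root\<close>

text \<open>The form of M is nonnegative at v - M v / F; expanding it there and using
  \<open>bound\<close> once gives the claim. In the Loewner order it reads M^2 \<le> F M, and it
  shows M v = 0 wherever the form vanishes.\<close>

lemma psd_zero_form:
  assumes M: "M \<in> carrier_mat n n" "psd M" and v: "v \<in> carrier_vec n" and F: "0 < F"
    and bound: "\<And>u. u \<in> carrier_vec n \<Longrightarrow> u \<bullet> (M *\<^sub>v u) \<le> F * (u \<bullet> u)"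
  shows "(M *\<^sub>v v) \<bullet> (M *\<^sub>v v) \<le> F * (v \<bullet> (M *\<^sub>v v))"
proof -
  define u where "u = M *\<^sub>v v"
  have u: "u \<in> carrier_vec n" using M v by (simp add: u_def)
  have Mu: "M *\<^sub>v u \<in> carrier_vec n" using M u by simp
  define w where "w = v - (1 / F) \<cdot>\<^sub>v u"
  have w: "w \<in> carrier_vec n" using u v by (simp add: w_def)
  have vMu: "v \<bullet> (M *\<^sub>v u) = u \<bullet> u"
    using transpose_vec_mult_scalar[OF M(1) u v] M comm_scalar_prod[OF v Mu] psd_iff[OF M(1)]
    by (metis transpose_vec_mult_scalar u_def v u)
  have "0 \<le> w \<bullet> (M *\<^sub>v w)" using M w by (auto simp: psd_iff[of _ n])
  also have "M *\<^sub>v w = u - (1 / F) \<cdot>\<^sub>v (M *\<^sub>v u)"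
    using M u v by (simp add: w_def mult_minus_distrib_mat_vec[of _ n n] mult_mat_vec[of _ n n] u_def)
  also have "w \<bullet> (u - (1 / F) \<cdot>\<^sub>v (M *\<^sub>v u)) =
      v \<bullet> u - (1 / F) * (v \<bullet> (M *\<^sub>v u)) - (1 / F) * (u \<bullet> u) + (1 / F)\<^sup>2 * (u \<bullet> (M *\<^sub>v u))"
    using u v Mu by (simp add: w_def minus_scalar_prod_distrib[of _ n] scalar_prod_minus_distrib[of _ n]
        power2_eq_square algebra_simps)
  also have "\<dots> \<le> v \<bullet> u - (2 / F) * (u \<bullet> u) + (1 / F)\<^sup>2 * (F * (u \<bullet> u))"
    unfolding vMu using bound[OF u] by (auto intro!: mult_left_mono)
  also have "\<dots> = v \<bullet> u - (1 / F) * (u \<bullet> u)"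
    using F by (simp add: power2_eq_square field_simps)
  finally show ?thesis using F by (simp add: u_def field_simps)
qed

text \<open>With D = S - T, equality of the squares gives S D + D T = 0. Pairing with D yields two
  nonnegative traces with sum zero, so both vanish; then S D = T D = 0 and D^2 = S D - T D =
  0.\<close>

lemma psd_sqrt_unique:
  assumes S: "S \<in> carrier_mat n n" "psd S" and T: "T \<in> carrier_mat n n" "psd T" and eq: "S * S = T * T"
  shows "S = T"
proof -
  define D where "D = S - T"
  have D: "D \<in> carrier_mat n n" using S T by (simp add: D_def minus_carrier_mat)
  have Dt: "transpose_mat D = D"
    using S T by (simp add: D_def transpose_minus[of _ n n] psd_iff[of _ n])
  have ann: "S *\<^sub>v (D *\<^sub>v v) = 0\<^sub>v n \<and> T *\<^sub>v (D *\<^sub>v v) = 0\<^sub>v n" if v: "v \<in> carrier_vec n" for v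
  proof -
    have nonneg: "0 \<le> (D *\<^sub>v x) \<bullet> (R *\<^sub>v (D *\<^sub>v x))" if "R \<in> carrier_mat n n" "psd R" "x \<in> carrier_vec n" for R x
      using that D by (auto simp: psd_iff[of R n])
    have quad: "fip D (R * D) = (\<Sum>j<n. (D *\<^sub>v unit_vec n j) \<bullet> (R *\<^sub>v (D *\<^sub>v unit_vec n j)))"
      if R: "R \<in> carrier_mat n n" for R
    proof -
      have "fip D (R * D) = (\<Sum>j<n. col D j \<bullet> col (R * D) j)"
        unfolding fip_def scalar_prod_def using D R
        by (simp add: atLeast0LessThan) (subst sum.swap, simp)
      also have "\<dots> = (\<Sum>j<n. (D *\<^sub>v unit_vec n j) \<bullet> (R *\<^sub>v (D *\<^sub>v unit_vec n j)))"
      proof (intro sum.cong refl)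
        fix j assume "j \<in> {..<n}"
        then have "col D j = D *\<^sub>v unit_vec n j" using D by (intro eq_vecI) auto
        then show "col D j \<bullet> col (R * D) j = (D *\<^sub>v unit_vec n j) \<bullet> (R *\<^sub>v (D *\<^sub>v unit_vec n j))"
          using \<open>j \<in> {..<n}\<close> col_mult_vec[OF R D, of j] by simp
      qed
      finally show ?thesis .
    qed
    have "S * D + D * T = 0\<^sub>m n n"
    proof -
      have "S * D + D * T = (S * S - S * T) + (S * T - T * T)"
        unfolding D_def mult_minus_distrib_mat[OF S(1) S(1) T(1)] minus_mult_distrib_mat[OF S(1) T(1) T(1)] ..
      also have "\<dots> = 0\<^sub>m n n" unfolding eq using S T by (intro eq_matI) auto
      finally show ?thesis .
    qed
    then have "fip D (S * D) + fip D (D * T) = 0"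
      using fip_add_right[of D n n "S * D" "D * T"] D S T by (simp add: fip_def)
    moreover have "fip D (D * T) = fip D (T * D)"
    proof -
      have "fip D (D * T) = fip (transpose_mat D) (transpose_mat (D * T))"
        using D T by (intro fip_transpose[symmetric, of _ n n]) auto
      also have "transpose_mat (D * T) = T * D" using D T Dt by (simp add: transpose_mult' psd_iff[of _ n])
      finally show ?thesis by (simp add: Dt)
    qed
    ultimately have sum0: "fip D (S * D) + fip D (T * D) = 0" by simp
    have "0 \<le> fip D (S * D)" "0 \<le> fip D (T * D)"
      using nonneg S T by (auto simp: quad intro!: sum_nonneg)
    then have z: "fip D (S * D) = 0" "fip D (T * D) = 0" using sum0 by linarith+
    have entry: "col (R * D) j = 0\<^sub>v n" if R: "R \<in> carrier_mat n n" "psd R" and zero: "fip D (R * D) = 0"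
      and j: "j < n" for R j
    proof -
      define x where "x = D *\<^sub>v unit_vec n j"
      have x: "x \<in> carrier_vec n" using D by (simp add: x_def)
      have "x \<bullet> (R *\<^sub>v x) = 0"
        using zero j nonneg[OF R] unfolding quad[OF R(1)] x_def by (subst (asm) sum_nonneg_eq_0_iff) auto
      \<comment> \<open>\<open>1 + frob_sq R\<close> dominates the operator norm of R, which is at
        most the square root of \<open>frob_sq R\<close>, and it is positive even for R = 0.\<close>
      moreover have "(R *\<^sub>v x) \<bullet> (R *\<^sub>v x) \<le> (1 + frob_sq R) * (x \<bullet> (R *\<^sub>v x))"
      proof (rule psd_zero_form[OF R x])
        fix u :: "real vec" assume u: "u \<in> carrier_vec n"
        have Ru: "R *\<^sub>v u \<in> carrier_vec n" using R u by simp
        have "(u \<bullet> (R *\<^sub>v u))\<^sup>2 \<le> (u \<bullet> u) * ((R *\<^sub>v u) \<bullet> (R *\<^sub>v u))"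
          using scalar_prod_Cauchy_Schwarz[OF u Ru] .
        also have "\<dots> \<le> (u \<bullet> u) * (frob_sq R * (u \<bullet> u))"
          using frob_sq_mult_vec_le[OF R(1) u] by (intro mult_left_mono scalar_prod_self_nonneg)
        also have "\<dots> \<le> ((1 + frob_sq R) * (u \<bullet> u))\<^sup>2"
        proof -
          have "frob_sq R \<le> (1 + frob_sq R)\<^sup>2" by (simp add: power2_eq_square algebra_simps)
          then have "frob_sq R * (u \<bullet> u)\<^sup>2 \<le> (1 + frob_sq R)\<^sup>2 * (u \<bullet> u)\<^sup>2"
            by (intro mult_right_mono) auto
          then show ?thesis by (simp add: power2_eq_square mult_ac)
        qed
        finally show "u \<bullet> (R *\<^sub>v u) \<le> (1 + frob_sq R) * (u \<bullet> u)"
          using scalar_prod_self_nonneg[of u] by (intro power2_le_imp_le[of "u \<bullet> (R *\<^sub>v u)"]) auto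
      qed (simp add: add_pos_nonneg)
      ultimately have "(R *\<^sub>v x) \<bullet> (R *\<^sub>v x) = 0" using scalar_prod_self_nonneg[of "R *\<^sub>v x"] by simp
      then have "R *\<^sub>v x = 0\<^sub>v n" using scalar_prod_self_zero[of "R *\<^sub>v x" n] R x by simp
      moreover have "x = col D j" using D j by (intro eq_vecI) (auto simp: x_def)
      ultimately show ?thesis using col_mult_vec[OF R(1) D j] by simp
    qed
    have "S * D = 0\<^sub>m n n" "T * D = 0\<^sub>m n n"
    proof -
      have *: "R * D = 0\<^sub>m n n" if R: "R \<in> carrier_mat n n" "psd R" and zero: "fip D (R * D) = 0" for R
      proof (intro eq_matI)
        fix i j assume ij: "i < dim_row (0\<^sub>m n n :: real mat)" "j < dim_col (0\<^sub>m n n :: real mat)"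
        then have "(R * D) $$ (i,j) = col (R * D) j $ i" using R D by simp
        then show "(R * D) $$ (i,j) = 0\<^sub>m n n $$ (i,j)" using entry[OF R zero] ij by simp
      qed (use R D in auto)
      show "S * D = 0\<^sub>m n n" by (rule *[OF S z(1)])
      show "T * D = 0\<^sub>m n n" by (rule *[OF T z(2)])
    qed
    moreover have "S *\<^sub>v (D *\<^sub>v v) = (S * D) *\<^sub>v v" "T *\<^sub>v (D *\<^sub>v v) = (T * D) *\<^sub>v v"
      using S T D v by (auto simp: assoc_mult_mat_vec[of _ n n _ n])
    ultimately show ?thesis using v by (intro conjI) (auto intro!: eq_vecI)
  qed
  have Dv: "D *\<^sub>v v = 0\<^sub>v n" if v: "v \<in> carrier_vec n" for v
  proof -
    define x where "x = D *\<^sub>v v"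
    have x: "x \<in> carrier_vec n" using D v by (simp add: x_def)
    have "x \<bullet> x = v \<bullet> (D *\<^sub>v x)"
      using gram_scalar_prod[OF D v] D v by (simp add: Dt x_def)
    also have "D *\<^sub>v x = S *\<^sub>v x - T *\<^sub>v x"
      unfolding D_def using S T x by (simp add: minus_mult_distrib_mat_vec[of _ n n])
    also have "\<dots> = 0\<^sub>v n" using ann[OF v] by (auto simp: x_def)
    finally show ?thesis using scalar_prod_self_zero[OF x] v by (simp add: x_def)
  qed
  show "S = T"
  proof (rule mat_eq_by_vec[OF S(1) T(1)])
    fix v :: "real vec" assume v: "v \<in> carrier_vec n"
    have "S *\<^sub>v v - T *\<^sub>v v = 0\<^sub>v n"
      using Dv[OF v] S T v by (simp add: D_def minus_mult_distrib_mat_vec[of _ n n])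
    then have "(S *\<^sub>v v) $ i = (T *\<^sub>v v) $ i" if "i < n" for i
      using that S T v by (metis (no_types) carrier_matD(1) dim_mult_mat_vec eq_iff_diff_eq_0 index_minus_vec(1) index_zero_vec(1))
    then show "S *\<^sub>v v = T *\<^sub>v v" using S T by (intro eq_vecI) auto
  qed
qed

text \<open>The square root is the matrix power series \<open>sqrt (1 - N) = (\<Sum>k. sqrt_coeff k * N^k)\<close>, whose coefficients
  are absolutely summable; this avoids the spectral theorem.\<close>

definition sqrt_coeff :: "nat \<Rightarrow> real" where
  "sqrt_coeff k = ((1/2) gchoose k) * (-1) ^ k"

lemma sqrt_coeff_nonpos: "sqrt_coeff (Suc k) \<le> 0"
proof -
  have "sqrt_coeff (Suc k) = pochhammer (- (1/2)) (Suc k) / fact (Suc k)"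
    by (simp add: sqrt_coeff_def gbinomial_pochhammer power_mult_distrib[symmetric])
  also have "pochhammer (- (1/2)) (Suc k) = - (1/2) * pochhammer (1/2 :: real) k"
    by (simp add: pochhammer_rec)
  finally show ?thesis by (simp add: pochhammer_nonneg divide_nonpos_pos)
qed

text \<open>Dividing the series of (1 - x)^(1/2) by 1 - x turns coefficients into partial sums, and
  the quotient (1 - x)^(-1/2) has positive coefficients.\<close>

lemma sum_sqrt_coeff: "(\<Sum>k\<le>n. sqrt_coeff k) = pochhammer (1/2) n / fact n"
proof -
  have "(\<Sum>k\<le>n. sqrt_coeff k) = (-1) ^ n * ((1/2 - 1) gchoose n)"
    unfolding sqrt_coeff_def by (rule gbinomial_sum_lower_neg)
  then show ?thesis by (simp add: gbinomial_pochhammer power_mult_distrib[symmetric])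
qed

lemma sum_sqrt_coeff_nonneg: "0 \<le> (\<Sum>k\<le>n. sqrt_coeff k)"
  by (simp add: sum_sqrt_coeff pochhammer_nonneg)

lemma sqrt_coeff_0 [simp]: "sqrt_coeff 0 = 1"
  by (simp add: sqrt_coeff_def)

text \<open>Only the first coefficient, 1, is positive, and all partial sums are nonnegative. So the
  negative coefficients have total size at most 1, and the absolute values sum to at most 2.\<close>

lemma summable_abs_sqrt_coeff: "summable (\<lambda>k. \<bar>sqrt_coeff k\<bar>)"
proof (rule summableI_nonneg_bounded)
  fix n
  have "(\<Sum>k<Suc m. \<bar>sqrt_coeff k\<bar>) = 2 - (\<Sum>k\<le>m. sqrt_coeff k)" for m
  proof (induction m)
    case (Suc m)
    then show ?case using sqrt_coeff_nonpos[of m] by simp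
  qed simp
  then have *: "(\<Sum>k<Suc m. \<bar>sqrt_coeff k\<bar>) \<le> 2" for m
    using sum_sqrt_coeff_nonneg[of m] by simp
  show "(\<Sum>k<n. \<bar>sqrt_coeff k\<bar>) \<le> 2"
    using *[of n] by (simp add: abs_ge_zero)
qed simp

text \<open>Vandermonde with 1/2 + 1/2 = 1: the square of the series is 1 - x.\<close>

lemma sqrt_coeff_conv:
  "(\<Sum>i\<le>k. sqrt_coeff i * sqrt_coeff (k - i)) = (if k = 0 then 1 else if k = 1 then -1 else 0)"
proof -
  have "(\<Sum>i\<le>k. sqrt_coeff i * sqrt_coeff (k - i)) =
      (\<Sum>i\<in>{0..k}. ((1/2) gchoose i) * ((1/2) gchoose (k - i)) * (-1) ^ k)"
    by (intro sum.cong) (auto simp: sqrt_coeff_def power_add[symmetric] mult_ac atLeast0AtMost)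
  also have "\<dots> = (1 gchoose k) * (-1) ^ k"
    using gbinomial_Vandermonde[of "1/2::real" "1/2" k] by (simp add: sum_distrib_right[symmetric])
  also have "(1 gchoose k :: real) = of_nat (1 choose k)"
    by (metis binomial_gbinomial of_nat_1)
  finally show ?thesis by (cases k) (auto simp: binomial_eq_0)
qed

primrec mpow :: "real mat \<Rightarrow> nat \<Rightarrow> real mat" where
  "mpow N 0 = 1\<^sub>m (dim_row N)"
| "mpow N (Suc k) = N * mpow N k"

lemma mpow_carrier [simp]: "N \<in> carrier_mat n n \<Longrightarrow> mpow N k \<in> carrier_mat n n"
  by (induction k) auto

lemma dim_mpow [simp]: "dim_col N = dim_row N \<Longrightarrow> dim_row (mpow N k) = dim_row N"
  "dim_col N = dim_row N \<Longrightarrow> dim_col (mpow N k) = dim_row N"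
  by (induction k) auto

lemma mpow_add: "N \<in> carrier_mat n n \<Longrightarrow> mpow N (p + q) = mpow N p * mpow N q"
proof (induction p)
  case 0
  then have "dim_col N = dim_row N" by simp
  then show ?case by simp
next
  case (Suc p)
  then have "dim_col N = dim_row N" by simp
  then show ?case using Suc by (simp add: mat_assoc)
qed

lemma mpow_symmetric:
  assumes N: "N \<in> carrier_mat n n" "transpose_mat N = N"
  shows "transpose_mat (mpow N k) = mpow N k"
proof (induction k)
  case (Suc k)
  have "transpose_mat (mpow N (Suc k)) = mpow N k * N"
    using N Suc by (simp add: transpose_mult' carrier_matD)
  also have "\<dots> = mpow N (k + 1)" using mpow_add[OF N(1), of k 1] N mpow_carrier[OF N(1), of k] by simp
  finally show ?case by simp
qed simp

lemma contraction_mpow: "contraction n N \<Longrightarrow> contraction n (mpow N k)"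
proof (induction k)
  case 0
  then have "dim_row N = n" by (auto simp: contraction_def)
  then show ?case by (simp add: contraction_one)
qed (simp add: contraction_mult)

lemma contraction_form_le:
  assumes "contraction n N" "v \<in> carrier_vec n" "u \<in> carrier_vec n"
  shows "(u \<bullet> (N *\<^sub>v v))\<^sup>2 \<le> (u \<bullet> u) * (v \<bullet> v)"
proof -
  have "N *\<^sub>v v \<in> carrier_vec n" using assms by (auto simp: contraction_def)
  then have "(u \<bullet> (N *\<^sub>v v))\<^sup>2 \<le> (u \<bullet> u) * ((N *\<^sub>v v) \<bullet> (N *\<^sub>v v))"
    by (rule scalar_prod_Cauchy_Schwarz[OF assms(3)])
  also have "\<dots> \<le> (u \<bullet> u) * (v \<bullet> v)"
    using assms by (intro mult_left_mono scalar_prod_self_nonneg) (auto simp: contraction_def)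
  finally show ?thesis .
qed

lemma sqrt_complement_exists:
  assumes N: "contraction n N" "transpose_mat N = N"
  obtains S where "S \<in> carrier_mat n n" "psd S" "S * S = 1\<^sub>m n - N"
proof -
  have Nc: "N \<in> carrier_mat n n" using N by (simp add: contraction_def)
  have Pc: "mpow N k \<in> carrier_mat n n" for k using Nc by simp
  have entry: "\<bar>mpow N k $$ (i,j)\<bar> \<le> 1" if "i < n" "j < n" for i j k
  proof -
    have "mpow N k $$ (i,j) = unit_vec n i \<bullet> (mpow N k *\<^sub>v unit_vec n j)"
      using Pc[of k] that by simp
    moreover have "(unit_vec n i \<bullet> (mpow N k *\<^sub>v unit_vec n j))\<^sup>2 \<le> 1"
      using contraction_form_le[OF contraction_mpow[OF N(1), of k], of "unit_vec n j" "unit_vec n i"] that by simp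
    ultimately show ?thesis by (simp add: abs_square_le_1)
  qed
  define a where "a k i j = sqrt_coeff k * mpow N k $$ (i,j)" for k i j
  have sm: "summable (\<lambda>k. \<bar>a k i j\<bar>)" if "i < n" "j < n" for i j
  proof (rule summable_comparison_test'[OF summable_abs_sqrt_coeff, of 0])
    fix k show "norm \<bar>a k i j\<bar> \<le> \<bar>sqrt_coeff k\<bar>"
      using entry[OF that, of k] by (simp add: a_def abs_mult mult_left_le)
  qed
  define S where "S = mat n n (\<lambda>(i,j). \<Sum>k. a k i j)"
  have S: "S \<in> carrier_mat n n" by (simp add: S_def)
  have Sij: "(\<lambda>k. a k i j) sums (S $$ (i,j))" if "i < n" "j < n" for i j
    using summable_rabs_cancel[OF sm[OF that]] that by (simp add: S_def summable_sums)
  have "psd S"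
    unfolding psd_iff[OF S]
  proof (intro conjI ballI)
    show "transpose_mat S = S"
    proof (intro eq_matI)
      fix i j assume ij: "i < dim_row S" "j < dim_col S"
      have "mpow N k $$ (j,i) = mpow N k $$ (i,j)" for k
        using arg_cong[OF mpow_symmetric[OF Nc N(2), of k], of "\<lambda>M. M $$ (i,j)"] ij Pc[of k] S by simp
      then show "transpose_mat S $$ (i,j) = S $$ (i,j)" using ij S by (simp add: S_def a_def)
    qed (use S in auto)
  next
    fix v :: "real vec" assume v: "v \<in> carrier_vec n"
    have "(\<lambda>k. \<Sum>i<n. \<Sum>j<n. v $ i * v $ j * a k i j) sums (\<Sum>i<n. \<Sum>j<n. v $ i * v $ j * S $$ (i,j))"
      using Sij by (intro sums_sum sums_mult) auto
    then have sums: "(\<lambda>k. sqrt_coeff k * (v \<bullet> (mpow N k *\<^sub>v v))) sums (v \<bullet> (S *\<^sub>v v))"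
      unfolding quad_form[OF S v] quad_form[OF Pc v] by (simp add: a_def sum_distrib_left mult_ac)
    have "0 \<le> (\<Sum>k<m. sqrt_coeff k * (v \<bullet> (mpow N k *\<^sub>v v)))" for m
    proof (cases m)
      case (Suc p)
      \<comment> \<open>The form of every power of N is at most \<open>v \<bullet> v\<close>, and
        all coefficients but the first are nonpositive; in degree 0 there is equality. So the
        partial sum is at least what it would be for N = 1, a multiple of a nonnegative partial sum
        of coefficients.\<close>
      have "(v \<bullet> v) * (\<Sum>k\<le>p. sqrt_coeff k) \<le> (\<Sum>k\<le>p. sqrt_coeff k * (v \<bullet> (mpow N k *\<^sub>v v)))"
        unfolding sum_distrib_left
      proof (intro sum_mono)
        fix k
        show "(v \<bullet> v) * sqrt_coeff k \<le> sqrt_coeff k * (v \<bullet> (mpow N k *\<^sub>v v))"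
        proof (cases k)
          case 0
          then show ?thesis using v Nc by simp
        next
          case (Suc q)
          have "(v \<bullet> (mpow N k *\<^sub>v v))\<^sup>2 \<le> (v \<bullet> v)\<^sup>2"
            using contraction_form_le[OF contraction_mpow[OF N(1), of k] v v] by (simp add: power2_eq_square)
          then have "v \<bullet> (mpow N k *\<^sub>v v) \<le> v \<bullet> v"
            by (rule power2_le_imp_le) (rule scalar_prod_self_nonneg)
          moreover have "sqrt_coeff k \<le> 0" using sqrt_coeff_nonpos Suc by simp
          ultimately show ?thesis unfolding mult.commute[of "v \<bullet> v"] by (rule mult_left_mono_neg)
        qed
      qed
      moreover have "0 \<le> (v \<bullet> v) * (\<Sum>k\<le>p. sqrt_coeff k)"
        by (intro mult_nonneg_nonneg scalar_prod_self_nonneg sum_sqrt_coeff_nonneg)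
      ultimately show ?thesis using Suc by (simp add: lessThan_Suc_atMost)
    qed simp
    then show "0 \<le> v \<bullet> (S *\<^sub>v v)"
      using sums by (intro LIMSEQ_le_const[of _ "v \<bullet> (S *\<^sub>v v)"]) (auto simp: sums_def)
  qed
  moreover have "S * S = 1\<^sub>m n - N"
  proof (intro eq_matI)
    fix i j assume "i < dim_row (1\<^sub>m n - N)" "j < dim_col (1\<^sub>m n - N)"
    then have ij: "i < n" "j < n" using Nc by auto
    have "(\<lambda>k. \<Sum>p\<le>k. a p i l * a (k - p) l j) sums (S $$ (i,l) * S $$ (l,j))" if "l < n" for l
      using Cauchy_product_sums[of "\<lambda>k. a k i l" "\<lambda>k. a k l j"] sm ij that Sij
      by (auto simp: sums_iff)
    then have "(\<lambda>k. \<Sum>l<n. \<Sum>p\<le>k. a p i l * a (k - p) l j) sums (\<Sum>l<n. S $$ (i,l) * S $$ (l,j))"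
      by (intro sums_sum) auto
    moreover have "(\<Sum>l<n. \<Sum>p\<le>k. a p i l * a (k - p) l j) =
        (if k = 0 then 1 else if k = 1 then -1 else 0) * mpow N k $$ (i,j)" for k
    proof -
      have "(\<Sum>l<n. \<Sum>p\<le>k. a p i l * a (k - p) l j) =
          (\<Sum>p\<le>k. sqrt_coeff p * sqrt_coeff (k - p) * (\<Sum>l<n. mpow N p $$ (i,l) * mpow N (k - p) $$ (l,j)))"
        by (subst sum.swap) (simp add: a_def sum_distrib_left mult_ac)
      also have "\<dots> = (\<Sum>p\<le>k. sqrt_coeff p * sqrt_coeff (k - p) * mpow N k $$ (i,j))"
      proof (intro sum.cong refl)
        fix p assume "p \<in> {..k}"
        then have "mpow N k = mpow N p * mpow N (k - p)" using mpow_add[OF Nc, of p "k - p"] by simp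
        then have "mpow N k $$ (i,j) = (\<Sum>l<n. mpow N p $$ (i,l) * mpow N (k - p) $$ (l,j))"
          using ij Pc[of p] Pc[of "k - p"] index_mat_mult[of i "mpow N p" j "mpow N (k - p)"] by simp
        then show "sqrt_coeff p * sqrt_coeff (k - p) * (\<Sum>l<n. mpow N p $$ (i,l) * mpow N (k - p) $$ (l,j)) =
            sqrt_coeff p * sqrt_coeff (k - p) * mpow N k $$ (i,j)" by simp
      qed
      finally show ?thesis by (simp only: sum_distrib_right[symmetric] sqrt_coeff_conv)
    qed
    ultimately have "(\<lambda>k. (if k = 0 then 1 else if k = 1 then -1 else 0) * mpow N k $$ (i,j)) sums
        (S * S) $$ (i,j)"
      using ij S by (simp add: index_mat_mult del: index_mult_mat)
    moreover have "(\<lambda>k. (if k = 0 then 1 else if k = 1 then -1 else 0) * mpow N k $$ (i,j)) sums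
        (\<Sum>k\<in>{0,1}. (if k = 0 then 1 else if k = 1 then -1 else 0) * mpow N k $$ (i,j))"
      by (rule sums_finite) auto
    ultimately have "(S * S) $$ (i,j) = (\<Sum>k\<in>{0,1::nat}. (if k = 0 then 1 else if k = 1 then -1 else 0) * mpow N k $$ (i,j))"
      using sums_unique2 by blast
    then show "(S * S) $$ (i,j) = (1\<^sub>m n - N) $$ (i,j)" using ij Nc by simp
  qed (use S Nc in auto)
  ultimately show ?thesis using that S by blast
qed

lemma psd_sqrt:
  assumes M: "M \<in> carrier_mat n n" "psd M"
  shows "psd_sqrt M \<in> carrier_mat n n" "psd (psd_sqrt M)" "psd_sqrt M * psd_sqrt M = M"
proof -
  \<comment> \<open>F dominates the operator norm of M because
    \<open>frob_sq M \<le> F\<^sup>2\<close>, and the summand 1 keeps it positive. Rescaling by F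
    makes N a contraction, to which the series applies.\<close>
  define F where "F = 1 + frob_sq M"
  have F: "0 < F" by (simp add: F_def add_pos_nonneg)
  define N where "N = 1\<^sub>m n - (1 / F) \<cdot>\<^sub>m M"
  have Nc: "N \<in> carrier_mat n n" using M by (simp add: N_def minus_carrier_mat)
  have Mt: "transpose_mat M = M" using M by (simp add: psd_iff)
  have "transpose_mat ((1 / F) \<cdot>\<^sub>m M) = (1 / F) \<cdot>\<^sub>m transpose_mat M" by (intro eq_matI) auto
  then have Nt: "transpose_mat N = N" using M Mt by (simp add: N_def transpose_minus[of _ n n])
  have bound: "u \<bullet> (M *\<^sub>v u) \<le> F * (u \<bullet> u)" if u: "u \<in> carrier_vec n" for u
  proof -
    have Mu: "M *\<^sub>v u \<in> carrier_vec n" using M u by simp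
    have "(u \<bullet> (M *\<^sub>v u))\<^sup>2 \<le> (u \<bullet> u) * ((M *\<^sub>v u) \<bullet> (M *\<^sub>v u))"
      using scalar_prod_Cauchy_Schwarz[OF u Mu] .
    also have "\<dots> \<le> (u \<bullet> u) * (frob_sq M * (u \<bullet> u))"
      using frob_sq_mult_vec_le[OF M(1) u] by (intro mult_left_mono scalar_prod_self_nonneg)
    also have "\<dots> \<le> (F * (u \<bullet> u))\<^sup>2"
    proof -
      have "frob_sq M \<le> F\<^sup>2" by (simp add: power2_eq_square algebra_simps F_def)
      then have "frob_sq M * (u \<bullet> u)\<^sup>2 \<le> F\<^sup>2 * (u \<bullet> u)\<^sup>2"
        by (intro mult_right_mono) auto
      then show ?thesis by (simp add: power2_eq_square mult_ac)
    qed
    finally show ?thesis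
      using scalar_prod_self_nonneg[of u] F by (intro power2_le_imp_le[of "u \<bullet> (M *\<^sub>v u)"]) auto
  qed
  have contr: "contraction n N"
    unfolding contraction_def
  proof (intro conjI ballI)
    fix v :: "real vec" assume v: "v \<in> carrier_vec n"
    define u where "u = M *\<^sub>v v"
    have u: "u \<in> carrier_vec n" using M v by (simp add: u_def)
    have Nv: "N *\<^sub>v v = v - (1 / F) \<cdot>\<^sub>v u"
      using M v by (simp add: N_def minus_mult_distrib_mat_vec[of _ n n] smult_mult_mat_vec u_def)
    have "(N *\<^sub>v v) \<bullet> (N *\<^sub>v v) = v \<bullet> v - (2 / F) * (v \<bullet> u) + (1 / F)\<^sup>2 * (u \<bullet> u)"
      unfolding Nv using u v comm_scalar_prod[OF u v]
      by (simp add: minus_scalar_prod_distrib[of _ n] scalar_prod_minus_distrib[of _ n] power2_eq_square algebra_simps)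
    also have "\<dots> \<le> v \<bullet> v - (2 / F) * (v \<bullet> u) + (1 / F)\<^sup>2 * (F * (v \<bullet> u))"
      using psd_zero_form[OF M v F bound] by (auto intro!: mult_left_mono simp: u_def)
    also have "\<dots> = v \<bullet> v - (1 / F) * (v \<bullet> u)" using F by (simp add: power2_eq_square field_simps)
    also have "\<dots> \<le> v \<bullet> v" using M v F by (auto simp: u_def psd_iff[of _ n])
    finally show "(N *\<^sub>v v) \<bullet> (N *\<^sub>v v) \<le> v \<bullet> v" .
  qed (rule Nc)
  obtain S where S: "S \<in> carrier_mat n n" "psd S" "S * S = 1\<^sub>m n - N"
    using sqrt_complement_exists[OF contr Nt] .
  define T where "T = sqrt F \<cdot>\<^sub>m S"
  have T: "T \<in> carrier_mat n n" "psd T" using S F psd_smult[of S n "sqrt F"] by (auto simp: T_def)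
  have "T * T = F \<cdot>\<^sub>m (S * S)"
  proof -
    have "T * T = sqrt F \<cdot>\<^sub>m (sqrt F \<cdot>\<^sub>m (S * S))"
      using S by (simp add: T_def mult_smult_assoc_mat[of _ n n _ n] mult_smult_distrib[of _ n n _ n])
    also have "\<dots> = F \<cdot>\<^sub>m (S * S)" using F by (intro eq_matI) auto
    finally show ?thesis .
  qed
  also have "\<dots> = M" unfolding S(3) using M F by (intro eq_matI) (auto simp: N_def field_simps)
  finally have TT: "T * T = M" .
  have "psd_sqrt M = T"
    unfolding psd_sqrt_def
  proof (rule the_equality)
    show "psd T \<and> dim_row T = dim_row M \<and> T * T = M" using T TT M by auto
    fix R assume R: "psd R \<and> dim_row R = dim_row M \<and> R * R = M"
    then have "R \<in> carrier_mat n n" using M by (auto simp: psd_def)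
    then show "R = T" using psd_sqrt_unique[of R n T] R T TT by auto
  qed
  then show "psd_sqrt M \<in> carrier_mat n n" "psd (psd_sqrt M)" "psd_sqrt M * psd_sqrt M = M"
    using T TT by auto
qed

section \<open>Residuals of sequential regression\<close>

lemma fip_psd_nonneg:
  assumes "D \<in> carrier_mat n n" "psd D" "M \<in> carrier_mat n n" "psd M"
  shows "0 \<le> fip D M"
  using fip_psd_gram[OF assms(1,2) psd_sqrt(1)[OF assms(3,4)]] psd_sqrt[OF assms(3,4)]
  by (simp add: psd_iff[of "psd_sqrt M"])

text \<open>\<open>1\<^sub>m P + strict_upper C\<close> is unit upper triangular, so it has
  determinant 1 and the inverse exists; row s of its product with \<open>mm\<close> gives the second
  claim. Row s is expressed through later rows only, which is the order of the backward pass over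
  the tasks.\<close>

lemma limit_matrix_rec:
  assumes C: "C \<in> carrier_mat P P" and s: "s < P" and \<mu>: "\<mu> < P"
  defines "mm \<equiv> mat_inv (1\<^sub>m P + strict_upper C) * C"
  shows "mm \<in> carrier_mat P P"
    "mm $$ (s,\<mu>) = C $$ (s,\<mu>) - (\<Sum>l<P. if s < l then C $$ (s,l) * mm $$ (l,\<mu>) else 0)"
proof -
  define L where "L = 1\<^sub>m P + strict_upper C"
  have L: "L \<in> carrier_mat P P" using C by (simp add: L_def strict_upper_def)
  have "det L = prod_list (diag_mat L)"
  proof (rule det_upper_triangular[OF _ L])
    show "upper_triangular L" using C unfolding L_def strict_upper_def by (intro upper_triangularI) auto
  qed
  also have "\<dots> = 1"
    using C by (auto simp: prod_list_diag_prod L_def strict_upper_def intro!: prod.neutral)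
  finally have "det L \<noteq> 0" by simp
  note X = mat_inv[OF L this]
  show mm: "mm \<in> carrier_mat P P" using X(1) C by (simp add: mm_def L_def[symmetric])
  have "L * mm = C" using X(1,2) C L by (simp add: mm_def L_def[symmetric] mat_assoc[symmetric] del: assoc_mult_mat)
  then have "C $$ (s,\<mu>) = (L * mm) $$ (s,\<mu>)" by simp
  also have "\<dots> = (\<Sum>l<P. L $$ (s,l) * mm $$ (l,\<mu>))"
    using L mm s \<mu> index_mat_mult[of s L \<mu> mm] by simp
  also have "\<dots> = (\<Sum>l<P. (if l = s then mm $$ (s,\<mu>) else 0) + (if s < l then C $$ (s,l) * mm $$ (l,\<mu>) else 0))"
    using C s by (intro sum.cong refl) (auto simp: L_def strict_upper_def)
  also have "\<dots> = mm $$ (s,\<mu>) + (\<Sum>l<P. if s < l then C $$ (s,l) * mm $$ (l,\<mu>) else 0)"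
    using s by (simp add: sum.distrib)
  finally show "mm $$ (s,\<mu>) = C $$ (s,\<mu>) - (\<Sum>l<P. if s < l then C $$ (s,l) * mm $$ (l,\<mu>) else 0)" by simp
qed

section \<open>Combinations of the task matrices and products of complementary projectors\<close>

definition lincomb_mat :: "nat \<Rightarrow> nat \<Rightarrow> nat \<Rightarrow> (nat \<Rightarrow> real) \<Rightarrow> (nat \<Rightarrow> real mat) \<Rightarrow> real mat" where
  "lincomb_mat P n m w F = mat n m (\<lambda>ij. \<Sum>l<P. w l * F l $$ ij)"

lemma lincomb_mat_carrier [simp]: "lincomb_mat P n m w F \<in> carrier_mat n m"
  by (simp add: lincomb_mat_def)

lemma lincomb_mat_dim [simp]: "dim_row (lincomb_mat P n m w F) = n" "dim_col (lincomb_mat P n m w F) = m"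
  by (simp_all add: lincomb_mat_def)

lemma lincomb_mat_Suc: "F P \<in> carrier_mat n m \<Longrightarrow>
    lincomb_mat (Suc P) n m w F = lincomb_mat P n m w F + w P \<cdot>\<^sub>m F P"
  by (intro eq_matI) (auto simp: lincomb_mat_def)

lemma lincomb_mat_0: "lincomb_mat 0 n m w F = 0\<^sub>m n m"
  by (intro eq_matI) (auto simp: lincomb_mat_def)

lemma mult_lincomb_mat:
  assumes "Q \<in> carrier_mat k n" "\<And>l. l < P \<Longrightarrow> F l \<in> carrier_mat n m"
  shows "Q * lincomb_mat P n m w F = lincomb_mat P k m w (\<lambda>l. Q * F l)"
  using assms(2)
proof (induction P)
  case 0
  then show ?case using assms(1) by (simp add: lincomb_mat_0)
next
  case (Suc P)
  have "Q * lincomb_mat (Suc P) n m w F = Q * lincomb_mat P n m w F + w P \<cdot>\<^sub>m (Q * F P)"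
    using assms(1) Suc.prems[of P]
    by (simp add: lincomb_mat_Suc mult_add_distrib_mat[of _ k n _ m] mult_smult_distrib[of _ k n _ m])
  then show ?case using Suc assms(1) by (simp add: lincomb_mat_Suc[of "\<lambda>l. Q * F l"])
qed

text \<open>Factors are ordered by task from left to right, because each training step multiplies
  the weights on the right. Start and length are separate arguments: the recursion appends a later
  task, as learning does, while \<open>tail_prod_left\<close> splits off the earliest one for the
  backward induction.\<close>

primrec tail_prod :: "nat \<Rightarrow> (nat \<Rightarrow> real mat) \<Rightarrow> nat \<Rightarrow> nat \<Rightarrow> real mat" where
  "tail_prod n A s 0 = 1\<^sub>m n"
| "tail_prod n A s (Suc d) = tail_prod n A s d * (1\<^sub>m n - col_proj (A (s + d)))"

text \<open>The matrix through which the target of task \<nu> enters the error on task \<mu>, see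
  \<open>final_error_resid\<close>. For the last task the tail product is empty.\<close>

definition resid :: "nat \<Rightarrow> nat \<Rightarrow> nat \<Rightarrow> (nat \<Rightarrow> real mat) \<Rightarrow> nat \<Rightarrow> nat \<Rightarrow> real mat" where
  "resid n m P A \<nu> \<mu> = (if \<nu> = \<mu> then 1 else 0) \<cdot>\<^sub>m 1\<^sub>m m -
     pinv (A \<nu>) * (tail_prod n A (Suc \<nu>) (P - Suc \<nu>) * A \<mu>)"

context
  fixes n m P :: nat and A :: "nat \<Rightarrow> real mat"
  assumes A: "\<And>\<mu>. \<mu> < P \<Longrightarrow> A \<mu> \<in> carrier_mat n m"
begin

lemma col_proj_props:
  assumes "\<mu> < P"
  shows "col_proj (A \<mu>) \<in> carrier_mat n n" "transpose_mat (col_proj (A \<mu>)) = col_proj (A \<mu>)"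
    "col_proj (A \<mu>) * col_proj (A \<mu>) = col_proj (A \<mu>)" "col_proj (A \<mu>) * A \<mu> = A \<mu>"
    "pinv (A \<mu>) * col_proj (A \<mu>) = pinv (A \<mu>)"
proof -
  note a = A[OF assms] and X = pinv[OF A[OF assms]]
  show "col_proj (A \<mu>) \<in> carrier_mat n n"
    unfolding col_proj_eq[OF a] by (rule mult_carrier_mat[OF a X(1)])
  show "transpose_mat (col_proj (A \<mu>)) = col_proj (A \<mu>)"
    unfolding col_proj_eq[OF a] by (rule X(4))
  show "col_proj (A \<mu>) * A \<mu> = A \<mu>"
    unfolding col_proj_eq[OF a] by (rule X(2))
  show XQ: "pinv (A \<mu>) * col_proj (A \<mu>) = pinv (A \<mu>)"
    unfolding col_proj_eq[OF a] using assoc_mult_mat[OF X(1) a X(1)] X(3) by (rule trans[OF sym])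
  show "col_proj (A \<mu>) * col_proj (A \<mu>) = col_proj (A \<mu>)"
    using assoc_mult_mat[OF a X(1) mult_carrier_mat[OF a X(1)]] XQ unfolding col_proj_eq[OF a] by metis
qed

lemma tail_prod_carrier: "s + d \<le> P \<Longrightarrow> tail_prod n A s d \<in> carrier_mat n n"
  by (induction d) (auto simp: col_proj_props minus_carrier_mat)

lemma tail_prod_left: "s + Suc d \<le> P \<Longrightarrow>
    tail_prod n A s (Suc d) = (1\<^sub>m n - col_proj (A s)) * tail_prod n A (Suc s) d"
proof (induction d)
  case 0
  then have "col_proj (A s) \<in> carrier_mat n n" using col_proj_props[of s] by simp
  then have Q: "1\<^sub>m n - col_proj (A s) \<in> carrier_mat n n" by (simp add: minus_carrier_mat)
  show ?case using left_mult_one_mat[OF Q] right_mult_one_mat[OF Q] by simp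
next
  case (Suc d)
  have Q: "1\<^sub>m n - col_proj (A s) \<in> carrier_mat n n" "1\<^sub>m n - col_proj (A (Suc (s + d))) \<in> carrier_mat n n"
    using Suc.prems col_proj_props(1)[of s] col_proj_props(1)[of "Suc (s + d)"] by (auto intro: minus_carrier_mat)
  have T: "tail_prod n A (Suc s) d \<in> carrier_mat n n" using Suc.prems tail_prod_carrier by simp
  have "tail_prod n A s (Suc (Suc d)) =
      (1\<^sub>m n - col_proj (A s)) * tail_prod n A (Suc s) d * (1\<^sub>m n - col_proj (A (Suc (s + d))))"
    using Suc by simp
  also have "\<dots> = (1\<^sub>m n - col_proj (A s)) * tail_prod n A (Suc s) (Suc d)"
    using assoc_mult_mat[OF Q(1) T Q(2)] by simp
  finally show ?case .
qed

lemma cl_weights_carrier: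
  assumes B: "\<And>\<mu>. \<mu> < P \<Longrightarrow> B \<mu> \<in> carrier_mat Ny m"
  shows "k \<le> P \<Longrightarrow> cl_weights Ny n A B k \<in> carrier_mat Ny n"
proof (induction k)
  case (Suc k)
  then show ?case
    using B[of k] pinv(1)[OF A[of k]] col_proj_props(1)[of k]
    by (auto intro!: add_carrier_mat mult_carrier_mat[of _ _ n] mult_carrier_mat[of _ _ m] minus_carrier_mat)
qed simp

text \<open>Unrolling the weight recursion. Y is arbitrary because one step replaces it by
  \<open>(1 - Q) * Y\<close>; the factor is then absorbed into the tail product of every earlier
  task.\<close>

lemma cl_weights_mult:
  assumes B: "\<And>\<mu>. \<mu> < P \<Longrightarrow> B \<mu> \<in> carrier_mat Ny m" and i: "i < Ny" and j: "j < c"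
  shows "k \<le> P \<Longrightarrow> Y \<in> carrier_mat n c \<Longrightarrow> (cl_weights Ny n A B k * Y) $$ (i,j) =
    (\<Sum>\<nu><k. (B \<nu> * (pinv (A \<nu>) * (tail_prod n A (Suc \<nu>) (k - Suc \<nu>) * Y))) $$ (i,j))"
proof (induction k arbitrary: Y)
  case 0
  then show ?case using i j by simp
next
  case (Suc k)
  define Q where "Q = 1\<^sub>m n - col_proj (A k)"
  have Q: "Q \<in> carrier_mat n n" using col_proj_props(1)[of k] Suc.prems by (simp add: Q_def minus_carrier_mat)
  have W: "cl_weights Ny n A B k \<in> carrier_mat Ny n" using cl_weights_carrier[OF B] Suc.prems by simp
  have X: "pinv (A k) \<in> carrier_mat m n" using pinv(1)[OF A[of k]] Suc.prems by simp
  have Bk: "B k \<in> carrier_mat Ny m" using B Suc.prems by simp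
  have Y: "Y \<in> carrier_mat n c" using Suc.prems by simp
  have "cl_weights Ny n A B (Suc k) * Y = cl_weights Ny n A B k * (Q * Y) + B k * (pinv (A k) * Y)"
    unfolding cl_weights.simps Q_def[symmetric]
    using W Q X Bk Y by (simp add: add_mult_distrib_mat[of _ Ny n _ _ c] mat_assoc)
  then have "(cl_weights Ny n A B (Suc k) * Y) $$ (i,j) =
      (cl_weights Ny n A B k * (Q * Y)) $$ (i,j) + (B k * (pinv (A k) * Y)) $$ (i,j)"
    using W Q X Bk Y i j by simp
  also have "(cl_weights Ny n A B k * (Q * Y)) $$ (i,j) =
      (\<Sum>\<nu><k. (B \<nu> * (pinv (A \<nu>) * (tail_prod n A (Suc \<nu>) (k - Suc \<nu>) * (Q * Y)))) $$ (i,j))"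
    using Suc.IH[of "Q * Y"] Suc.prems Q Y by simp
  also have "\<dots> = (\<Sum>\<nu><k. (B \<nu> * (pinv (A \<nu>) * (tail_prod n A (Suc \<nu>) (Suc k - Suc \<nu>) * Y))) $$ (i,j))"
  proof (intro sum.cong refl)
    fix \<nu> assume "\<nu> \<in> {..<k}"
    then have \<nu>: "\<nu> < k" by simp
    have T: "tail_prod n A (Suc \<nu>) (k - Suc \<nu>) \<in> carrier_mat n n"
      using tail_prod_carrier[of "Suc \<nu>" "k - Suc \<nu>"] \<nu> Suc.prems by simp
    have "tail_prod n A (Suc \<nu>) (Suc k - Suc \<nu>) = tail_prod n A (Suc \<nu>) (k - Suc \<nu>) * Q"
      using \<nu> Suc_diff_Suc[OF \<nu>] by (simp add: Q_def flip: Suc_diff_Suc[OF \<nu>])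
    then show "(B \<nu> * (pinv (A \<nu>) * (tail_prod n A (Suc \<nu>) (k - Suc \<nu>) * (Q * Y)))) $$ (i,j) =
        (B \<nu> * (pinv (A \<nu>) * (tail_prod n A (Suc \<nu>) (Suc k - Suc \<nu>) * Y))) $$ (i,j)"
      using assoc_mult_mat[OF T Q Y] by simp
  qed
  also have "pinv (A k) * Y = pinv (A k) * (tail_prod n A (Suc k) (Suc k - Suc k) * Y)" using Y by simp
  finally show ?case by simp
qed

lemma resid_carrier: "\<nu> < P \<Longrightarrow> \<mu> < P \<Longrightarrow> resid n m P A \<nu> \<mu> \<in> carrier_mat m m"
  using pinv(1)[OF A[of \<nu>]] tail_prod_carrier[of "Suc \<nu>" "P - Suc \<nu>"] A[of \<mu>]
  by (auto simp: resid_def intro!: minus_carrier_mat mult_carrier_mat[of _ m n] mult_carrier_mat[of _ n n])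

lemma final_error_resid:
  assumes B: "\<And>\<mu>. \<mu> < P \<Longrightarrow> B \<mu> \<in> carrier_mat Ny m"
  shows "final_error P Ny n A B = (1 / real Ny) *
    (\<Sum>\<mu><P. \<Sum>i<Ny. \<Sum>j<m. (\<Sum>\<nu><P. \<Sum>l<m. B \<nu> $$ (i,l) * resid n m P A \<nu> \<mu> $$ (l,j))\<^sup>2)"
proof -
  have "frob_sq (B \<mu> - cl_weights Ny n A B P * A \<mu>) =
      (\<Sum>i<Ny. \<Sum>j<m. (\<Sum>\<nu><P. \<Sum>l<m. B \<nu> $$ (i,l) * resid n m P A \<nu> \<mu> $$ (l,j))\<^sup>2)" if \<mu>: "\<mu> < P" for \<mu>
  proof -
    have W: "cl_weights Ny n A B P \<in> carrier_mat Ny n" using cl_weights_carrier[OF B] by simp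
    have "(B \<mu> - cl_weights Ny n A B P * A \<mu>) $$ (i,j) =
        (\<Sum>\<nu><P. \<Sum>l<m. B \<nu> $$ (i,l) * resid n m P A \<nu> \<mu> $$ (l,j))" if ij: "i < Ny" "j < m" for i j
    proof -
      have entry: "(B \<nu> * resid n m P A \<nu> \<mu>) $$ (i,j) = (if \<nu> = \<mu> then B \<nu> $$ (i,j) else 0) -
          (B \<nu> * (pinv (A \<nu>) * (tail_prod n A (Suc \<nu>) (P - Suc \<nu>) * A \<mu>))) $$ (i,j)" if \<nu>: "\<nu> < P" for \<nu>
      proof -
        define Z where "Z = pinv (A \<nu>) * (tail_prod n A (Suc \<nu>) (P - Suc \<nu>) * A \<mu>)"
        have Z: "Z \<in> carrier_mat m m"
          using pinv(1)[OF A[OF \<nu>]] tail_prod_carrier[of "Suc \<nu>" "P - Suc \<nu>"] A[OF \<mu>] \<nu> by (simp add: Z_def)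
        have "B \<nu> * resid n m P A \<nu> \<mu> = (if \<nu> = \<mu> then 1 else 0) \<cdot>\<^sub>m B \<nu> - B \<nu> * Z"
          unfolding resid_def Z_def[symmetric] using B[OF \<nu>] Z
          by (simp add: mult_minus_distrib_mat[of _ Ny m _ m] mult_smult_distrib[of _ Ny m _ m])
        then show ?thesis using B[OF \<nu>] Z ij by (simp add: Z_def[symmetric])
      qed
      have "(B \<mu> - cl_weights Ny n A B P * A \<mu>) $$ (i,j) = B \<mu> $$ (i,j) -
          (\<Sum>\<nu><P. (B \<nu> * (pinv (A \<nu>) * (tail_prod n A (Suc \<nu>) (P - Suc \<nu>) * A \<mu>))) $$ (i,j))"
        using cl_weights_mult[where B = B and c = m, OF B ij order_refl A[OF \<mu>]] W A[OF \<mu>] B[OF \<mu>] ij by simp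
      also have "\<dots> = (\<Sum>\<nu><P. (B \<nu> * resid n m P A \<nu> \<mu>) $$ (i,j))"
        using \<mu> by (simp add: entry sum_subtractf)
      also have "\<dots> = (\<Sum>\<nu><P. \<Sum>l<m. B \<nu> $$ (i,l) * resid n m P A \<nu> \<mu> $$ (l,j))"
      proof (intro sum.cong refl)
        fix \<nu> assume "\<nu> \<in> {..<P}"
        then show "(B \<nu> * resid n m P A \<nu> \<mu>) $$ (i,j) = (\<Sum>l<m. B \<nu> $$ (i,l) * resid n m P A \<nu> \<mu> $$ (l,j))"
          using B[of \<nu>] resid_carrier[of \<nu> \<mu>] \<mu> ij index_mat_mult[of i "B \<nu>" j "resid n m P A \<nu> \<mu>"] by simp
      qed
      finally show ?thesis .
    qed
    then show ?thesis using W B[OF \<mu>] A[OF \<mu>] by (simp add: frob_sq_def)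
  qed
  then show ?thesis by (simp add: final_error_def)
qed

text \<open>Every error term of the backward recursion is \<open>pinv (A \<nu>)\<close> applied to a contraction applied to a defect
  \<open>q k l\<close>.\<close>

lemma resid_limit_bound:
  fixes C :: "real mat"
  assumes C: "C \<in> carrier_mat P P" and \<nu>: "\<nu> < P" and \<mu>: "\<mu> < P"
    and rank: "pinv (A \<nu>) * A \<nu> = 1\<^sub>m m"
  defines "mm \<equiv> mat_inv (1\<^sub>m P + strict_upper C) * C"
  defines "q \<equiv> \<lambda>k l. col_proj (A k) * (A l - C $$ (k,l) \<cdot>\<^sub>m A k)"
  shows "frob_sq (resid n m P A \<nu> \<mu> - (1\<^sub>m P - mm) $$ (\<nu>,\<mu>) \<cdot>\<^sub>m 1\<^sub>m m) \<le>
    ((real P + 1) * (1 + (\<Sum>l<P. \<bar>mm $$ (l,\<mu>)\<bar>)))\<^sup>2 *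
      (sqrt (frob_sq (pinv (A \<nu>) * transpose_mat (pinv (A \<nu>)))) *
       (\<Sum>k<P. \<Sum>l<P. sqrt (frob_sq (transpose_mat (q k l) * q k l))))"
proof -
  define X where "X = pinv (A \<nu>)"
  define g where "g = sqrt (frob_sq (X * transpose_mat X))"
  define s where "s = (\<Sum>k<P. \<Sum>l<P. sqrt (frob_sq (transpose_mat (q k l) * q k l)))"
  \<comment> \<open>A common unit for all error terms: the sum s over all pairs of tasks dominates
    each single defect.\<close>
  define E where "E = sqrt (g * s)"
  define \<kappa> where "\<kappa> = 1 + (\<Sum>l<P. \<bar>mm $$ (l,\<mu>)\<bar>)"
  have g0: "0 \<le> g" by (simp add: g_def)
  have s0: "0 \<le> s" by (auto simp: s_def intro!: sum_nonneg)
  have E0: "0 \<le> E" using g0 s0 by (simp add: E_def)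
  note X = pinv[OF A[OF \<nu>], folded X_def]
  have q: "q k l \<in> carrier_mat n m" if "k < P" "l < P" for k l
    using col_proj_props(1)[OF that(1)] A[OF that(1)] A[OF that(2)] by (simp add: q_def minus_carrier_mat)
  \<comment> \<open>Quantifying over every contraction T makes this class stable under left
    multiplication by complementary projectors, so errors made early in the recursion pass through
    the remaining factors at no cost.\<close>
  define bnd where "bnd K R \<longleftrightarrow> R \<in> carrier_mat n m \<and>
      (\<forall>T. contraction n T \<longrightarrow> sqrt (frob_sq (X * (T * R))) \<le> K * E)" for K R
  have bnd_zero: "bnd 0 (0\<^sub>m n m)"
  proof -
    have "frob_sq (X * (T * 0\<^sub>m n m)) = 0" if "contraction n T" for T
    proof -
      have "T \<in> carrier_mat n n" using that by (simp add: contraction_def)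
      then have "T * 0\<^sub>m n m = 0\<^sub>m n m" by simp
      moreover have "X * 0\<^sub>m n m = 0\<^sub>m m m" using X(1) by simp
      ultimately show ?thesis by (simp add: frob_sq_def)
    qed
    then show ?thesis by (simp add: bnd_def)
  qed
  have bnd_q: "bnd 1 (q k l)" if kl: "k < P" "l < P" for k l
    unfolding bnd_def
  proof (intro conjI allI impI q[OF kl])
    fix T assume T: "contraction n T"
    then have Tc: "T \<in> carrier_mat n n" by (simp add: contraction_def)
    have "frob_sq (X * (T * q k l)) \<le> g * sqrt (frob_sq (transpose_mat (T * q k l) * (T * q k l)))"
      unfolding g_def by (rule frob_sq_mult_le[of _ m n _ m]) (use X(1) Tc q[OF kl] in auto)
    also have "\<dots> \<le> g * sqrt (frob_sq (transpose_mat (q k l) * q k l))"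
      using frob_sq_gram_contraction[OF T q[OF kl]] g0 by (intro mult_left_mono) auto
    also have "\<dots> \<le> g * s"
    proof (intro mult_left_mono g0)
      have "sqrt (frob_sq (transpose_mat (q k l) * q k l)) \<le>
          (\<Sum>l<P. sqrt (frob_sq (transpose_mat (q k l) * q k l)))"
        using kl by (intro member_le_sum[of l _ "\<lambda>l. sqrt (frob_sq (transpose_mat (q k l) * q k l))"]) auto
      also have "\<dots> \<le> s"
        unfolding s_def using kl
        by (intro member_le_sum[of k _ "\<lambda>k. \<Sum>l<P. sqrt (frob_sq (transpose_mat (q k l) * q k l))"])
          (auto intro!: sum_nonneg)
      finally show "sqrt (frob_sq (transpose_mat (q k l) * q k l)) \<le> s" .
    qed
    finally show "sqrt (frob_sq (X * (T * q k l))) \<le> 1 * E" by (simp add: E_def)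
  qed
  have bnd_add: "bnd (K + K') (R + R')" if "bnd K R" "bnd K' R'" for K K' R R'
    unfolding bnd_def
  proof (intro conjI allI impI)
    show "R + R' \<in> carrier_mat n m" using that by (simp add: bnd_def)
    fix T assume T: "contraction n T"
    then have Tc: "T \<in> carrier_mat n n" by (simp add: contraction_def)
    have R: "R \<in> carrier_mat n m" "R' \<in> carrier_mat n m" using that by (auto simp: bnd_def)
    have "X * (T * (R + R')) = X * (T * R) + X * (T * R')"
      using X(1) Tc R by (simp add: mult_add_distrib_mat[of _ n n _ m] mult_add_distrib_mat[of _ m n _ m])
    then have "sqrt (frob_sq (X * (T * (R + R')))) \<le> sqrt (frob_sq (X * (T * R))) + sqrt (frob_sq (X * (T * R')))"
      using sqrt_frob_add[of "X * (T * R)" m m "X * (T * R')"] X(1) Tc R by simp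
    also have "\<dots> \<le> K * E + K' * E" using that T by (intro add_mono) (auto simp: bnd_def)
    finally show "sqrt (frob_sq (X * (T * (R + R')))) \<le> (K + K') * E" by (simp add: algebra_simps)
  qed
  have bnd_smult: "bnd (\<bar>c\<bar> * K) (c \<cdot>\<^sub>m R)" if "bnd K R" for c K R
    unfolding bnd_def
  proof (intro conjI allI impI)
    show "c \<cdot>\<^sub>m R \<in> carrier_mat n m" using that by (simp add: bnd_def)
    fix T assume T: "contraction n T"
    then have Tc: "T \<in> carrier_mat n n" by (simp add: contraction_def)
    have R: "R \<in> carrier_mat n m" using that by (auto simp: bnd_def)
    have "X * (T * (c \<cdot>\<^sub>m R)) = c \<cdot>\<^sub>m (X * (T * R))"
      using X(1) Tc R by (simp add: mult_smult_distrib[of _ n n _ m] mult_smult_distrib[of _ m n _ m])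
    then have "sqrt (frob_sq (X * (T * (c \<cdot>\<^sub>m R)))) = \<bar>c\<bar> * sqrt (frob_sq (X * (T * R)))"
      by (simp add: frob_sq_smult real_sqrt_mult)
    also have "\<dots> \<le> \<bar>c\<bar> * (K * E)" using that T by (intro mult_left_mono) (auto simp: bnd_def)
    finally show "sqrt (frob_sq (X * (T * (c \<cdot>\<^sub>m R)))) \<le> \<bar>c\<bar> * K * E" by (simp add: mult.assoc)
  qed
  have bnd_contr: "bnd K (S * R)" if "bnd K R" "contraction n S" for K R S
    unfolding bnd_def
  proof (intro conjI allI impI)
    have R: "R \<in> carrier_mat n m" and Sc: "S \<in> carrier_mat n n" using that by (auto simp: bnd_def contraction_def)
    then show "S * R \<in> carrier_mat n m" by simp
    fix T assume T: "contraction n T"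
    then have Tc: "T \<in> carrier_mat n n" by (simp add: contraction_def)
    have "T * (S * R) = (T * S) * R" using assoc_mult_mat[OF Tc Sc R] by simp
    then show "sqrt (frob_sq (X * (T * (S * R)))) \<le> K * E"
      using that(1) contraction_mult[OF T that(2)] by (simp add: bnd_def)
  qed
  have bnd_mono: "bnd K' R" if "bnd K R" "K \<le> K'" for K K' R
    unfolding bnd_def
  proof (intro conjI allI impI)
    show "R \<in> carrier_mat n m" using that by (simp add: bnd_def)
    fix T assume "contraction n T"
    then have "sqrt (frob_sq (X * (T * R))) \<le> K * E" using that by (simp add: bnd_def)
    also have "\<dots> \<le> K' * E" using that E0 by (intro mult_right_mono)
    finally show "sqrt (frob_sq (X * (T * R))) \<le> K' * E" .
  qed
  have bnd_lincomb: "bnd (\<Sum>l<p. \<bar>w l\<bar>) (lincomb_mat p n m w (q k))" if "k < P" "p \<le> P" for k p w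
    using that(2)
  proof (induction p)
    case 0
    then show ?case using bnd_zero by (simp add: lincomb_mat_0)
  next
    case (Suc p)
    then have "bnd ((\<Sum>l<p. \<bar>w l\<bar>) + \<bar>w p\<bar> * 1) (lincomb_mat p n m w (q k) + w p \<cdot>\<^sub>m q k p)"
      using bnd_q[of k p] \<open>k < P\<close> by (intro bnd_add bnd_smult) auto
    then show ?case using q[of k p] \<open>k < P\<close> Suc.prems by (simp add: lincomb_mat_Suc)
  qed
  \<comment> \<open>Coefficients of the combination of task matrices that replaces the tail product
    from task t on, applied to the matrix of task \<mu>: begin with that matrix and subtract the
    limit coefficient of each task already passed.\<close>
  define w where "w t l = (if l = \<mu> then 1 else 0) - (if t \<le> l then mm $$ (l,\<mu>) else 0)" for t l
  have w_bound: "(\<Sum>l<P. \<bar>w t l\<bar>) \<le> \<kappa>" for t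
  proof -
    have "(\<Sum>l<P. \<bar>w t l\<bar>) \<le> (\<Sum>l<P. (if l = \<mu> then 1 else 0) + \<bar>mm $$ (l,\<mu>)\<bar>)"
      by (intro sum_mono) (auto simp: w_def)
    then show ?thesis using \<mu> by (simp add: \<kappa>_def sum.distrib)
  qed
  have proj_lincomb: "col_proj (A k) * lincomb_mat P n m (w (Suc k)) A =
      mm $$ (k,\<mu>) \<cdot>\<^sub>m A k + lincomb_mat P n m (w (Suc k)) (q k)" if k: "k < P" for k
  proof -
    note Qk = col_proj_props[OF k]
    have qA: "col_proj (A k) * A l = C $$ (k,l) \<cdot>\<^sub>m A k + q k l" if l: "l < P" for l
    proof -
      have "q k l = col_proj (A k) * A l - C $$ (k,l) \<cdot>\<^sub>m A k"
        unfolding q_def using Qk(1,4) A[OF k] A[OF l]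
        by (simp add: mult_minus_distrib_mat[of _ n n _ m] mult_smult_distrib[of _ n n _ m])
      moreover have "col_proj (A k) * A l \<in> carrier_mat n m" using Qk(1) A[OF l] by simp
      ultimately show ?thesis using A[OF k] by (intro eq_matI) auto
    qed
    \<comment> \<open>This is the recursion of \<open>limit_matrix_rec\<close>: up to defects,
      projecting the current combination onto the range of task k yields exactly
      \<open>mm $$ (k,\<mu>)\<close> times the matrix of task k.\<close>
    have wsum: "(\<Sum>l<P. w (Suc k) l * C $$ (k,l)) = mm $$ (k,\<mu>)"
    proof -
      have "(\<Sum>l<P. w (Suc k) l * C $$ (k,l)) =
          (\<Sum>l<P. (if l = \<mu> then C $$ (k,\<mu>) else 0) - (if k < l then C $$ (k,l) * mm $$ (l,\<mu>) else 0))"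
        by (intro sum.cong refl) (auto simp: w_def algebra_simps Suc_le_eq)
      also have "\<dots> = C $$ (k,\<mu>) - (\<Sum>l<P. if k < l then C $$ (k,l) * mm $$ (l,\<mu>) else 0)"
        using \<mu> by (simp add: sum_subtractf)
      also have "\<dots> = mm $$ (k,\<mu>)" using limit_matrix_rec(2)[OF C k \<mu>, folded mm_def] by simp
      finally show ?thesis .
    qed
    have "col_proj (A k) * lincomb_mat P n m (w (Suc k)) A = lincomb_mat P n m (w (Suc k)) (\<lambda>l. col_proj (A k) * A l)"
      by (rule mult_lincomb_mat[OF Qk(1) A])
    also have "\<dots> = mm $$ (k,\<mu>) \<cdot>\<^sub>m A k + lincomb_mat P n m (w (Suc k)) (q k)"
    proof (intro eq_matI)
      fix i j assume "i < dim_row (mm $$ (k,\<mu>) \<cdot>\<^sub>m A k + lincomb_mat P n m (w (Suc k)) (q k))"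
        "j < dim_col (mm $$ (k,\<mu>) \<cdot>\<^sub>m A k + lincomb_mat P n m (w (Suc k)) (q k))"
      then have ij: "i < n" "j < m" by auto
      have "lincomb_mat P n m (w (Suc k)) (\<lambda>l. col_proj (A k) * A l) $$ (i,j) =
          (\<Sum>l<P. w (Suc k) l * C $$ (k,l) * A k $$ (i,j) + w (Suc k) l * q k l $$ (i,j))"
        unfolding lincomb_mat_def using ij
      proof (simp, intro sum.cong refl)
        fix l assume "l \<in> {..<P}"
        then have l: "l < P" by simp
        have "(col_proj (A k) * A l) $$ (i,j) = C $$ (k,l) * A k $$ (i,j) + q k l $$ (i,j)"
          unfolding qA[OF l] using ij A[OF k] q[OF k l] by simp
        then show "w (Suc k) l * (col_proj (A k) * A l) $$ (i,j) =
            w (Suc k) l * C $$ (k,l) * A k $$ (i,j) + w (Suc k) l * q k l $$ (i,j)"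
          by (simp add: algebra_simps)
      qed
      also have "\<dots> = (\<Sum>l<P. w (Suc k) l * C $$ (k,l)) * A k $$ (i,j) + (\<Sum>l<P. w (Suc k) l * q k l $$ (i,j))"
        by (simp add: sum.distrib sum_distrib_right)
      also have "\<dots> = (mm $$ (k,\<mu>) \<cdot>\<^sub>m A k + lincomb_mat P n m (w (Suc k)) (q k)) $$ (i,j)"
        unfolding wsum using ij A[OF k] by (simp add: lincomb_mat_def)
      finally show "lincomb_mat P n m (w (Suc k)) (\<lambda>l. col_proj (A k) * A l) $$ (i,j) =
          (mm $$ (k,\<mu>) \<cdot>\<^sub>m A k + lincomb_mat P n m (w (Suc k)) (q k)) $$ (i,j)" .
    qed (use A[OF k] in auto)
    finally show ?thesis .
  qed
  \<comment> \<open>Backward induction on the number d of projectors applied. Each of them adds a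
    combination of defects of total weight at most \<kappa> and sends the errors made so far through
    a contraction.\<close>
  have tail: "\<exists>R. bnd (real d * \<kappa>) R \<and>
      tail_prod n A (P - d) d * A \<mu> = lincomb_mat P n m (w (P - d)) A + R" if "d \<le> P" for d
    using that
  proof (induction d)
    case 0
    have "tail_prod n A (P - 0) 0 * A \<mu> = lincomb_mat P n m (w (P - 0)) A + 0\<^sub>m n m"
    proof (intro eq_matI)
      fix i j assume "i < dim_row (lincomb_mat P n m (w (P - 0)) A + 0\<^sub>m n m)"
        "j < dim_col (lincomb_mat P n m (w (P - 0)) A + 0\<^sub>m n m)"
      then have ij: "i < n" "j < m" by auto
      have "(\<Sum>l<P. w P l * A l $$ (i,j)) = (\<Sum>l<P. if l = \<mu> then A \<mu> $$ (i,j) else 0)"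
        by (intro sum.cong refl) (auto simp: w_def)
      then show "(tail_prod n A (P - 0) 0 * A \<mu>) $$ (i,j) = (lincomb_mat P n m (w (P - 0)) A + 0\<^sub>m n m) $$ (i,j)"
        using ij A[OF \<mu>] \<mu> by (simp add: lincomb_mat_def)
    qed (use A[OF \<mu>] in auto)
    then show ?case using bnd_zero by auto
  next
    case (Suc d)
    define k where "k = P - Suc d"
    have k: "k < P" and kd: "P - d = Suc k" "Suc k + d = P" using Suc.prems by (auto simp: k_def)
    obtain R where R: "bnd (real d * \<kappa>) R"
      and eq: "tail_prod n A (Suc k) d * A \<mu> = lincomb_mat P n m (w (Suc k)) A + R"
      using Suc unfolding kd(1) by auto
    have Rc: "R \<in> carrier_mat n m" using R by (simp add: bnd_def)
    define Q where "Q = col_proj (A k)"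
    note Qk = col_proj_props[OF k, folded Q_def]
    define L where "L = lincomb_mat P n m (w (Suc k)) A"
    define R' where "R' = (1\<^sub>m n - Q) * R + (-1) \<cdot>\<^sub>m lincomb_mat P n m (w (Suc k)) (q k)"
    have IQ: "1\<^sub>m n - Q \<in> carrier_mat n n" using Qk(1) by (rule minus_carrier_mat)
    have "bnd (real d * \<kappa> + \<bar>-1\<bar> * (\<Sum>l<P. \<bar>w (Suc k) l\<bar>)) R'"
      unfolding R'_def using R contraction_complement[OF Qk(1-3)] bnd_lincomb[OF k order_refl]
      by (intro bnd_add bnd_smult bnd_contr) auto
    then have "bnd (real (Suc d) * \<kappa>) R'"
      by (rule bnd_mono) (use w_bound[of "Suc k"] in \<open>simp add: algebra_simps\<close>)
    moreover have "tail_prod n A (P - Suc d) (Suc d) * A \<mu> = lincomb_mat P n m (w (P - Suc d)) A + R'"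
    proof -
      have T: "tail_prod n A (Suc k) d \<in> carrier_mat n n" using tail_prod_carrier[of "Suc k" d] kd by simp
      have "tail_prod n A k (Suc d) * A \<mu> = (1\<^sub>m n - Q) * (tail_prod n A (Suc k) d * A \<mu>)"
        using tail_prod_left[of k d] kd assoc_mult_mat[OF IQ T A[OF \<mu>]] by (simp add: Q_def)
      also have "\<dots> = (1\<^sub>m n - Q) * L + (1\<^sub>m n - Q) * R"
        unfolding eq L_def using IQ Rc by (intro mult_add_distrib_mat[of _ n n]) auto
      also have "(1\<^sub>m n - Q) * L = L - Q * L"
        using Qk(1) by (simp add: L_def minus_mult_distrib_mat[of _ n n _ _ m])
      also have "Q * L = mm $$ (k,\<mu>) \<cdot>\<^sub>m A k + lincomb_mat P n m (w (Suc k)) (q k)"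
        unfolding L_def Q_def by (rule proj_lincomb[OF k])
      finally have e: "tail_prod n A k (Suc d) * A \<mu> =
          L - (mm $$ (k,\<mu>) \<cdot>\<^sub>m A k + lincomb_mat P n m (w (Suc k)) (q k)) + (1\<^sub>m n - Q) * R" .
      have wk: "w k l = w (Suc k) l - (if l = k then mm $$ (k,\<mu>) else 0)" for l
        by (auto simp: w_def)
      have "L - mm $$ (k,\<mu>) \<cdot>\<^sub>m A k = lincomb_mat P n m (w k) A"
      proof (intro eq_matI)
        fix i j assume "i < dim_row (lincomb_mat P n m (w k) A)" "j < dim_col (lincomb_mat P n m (w k) A)"
        then have ij: "i < n" "j < m" by auto
        have "(\<Sum>l<P. w k l * A l $$ (i,j)) =
            (\<Sum>l<P. w (Suc k) l * A l $$ (i,j) - (if l = k then mm $$ (k,\<mu>) * A k $$ (i,j) else 0))"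
          by (intro sum.cong refl) (auto simp: wk algebra_simps)
        then show "(L - mm $$ (k,\<mu>) \<cdot>\<^sub>m A k) $$ (i,j) = lincomb_mat P n m (w k) A $$ (i,j)"
          using ij A[OF k] k by (simp add: L_def lincomb_mat_def sum_subtractf)
      qed (use A[OF k] in auto)
      then have "lincomb_mat P n m (w k) A + R' = (L - mm $$ (k,\<mu>) \<cdot>\<^sub>m A k) + R'" by simp
      also have "\<dots> = tail_prod n A k (Suc d) * A \<mu>"
        unfolding e R'_def using A[OF k] IQ Rc by (intro eq_matI) (auto simp: L_def)
      finally show ?thesis by (simp add: k_def)
    qed
    ultimately show ?case by blast
  qed
  define d where "d = P - Suc \<nu>"
  have d: "d \<le> P" "P - d = Suc \<nu>" using \<nu> by (auto simp: d_def)
  obtain R where R: "bnd (real d * \<kappa>) R"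
    and eq: "tail_prod n A (Suc \<nu>) d * A \<mu> = lincomb_mat P n m (w (Suc \<nu>)) A + R"
    using tail[OF d(1)] unfolding d(2) by auto
  have Rc: "R \<in> carrier_mat n m" using R by (simp add: bnd_def)
  define L where "L = lincomb_mat P n m (w (Suc \<nu>)) (q \<nu>)"
  have L: "L \<in> carrier_mat n m" by (simp add: L_def)
  note Q = col_proj_props[OF \<nu>, folded X_def]
  \<comment> \<open>The pseudo-inverse absorbs its own projector, which permits one more projection
    step; full rank then turns \<open>X * A \<nu>\<close> into the identity.\<close>
  have "X * lincomb_mat P n m (w (Suc \<nu>)) A = X * (col_proj (A \<nu>) * lincomb_mat P n m (w (Suc \<nu>)) A)"
    using assoc_mult_mat[OF X(1) Q(1) lincomb_mat_carrier, of P m "w (Suc \<nu>)" A] Q(5) by simp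
  also have "\<dots> = X * (mm $$ (\<nu>,\<mu>) \<cdot>\<^sub>m A \<nu> + L)" unfolding proj_lincomb[OF \<nu>] L_def ..
  also have "\<dots> = mm $$ (\<nu>,\<mu>) \<cdot>\<^sub>m 1\<^sub>m m + X * L"
    using X(1) A[OF \<nu>] L rank by (simp add: mult_add_distrib_mat[of _ m n _ m] mult_smult_distrib[of _ m n _ m] X_def)
  finally have XL: "X * lincomb_mat P n m (w (Suc \<nu>)) A = mm $$ (\<nu>,\<mu>) \<cdot>\<^sub>m 1\<^sub>m m + X * L" .
  have "X * (tail_prod n A (Suc \<nu>) d * A \<mu>) = mm $$ (\<nu>,\<mu>) \<cdot>\<^sub>m 1\<^sub>m m + X * L + X * R"
    unfolding eq using X(1) Rc XL by (simp add: mult_add_distrib_mat[of _ m n _ m])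
  also have "\<dots> = mm $$ (\<nu>,\<mu>) \<cdot>\<^sub>m 1\<^sub>m m + X * (1\<^sub>m n * (L + R))"
    using X(1) L Rc by (simp add: mult_add_distrib_mat[of _ m n _ m] assoc_add_mat[of _ m m])
  finally have M: "X * (tail_prod n A (Suc \<nu>) d * A \<mu>) = mm $$ (\<nu>,\<mu>) \<cdot>\<^sub>m 1\<^sub>m m + X * (1\<^sub>m n * (L + R))" .
  have mmc: "mm \<in> carrier_mat P P" using limit_matrix_rec(1)[OF C \<nu> \<mu>] by (simp add: mm_def)
  define Z where "Z = X * (1\<^sub>m n * (L + R))"
  have XLR: "Z \<in> carrier_mat m m" using X(1) L Rc by (simp add: Z_def)
  have "resid n m P A \<nu> \<mu> - (1\<^sub>m P - mm) $$ (\<nu>,\<mu>) \<cdot>\<^sub>m 1\<^sub>m m = (-1) \<cdot>\<^sub>m Z"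
    unfolding resid_def d_def[symmetric] X_def[symmetric] M Z_def[symmetric]
    using XLR mmc \<nu> \<mu> by (intro eq_matI) (auto simp: algebra_simps)
  then have "frob_sq (resid n m P A \<nu> \<mu> - (1\<^sub>m P - mm) $$ (\<nu>,\<mu>) \<cdot>\<^sub>m 1\<^sub>m m) = frob_sq (X * (1\<^sub>m n * (L + R)))"
    by (simp add: frob_sq_smult Z_def)
  also have "\<dots> \<le> (((real P + 1) * \<kappa>) * E)\<^sup>2"
  proof -
    have "bnd ((\<Sum>l<P. \<bar>w (Suc \<nu>) l\<bar>) + real d * \<kappa>) (L + R)"
      unfolding L_def using bnd_lincomb[OF \<nu> order_refl] R by (intro bnd_add) auto
    \<comment> \<open>One \<kappa> comes from the projection just made and at most P of them from
      the tail.\<close>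
    moreover have "(\<Sum>l<P. \<bar>w (Suc \<nu>) l\<bar>) + real d * \<kappa> \<le> (real P + 1) * \<kappa>"
    proof -
      have "0 \<le> \<kappa>" by (auto simp: \<kappa>_def intro!: add_nonneg_nonneg sum_nonneg)
      then have "real d * \<kappa> \<le> real P * \<kappa>" using d(1) by (intro mult_right_mono) auto
      then show ?thesis using w_bound[of "Suc \<nu>"] by (simp add: algebra_simps)
    qed
    ultimately have "bnd ((real P + 1) * \<kappa>) (L + R)" by (rule bnd_mono)
    then have "sqrt (frob_sq (X * (1\<^sub>m n * (L + R)))) \<le> (real P + 1) * \<kappa> * E"
      using contraction_one unfolding bnd_def by blast
    then show ?thesis by (rule sqrt_le_D)
  qed
  also have "\<dots> = ((real P + 1) * \<kappa>)\<^sup>2 * (g * s)"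
    using g0 s0 by (simp add: power_mult_distrib E_def)
  finally show ?thesis by (simp add: g_def s_def \<kappa>_def X_def)
qed

end

text \<open>Both identities hold after left multiplication by the invertible Gram matrix. The second
  turns the pseudo-inverse factor of \<open>resid_limit_bound\<close> into an inverse Gram matrix,
  whose moments can be bounded.\<close>

lemma pinv_full_rank:
  assumes A: "A \<in> carrier_mat n m" and det: "det (transpose_mat A * A) \<noteq> 0"
  shows "pinv A * A = 1\<^sub>m m" "pinv A * transpose_mat (pinv A) = mat_inv (transpose_mat A * A)"
proof -
  define G where "G = transpose_mat A * A"
  define X where "X = pinv A"
  note X = pinv[OF A, folded X_def]
  have G: "G \<in> carrier_mat m m" using A by (simp add: G_def)
  note H = mat_inv[OF G det[folded G_def]]
  have XA: "X * A \<in> carrier_mat m m" using X(1) A by simp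
  have "G * (X * A) = transpose_mat A * (A * X * A)"
    using A X(1) by (simp add: G_def mat_assoc)
  then have GXA: "G * (X * A) = G" using X(2) by (simp add: G_def)
  have "X * A = (mat_inv G * G) * (X * A)" using H(3) left_mult_one_mat[OF XA] by simp
  also have "\<dots> = mat_inv G * (G * (X * A))" using assoc_mult_mat[OF H(1) G XA] .
  also have "\<dots> = 1\<^sub>m m" using GXA H(3) by simp
  finally have one: "X * A = 1\<^sub>m m" .
  then show "pinv A * A = 1\<^sub>m m" by (simp add: X_def)
  have "G * X = transpose_mat A" using pinv_normal_eq[OF A] by (simp add: G_def X_def)
  then have "G * (X * transpose_mat X) = transpose_mat (X * A)"
    using G X(1) A by (simp add: mat_assoc[symmetric] transpose_mult' del: assoc_mult_mat)
  then have GXX: "G * (X * transpose_mat X) = 1\<^sub>m m" using one by simp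
  have XX: "X * transpose_mat X \<in> carrier_mat m m" using X(1) by simp
  have "X * transpose_mat X = (mat_inv G * G) * (X * transpose_mat X)" using H(3) left_mult_one_mat[OF XX] by simp
  also have "\<dots> = mat_inv G * (G * (X * transpose_mat X))" using assoc_mult_mat[OF H(1) G XX] .
  also have "\<dots> = mat_inv G" using GXX H(1) by simp
  finally show "pinv A * transpose_mat (pinv A) = mat_inv (transpose_mat A * A)" by (simp add: X_def G_def)
qed

text \<open>Cyclicity replaces the trace by that of \<open>pinv A * A\<close>, an m by m projector,
  and a diagonal entry t of a projector satisfies t^2 \<le> t, hence t \<le> 1. The bound is free of
  n, which is why projected noise stays small in high dimension.\<close>

lemma col_proj_trace_le:
  assumes A: "A \<in> carrier_mat n m"
  shows "(\<Sum>i<n. col_proj A $$ (i,i)) \<le> real m"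
proof -
  define X where "X = pinv A"
  note X = pinv[OF A, folded X_def]
  define R where "R = X * A"
  have R: "R \<in> carrier_mat m m" "transpose_mat R = R" using X A by (auto simp: R_def)
  have "R * R = (X * A * X) * A" using X(1) A by (simp add: R_def mat_assoc)
  then have RR: "R * R = R" unfolding X(3) R_def .
  have "(\<Sum>i<n. col_proj A $$ (i,i)) = (\<Sum>i<n. \<Sum>j<m. A $$ (i,j) * X $$ (j,i))"
    using A X(1) by (intro sum.cong refl) (simp add: col_proj_eq[OF A] X_def[symmetric] scalar_prod_def atLeast0LessThan)
  also have "\<dots> = (\<Sum>j<m. \<Sum>i<n. X $$ (j,i) * A $$ (i,j))"
    by (subst sum.swap) (simp add: mult.commute)
  also have "\<dots> = (\<Sum>j<m. R $$ (j,j))"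
    using A X(1) by (intro sum.cong refl) (simp add: R_def scalar_prod_def atLeast0LessThan)
  also have "\<dots> \<le> (\<Sum>j<m. 1)"
  proof (intro sum_mono)
    fix j assume "j \<in> {..<m}"
    then have j: "j < m" by simp
    have "R $$ (j,j) = (R * R) $$ (j,j)" by (simp add: RR)
    also have "\<dots> = (\<Sum>k<m. R $$ (j,k) * R $$ (k,j))"
      using R j index_mat_mult[of j R j R] by simp
    also have "\<dots> = (\<Sum>k<m. (R $$ (j,k))\<^sup>2)"
    proof (intro sum.cong refl)
      fix k assume "k \<in> {..<m}"
      then have "R $$ (k,j) = R $$ (j,k)"
        using arg_cong[OF R(2), of "\<lambda>M. M $$ (k,j)"] R(1) j by simp
      then show "R $$ (j,k) * R $$ (k,j) = (R $$ (j,k))\<^sup>2" by (simp add: power2_eq_square)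
    qed
    also have "\<dots> \<ge> (R $$ (j,j))\<^sup>2" using j by (intro member_le_sum) auto
    finally have "(R $$ (j,j))\<^sup>2 \<le> R $$ (j,j)" .
    show "R $$ (j,j) \<le> 1"
    proof (rule ccontr)
      assume "\<not> R $$ (j,j) \<le> 1"
      then have "R $$ (j,j) * 1 < R $$ (j,j) * R $$ (j,j)" by (intro mult_strict_left_mono) auto
      with \<open>(R $$ (j,j))\<^sup>2 \<le> R $$ (j,j)\<close> show False by (simp add: power2_eq_square)
    qed
  qed
  finally show ?thesis by simp
qed

section \<open>Measurability of the matrix functions\<close>

text \<open>The fixed shape is part of the notion: with it the entries of sums and products, and the
  determinant, are fixed polynomials in the entries.\<close>

definition meas_mat :: "'a measure \<Rightarrow> nat \<Rightarrow> nat \<Rightarrow> ('a \<Rightarrow> real mat) \<Rightarrow> bool" where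
  "meas_mat M n m F \<longleftrightarrow> (\<forall>x\<in>space M. F x \<in> carrier_mat n m) \<and>
     (\<forall>i<n. \<forall>j<m. (\<lambda>x. F x $$ (i,j)) \<in> borel_measurable M)"

lemma meas_matI:
  "(\<And>x. x \<in> space M \<Longrightarrow> F x \<in> carrier_mat n m) \<Longrightarrow>
   (\<And>i j. i < n \<Longrightarrow> j < m \<Longrightarrow> (\<lambda>x. F x $$ (i,j)) \<in> borel_measurable M) \<Longrightarrow> meas_mat M n m F"
  by (simp add: meas_mat_def)

lemma meas_mat_carrier: "meas_mat M n m F \<Longrightarrow> x \<in> space M \<Longrightarrow> F x \<in> carrier_mat n m"
  by (simp add: meas_mat_def)

lemma meas_mat_entry: "meas_mat M n m F \<Longrightarrow> i < n \<Longrightarrow> j < m \<Longrightarrow> (\<lambda>x. F x $$ (i,j)) \<in> borel_measurable M"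
  by (simp add: meas_mat_def)

lemma meas_mat_cong_entry:
  assumes "\<And>x. x \<in> space M \<Longrightarrow> F x \<in> carrier_mat n m"
    and "\<And>i j x. i < n \<Longrightarrow> j < m \<Longrightarrow> x \<in> space M \<Longrightarrow> F x $$ (i,j) = f i j x"
    and "\<And>i j. i < n \<Longrightarrow> j < m \<Longrightarrow> f i j \<in> borel_measurable M"
  shows "meas_mat M n m F"
proof (rule meas_matI[OF assms(1)])
  fix i j assume ij: "i < n" "j < m"
  show "(\<lambda>x. F x $$ (i,j)) \<in> borel_measurable M"
    using assms(2)[OF ij] assms(3)[OF ij] by (subst measurable_cong[of _ _ "f i j"]) auto
qed

lemma meas_mat_const: "A \<in> carrier_mat n m \<Longrightarrow> meas_mat M n m (\<lambda>_. A)"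
  by (simp add: meas_mat_def)

lemma meas_mat_add:
  assumes "meas_mat M n m F" "meas_mat M n m G"
  shows "meas_mat M n m (\<lambda>x. F x + G x)"
  by (rule meas_mat_cong_entry[where f = "\<lambda>i j x. F x $$ (i,j) + G x $$ (i,j)"])
    (use assms in \<open>auto dest: meas_mat_carrier intro!: borel_measurable_add meas_mat_entry\<close>)

lemma meas_mat_minus:
  assumes "meas_mat M n m F" "meas_mat M n m G"
  shows "meas_mat M n m (\<lambda>x. F x - G x)"
  by (rule meas_mat_cong_entry[where f = "\<lambda>i j x. F x $$ (i,j) - G x $$ (i,j)"])
    (use assms in \<open>auto dest: meas_mat_carrier intro!: borel_measurable_diff meas_mat_entry minus_carrier_mat\<close>)

lemma meas_mat_transpose:
  assumes "meas_mat M n m F"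
  shows "meas_mat M m n (\<lambda>x. transpose_mat (F x))"
  by (rule meas_mat_cong_entry[where f = "\<lambda>i j x. F x $$ (j,i)"])
    (use assms in \<open>auto dest: meas_mat_carrier intro!: meas_mat_entry\<close>)

lemma meas_mat_smult:
  assumes "meas_mat M n m F" "c \<in> borel_measurable M"
  shows "meas_mat M n m (\<lambda>x. c x \<cdot>\<^sub>m F x)"
  by (rule meas_mat_cong_entry[where f = "\<lambda>i j x. c x * F x $$ (i,j)"])
    (use assms in \<open>auto dest: meas_mat_carrier intro!: borel_measurable_times meas_mat_entry\<close>)

lemma meas_mat_mult:
  assumes "meas_mat M n k F" "meas_mat M k m G"
  shows "meas_mat M n m (\<lambda>x. F x * G x)"
proof (rule meas_mat_cong_entry[where f = "\<lambda>i j x. \<Sum>l<k. F x $$ (i,l) * G x $$ (l,j)"])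
  fix x assume "x \<in> space M"
  then show "F x * G x \<in> carrier_mat n m"
    using mult_carrier_mat meas_mat_carrier[OF assms(1)] meas_mat_carrier[OF assms(2)] by blast
next
  fix i j x assume "i < n" "j < m" "x \<in> space M"
  then show "(F x * G x) $$ (i,j) = (\<Sum>l<k. F x $$ (i,l) * G x $$ (l,j))"
    using meas_mat_carrier[OF assms(1), of x] meas_mat_carrier[OF assms(2), of x]
    by (subst index_mat_mult) auto
qed (use assms in \<open>auto intro!: borel_measurable_sum borel_measurable_times meas_mat_entry\<close>)

lemma meas_mat_det:
  assumes "meas_mat M n n F"
  shows "(\<lambda>x. det (F x)) \<in> borel_measurable M"
proof -
  have "(\<lambda>x. \<Sum>p | p permutes {0..<n}. signof p * (\<Prod>i = 0..<n. F x $$ (i, p i))) \<in> borel_measurable M"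
    using assms
    by (intro borel_measurable_sum borel_measurable_times borel_measurable_prod borel_measurable_const meas_mat_entry)
      (auto simp: permutes_in_image)
  then show ?thesis
    by (subst measurable_cong[of _ _ "\<lambda>x. \<Sum>p | p permutes {0..<n}. signof p * (\<Prod>i = 0..<n. F x $$ (i, p i))"])
      (use assms in \<open>auto dest!: meas_mat_carrier simp: det_def'\<close>)
qed

lemma meas_mat_adj:
  assumes "meas_mat M n n F"
  shows "meas_mat M n n (\<lambda>x. adj_mat (F x))"
proof (rule meas_mat_cong_entry[where f = "\<lambda>i j x. (-1) ^ (j + i) * det (mat_delete (F x) j i)"])
  fix i j assume ij: "i < n" "j < n"
  have "meas_mat M (n - 1) (n - 1) (\<lambda>x. mat_delete (F x) j i)"
  proof (rule meas_mat_cong_entry[where f = "\<lambda>i' j' x. F x $$ (if i' < j then i' else Suc i', if j' < i then j' else Suc j')"])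
    fix x assume "x \<in> space M"
    then show "mat_delete (F x) j i \<in> carrier_mat (n - 1) (n - 1)"
      using mat_delete_carrier[OF meas_mat_carrier[OF assms]] by blast
  next
    fix i' j' x assume "i' < n - 1" "j' < n - 1" "x \<in> space M"
    then show "mat_delete (F x) j i $$ (i',j') = F x $$ (if i' < j then i' else Suc i', if j' < i then j' else Suc j')"
      using meas_mat_carrier[OF assms, of x] by (simp add: mat_delete_def)
  next
    fix i' j' assume "i' < n - 1" "j' < n - 1"
    then show "(\<lambda>x. F x $$ (if i' < j then i' else Suc i', if j' < i then j' else Suc j')) \<in> borel_measurable M"
      by (intro meas_mat_entry[OF assms]) auto
  qed
  then show "(\<lambda>x. (-1) ^ (j + i) * det (mat_delete (F x) j i)) \<in> borel_measurable M"
    by (intro borel_measurable_times borel_measurable_const meas_mat_det)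
qed (use assms in \<open>auto dest!: meas_mat_carrier simp: adj_mat_def cofactor_def\<close>)

lemma meas_mat_inv:
  assumes "meas_mat M n n F" "\<And>x. x \<in> space M \<Longrightarrow> det (F x) \<noteq> 0"
  shows "meas_mat M n n (\<lambda>x. mat_inv (F x))"
proof -
  have m: "meas_mat M n n (\<lambda>x. (1 / det (F x)) \<cdot>\<^sub>m adj_mat (F x))"
    using assms(1) by (intro meas_mat_smult meas_mat_adj borel_measurable_divide borel_measurable_const meas_mat_det)
  show ?thesis
    by (rule meas_mat_cong_entry[where f = "\<lambda>i j x. ((1 / det (F x)) \<cdot>\<^sub>m adj_mat (F x)) $$ (i,j)"])
      (use m meas_mat_entry[OF m] mat_inv[OF meas_mat_carrier[OF assms(1)] assms(2)] in auto)
qed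

lemma meas_mat_resolvent:
  assumes F: "meas_mat M n n F" and psd: "\<And>x. x \<in> space M \<Longrightarrow> psd (F x)" and \<delta>: "0 < \<delta>"
  shows "meas_mat M n n (\<lambda>x. resolvent \<delta> (F x))"
proof -
  have "meas_mat M n n (\<lambda>x. mat_inv (F x + \<delta> \<cdot>\<^sub>m 1\<^sub>m n))"
    using meas_mat_carrier[OF F] psd \<delta>
    by (intro meas_mat_inv meas_mat_add F meas_mat_const det_shift) auto
  then show ?thesis
    by (intro meas_mat_cong_entry[where f = "\<lambda>i j x. mat_inv (F x + \<delta> \<cdot>\<^sub>m 1\<^sub>m n) $$ (i,j)"])
      (use meas_mat_carrier[OF F] in \<open>auto simp: resolvent_def meas_mat_def\<close>)
qed

lemma meas_mat_pinv:
  assumes F: "meas_mat M n m F"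
  shows "meas_mat M m n (\<lambda>x. pinv (F x))"
proof (rule meas_matI)
  fix x assume "x \<in> space M"
  then show "pinv (F x) \<in> carrier_mat m n" using pinv(1) meas_mat_carrier[OF F] by blast
next
  fix i j assume ij: "i < m" "j < n"
  have R: "meas_mat M m n (\<lambda>x. resolvent (1 / real (Suc k)) (transpose_mat (F x) * F x) * transpose_mat (F x))" for k
    using F psd_gram by (intro meas_mat_mult[of M m m] meas_mat_resolvent meas_mat_mult[of M m n] meas_mat_transpose) auto
  show "(\<lambda>x. pinv (F x) $$ (i,j)) \<in> borel_measurable M"
    by (rule borel_measurable_LIMSEQ_real[OF resolvent_pinv_limit meas_mat_entry[OF R]])
      (use meas_mat_carrier[OF F] ij in auto)
qed

lemma meas_mat_col_proj:
  assumes F: "meas_mat M n m F"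
  shows "meas_mat M n n (\<lambda>x. col_proj (F x))"
proof -
  have "meas_mat M n n (\<lambda>x. F x * pinv (F x))"
    by (intro meas_mat_mult[of M n m] F meas_mat_pinv)
  then show ?thesis
    unfolding meas_mat_def using col_proj_eq[OF meas_mat_carrier[OF F]] by (auto cong: measurable_cong)
qed

lemma meas_frob_sq:
  assumes F: "meas_mat M n m F"
  shows "(\<lambda>x. frob_sq (F x)) \<in> borel_measurable M"
proof -
  have "(\<lambda>x. \<Sum>i<n. \<Sum>j<m. (F x $$ (i,j))\<^sup>2) \<in> borel_measurable M"
    by (intro borel_measurable_sum borel_measurable_power meas_mat_entry[OF F]) auto
  then show ?thesis
    by (subst measurable_cong[of _ _ "\<lambda>x. \<Sum>i<n. \<Sum>j<m. (F x $$ (i,j))\<^sup>2"])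
      (auto dest!: meas_mat_carrier[OF F] simp: frob_sq_def)
qed

lemma meas_fip:
  assumes F: "meas_mat M n m F" and G: "meas_mat M n m G"
  shows "(\<lambda>x. fip (F x) (G x)) \<in> borel_measurable M"
proof -
  have "(\<lambda>x. \<Sum>i<n. \<Sum>j<m. F x $$ (i,j) * G x $$ (i,j)) \<in> borel_measurable M"
    by (intro borel_measurable_sum borel_measurable_times meas_mat_entry[OF F] meas_mat_entry[OF G]) auto
  then show ?thesis
    by (subst measurable_cong[of _ _ "\<lambda>x. \<Sum>i<n. \<Sum>j<m. F x $$ (i,j) * G x $$ (i,j)"])
      (auto dest!: meas_mat_carrier[OF F] simp: fip_def)
qed

section \<open>Measurability of the learned weights and of the error\<close>

lemma meas_mat_tail_prod:
  assumes A: "\<And>\<mu>. \<mu> < P \<Longrightarrow> meas_mat M n m (\<lambda>x. A x \<mu>)"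
  shows "s + d \<le> P \<Longrightarrow> meas_mat M n n (\<lambda>x. tail_prod n (A x) s d)"
proof (induction d)
  case 0
  then show ?case by (simp add: meas_mat_const)
next
  case (Suc d)
  then show ?case
    using A[of "s + d"] by (auto intro!: meas_mat_mult[of M n n] meas_mat_minus meas_mat_const meas_mat_col_proj)
qed

lemma meas_mat_resid:
  assumes A: "\<And>\<mu>. \<mu> < P \<Longrightarrow> meas_mat M n m (\<lambda>x. A x \<mu>)" and "\<nu> < P" "\<mu> < P"
  shows "meas_mat M m m (\<lambda>x. resid n m P (A x) \<nu> \<mu>)"
proof -
  have "meas_mat M n n (\<lambda>x. tail_prod n (A x) (Suc \<nu>) (P - Suc \<nu>))"
    using assms by (intro meas_mat_tail_prod[of P] A) auto
  then show ?thesis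
    unfolding resid_def using A assms(2,3)
    by (intro meas_mat_minus meas_mat_const meas_mat_mult[of M m n] meas_mat_mult[of M n n] meas_mat_pinv) auto
qed

lemma meas_mat_cl_weights:
  assumes A: "\<And>\<mu>. \<mu> < P \<Longrightarrow> meas_mat M n m (\<lambda>x. A x \<mu>)"
    and B: "\<And>\<mu>. \<mu> < P \<Longrightarrow> meas_mat M Ny m (\<lambda>x. B x \<mu>)"
  shows "k \<le> P \<Longrightarrow> meas_mat M Ny n (\<lambda>x. cl_weights Ny n (A x) (B x) k)"
proof (induction k)
  case 0
  then show ?case by (simp add: meas_mat_const)
next
  case (Suc k)
  then have IH: "meas_mat M Ny n (\<lambda>x. cl_weights Ny n (A x) (B x) k)"
    and Ak: "meas_mat M n m (\<lambda>x. A x k)" and Bk: "meas_mat M Ny m (\<lambda>x. B x k)"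
    using A B by auto
  have "meas_mat M n n (\<lambda>x. 1\<^sub>m n - col_proj (A x k))"
    by (intro meas_mat_minus meas_mat_const meas_mat_col_proj[OF Ak]) auto
  then show ?case
    unfolding cl_weights.simps by (intro meas_mat_add meas_mat_mult[OF IH] meas_mat_mult[OF Bk] meas_mat_pinv[OF Ak])
qed

lemma meas_final_error:
  assumes A: "\<And>\<mu>. \<mu> < P \<Longrightarrow> meas_mat M n m (\<lambda>x. A x \<mu>)"
    and B: "\<And>\<mu>. \<mu> < P \<Longrightarrow> meas_mat M Ny m (\<lambda>x. B x \<mu>)"
  shows "(\<lambda>x. final_error P Ny n (A x) (B x)) \<in> borel_measurable M"
  unfolding final_error_def
  by (intro borel_measurable_times borel_measurable_const borel_measurable_sum meas_frob_sq[of M Ny m]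
      meas_mat_minus meas_mat_mult[of M Ny n] meas_mat_cl_weights[OF A B] A B) auto

section \<open>Inverse moments of Gaussian Gram matrices\<close>

text \<open>The derivative of f times the Gaussian density is that density times (f' - t f), and the
  product itself vanishes at both infinities. Boundedness of f and f' supplies the integrability on
  the whole line.\<close>

lemma stein_1d:
  fixes f f' :: "real \<Rightarrow> real"
  assumes deriv: "\<And>t. (f has_real_derivative f' t) (at t)" and cont: "\<And>t. isCont f' t"
    and B: "\<And>t. \<bar>f t\<bar> \<le> B" and B': "\<And>t. \<bar>f' t\<bar> \<le> B'"
  shows "(\<integral>t. t * f t \<partial>std_normal_distribution) = (\<integral>t. f' t \<partial>std_normal_distribution)"
proof -
  let ?\<phi> = std_normal_density
  have fm[measurable]: "f \<in> borel_measurable borel"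
    using deriv by (intro borel_measurable_continuous_onI continuous_at_imp_continuous_on) (auto intro: DERIV_isCont)
  have f'm[measurable]: "f' \<in> borel_measurable borel"
    using cont by (intro borel_measurable_continuous_onI continuous_at_imp_continuous_on) auto
  have \<phi>: "(?\<phi> has_real_derivative - t * ?\<phi> t) (at t)" for t
    unfolding std_normal_density_def by (auto intro!: derivative_eq_intros simp: field_simps)
  have int1: "integrable lborel (\<lambda>t. ?\<phi> t * f' t)"
  proof (rule Bochner_Integration.integrable_bound[of _ "\<lambda>t. B' * ?\<phi> t"])
    show "integrable lborel (\<lambda>t. B' * ?\<phi> t)" by simp
    have "0 \<le> B'" using B'[of 0] by linarith
    then show "AE t in lborel. norm (?\<phi> t * f' t) \<le> norm (B' * ?\<phi> t)"
      using B' by (auto simp: abs_mult mult.commute intro!: mult_right_mono)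
  qed simp
  have int2: "integrable lborel (\<lambda>t. ?\<phi> t * (t * f t))"
  proof (rule Bochner_Integration.integrable_bound[of _ "\<lambda>t. B * (?\<phi> t * \<bar>t\<bar>)"])
    show "integrable lborel (\<lambda>t. B * (?\<phi> t * \<bar>t\<bar>))"
      using std_normal_moment_abs_odd[of 0] by (auto simp: has_bochner_integral_iff)
    have "0 \<le> B" using B[of 0] by linarith
    moreover have "\<bar>t * f t\<bar> \<le> B * \<bar>t\<bar>" for t
      using mult_right_mono[OF B[of t], of "\<bar>t\<bar>"] by (simp add: abs_mult mult.commute)
    ultimately show "AE t in lborel. norm (?\<phi> t * (t * f t)) \<le> norm (B * (?\<phi> t * \<bar>t\<bar>))"
      by (auto simp: abs_mult intro!: AE_I2) (metis abs_mult abs_ge_zero mult.left_commute mult_left_mono normal_density_nonneg)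
  qed simp
  define F where "F t = f t * ?\<phi> t" for t
  define F' where "F' t = ?\<phi> t * f' t - ?\<phi> t * (t * f t)" for t
  have "(F has_real_derivative F' t) (at t)" for t
    unfolding F_def F'_def using DERIV_mult[OF deriv \<phi>, of t] by (simp add: algebra_simps)
  then have FV: "(F has_vector_derivative F' t) (at t)" for t
    by (simp add: has_real_derivative_iff_has_vector_derivative)
  have intF: "integrable lborel F'" unfolding F'_def using int1 int2 by (rule Bochner_Integration.integrable_diff)
  have contF: "isCont F' t" for t
    unfolding F'_def using cont DERIV_isCont[OF deriv] DERIV_isCont[OF \<phi>]
    by (intro continuous_intros) auto
  have bound: "\<bar>F t\<bar> \<le> B * ?\<phi> t" for t
    using B[of t] by (simp add: F_def abs_mult mult_right_mono)
  have "(?\<phi> \<longlongrightarrow> 0) at_top" "(?\<phi> \<longlongrightarrow> 0) at_bot"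
    unfolding std_normal_density_def by real_asymp+
  then have lim: "((\<lambda>t. B * ?\<phi> t) \<longlongrightarrow> 0) at_top" "((\<lambda>t. B * ?\<phi> t) \<longlongrightarrow> 0) at_bot"
    by (auto intro!: tendsto_mult_right_zero)
  have "(F \<longlongrightarrow> 0) at_top" "(F \<longlongrightarrow> 0) at_bot"
    by (rule Lim_null_comparison[OF _ lim(1)], use bound in simp)
      (rule Lim_null_comparison[OF _ lim(2)], use bound in simp)
  then have "(LBINT t=-\<infinity>..\<infinity>. F' t) = 0 - 0"
    using intF FV contF by (intro interval_integral_FTC_integrable[where F = F])
      (auto simp: ereal_tendsto_simps set_integrable_def)
  then have "(\<integral>t. F' t \<partial>lborel) = 0"
    by (simp add: interval_lebesgue_integral_def set_lebesgue_integral_def)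
  then have "(\<integral>t. ?\<phi> t * f' t \<partial>lborel) = (\<integral>t. ?\<phi> t * (t * f t) \<partial>lborel)"
    unfolding F'_def using int1 int2 by simp
  then show ?thesis by (simp add: integral_density)
qed

section \<open>Products of standard Gaussians and integration by parts in one coordinate\<close>

lemma prob_space_std_normal: "prob_space std_normal_distribution"
  by (rule prob_space_normal_density) simp

interpretation std_normal: product_sigma_finite "\<lambda>_. std_normal_distribution"
  by (intro product_sigma_finite.intro prob_space_imp_sigma_finite prob_space_std_normal)

abbreviation gauss :: "'i set \<Rightarrow> ('i \<Rightarrow> real) measure" where
  "gauss I \<equiv> PiM I (\<lambda>_. std_normal_distribution)"

lemma prob_space_gauss: "prob_space (gauss I)"
  by (intro prob_space_PiM prob_space_std_normal)

lemma measurable_gauss_component: "i \<in> I \<Longrightarrow> (\<lambda>x. x i) \<in> borel_measurable (gauss I)"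
  using measurable_component_singleton[of i I "\<lambda>_. std_normal_distribution"] by simp

lemma integrable_gauss_component:
  assumes "i \<in> I"
  shows "integrable (gauss I) (\<lambda>x. \<bar>x i\<bar>)"
proof -
  interpret product_prob_space "\<lambda>_. std_normal_distribution" I
    by (intro product_prob_spaceI prob_space_std_normal)
  have "integrable lborel (\<lambda>t. std_normal_density t * \<bar>t\<bar>)"
    using std_normal_moment_abs_odd[of 0] by (auto simp: has_bochner_integral_iff)
  then have "integrable std_normal_distribution (\<lambda>t. \<bar>t\<bar>)"
    by (simp add: integrable_density)
  then have "integrable (distr (gauss I) std_normal_distribution (\<lambda>x. x i)) (\<lambda>t. \<bar>t\<bar>)"
    using PiM_component[OF assms] by simp
  then show ?thesis
    by (subst (asm) integrable_distr_eq) (auto intro: measurable_gauss_component assms)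
qed

text \<open>Fubini isolates coordinate i, and \<open>stein_1d\<close> applies along each line
  parallel to that axis.\<close>

lemma stein_gauss:
  fixes g g' :: "('i \<Rightarrow> real) \<Rightarrow> real"
  assumes I: "finite I" and i: "i \<in> I"
    and g: "g \<in> borel_measurable (gauss I)" and g': "g' \<in> borel_measurable (gauss I)"
    and B: "\<And>x. x \<in> space (gauss I) \<Longrightarrow> \<bar>g x\<bar> \<le> B"
    and B': "\<And>x. x \<in> space (gauss I) \<Longrightarrow> \<bar>g' x\<bar> \<le> B'"
    and deriv: "\<And>x t. x \<in> space (gauss I) \<Longrightarrow> ((\<lambda>t. g (x(i:=t))) has_real_derivative g' (x(i:=t))) (at t)"
    and cont: "\<And>x t. x \<in> space (gauss I) \<Longrightarrow> isCont (\<lambda>t. g' (x(i:=t))) t"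
  shows "integrable (gauss I) (\<lambda>x. x i * g x)" "integrable (gauss I) g'"
    "(\<integral>x. x i * g x \<partial>gauss I) = (\<integral>x. g' x \<partial>gauss I)"
proof -
  interpret prob_space "gauss I" by (rule prob_space_gauss)
  note [measurable] = g g' measurable_gauss_component[OF i]
  show int1: "integrable (gauss I) (\<lambda>x. x i * g x)"
  proof (rule Bochner_Integration.integrable_bound[of _ "\<lambda>x. B * \<bar>x i\<bar>"])
    show "integrable (gauss I) (\<lambda>x. B * \<bar>x i\<bar>)" using integrable_gauss_component[OF i] by simp
    show "AE x in gauss I. norm (x i * g x) \<le> norm (B * \<bar>x i\<bar>)"
    proof (rule AE_I2)
      fix x assume x: "x \<in> space (gauss I)"
      have "0 \<le> B" using B[OF x] by linarith
      then show "norm (x i * g x) \<le> norm (B * \<bar>x i\<bar>)"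
        using mult_right_mono[OF B[OF x], of "\<bar>x i\<bar>"] by (simp add: abs_mult mult.commute)
    qed
  qed simp
  show int2: "integrable (gauss I) g'"
    by (rule integrable_const_bound[of _ B']) (use B' in auto)
  define J where "J = I - {i}"
  have J: "finite J" "i \<notin> J" "insert i J = I" using I i by (auto simp: J_def)
  have "(\<integral>x. x i * g x \<partial>gauss I) =
      (\<integral>x. (\<integral>t. (x(i:=t)) i * g (x(i:=t)) \<partial>std_normal_distribution) \<partial>gauss J)"
    using std_normal.product_integral_insert[OF J(1,2), of "\<lambda>x. x i * g x"] int1 unfolding J(3) .
  also have "\<dots> = (\<integral>x. (\<integral>t. g' (x(i:=t)) \<partial>std_normal_distribution) \<partial>gauss J)"
  proof (rule Bochner_Integration.integral_cong[OF refl])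
    fix x assume x: "x \<in> space (gauss J)"
    have sp: "x(i:=t) \<in> space (gauss I)" for t
      using x i by (auto simp: space_PiM J_def PiE_def extensional_def Pi_def)
    have upd: "(x(i:=s))(i:=t) = x(i:=t)" for s t by simp
    have "(\<integral>t. t * g (x(i:=t)) \<partial>std_normal_distribution) = (\<integral>t. g' (x(i:=t)) \<partial>std_normal_distribution)"
      using deriv[OF sp[of 0]] cont[OF sp[of 0]] unfolding upd
      by (intro stein_1d[where B = B and B' = B']) (auto intro: B[OF sp] B'[OF sp])
    then show "(\<integral>t. (x(i:=t)) i * g (x(i:=t)) \<partial>std_normal_distribution) =
        (\<integral>t. g' (x(i:=t)) \<partial>std_normal_distribution)" by simp
  qed
  also have "\<dots> = (\<integral>x. g' x \<partial>gauss I)"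
    using std_normal.product_integral_insert[OF J(1,2), of g'] int2 unfolding J(3) by simp
  finally show "(\<integral>x. x i * g x \<partial>gauss I) = (\<integral>x. g' x \<partial>gauss I)" .
qed

text \<open>Indexed by a set of rows, so that removing one row and splitting into independent halves
  are both operations on sets.\<close>

definition row_gram :: "nat set \<Rightarrow> nat \<Rightarrow> (nat \<times> nat \<Rightarrow> real) \<Rightarrow> real mat" where
  "row_gram R m a = mat m m (\<lambda>(k,l). \<Sum>i\<in>R. a (i,k) * a (i,l))"

definition data_row :: "nat \<Rightarrow> (nat \<times> nat \<Rightarrow> real) \<Rightarrow> nat \<Rightarrow> real vec" where
  "data_row m a i = vec m (\<lambda>k. a (i,k))"

lemma data_row_carrier [simp]: "data_row m a i \<in> carrier_vec m"
  by (simp add: data_row_def)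

lemma row_gram_carrier [simp]: "row_gram R m a \<in> carrier_mat m m"
  by (simp add: row_gram_def)

lemma row_gram_insert: "finite R \<Longrightarrow> i \<notin> R \<Longrightarrow>
    row_gram (insert i R) m a = row_gram R m a + outer (data_row m a i) (data_row m a i)"
  by (intro eq_matI) (auto simp: row_gram_def data_row_def)

lemma row_gram_Un: "finite R \<Longrightarrow> finite S \<Longrightarrow> R \<inter> S = {} \<Longrightarrow>
    row_gram (R \<union> S) m a = row_gram R m a + row_gram S m a"
  by (intro eq_matI) (auto simp: row_gram_def sum.union_disjoint)

lemma psd_outer: "v \<in> carrier_vec m \<Longrightarrow> psd (outer v v)"
proof -
  assume v: "v \<in> carrier_vec m"
  have "x \<bullet> (outer v v *\<^sub>v x) = (v \<bullet> x)\<^sup>2" if "x \<in> carrier_vec m" for x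
    using v that comm_scalar_prod[OF v that] by (simp add: outer_mult_vec[of _ m] power2_eq_square)
  then show ?thesis using v by (auto simp: psd_iff[of _ m] transpose_outer)
qed

lemma row_gram_psd: "finite R \<Longrightarrow> psd (row_gram R m a)"
proof (induction R rule: finite_induct)
  case empty
  have "row_gram {} m a = 0\<^sub>m m m" by (intro eq_matI) (auto simp: row_gram_def)
  moreover have "0\<^sub>m m m *\<^sub>v v = 0\<^sub>v m" if "v \<in> carrier_vec m" for v :: "real vec"
    using that by (intro eq_vecI) auto
  then have "psd (0\<^sub>m m m)" by (auto simp: psd_iff[of _ m])
  ultimately show ?case by simp
next
  case (insert i R)
  then show ?case
    by (auto simp: row_gram_insert intro!: psd_add[of _ m] psd_outer[of _ m])
qed

text \<open>Sherman--Morrison. It makes the dependence on one data row explicit with a denominator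
  of at least 1, so along a single coordinate the resolvent is a rational function without
  poles.\<close>

lemma resolvent_rank_one:
  fixes r :: "real vec"
  assumes G: "G \<in> carrier_mat m m" "psd G" and \<delta>: "0 < \<delta>" and r: "r \<in> carrier_vec m"
  defines "S \<equiv> resolvent \<delta> G"
  defines "u \<equiv> S *\<^sub>v r"
  defines "D \<equiv> 1 + r \<bullet> u"
  shows "1 \<le> D" "resolvent \<delta> (G + outer r r) = S - (1 / D) \<cdot>\<^sub>m outer u u"
    "resolvent \<delta> (G + outer r r) *\<^sub>v r = (1 / D) \<cdot>\<^sub>v u"
proof -
  note S = resolvent[OF G \<delta>, folded S_def]
  have u: "u \<in> carrier_vec m" using S(1) r by (simp add: u_def)
  have ru: "0 \<le> r \<bullet> u" using resolvent_psd[OF G \<delta>] S(1) r by (auto simp: u_def S_def psd_iff[of _ m])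
  then show D1: "1 \<le> D" by (simp add: D_def)
  have Dn: "1 + r \<bullet> u \<noteq> 0" using ru by linarith
  define K where "K = G + \<delta> \<cdot>\<^sub>m 1\<^sub>m m"
  have K: "K \<in> carrier_mat m m" using G by (simp add: K_def)
  define T where "T = S - (1 / D) \<cdot>\<^sub>m outer u u"
  have T: "T \<in> carrier_mat m m" using u by (auto simp: T_def intro: minus_carrier_mat)
  have shift: "(G + outer r r) + \<delta> \<cdot>\<^sub>m 1\<^sub>m m = K + outer r r"
    using G r by (intro eq_matI) (auto simp: K_def)
  have Ku: "K *\<^sub>v u = r"
    using assoc_mult_mat_vec[OF K S(1) r] S(2) r by (simp add: u_def K_def)
  have "T * (K + outer r r) = 1\<^sub>m m"
  proof (rule mat_eq_by_vec[of _ m m])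
    fix v :: "real vec" assume v: "v \<in> carrier_vec m"
    have Kv: "K *\<^sub>v v \<in> carrier_vec m" using K v by simp
    have SKv: "S *\<^sub>v (K *\<^sub>v v) = v"
      using assoc_mult_mat_vec[OF S(1) K v] S(3) v by (simp add: K_def)
    have uKv: "u \<bullet> (K *\<^sub>v v) = r \<bullet> v"
    proof -
      have Kt: "transpose_mat K = K"
      proof -
        have "transpose_mat (\<delta> \<cdot>\<^sub>m 1\<^sub>m m) = \<delta> \<cdot>\<^sub>m 1\<^sub>m m" by (intro eq_matI) auto
        then show ?thesis using G by (simp add: K_def transpose_add[of _ m m] psd_iff[of _ m])
      qed
      show ?thesis using transpose_vec_mult_scalar[OF K v u] Kt Ku by simp
    qed
    have Tw: "T *\<^sub>v w = S *\<^sub>v w - ((1 / D) * (u \<bullet> w)) \<cdot>\<^sub>v u" if "w \<in> carrier_vec m" for w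
      using S(1) u that by (simp add: T_def minus_mult_distrib_mat_vec[of _ m m] smult_mult_mat_vec
          outer_mult_vec[of _ m] smult_smult_assoc)
    have "(T * (K + outer r r)) *\<^sub>v v = T *\<^sub>v ((K + outer r r) *\<^sub>v v)"
      using T K r v by (intro assoc_mult_mat_vec[of _ m m _ m]) auto
    also have "(K + outer r r) *\<^sub>v v = K *\<^sub>v v + (r \<bullet> v) \<cdot>\<^sub>v r"
      using K r v by (simp add: add_mult_distrib_mat_vec[of _ m m] outer_mult_vec[of _ m])
    also have "T *\<^sub>v (K *\<^sub>v v + (r \<bullet> v) \<cdot>\<^sub>v r) = T *\<^sub>v (K *\<^sub>v v) + (r \<bullet> v) \<cdot>\<^sub>v (T *\<^sub>v r)"
      using T Kv r by (simp add: mult_add_distrib_mat_vec[of _ m m] mult_mat_vec[of _ m m])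
    also have "T *\<^sub>v (K *\<^sub>v v) = v - ((1 / D) * (r \<bullet> v)) \<cdot>\<^sub>v u" unfolding Tw[OF Kv] SKv uKv ..
    also have "T *\<^sub>v r = u - ((1 / D) * (r \<bullet> u)) \<cdot>\<^sub>v u"
      unfolding Tw[OF r] u_def[symmetric] comm_scalar_prod[OF u r] ..
    also have "v - ((1 / D) * (r \<bullet> v)) \<cdot>\<^sub>v u + (r \<bullet> v) \<cdot>\<^sub>v (u - ((1 / D) * (r \<bullet> u)) \<cdot>\<^sub>v u) = v"
    proof (intro eq_vecI)
      fix i assume "i < dim_vec v"
      then have i: "i < m" using v by simp
      have "u $ i - (1 / D) * (r \<bullet> u) * u $ i = (1 / D) * u $ i"
        using Dn unfolding D_def by (simp add: field_simps)
      then have "v $ i - (1 / D) * (r \<bullet> v) * u $ i + (r \<bullet> v) * (u $ i - (1 / D) * (r \<bullet> u) * u $ i) = v $ i"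
        by (simp only:) simp
      then show "(v - ((1 / D) * (r \<bullet> v)) \<cdot>\<^sub>v u + (r \<bullet> v) \<cdot>\<^sub>v (u - ((1 / D) * (r \<bullet> u)) \<cdot>\<^sub>v u)) $ i = v $ i"
        using i u v by simp
    qed (use u v in auto)
    finally show "(T * (K + outer r r)) *\<^sub>v v = 1\<^sub>m m *\<^sub>v v" using v by simp
  qed (use T K r in auto)
  then have "mat_inv (K + outer r r) = T"
    using K r T by (intro mat_inv_unique(2)[of _ m]) auto
  then show eq: "resolvent \<delta> (G + outer r r) = S - (1 / D) \<cdot>\<^sub>m outer u u"
    using r shift by (simp add: resolvent_def T_def)
  have "(S - (1 / D) \<cdot>\<^sub>m outer u u) *\<^sub>v r = u - ((1 / D) * (r \<bullet> u)) \<cdot>\<^sub>v u"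
    using S(1) u r by (simp add: minus_mult_distrib_mat_vec[of _ m m] smult_mult_mat_vec
        outer_mult_vec[of _ m] smult_smult_assoc u_def[symmetric] comm_scalar_prod[OF u r])
  also have "\<dots> = (1 / D) \<cdot>\<^sub>v u"
  proof (intro eq_vecI)
    fix i assume "i < dim_vec ((1 / D) \<cdot>\<^sub>v u)"
    moreover have "x - (1 / D) * (r \<bullet> u) * x = (1 / D) * x" for x
      using Dn unfolding D_def by (simp add: field_simps)
    ultimately show "(u - ((1 / D) * (r \<bullet> u)) \<cdot>\<^sub>v u) $ i = ((1 / D) \<cdot>\<^sub>v u) $ i"
      using u by simp
  qed (use u in auto)
  finally show "resolvent \<delta> (G + outer r r) *\<^sub>v r = (1 / D) \<cdot>\<^sub>v u" unfolding eq .
qed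

text \<open>For y = H r, pairing r = (G + r r^T + \<delta>) y with y gives p = y.G y + p^2 +
  \<delta> y.y, where p = r.y. The terms on the right are nonnegative, so p^2 \<le> p and \<delta>
  y.y \<le> 1. These are the bounds that Stein's identity asks for.\<close>

lemma resolvent_bounds:
  fixes r :: "real vec"
  assumes G: "G \<in> carrier_mat m m" "psd G" and \<delta>: "0 < \<delta>" and r: "r \<in> carrier_vec m"
  defines "H \<equiv> resolvent \<delta> (G + outer r r)"
  shows "0 \<le> r \<bullet> (H *\<^sub>v r)" "r \<bullet> (H *\<^sub>v r) \<le> 1"
    "\<And>k. k < m \<Longrightarrow> ((H *\<^sub>v r) $ k)\<^sup>2 \<le> 1 / \<delta>"
proof -
  have G': "G + outer r r \<in> carrier_mat m m" "psd (G + outer r r)"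
    using G r by (auto intro!: psd_add[of _ m] psd_outer[of _ m])
  note H = resolvent[OF G' \<delta>, folded H_def]
  define y where "y = H *\<^sub>v r"
  have y: "y \<in> carrier_vec m" using H(1) r by (simp add: y_def)
  have Gy: "G *\<^sub>v y \<in> carrier_vec m" using G y by simp
  have "r = (G + outer r r + \<delta> \<cdot>\<^sub>m 1\<^sub>m m) *\<^sub>v y"
    unfolding y_def using assoc_mult_mat_vec[of "G + outer r r + \<delta> \<cdot>\<^sub>m 1\<^sub>m m" m m H m r] H G' r by simp
  also have "\<dots> = G *\<^sub>v y + (r \<bullet> y) \<cdot>\<^sub>v r + \<delta> \<cdot>\<^sub>v y"
    using shift_mult_vec[OF G'(1) y] G r y
    by (simp add: add_mult_distrib_mat_vec[of _ m m] outer_mult_vec[of _ m])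
  finally have "y \<bullet> r = y \<bullet> (G *\<^sub>v y + (r \<bullet> y) \<cdot>\<^sub>v r + \<delta> \<cdot>\<^sub>v y)" by simp
  also have "\<dots> = y \<bullet> (G *\<^sub>v y) + (r \<bullet> y) * (y \<bullet> r) + \<delta> * (y \<bullet> y)"
    using y r Gy by (simp add: scalar_prod_add_distrib[of _ m])
  finally have eq: "r \<bullet> y = y \<bullet> (G *\<^sub>v y) + (r \<bullet> y)\<^sup>2 + \<delta> * (y \<bullet> y)"
    using comm_scalar_prod[OF y r] by (simp add: power2_eq_square)
  have nn: "0 \<le> y \<bullet> (G *\<^sub>v y)" "0 \<le> \<delta> * (y \<bullet> y)"
    using G y \<delta> scalar_prod_self_nonneg[of y] by (auto simp: psd_iff[of _ m])
  then have sq: "(r \<bullet> y)\<^sup>2 \<le> r \<bullet> y" using eq by linarith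
  then have p0: "0 \<le> r \<bullet> y" by (meson order_trans zero_le_power2)
  have p1: "r \<bullet> y \<le> 1"
  proof (rule ccontr)
    assume "\<not> r \<bullet> y \<le> 1"
    then have "(r \<bullet> y) * 1 < (r \<bullet> y) * (r \<bullet> y)" by (intro mult_strict_left_mono) auto
    then show False using sq by (simp add: power2_eq_square)
  qed
  show "0 \<le> r \<bullet> (H *\<^sub>v r)" "r \<bullet> (H *\<^sub>v r) \<le> 1" using p0 p1 by (auto simp: y_def)
  fix k assume k: "k < m"
  have "(y $ k)\<^sup>2 \<le> y \<bullet> y"
    using y k member_le_sum[of k "{0..<m}" "\<lambda>k. y $ k * y $ k"] by (simp add: scalar_prod_def power2_eq_square)
  moreover have "\<delta> * (y \<bullet> y) \<le> 1" using eq nn p1 zero_le_power2[of "r \<bullet> y"] by linarith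
  then have "y \<bullet> y \<le> 1 / \<delta>" using \<delta> by (simp add: field_simps)
  ultimately show "((H *\<^sub>v r) $ k)\<^sup>2 \<le> 1 / \<delta>" by (simp add: y_def)
qed

lemma resolvent_entry_bound:
  assumes G: "G \<in> carrier_mat m m" "psd G" and \<delta>: "0 < \<delta>" and ij: "i < m" "j < m"
  shows "\<bar>resolvent \<delta> G $$ (i,j)\<bar> \<le> 1 / \<delta>"
proof -
  have "(unit_vec m i \<bullet> ((\<delta> \<cdot>\<^sub>m resolvent \<delta> G) *\<^sub>v unit_vec m j))\<^sup>2 \<le> 1"
    using contraction_form_le[OF resolvent_contraction[OF G \<delta>], of "unit_vec m j" "unit_vec m i"] ij by simp
  moreover have "unit_vec m i \<bullet> ((\<delta> \<cdot>\<^sub>m resolvent \<delta> G) *\<^sub>v unit_vec m j) = \<delta> * resolvent \<delta> G $$ (i,j)"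
  proof -
    note M = resolvent(1)[OF G \<delta>]
    have "resolvent \<delta> G *\<^sub>v unit_vec m j = col (resolvent \<delta> G) j" using M ij by (intro eq_vecI) auto
    moreover have "col (resolvent \<delta> G) j \<in> carrier_vec m" using M by auto
    ultimately show ?thesis using M ij by (simp add: smult_mult_mat_vec)
  qed
  ultimately have "\<bar>\<delta> * resolvent \<delta> G $$ (i,j)\<bar> \<le> 1" by (simp add: abs_square_le_1)
  then show ?thesis using \<delta> by (simp add: abs_mult field_simps)
qed

lemma meas_mat_row_gram: "meas_mat (gauss (R \<times> {..<m})) m m (row_gram R m)"
  by (rule meas_mat_cong_entry[where f = "\<lambda>k l a. \<Sum>i\<in>R. a (i,k) * a (i,l)"])
    (auto simp: row_gram_def intro!: borel_measurable_sum borel_measurable_times measurable_gauss_component)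

lemma meas_mat_row_resolvent:
  "finite R \<Longrightarrow> 0 < \<delta> \<Longrightarrow> meas_mat (gauss (R \<times> {..<m})) m m (\<lambda>a. resolvent \<delta> (row_gram R m a))"
  by (intro meas_mat_resolvent meas_mat_row_gram row_gram_psd)

lemma data_row_scalar_prod: "v \<in> carrier_vec m \<Longrightarrow> data_row m a i \<bullet> v = (\<Sum>k<m. a (i,k) * v $ k)"
  by (simp add: scalar_prod_def data_row_def atLeast0LessThan)

lemma transpose_smult: "transpose_mat (c \<cdot>\<^sub>m A) = c \<cdot>\<^sub>m transpose_mat A" for A :: "real mat"
  by (intro eq_matI) auto

lemma integral_weighted_sum:
  fixes f :: "nat \<Rightarrow> nat \<Rightarrow> nat \<Rightarrow> 'a \<Rightarrow> real"
  assumes "\<And>k j i. k < m \<Longrightarrow> j < m \<Longrightarrow> i \<in> R \<Longrightarrow> integrable M (f k j i)"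
  shows "(\<integral>a. (\<Sum>k<m. \<Sum>j<m. b k j * (\<Sum>i\<in>R. f k j i a)) \<partial>M) =
    (\<Sum>k<m. \<Sum>j<m. b k j * (\<Sum>i\<in>R. \<integral>a. f k j i a \<partial>M))"
proof -
  have 1: "integrable M (\<lambda>a. b k j * (\<Sum>i\<in>R. f k j i a))" if "k < m" "j < m" for k j
    using that by (intro integrable_mult_right Bochner_Integration.integrable_sum assms)
  have "(\<integral>a. (\<Sum>i\<in>R. f k j i a) \<partial>M) = (\<Sum>i\<in>R. \<integral>a. f k j i a \<partial>M)"
    if "k < m" "j < m" for k j
    using that by (intro Bochner_Integration.integral_sum assms) auto
  moreover have "(\<integral>a. (\<Sum>k<m. \<Sum>j<m. b k j * (\<Sum>i\<in>R. f k j i a)) \<partial>M) =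
      (\<Sum>k<m. \<integral>a. (\<Sum>j<m. b k j * (\<Sum>i\<in>R. f k j i a)) \<partial>M)"
    using 1 by (intro Bochner_Integration.integral_sum Bochner_Integration.integrable_sum) auto
  moreover have "(\<integral>a. (\<Sum>j<m. b k j * (\<Sum>i\<in>R. f k j i a)) \<partial>M) =
      (\<Sum>j<m. \<integral>a. b k j * (\<Sum>i\<in>R. f k j i a) \<partial>M)" if "k < m" for k
    using 1 that by (intro Bochner_Integration.integral_sum) auto
  ultimately show ?thesis by simp
qed

text \<open>Stein's identity for the k-th entry of H r in the coordinate \<open>a (i,j)\<close>,
  which occurs both in r and in H. The product rule with dH = -H dG H and dG = e r^T + r e^T, e the
  j-th unit vector, produces the integrand on the right.\<close>

lemma stein_resolvent_entry:
  assumes R: "finite R" "i \<in> R" and jk: "j < m" "k < m" and \<delta>: "0 < \<delta>"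
  defines "H \<equiv> \<lambda>a. resolvent \<delta> (row_gram R m a)"
  defines "r \<equiv> \<lambda>a. data_row m a i"
  shows "integrable (gauss (R \<times> {..<m})) (\<lambda>a. a (i,j) * (H a *\<^sub>v r a) $ k)"
    "integrable (gauss (R \<times> {..<m})) (\<lambda>a. H a $$ (k,j) * (1 - r a \<bullet> (H a *\<^sub>v r a)) - (H a *\<^sub>v r a) $ k * (H a *\<^sub>v r a) $ j)"
    "(\<integral>a. a (i,j) * (H a *\<^sub>v r a) $ k \<partial>gauss (R \<times> {..<m})) =
     (\<integral>a. H a $$ (k,j) * (1 - r a \<bullet> (H a *\<^sub>v r a)) - (H a *\<^sub>v r a) $ k * (H a *\<^sub>v r a) $ j \<partial>gauss (R \<times> {..<m}))"
proof -
  let ?M = "gauss (R \<times> {..<m})"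
  let ?g = "\<lambda>a. (H a *\<^sub>v r a) $ k"
  let ?g' = "\<lambda>a. H a $$ (k,j) * (1 - r a \<bullet> (H a *\<^sub>v r a)) - (H a *\<^sub>v r a) $ k * (H a *\<^sub>v r a) $ j"
  \<comment> \<open>Row i is left out, so G is constant along the path and all dependence sits in
    the rank-one term.\<close>
  define G where "G a = row_gram (R - {i}) m a" for a
  have G: "G a \<in> carrier_mat m m" "psd (G a)" for a using R by (auto simp: G_def row_gram_psd)
  have r: "r a \<in> carrier_vec m" for a by (simp add: r_def)
  have split: "row_gram R m a = G a + outer (r a) (r a)" for a
    using row_gram_insert[of "R - {i}" i m a] R by (simp add: G_def r_def insert_absorb)
  have Hc: "H a \<in> carrier_mat m m" for a using resolvent(1) R \<delta> by (simp add: H_def row_gram_psd)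
  have Hm: "meas_mat ?M m m H" unfolding H_def by (rule meas_mat_row_resolvent[OF R(1) \<delta>])
  have comp: "(\<lambda>a. a (i,l)) \<in> borel_measurable ?M" if "l < m" for l
    using that R by (intro measurable_gauss_component) auto
  have mv: "(H a *\<^sub>v r a) $ l = (\<Sum>p<m. H a $$ (l,p) * a (i,p))" if "l < m" for l a
    using Hc[of a] that by (simp add: scalar_prod_def r_def data_row_def atLeast0LessThan)
  have ym: "(\<lambda>a. (H a *\<^sub>v r a) $ l) \<in> borel_measurable ?M" if "l < m" for l
    unfolding mv[OF that] using that
    by (intro borel_measurable_sum borel_measurable_times meas_mat_entry[OF Hm] comp) auto
  have quad: "r a \<bullet> (H a *\<^sub>v r a) = (\<Sum>l<m. a (i,l) * (H a *\<^sub>v r a) $ l)" for a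
    unfolding r_def by (rule data_row_scalar_prod) (use Hc[of a] in \<open>simp add: mult_mat_vec_carrier[of _ m m]\<close>)
  have g: "?g \<in> borel_measurable ?M" by (rule ym[OF jk(2)])
  have g': "?g' \<in> borel_measurable ?M"
    unfolding quad using jk
    by (intro borel_measurable_diff borel_measurable_times borel_measurable_const borel_measurable_sum
        ym meas_mat_entry[OF Hm] comp) auto
  have b: "0 \<le> r a \<bullet> (H a *\<^sub>v r a)" "r a \<bullet> (H a *\<^sub>v r a) \<le> 1" "l < m \<Longrightarrow> ((H a *\<^sub>v r a) $ l)\<^sup>2 \<le> 1 / \<delta>" for a l
    using resolvent_bounds[OF G(1)[of a] G(2)[of a] \<delta> r[of a]] unfolding H_def split by auto
  have ba: "\<bar>(H a *\<^sub>v r a) $ l\<bar> \<le> sqrt (1 / \<delta>)" if "l < m" for a l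
    using b(3)[OF that, of a] by (metis real_sqrt_abs real_sqrt_le_mono)
  have B: "\<bar>?g a\<bar> \<le> sqrt (1 / \<delta>)" for a by (rule ba[OF jk(2)])
  have B': "\<bar>?g' a\<bar> \<le> 1 / \<delta> * 1 + sqrt (1 / \<delta>) * sqrt (1 / \<delta>)" for a
  proof -
    have "\<bar>H a $$ (k,j)\<bar> \<le> 1 / \<delta>"
      unfolding H_def by (rule resolvent_entry_bound) (use R \<delta> jk in \<open>auto simp: row_gram_psd\<close>)
    then have "\<bar>H a $$ (k,j) * (1 - r a \<bullet> (H a *\<^sub>v r a))\<bar> \<le> 1 / \<delta> * 1"
      unfolding abs_mult using b(1,2)[of a] \<delta> by (intro mult_mono) auto
    moreover have "\<bar>(H a *\<^sub>v r a) $ k * (H a *\<^sub>v r a) $ j\<bar> \<le> sqrt (1 / \<delta>) * sqrt (1 / \<delta>)"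
      unfolding abs_mult using ba jk \<delta> by (intro mult_mono) auto
    ultimately show ?thesis by linarith
  qed
  have path: "((\<lambda>t. ?g (x((i,j):=t))) has_real_derivative ?g' (x((i,j):=t))) (at t) \<and>
      isCont (\<lambda>t. ?g' (x((i,j):=t))) t" for x t
  proof -
    define S where "S = resolvent \<delta> (G x)"
    have S: "S \<in> carrier_mat m m" "transpose_mat S = S" using resolvent(1,4)[OF G \<delta>] by (auto simp: S_def)
    have Gx: "G (x((i,j):=t)) = G x" for t
      by (intro eq_matI) (auto simp: G_def row_gram_def intro!: sum.cong)
    define r0 where "r0 = r (x((i,j):=0))"
    define \<alpha> where "\<alpha> = S *\<^sub>v r0"
    define c where "c = r0 \<bullet> \<alpha>"
    have r0: "r0 \<in> carrier_vec m" by (simp add: r0_def r)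
    have \<alpha>: "\<alpha> \<in> carrier_vec m" using S by (simp add: \<alpha>_def r0)
    define e :: "real vec" where "e = unit_vec m j"
    have e: "e \<in> carrier_vec m" by (simp add: e_def)
    have rt: "r (x((i,j):=t)) = r0 + t \<cdot>\<^sub>v e" for t
      using jk by (intro eq_vecI) (auto simp: r_def r0_def data_row_def e_def)
    have Se: "S *\<^sub>v e = col S j" using S jk by (intro eq_vecI) (auto simp: e_def)
    have Srt: "S *\<^sub>v r (x((i,j):=t)) = \<alpha> + t \<cdot>\<^sub>v col S j" for t
      unfolding rt using S r0 e
      by (simp add: mult_add_distrib_mat_vec[of _ m m] mult_mat_vec[of _ m m] \<alpha>_def Se)
    \<comment> \<open>S r moves affinely with the coordinate, so u is affine and D below is a
      quadratic polynomial in t.\<close>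
    define u where "u l t = \<alpha> $ l + t * S $$ (l,j)" for l t
    have u: "(S *\<^sub>v r (x((i,j):=t))) $ l = u l t" if "l < m" for l t
      unfolding Srt using that S \<alpha> jk by (simp add: u_def)
    define D where "D t = 1 + (c + 2 * t * \<alpha> $ j + t\<^sup>2 * S $$ (j,j))" for t
    have Dt: "1 + r (x((i,j):=t)) \<bullet> (S *\<^sub>v r (x((i,j):=t))) = D t" for t
    proof -
      have cj: "col S j \<in> carrier_vec m" using S by auto
      have "r0 \<bullet> col S j = \<alpha> $ j"
      proof -
        have "col S j = row S j" using S jk by (metis carrier_matD(1) row_transpose transpose_carrier_mat carrier_matD(2))
        then show ?thesis using comm_scalar_prod[OF r0 cj] S jk by (simp add: \<alpha>_def)
      qed
      moreover have "e \<bullet> \<alpha> = \<alpha> $ j" "e \<bullet> col S j = S $$ (j,j)" using \<alpha> cj S jk by (auto simp: e_def)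
      ultimately show ?thesis
        unfolding Srt unfolding rt using r0 \<alpha> e cj
        by (simp add: add_scalar_prod_distrib[of _ m] scalar_prod_add_distrib[of _ m] D_def c_def power2_eq_square algebra_simps)
    qed
    note rank1 = resolvent_rank_one[OF G(1)[of x] G(2)[of x] \<delta> r]
    have D1: "1 \<le> D t" for t using rank1(1)[of "x((i,j):=t)"] unfolding S_def[symmetric] Dt .
    have HH: "H (x((i,j):=t)) = S - (1 / D t) \<cdot>\<^sub>m outer (S *\<^sub>v r (x((i,j):=t))) (S *\<^sub>v r (x((i,j):=t)))" for t
      unfolding H_def split Gx using rank1(2)[of "x((i,j):=t)"] unfolding S_def[symmetric] Dt .
    have Hr: "H (x((i,j):=t)) *\<^sub>v r (x((i,j):=t)) = (1 / D t) \<cdot>\<^sub>v (S *\<^sub>v r (x((i,j):=t)))" for t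
      unfolding H_def split Gx using rank1(3)[of "x((i,j):=t)"] unfolding S_def[symmetric] Dt .
    have gt: "?g (x((i,j):=t)) = u k t / D t" for t
      unfolding Hr using S jk u[OF jk(2), of t] by simp
    have rHr: "r (x((i,j):=t)) \<bullet> (H (x((i,j):=t)) *\<^sub>v r (x((i,j):=t))) = (D t - 1) / D t" for t
      unfolding Hr using Dt[of t] S r by simp
    have Hkj: "H (x((i,j):=t)) $$ (k,j) = S $$ (k,j) - u k t * u j t / D t" for t
      unfolding HH using S jk u[of _ t] by simp
    have yj: "(H (x((i,j):=t)) *\<^sub>v r (x((i,j):=t))) $ j = u j t / D t" for t
      unfolding Hr using S jk u[OF jk(1), of t] by simp
    have g't: "?g' (x((i,j):=t)) = S $$ (k,j) / D t - 2 * (u k t * u j t) / (D t)\<^sup>2" for t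
    proof -
      have "D t \<noteq> 0" using D1[of t] by linarith
      then show ?thesis unfolding rHr Hkj yj gt by (simp add: field_simps power2_eq_square)
    qed
    have Dn: "D t \<noteq> 0" for t using D1[of t] by linarith
    have du: "(u k has_real_derivative S $$ (k,j)) (at t)" unfolding u_def by (auto intro!: derivative_eq_intros)
    have dD: "(D has_real_derivative 2 * u j t) (at t)"
      unfolding D_def u_def by (auto intro!: derivative_eq_intros)
    have "((\<lambda>t. u k t / D t) has_real_derivative (S $$ (k,j) * D t - u k t * (2 * u j t)) / (D t * D t)) (at t)"
      by (rule DERIV_divide[OF du dD Dn])
    also have "(S $$ (k,j) * D t - u k t * (2 * u j t)) / (D t * D t) = ?g' (x((i,j):=t))"
      unfolding g't using Dn[of t] by (simp add: field_simps power2_eq_square)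
    finally have "((\<lambda>t. ?g (x((i,j):=t))) has_real_derivative ?g' (x((i,j):=t))) (at t)"
      unfolding gt .
    moreover have "isCont (\<lambda>t. ?g' (x((i,j):=t))) t"
      unfolding g't using Dn unfolding u_def D_def by (intro continuous_intros) auto
    ultimately show ?thesis by blast
  qed
  have fin: "finite (R \<times> {..<m})" and ij: "(i,j) \<in> R \<times> {..<m}" using R jk by auto
  note st = stein_gauss[OF fin ij g g' B B' conjunct1[OF path] conjunct2[OF path]]
  show "integrable ?M (\<lambda>a. a (i,j) * ?g a)" "integrable ?M ?g'"
    "(\<integral>a. a (i,j) * ?g a \<partial>?M) = (\<integral>a. ?g' a \<partial>?M)"
    by (rule st)+
qed

lemma row_gram_entry: "k < m \<Longrightarrow> l < m \<Longrightarrow> row_gram R m a $$ (k,l) = (\<Sum>i\<in>R. a (i,k) * a (i,l))"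
  by (simp add: row_gram_def)

text \<open>Summing Stein's identity over the entries of the rows expresses the mean of \<open>H G = 1 - \<delta> H\<close> through the means
  of \<open>H\<close> itself, where \<open>H\<close> is the resolvent of the Gram matrix \<open>G\<close>.\<close>

lemma expectation_resolvent_le:
  assumes R: "finite R" and \<delta>: "0 < \<delta>" and B: "B \<in> carrier_mat m m" "psd B" and card: "m + 1 < card R"
  shows "(\<integral>a. fip B (resolvent \<delta> (row_gram R m a)) \<partial>gauss (R \<times> {..<m})) \<le> fip B (1\<^sub>m m) / (real (card R) - real m - 1)"
    "integrable (gauss (R \<times> {..<m})) (\<lambda>a. fip B (resolvent \<delta> (row_gram R m a)))"
    "0 \<le> fip B (resolvent \<delta> (row_gram R m a))"
proof -
  let ?M = "gauss (R \<times> {..<m})"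
  interpret prob_space ?M by (rule prob_space_gauss)
  define G where "G = row_gram R m"
  define H where "H a = resolvent \<delta> (G a)" for a
  define r where "r a i = data_row m a i" for a i
  define y where "y a i = H a *\<^sub>v r a i" for a i
  have G: "G a \<in> carrier_mat m m" "psd (G a)" for a using R by (auto simp: G_def row_gram_psd)
  note Hp = resolvent[OF G \<delta>, folded H_def]
  note Hpsd = resolvent_psd[OF G \<delta>, folded H_def]
  have HHc: "H a * H a \<in> carrier_mat m m" for a using Hp(1)[of a] by simp
  have HHpsd: "psd (H a * H a)" for a using psd_gram[of "H a"] Hp(4)[of a] by simp
  have pos: "0 \<le> fip B (H a)" "0 \<le> fip B (H a * H a)" "0 \<le> fip (1\<^sub>m m) (H a)" for a
    using fip_psd_nonneg[OF B Hp(1) Hpsd, of a] fip_psd_nonneg[OF B HHc HHpsd, of a]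
      fip_psd_nonneg[OF one_carrier_mat psd_one Hp(1) Hpsd, of a] by auto
  show "0 \<le> fip B (resolvent \<delta> (row_gram R m a))" using pos(1)[of a] by (simp add: H_def G_def)
  have HG: "H a * G a = 1\<^sub>m m - \<delta> \<cdot>\<^sub>m H a" for a using resolvent_mult(1)[OF G \<delta>] by (simp add: H_def)
  have yc: "y a i \<in> carrier_vec m" for a i using Hp(1)[of a] by (simp add: y_def r_def)
  have yk: "y a i $ k = (\<Sum>l<m. H a $$ (k,l) * a (i,l))" if "k < m" for a i k
    using Hp(1)[of a] that by (simp add: y_def r_def data_row_def scalar_prod_def atLeast0LessThan)
  have ay: "(\<Sum>i\<in>R. a (i,j) * y a i $ k) = (H a * G a) $$ (k,j)" if "j < m" "k < m" for a j k
  proof -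
    have "(\<Sum>i\<in>R. a (i,j) * y a i $ k) = (\<Sum>l<m. \<Sum>i\<in>R. H a $$ (k,l) * (a (i,l) * a (i,j)))"
      unfolding yk[OF that(2)] sum_distrib_left by (subst sum.swap) (simp add: mult_ac)
    also have "\<dots> = (\<Sum>l<m. H a $$ (k,l) * G a $$ (l,j))"
      using that by (simp add: G_def row_gram_entry sum_distrib_left)
    also have "\<dots> = (H a * G a) $$ (k,j)"
      using that Hp(1)[of a] G(1)[of a] index_mat_mult[of k "H a" j "G a"] by simp
    finally show ?thesis .
  qed
  have quadsum: "(\<Sum>i\<in>R. r a i \<bullet> y a i) = fip (1\<^sub>m m) (H a * G a)" for a
  proof -
    have "(\<Sum>i\<in>R. r a i \<bullet> y a i) = (\<Sum>i\<in>R. \<Sum>k<m. a (i,k) * y a i $ k)"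
      unfolding r_def by (intro sum.cong refl data_row_scalar_prod yc)
    also have "\<dots> = (\<Sum>k<m. (H a * G a) $$ (k,k))" by (subst sum.swap) (simp add: ay)
    also have "\<dots> = (\<Sum>k<m. \<Sum>j<m. if j = k then (H a * G a) $$ (k,j) else 0)" by simp
    also have "\<dots> = fip (1\<^sub>m m) (H a * G a)"
      unfolding fip_def by (auto intro!: sum.cong simp del: index_mult_mat sum.delta)
    finally show ?thesis .
  qed
  have yy: "(\<Sum>i\<in>R. y a i $ k * y a i $ j) = (H a * G a * H a) $$ (k,j)" if "j < m" "k < m" for a j k
  proof -
    have sym: "H a $$ (j,l) = H a $$ (l,j)" if "l < m" for l
      using arg_cong[OF Hp(4)[of a], of "\<lambda>M. M $$ (l,j)"] Hp(1)[of a] that \<open>j < m\<close> by simp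
    have "(\<Sum>i\<in>R. y a i $ k * y a i $ j) = (\<Sum>l<m. H a $$ (j,l) * (\<Sum>i\<in>R. a (i,l) * y a i $ k))"
      unfolding yk[OF that(1)] sum_distrib_left by (subst sum.swap) (simp add: mult_ac)
    also have "\<dots> = (\<Sum>l<m. (H a * G a) $$ (k,l) * H a $$ (l,j))"
      using that by (simp add: ay sym mult.commute del: index_mult_mat)
    also have "\<dots> = (H a * G a * H a) $$ (k,j)"
      using that Hp(1)[of a] G(1)[of a] index_mat_mult[of k "H a * G a" j "H a"] by simp
    finally show ?thesis .
  qed
  have e1: "fip B (H a * G a) = fip B (1\<^sub>m m) - \<delta> * fip B (H a)" for a
    unfolding HG using B Hp(1)[of a] by (simp add: fip_minus_right[of _ m m] fip_smult_right[of _ m m])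
  have e2: "fip (1\<^sub>m m) (H a * G a) \<le> real m" for a
  proof -
    have "fip (1\<^sub>m m) (H a * G a) = fip (1\<^sub>m m) (1\<^sub>m m) - \<delta> * fip (1\<^sub>m m) (H a)"
      unfolding HG using Hp(1)[of a] by (simp add: fip_minus_right[of _ m m] fip_smult_right[of _ m m])
    then show ?thesis using pos(3)[of a] \<delta> by (simp add: fip_one_one)
  qed
  have e3: "fip B (H a * G a * H a) \<le> fip B (H a)" for a
  proof -
    have "H a * G a * H a = H a - \<delta> \<cdot>\<^sub>m (H a * H a)"
      unfolding HG using Hp(1)[of a] by (simp add: minus_mult_distrib_mat[of _ m m _ _ m] mult_smult_assoc_mat[of _ m m _ m])
    then have "fip B (H a * G a * H a) = fip B (H a) - \<delta> * fip B (H a * H a)"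
      using B Hp(1)[of a] by (simp add: fip_minus_right[of _ m m] fip_smult_right[of _ m m])
    then show ?thesis using pos(2)[of a] \<delta> by simp
  qed
  \<comment> \<open>Stein's identity weighted by B and summed over rows and entries: L is the side
    with the Gaussian factor, T the side with the derivative. The weight is a general psd matrix
    because the resolvent of an independent half of the rows will take its place.\<close>
  define L where "L a = (\<Sum>k<m. \<Sum>j<m. B $$ (k,j) * (\<Sum>i\<in>R. a (i,j) * y a i $ k))" for a
  define T where "T a = (\<Sum>k<m. \<Sum>j<m. B $$ (k,j) *
      (\<Sum>i\<in>R. H a $$ (k,j) * (1 - r a i \<bullet> y a i) - y a i $ k * y a i $ j))" for a
  have stein: "integrable ?M (\<lambda>a. a (i,j) * y a i $ k)"
      "integrable ?M (\<lambda>a. H a $$ (k,j) * (1 - r a i \<bullet> y a i) - y a i $ k * y a i $ j)"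
      "(\<integral>a. a (i,j) * y a i $ k \<partial>?M) = (\<integral>a. H a $$ (k,j) * (1 - r a i \<bullet> y a i) - y a i $ k * y a i $ j \<partial>?M)"
    if "i \<in> R" "j < m" "k < m" for i j k
    using stein_resolvent_entry[OF R that \<delta>] by (simp_all add: y_def H_def G_def r_def)
  have intL: "integrable ?M L" and intT: "integrable ?M T"
    unfolding L_def T_def by (intro Bochner_Integration.integrable_sum integrable_mult_right stein; simp)+
  have LT: "(\<integral>a. L a \<partial>?M) = (\<integral>a. T a \<partial>?M)"
  proof -
    have "(\<integral>a. L a \<partial>?M) = (\<Sum>k<m. \<Sum>j<m. B $$ (k,j) * (\<Sum>i\<in>R. \<integral>a. a (i,j) * y a i $ k \<partial>?M))"
      unfolding L_def by (rule integral_weighted_sum) (use stein(1) in blast)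
    also have "\<dots> = (\<Sum>k<m. \<Sum>j<m. B $$ (k,j) *
        (\<Sum>i\<in>R. \<integral>a. H a $$ (k,j) * (1 - r a i \<bullet> y a i) - y a i $ k * y a i $ j \<partial>?M))"
      by (intro sum.cong refl arg_cong2[of _ _ _ _ "(*)"]) (use stein(3) in auto)
    also have "\<dots> = (\<integral>a. T a \<partial>?M)"
      unfolding T_def by (rule integral_weighted_sum[symmetric]) (use stein(2) in blast)
    finally show ?thesis .
  qed
  have L_eq: "L a = fip B (H a * G a)" for a
    using B(1) by (simp add: L_def fip_def ay del: index_mult_mat)
  have T_eq: "T a = fip B (H a) * (real (card R) - fip (1\<^sub>m m) (H a * G a)) - fip B (H a * G a * H a)" for a
  proof -
    have "(\<Sum>i\<in>R. H a $$ (k,j) * (1 - r a i \<bullet> y a i) - y a i $ k * y a i $ j) =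
        H a $$ (k,j) * (real (card R) - fip (1\<^sub>m m) (H a * G a)) - (H a * G a * H a) $$ (k,j)"
      if "k < m" "j < m" for k j
      using that by (simp add: sum_subtractf sum_distrib_left[symmetric] quadsum yy del: index_mult_mat)
    then have "T a = (\<Sum>k<m. \<Sum>j<m. B $$ (k,j) *
        (H a $$ (k,j) * (real (card R) - fip (1\<^sub>m m) (H a * G a)) - (H a * G a * H a) $$ (k,j)))"
      unfolding T_def by (intro sum.cong refl) simp
    also have "\<dots> = fip B (H a) * (real (card R) - fip (1\<^sub>m m) (H a * G a)) - fip B (H a * G a * H a)"
      using B(1) by (simp add: fip_def[of B] sum_subtractf sum_distrib_right right_diff_distrib mult.assoc del: index_mult_mat)
    finally show ?thesis .
  qed
  have Hm: "meas_mat ?M m m H" unfolding H_def G_def by (rule meas_mat_row_resolvent[OF R \<delta>])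
  have fm: "(\<lambda>a. fip B (H a)) \<in> borel_measurable ?M" by (rule meas_fip[OF meas_mat_const[OF B(1)] Hm])
  \<comment> \<open>\<open>H a * G a\<close> is the identity minus \<delta> times H and is psd,
    which caps the pairing. The cap depends on \<delta> and serves integrability.\<close>
  have bound: "fip B (H a) \<le> fip B (1\<^sub>m m) / \<delta>" for a
  proof -
    have "0 \<le> fip B (H a * G a)"
    proof -
      have "psd (H a * G a)"
      proof -
        have "transpose_mat (H a * G a) = H a * G a"
        proof -
          have "transpose_mat (\<delta> \<cdot>\<^sub>m H a) = \<delta> \<cdot>\<^sub>m H a" using Hp(4)[of a] by (simp add: transpose_smult)
          then show ?thesis unfolding HG using Hp(1)[of a] by (simp add: transpose_minus[of _ m m])
        qed
        moreover have "0 \<le> v \<bullet> ((H a * G a) *\<^sub>v v)" if v: "v \<in> carrier_vec m" for v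
        proof -
          define w where "w = (\<delta> \<cdot>\<^sub>m H a) *\<^sub>v v"
          have w: "w \<in> carrier_vec m"
            unfolding w_def using Hp(1)[of a] v by (intro mult_mat_vec_carrier[of _ m m]) auto
          have "(v \<bullet> w)\<^sup>2 \<le> (v \<bullet> v)\<^sup>2"
            using contraction_form_le[OF resolvent_contraction[OF G \<delta>, of a] v v] by (simp add: w_def H_def power2_eq_square)
          then have "v \<bullet> w \<le> v \<bullet> v" by (rule power2_le_imp_le) (rule scalar_prod_self_nonneg)
          moreover have "(H a * G a) *\<^sub>v v = v - w"
            unfolding HG using Hp(1)[of a] v by (simp add: minus_mult_distrib_mat_vec[of _ m m] w_def)
          ultimately show ?thesis using v w by (simp add: scalar_prod_minus_distrib[of _ m])
        qed
        ultimately show ?thesis using Hp(1)[of a] G(1)[of a] by (auto simp: psd_iff[of _ m])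
      qed
      then show ?thesis using fip_psd_nonneg[OF B _ , of "H a * G a"] Hp(1)[of a] G(1)[of a] by simp
    qed
    then show ?thesis using e1[of a] \<delta> by (simp add: field_simps)
  qed
  have intB: "integrable ?M (\<lambda>a. fip B (H a))"
    by (rule integrable_const_bound[of _ "fip B (1\<^sub>m m) / \<delta>"]) (use bound pos(1) fm in auto)
  then show "integrable ?M (\<lambda>a. fip B (resolvent \<delta> (row_gram R m a)))" by (simp add: H_def G_def)
  \<comment> \<open>The trace of H G is at most m, and H G H lies below H in the Loewner order;
    these cost m and 1 of the rows, whence the denominator.\<close>
  have le: "(real (card R) - real m - 1) * fip B (H a) \<le> T a" for a
  proof -
    have "fip B (H a) * (real (card R) - real m) \<le> fip B (H a) * (real (card R) - fip (1\<^sub>m m) (H a * G a))"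
      using e2[of a] pos(1)[of a] by (intro mult_left_mono) auto
    then show ?thesis unfolding T_eq using e3[of a] by (simp add: algebra_simps)
  qed
  have "(real (card R) - real m - 1) * (\<integral>a. fip B (H a) \<partial>?M) = (\<integral>a. (real (card R) - real m - 1) * fip B (H a) \<partial>?M)"
    by simp
  also have "\<dots> \<le> (\<integral>a. T a \<partial>?M)"
    using intB intT le by (intro integral_mono) auto
  also have "\<dots> = (\<integral>a. L a \<partial>?M)" using LT ..
  also have "\<dots> \<le> (\<integral>a. fip B (1\<^sub>m m) \<partial>?M)"
  proof (rule integral_mono[OF intL])
    show "L a \<le> fip B (1\<^sub>m m)" for a using pos(1)[of a] \<delta> by (simp add: L_eq e1)
  qed simp
  also have "\<dots> = fip B (1\<^sub>m m)" by (simp add: prob_space)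
  finally show "(\<integral>a. fip B (resolvent \<delta> (row_gram R m a)) \<partial>?M) \<le> fip B (1\<^sub>m m) / (real (card R) - real m - 1)"
    using card by (simp add: H_def G_def field_simps)
qed

text \<open>For u = H' v, w = H v and z = w - u, the difference u.v - w.v equals z.G z + \<delta>'
  z.z + w.E w + (\<delta> - \<delta>') w.w, a sum of nonnegative terms.\<close>

lemma resolvent_antimono:
  assumes G: "G \<in> carrier_mat m m" "psd G" and E: "E \<in> carrier_mat m m" "psd E"
    and \<delta>: "0 < \<delta>'" "\<delta>' \<le> \<delta>"
  shows "psd (resolvent \<delta>' G - resolvent \<delta> (G + E))"
proof -
  have \<delta>0: "0 < \<delta>" using \<delta> by simp
  have GE: "G + E \<in> carrier_mat m m" "psd (G + E)" using G E psd_add by auto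
  define H' where "H' = resolvent \<delta>' G"
  define H where "H = resolvent \<delta> (G + E)"
  note H' = resolvent[OF G \<delta>(1), folded H'_def]
  note H = resolvent[OF GE \<delta>0, folded H_def]
  have "0 \<le> v \<bullet> ((H' - H) *\<^sub>v v)" if v: "v \<in> carrier_vec m" for v
  proof -
    define w where "w = H *\<^sub>v v"
    define u where "u = H' *\<^sub>v v"
    have w: "w \<in> carrier_vec m" and u: "u \<in> carrier_vec m"
      unfolding w_def u_def using H(1) H'(1) v by (auto intro: mult_mat_vec_carrier)
    have Gw: "G *\<^sub>v w \<in> carrier_vec m" and Gu: "G *\<^sub>v u \<in> carrier_vec m" and Ew: "E *\<^sub>v w \<in> carrier_vec m"
      using G E w u by (auto intro: mult_mat_vec_carrier)
    have vw: "v = G *\<^sub>v w + E *\<^sub>v w + \<delta> \<cdot>\<^sub>v w"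
    proof -
      have "v = (G + E + \<delta> \<cdot>\<^sub>m 1\<^sub>m m) *\<^sub>v w"
        unfolding w_def using assoc_mult_mat_vec[of "G + E + \<delta> \<cdot>\<^sub>m 1\<^sub>m m" m m H m v] H GE v by simp
      then show ?thesis using shift_mult_vec[OF GE(1) w] G E w by (simp add: add_mult_distrib_mat_vec[of _ m m])
    qed
    have vu: "v = G *\<^sub>v u + \<delta>' \<cdot>\<^sub>v u"
    proof -
      have "v = (G + \<delta>' \<cdot>\<^sub>m 1\<^sub>m m) *\<^sub>v u"
        unfolding u_def using assoc_mult_mat_vec[of "G + \<delta>' \<cdot>\<^sub>m 1\<^sub>m m" m m H' m v] H' G v by simp
      then show ?thesis using shift_mult_vec[OF G(1) u] by simp
    qed
    define z where "z = w - u"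
    have z: "z \<in> carrier_vec m" using w u by (simp add: z_def)
    have Gz: "G *\<^sub>v z = G *\<^sub>v w - G *\<^sub>v u"
      using G w u by (simp add: z_def mult_minus_distrib_mat_vec[of _ m m])
    have sym: "u \<bullet> (G *\<^sub>v w) = w \<bullet> (G *\<^sub>v u)"
      using transpose_vec_mult_scalar[OF G(1) w u] G comm_scalar_prod[OF Gu w] by (simp add: psd_iff[of _ m])
    have p1: "0 \<le> z \<bullet> (G *\<^sub>v z)" "0 \<le> w \<bullet> (E *\<^sub>v w)" using G E z w by (auto simp: psd_iff[of _ m])
    have p2: "0 \<le> z \<bullet> z" "0 \<le> w \<bullet> w" by (rule scalar_prod_self_nonneg)+
    have zGz: "z \<bullet> (G *\<^sub>v z) = w \<bullet> (G *\<^sub>v w) - 2 * (w \<bullet> (G *\<^sub>v u)) + u \<bullet> (G *\<^sub>v u)"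
      unfolding Gz using w u Gw Gu sym
      by (simp add: z_def minus_scalar_prod_distrib[of _ m] scalar_prod_minus_distrib[of _ m])
    have zz: "z \<bullet> z = w \<bullet> w - 2 * (w \<bullet> u) + u \<bullet> u"
      using w u comm_scalar_prod[OF u w]
      by (simp add: z_def minus_scalar_prod_distrib[of _ m] scalar_prod_minus_distrib[of _ m])
    have wv: "w \<bullet> v = w \<bullet> (G *\<^sub>v w) + w \<bullet> (E *\<^sub>v w) + \<delta> * (w \<bullet> w)"
      by (subst vw) (use w Gw Ew in \<open>simp add: scalar_prod_add_distrib[of _ m]\<close>)
    have wv': "w \<bullet> v = w \<bullet> (G *\<^sub>v u) + \<delta>' * (w \<bullet> u)"
      by (subst vu) (use w u Gu in \<open>simp add: scalar_prod_add_distrib[of _ m]\<close>)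
    have uv: "u \<bullet> v = u \<bullet> (G *\<^sub>v u) + \<delta>' * (u \<bullet> u)"
      by (subst vu) (use u Gu in \<open>simp add: scalar_prod_add_distrib[of _ m]\<close>)
    have "\<delta>' * (w \<bullet> w) \<le> \<delta> * (w \<bullet> w)" using \<delta>(2) p2(2) by (rule mult_right_mono)
    moreover have "0 \<le> \<delta>' * (z \<bullet> z)" using \<delta>(1) p2(1) by simp
    moreover have "u \<bullet> v - w \<bullet> v = z \<bullet> (G *\<^sub>v z) + \<delta>' * (z \<bullet> z) + w \<bullet> (E *\<^sub>v w) + (\<delta> * (w \<bullet> w) - \<delta>' * (w \<bullet> w))"
      using wv wv' uv unfolding zGz zz by (simp add: algebra_simps)
    ultimately have "0 \<le> u \<bullet> v - w \<bullet> v" using p1 by linarith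
    moreover have "v \<bullet> ((H' - H) *\<^sub>v v) = u \<bullet> v - w \<bullet> v"
      using H(1) H'(1) v u w comm_scalar_prod[OF v u] comm_scalar_prod[OF v w]
      by (simp add: minus_mult_distrib_mat_vec[of _ m m] scalar_prod_minus_distrib[of _ m] u_def w_def)
    ultimately show ?thesis by simp
  qed
  moreover have "transpose_mat (H' - H) = H' - H"
    using H(4) H'(4) transpose_minus[OF H'(1) H(1)] by simp
  ultimately show ?thesis
    using psd_iff[OF minus_carrier_mat[OF H(1)], of H'] by (simp add: H_def H'_def)
qed

text \<open>Decouples the second inverse moment: the two factors on the right come from independent halves of the rows.\<close>

lemma frob_resolvent_add_le:
  assumes G: "G \<in> carrier_mat m m" "psd G" and E: "E \<in> carrier_mat m m" "psd E" and \<delta>: "0 < \<delta>"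
  shows "frob_sq (resolvent \<delta> (G + E)) \<le> fip (resolvent (\<delta> / 2) G) (resolvent (\<delta> / 2) E)"
proof -
  have \<delta>2: "0 < \<delta> / 2" "\<delta> / 2 \<le> \<delta>" using \<delta> by auto
  have GE: "G + E \<in> carrier_mat m m" "psd (G + E)" using G E psd_add by auto
  define H where "H = resolvent \<delta> (G + E)"
  define H1 where "H1 = resolvent (\<delta> / 2) G"
  define H2 where "H2 = resolvent (\<delta> / 2) E"
  have c: "H \<in> carrier_mat m m" "H1 \<in> carrier_mat m m" "H2 \<in> carrier_mat m m"
    using resolvent(1) G E GE \<delta> \<delta>2 by (auto simp: H_def H1_def H2_def)
  have p: "psd H" "psd H1"
    using resolvent_psd G GE \<delta> \<delta>2 by (auto simp: H_def H1_def)
  have "E + G = G + E" using G E by (intro comm_add_mat)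
  \<comment> \<open>H lies below both H1 and H2, and pairing with psd matrices preserves order:
    \<open>frob_sq H\<close> is at most \<open>fip H1 H\<close>, which is at most
    \<open>fip H1 H2\<close>.\<close>
  then have d: "psd (H1 - H)" "psd (H2 - H)"
    using resolvent_antimono[OF G E \<delta>2] resolvent_antimono[OF E G \<delta>2] by (auto simp: H_def H1_def H2_def)
  have "0 \<le> fip (H1 - H) H" by (rule fip_psd_nonneg[OF minus_carrier_mat[OF c(1)] d(1) c(1) p(1)])
  moreover have "0 \<le> fip H1 (H2 - H)" by (rule fip_psd_nonneg[OF c(2) p(2) minus_carrier_mat[OF c(1)] d(2)])
  ultimately show ?thesis
    using c fip_minus_left[OF c(2) c(1), of H] fip_minus_right[OF c(2) c(3) c(1)]
    by (simp add: fip_self H_def H1_def H2_def)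
qed

text \<open>Fubini over the two halves. For a fixed first half its resolvent is the weight in
  \<open>expectation_resolvent_le\<close> for the second; the outcome is the trace of the first
  resolvent, to which the same lemma applies with the identity as weight. The bound is uniform in
  \<delta>.\<close>

lemma nn_integral_frob_resolvent_le:
  assumes R: "finite R1" "finite R2" "R1 \<inter> R2 = {}" and \<delta>: "0 < \<delta>"
    and card: "m + 1 < card R1" "m + 1 < card R2"
  shows "(\<integral>\<^sup>+a. ennreal (frob_sq (resolvent \<delta> (row_gram (R1 \<union> R2) m a))) \<partial>gauss ((R1 \<union> R2) \<times> {..<m})) \<le>
    ennreal (real m / (real (card R1) - real m - 1) / (real (card R2) - real m - 1))"
proof -
  let ?I = "R1 \<times> {..<m}" and ?J = "R2 \<times> {..<m}"
  define c1 where "c1 = real (card R1) - real m - 1"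
  define c2 where "c2 = real (card R2) - real m - 1"
  have c: "0 < c1" "0 < c2" using card by (auto simp: c1_def c2_def)
  have \<delta>2: "0 < \<delta> / 2" using \<delta> by simp
  define H1 where "H1 x = resolvent (\<delta> / 2) (row_gram R1 m x)" for x
  define H2 where "H2 x = resolvent (\<delta> / 2) (row_gram R2 m x)" for x
  have H1c: "H1 x \<in> carrier_mat m m" "psd (H1 x)" for x
    using resolvent(1)[OF row_gram_carrier row_gram_psd[OF R(1)] \<delta>2]
      resolvent_psd[OF row_gram_carrier row_gram_psd[OF R(1)] \<delta>2] by (auto simp: H1_def)
  have U: "(R1 \<union> R2) \<times> {..<m} = ?I \<union> ?J" by auto
  have meas: "(\<lambda>a. ennreal (frob_sq (resolvent \<delta> (row_gram (R1 \<union> R2) m a)))) \<in> borel_measurable (gauss (?I \<union> ?J))"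
    unfolding U[symmetric]
    by (rule measurable_compose[OF meas_frob_sq[OF meas_mat_row_resolvent] measurable_ennreal]) (use R \<delta> in auto)
  have "(\<integral>\<^sup>+a. ennreal (frob_sq (resolvent \<delta> (row_gram (R1 \<union> R2) m a))) \<partial>gauss ((R1 \<union> R2) \<times> {..<m})) =
      (\<integral>\<^sup>+x. (\<integral>\<^sup>+y. ennreal (frob_sq (resolvent \<delta> (row_gram (R1 \<union> R2) m (merge ?I ?J (x,y))))) \<partial>gauss ?J) \<partial>gauss ?I)"
    unfolding U by (rule std_normal.product_nn_integral_fold) (use R meas in auto)
  also have "\<dots> \<le> (\<integral>\<^sup>+x. ennreal (fip (1\<^sub>m m) (H1 x) / c2) \<partial>gauss ?I)"
  proof (rule nn_integral_mono)
    fix x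
    have merge: "row_gram (R1 \<union> R2) m (merge ?I ?J (x,y)) = row_gram R1 m x + row_gram R2 m y" for y
    proof -
      have "row_gram R1 m (merge ?I ?J (x,y)) = row_gram R1 m x"
        by (intro eq_matI) (auto simp: row_gram_def merge_def intro!: sum.cong)
      moreover have "row_gram R2 m (merge ?I ?J (x,y)) = row_gram R2 m y"
        using R(3) by (intro eq_matI) (auto simp: row_gram_def merge_def intro!: sum.cong)
      ultimately show ?thesis using row_gram_Un[OF R] by simp
    qed
    note ex = expectation_resolvent_le[OF R(2) \<delta>2 H1c[of x] card(2)]
    have "(\<integral>\<^sup>+y. ennreal (frob_sq (resolvent \<delta> (row_gram (R1 \<union> R2) m (merge ?I ?J (x,y))))) \<partial>gauss ?J) \<le>
        (\<integral>\<^sup>+y. ennreal (fip (H1 x) (H2 y)) \<partial>gauss ?J)"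
      unfolding merge H1_def H2_def using R \<delta>
      by (intro nn_integral_mono ennreal_leI frob_resolvent_add_le[of _ m]) (auto simp: row_gram_psd)
    also have "\<dots> = ennreal (\<integral>y. fip (H1 x) (H2 y) \<partial>gauss ?J)"
      unfolding H2_def using ex(2,3) by (intro nn_integral_eq_integral) auto
    also have "\<dots> \<le> ennreal (fip (H1 x) (1\<^sub>m m) / c2)"
      unfolding H2_def c2_def by (rule ennreal_leI[OF ex(1)])
    also have "fip (H1 x) (1\<^sub>m m) = fip (1\<^sub>m m) (H1 x)"
      using H1c by (intro fip_comm[of _ m m]) auto
    finally show "(\<integral>\<^sup>+y. ennreal (frob_sq (resolvent \<delta> (row_gram (R1 \<union> R2) m (merge ?I ?J (x,y))))) \<partial>gauss ?J) \<le>
        ennreal (fip (1\<^sub>m m) (H1 x) / c2)" .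
  qed
  also have "\<dots> \<le> ennreal (real m / c1 / c2)"
  proof -
    note ex = expectation_resolvent_le[OF R(1) \<delta>2 one_carrier_mat psd_one card(1), folded H1_def c1_def]
    have "(\<integral>\<^sup>+x. ennreal (fip (1\<^sub>m m) (H1 x) / c2) \<partial>gauss ?I) = ennreal (\<integral>x. fip (1\<^sub>m m) (H1 x) / c2 \<partial>gauss ?I)"
      using ex(2,3) c by (intro nn_integral_eq_integral) auto
    also have "\<dots> \<le> ennreal (real m / c1 / c2)"
      using divide_right_mono[OF ex(1), of c2] c by (intro ennreal_leI) (simp add: fip_one_one)
    finally show ?thesis .
  qed
  finally show ?thesis by (simp add: c1_def c2_def)
qed

text \<open>Fatou along \<delta> = 1/(k+1). The bound is uniform in k while the resolvents blow up
  at singular Gram matrices, so these form a null set; elsewhere the resolvents converge to the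
  inverse.\<close>

lemma wishart_inverse:
  assumes n: "m + 1 < n div 2"
  shows "AE a in gauss ({..<n} \<times> {..<m}). det (row_gram {..<n} m a) \<noteq> 0"
    "(\<integral>\<^sup>+a. ennreal (frob_sq (mat_inv (row_gram {..<n} m a))) \<partial>gauss ({..<n} \<times> {..<m})) \<le>
      ennreal (real m / (real (n div 2) - real m - 1)\<^sup>2)"
proof -
  let ?M = "gauss ({..<n} \<times> {..<m})"
  define G where "G = row_gram {..<n} m"
  have G: "G a \<in> carrier_mat m m" "psd (G a)" for a by (auto simp: G_def row_gram_psd)
  define c where "c = real (n div 2) - real m - 1"
  have c: "0 < c" using n by (simp add: c_def)
  define f where "f k a = ennreal (frob_sq (resolvent (1 / real (Suc k)) (G a)))" for k a
  have fm: "f k \<in> borel_measurable ?M" for k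
    unfolding f_def G_def
    by (rule measurable_compose[OF meas_frob_sq[OF meas_mat_row_resolvent] measurable_ennreal]) auto
  have bound: "(\<integral>\<^sup>+a. f k a \<partial>?M) \<le> ennreal (real m / c\<^sup>2)" for k
  proof -
    define R1 where "R1 = {..<n div 2}"
    \<comment> \<open>The second half takes the odd row, so both halves have at least
      \<open>n div 2\<close> rows.\<close>
    define R2 where "R2 = {n div 2..<n}"
    have R: "finite R1" "finite R2" "R1 \<inter> R2 = {}" "R1 \<union> R2 = {..<n}" by (auto simp: R1_def R2_def)
    have cards: "card R1 = n div 2" "n div 2 \<le> card R2" by (auto simp: R1_def R2_def)
    have "(\<integral>\<^sup>+a. f k a \<partial>?M) \<le> ennreal (real m / (real (card R1) - real m - 1) / (real (card R2) - real m - 1))"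
      using nn_integral_frob_resolvent_le[OF R(1-3), of "1 / real (Suc k)" m] n cards
      by (simp add: f_def G_def R(4) del: of_nat_Suc)
    also have "\<dots> \<le> ennreal (real m / c\<^sup>2)"
    proof (rule ennreal_leI)
      have "c \<le> real (card R2) - real m - 1" using cards by (simp add: c_def)
      then have "real m / c / (real (card R2) - real m - 1) \<le> real m / c / c"
        using c by (intro divide_left_mono) auto
      then show "real m / (real (card R1) - real m - 1) / (real (card R2) - real m - 1) \<le> real m / c\<^sup>2"
        by (simp add: cards c_def[symmetric] power2_eq_square)
    qed
    finally show ?thesis .
  qed
  have fatou: "(\<integral>\<^sup>+a. liminf (\<lambda>k. f k a) \<partial>?M) \<le> ennreal (real m / c\<^sup>2)"
  proof -
    have "(\<integral>\<^sup>+a. liminf (\<lambda>k. f k a) \<partial>?M) \<le> liminf (\<lambda>k. \<integral>\<^sup>+a. f k a \<partial>?M)"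
      by (rule nn_integral_liminf[OF fm])
    also have "\<dots> \<le> limsup (\<lambda>k. \<integral>\<^sup>+a. f k a \<partial>?M)" by (rule Liminf_le_Limsup) simp
    also have "\<dots> \<le> ennreal (real m / c\<^sup>2)" using bound by (intro Limsup_bounded) auto
    finally show ?thesis .
  qed
  have sing: "liminf (\<lambda>k. f k a) = \<infinity>" if "det (G a) = 0" for a
  proof -
    have "filterlim (\<lambda>k. real (Suc k)) at_top sequentially"
      by (rule filterlim_compose[OF filterlim_real_sequentially filterlim_Suc])
    then have lim: "filterlim (\<lambda>k. (real (Suc k))\<^sup>2) at_top sequentially"
      by (intro filterlim_pow_at_top) auto
    have "(real (Suc k))\<^sup>2 \<le> frob_sq (resolvent (1 / real (Suc k)) (G a))" for k
      using resolvent_singular[OF G that, of "1 / real (Suc k)"] by (simp add: power_divide del: of_nat_Suc)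
    then have "filterlim (\<lambda>k. frob_sq (resolvent (1 / real (Suc k)) (G a))) at_top sequentially"
      by (intro filterlim_at_top_mono[OF lim] always_eventually allI)
    then have "((\<lambda>k. f k a) \<longlongrightarrow> \<infinity>) sequentially"
      unfolding f_def infinity_ennreal_def by (rule ennreal_tendsto_top_eq_at_top[THEN iffD2])
    then show ?thesis by (intro lim_imp_Liminf) auto
  qed
  have reg: "liminf (\<lambda>k. f k a) = ennreal (frob_sq (mat_inv (G a)))" if d: "det (G a) \<noteq> 0" for a
  proof -
    have "(\<lambda>k. \<Sum>i<m. \<Sum>j<m. (resolvent (1 / real (Suc k)) (G a) $$ (i,j))\<^sup>2) \<longlonglongrightarrow> (\<Sum>i<m. \<Sum>j<m. (mat_inv (G a) $$ (i,j))\<^sup>2)"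
      by (intro tendsto_sum tendsto_power resolvent_inverse_limit[OF G d]) auto
    moreover have "(\<Sum>i<m. \<Sum>j<m. (resolvent (1 / real (Suc k)) (G a) $$ (i,j))\<^sup>2) = frob_sq (resolvent (1 / real (Suc k)) (G a))" for k
      using resolvent(1)[OF G, of "1 / real (Suc k)" a] unfolding frob_sq_def by (auto simp del: of_nat_Suc)
    moreover have "(\<Sum>i<m. \<Sum>j<m. (mat_inv (G a) $$ (i,j))\<^sup>2) = frob_sq (mat_inv (G a))"
      using mat_inv(1)[OF G(1) d] unfolding frob_sq_def by auto
    ultimately have "(\<lambda>k. f k a) \<longlonglongrightarrow> ennreal (frob_sq (mat_inv (G a)))"
      unfolding f_def by (intro tendsto_ennrealI) (simp del: of_nat_Suc)
    then show ?thesis by (intro lim_imp_Liminf) auto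
  qed
  have lm: "(\<lambda>a. liminf (\<lambda>k. f k a)) \<in> borel_measurable ?M"
    by (rule borel_measurable_liminf[OF fm])
  have "(\<integral>\<^sup>+a. liminf (\<lambda>k. f k a) \<partial>?M) \<noteq> \<infinity>" using fatou by (auto simp: top_unique)
  then have "AE a in ?M. liminf (\<lambda>k. f k a) \<noteq> \<infinity>" by (rule nn_integral_PInf_AE[OF lm])
  then have AE: "AE a in ?M. det (G a) \<noteq> 0" by eventually_elim (use sing in blast)
  then show "AE a in ?M. det (row_gram {..<n} m a) \<noteq> 0" by (simp add: G_def)
  have "(\<integral>\<^sup>+a. ennreal (frob_sq (mat_inv (G a))) \<partial>?M) = (\<integral>\<^sup>+a. liminf (\<lambda>k. f k a) \<partial>?M)"
  proof (rule nn_integral_cong_AE)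
    show "AE a in ?M. ennreal (frob_sq (mat_inv (G a))) = liminf (\<lambda>k. f k a)"
      using AE by eventually_elim (simp add: reg)
  qed
  then show "(\<integral>\<^sup>+a. ennreal (frob_sq (mat_inv (row_gram {..<n} m a))) \<partial>?M) \<le>
      ennreal (real m / (real (n div 2) - real m - 1)\<^sup>2)"
    using fatou by (simp add: G_def c_def)
qed

section \<open>Linear and quadratic functions of Gaussian vectors\<close>

abbreviation stdN :: "real measure" where "stdN \<equiv> std_normal_distribution"

lemma sigma_finite_stdN: "sigma_finite_measure stdN"
  by (intro prob_space_imp_sigma_finite prob_space_std_normal)

lemma nn_integral_stdN: "g \<in> borel_measurable borel \<Longrightarrow>
    (\<integral>\<^sup>+x. g x \<partial>stdN) = (\<integral>\<^sup>+x. ennreal (std_normal_density x) * g x \<partial>lborel)"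
  by (subst nn_integral_density) auto

lemma nn_integral_stdN_swap:
  assumes [measurable]: "(\<lambda>(x,y). f x y) \<in> borel_measurable (borel \<Otimes>\<^sub>M borel)"
  shows "(\<integral>\<^sup>+x. (\<integral>\<^sup>+y. f x y \<partial>stdN) \<partial>stdN) = (\<integral>\<^sup>+y. (\<integral>\<^sup>+x. f x y \<partial>stdN) \<partial>stdN)"
proof -
  interpret pair_sigma_finite stdN stdN
    by (intro pair_sigma_finite.intro sigma_finite_stdN)
  show ?thesis by (rule Fubini'[symmetric]) measurable
qed

lemma std_normal_density_rotate:
  assumes "a\<^sup>2 + b\<^sup>2 = 1"
  shows "std_normal_density (a * s - b * t) * std_normal_density (b * s + a * t) =
    std_normal_density t * std_normal_density s"
proof -
  have "(a * s - b * t)\<^sup>2 + (b * s + a * t)\<^sup>2 = (a\<^sup>2 + b\<^sup>2) * (s\<^sup>2 + t\<^sup>2)"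
    by (simp add: power2_eq_square algebra_simps)
  then have "- (a * s - b * t)\<^sup>2 / 2 + - (b * s + a * t)\<^sup>2 / 2 = - t\<^sup>2 / 2 + - s\<^sup>2 / 2"
    using assms by simp
  then have "exp (- (a * s - b * t)\<^sup>2 / 2) * exp (- (b * s + a * t)\<^sup>2 / 2) = exp (- t\<^sup>2 / 2) * exp (- s\<^sup>2 / 2)"
    by (metis exp_add)
  then show ?thesis by (simp add: std_normal_density_def)
qed

text \<open>The rotation is composed of two affine substitutions in one variable: x at fixed y, then
  y at a fixed value of the first new coordinate. The Jacobian factors 1/a and a cancel, and a must
  be nonzero for the first of them.\<close>

lemma nn_integral_stdN_rotate_aux:
  assumes f[measurable]: "(\<lambda>(x,y). f x y) \<in> borel_measurable (borel \<Otimes>\<^sub>M borel)" and ab: "a\<^sup>2 + b\<^sup>2 = 1" and a: "a \<noteq> 0"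
  shows "(\<integral>\<^sup>+x. (\<integral>\<^sup>+y. f (a * x - b * y) (b * x + a * y) \<partial>stdN) \<partial>stdN) =
    (\<integral>\<^sup>+x. (\<integral>\<^sup>+y. f x y \<partial>stdN) \<partial>stdN)"
proof -
  let ?\<phi> = "\<lambda>x. ennreal (std_normal_density x)"
  have "(\<integral>\<^sup>+x. (\<integral>\<^sup>+y. f (a * x - b * y) (b * x + a * y) \<partial>stdN) \<partial>stdN) =
      (\<integral>\<^sup>+y. (\<integral>\<^sup>+x. f (a * x - b * y) (b * x + a * y) \<partial>stdN) \<partial>stdN)"
    by (rule nn_integral_stdN_swap) measurable
  also have "\<dots> = (\<integral>\<^sup>+y. (\<integral>\<^sup>+x. ?\<phi> y * (?\<phi> x * f (a * x - b * y) (b * x + a * y)) \<partial>lborel) \<partial>lborel)"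
    by (simp add: nn_integral_stdN nn_integral_cmult)
  also have "\<dots> = (\<integral>\<^sup>+y. ennreal \<bar>1 / a\<bar> * (\<integral>\<^sup>+t. ?\<phi> y * (?\<phi> (b / a * y + 1 / a * t) * f t ((b * t + y) / a)) \<partial>lborel) \<partial>lborel)"
  proof (intro nn_integral_cong)
    fix y
    have e: "a * (b / a * y + 1 / a * t) - b * y = t" for t using a by (simp add: field_simps)
    have e2: "b * (b / a * y + 1 / a * t) + a * y = (b * t + y) / a" for t
    proof -
      have "b * (b / a * y + 1 / a * t) + a * y = (b * t + (a\<^sup>2 + b\<^sup>2) * y) / a"
        using a by (simp add: field_simps power2_eq_square)
      then show ?thesis using ab by simp
    qed
    show "(\<integral>\<^sup>+x. ?\<phi> y * (?\<phi> x * f (a * x - b * y) (b * x + a * y)) \<partial>lborel) =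
        ennreal \<bar>1 / a\<bar> * (\<integral>\<^sup>+t. ?\<phi> y * (?\<phi> (b / a * y + 1 / a * t) * f t ((b * t + y) / a)) \<partial>lborel)"
      using a by (subst nn_integral_real_affine[where c = "1 / a" and t = "b / a * y"]) (simp_all only: e e2, measurable)
  qed
  also have "\<dots> = ennreal \<bar>1 / a\<bar> * (\<integral>\<^sup>+y. (\<integral>\<^sup>+t. ?\<phi> y * (?\<phi> (b / a * y + 1 / a * t) * f t ((b * t + y) / a)) \<partial>lborel) \<partial>lborel)"
    by (rule nn_integral_cmult) measurable
  also have "(\<integral>\<^sup>+y. (\<integral>\<^sup>+t. ?\<phi> y * (?\<phi> (b / a * y + 1 / a * t) * f t ((b * t + y) / a)) \<partial>lborel) \<partial>lborel) =
      (\<integral>\<^sup>+t. (\<integral>\<^sup>+y. ?\<phi> y * (?\<phi> (b / a * y + 1 / a * t) * f t ((b * t + y) / a)) \<partial>lborel) \<partial>lborel)"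
    by (rule lborel_pair.Fubini'[symmetric]) measurable
  also have "\<dots> = (\<integral>\<^sup>+t. ennreal \<bar>a\<bar> * (\<integral>\<^sup>+s. ?\<phi> t * (?\<phi> s * f t s) \<partial>lborel) \<partial>lborel)"
  proof (intro nn_integral_cong)
    fix t
    have e: "(b * t + (- b * t + a * s)) / a = s" for s using a by simp
    have e2: "b / a * (- b * t + a * s) + 1 / a * t = b * s + a * t" for s
    proof -
      have "b / a * (- b * t + a * s) + 1 / a * t = b * s + (1 - b\<^sup>2) / a * t"
        using a by (simp add: field_simps power2_eq_square)
      also have "1 - b\<^sup>2 = a\<^sup>2" using ab by simp
      finally show ?thesis using a by (simp add: power2_eq_square)
    qed
    have d: "?\<phi> (- b * t + a * s) * (?\<phi> (b * s + a * t) * X) = ?\<phi> t * (?\<phi> s * X)" for s X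
    proof -
      have "?\<phi> (- b * t + a * s) * ?\<phi> (b * s + a * t) = ?\<phi> t * ?\<phi> s"
        using std_normal_density_rotate[OF ab, of s t]
        by (simp add: ennreal_mult[symmetric] algebra_simps)
      then show ?thesis by (metis mult.assoc)
    qed
    show "(\<integral>\<^sup>+y. ?\<phi> y * (?\<phi> (b / a * y + 1 / a * t) * f t ((b * t + y) / a)) \<partial>lborel) =
        ennreal \<bar>a\<bar> * (\<integral>\<^sup>+s. ?\<phi> t * (?\<phi> s * f t s) \<partial>lborel)"
      using a by (subst nn_integral_real_affine[where c = a and t = "- b * t"]) (simp_all only: e e2 d, measurable)
  qed
  also have "\<dots> = ennreal \<bar>a\<bar> * (\<integral>\<^sup>+t. (\<integral>\<^sup>+s. ?\<phi> t * (?\<phi> s * f t s) \<partial>lborel) \<partial>lborel)"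
    by (rule nn_integral_cmult) measurable
  also have "(\<integral>\<^sup>+t. (\<integral>\<^sup>+s. ?\<phi> t * (?\<phi> s * f t s) \<partial>lborel) \<partial>lborel) = (\<integral>\<^sup>+x. (\<integral>\<^sup>+y. f x y \<partial>stdN) \<partial>stdN)"
    by (simp add: nn_integral_stdN nn_integral_cmult)
  also have "ennreal \<bar>1 / a\<bar> * (ennreal \<bar>a\<bar> * X) = X" for X
  proof -
    have "ennreal \<bar>1 / a\<bar> * ennreal \<bar>a\<bar> = 1" using a by (simp add: ennreal_mult[symmetric] abs_mult[symmetric])
    then show ?thesis by (metis mult.assoc mult_1)
  qed
  finally show ?thesis .
qed

lemma nn_integral_stdN_uminus:
  assumes [measurable]: "g \<in> borel_measurable borel"
  shows "(\<integral>\<^sup>+x. g (- x) \<partial>stdN) = (\<integral>\<^sup>+x. g x \<partial>stdN)"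
  by (subst (1 2) nn_integral_stdN, measurable, subst nn_integral_real_affine[where c = "-1" and t = 0])
    (simp_all add: std_normal_density_def)

text \<open>For a = 0 the rotation is a swap of coordinates with one sign change, handled by Fubini
  and the symmetry of the density.\<close>

lemma nn_integral_stdN_rotate:
  assumes f[measurable]: "(\<lambda>(x,y). f x y) \<in> borel_measurable (borel \<Otimes>\<^sub>M borel)" and ab: "a\<^sup>2 + b\<^sup>2 = 1"
  shows "(\<integral>\<^sup>+x. (\<integral>\<^sup>+y. f (a * x - b * y) (b * x + a * y) \<partial>stdN) \<partial>stdN) =
    (\<integral>\<^sup>+x. (\<integral>\<^sup>+y. f x y \<partial>stdN) \<partial>stdN)"
proof (cases "a = 0")
  case False
  then show ?thesis using nn_integral_stdN_rotate_aux[OF f ab] by simp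
next
  case True
  then have b: "b = 1 \<or> b = - 1" using ab by (simp add: power2_eq_1_iff)
  have "(\<integral>\<^sup>+x. (\<integral>\<^sup>+y. f (a * x - b * y) (b * x + a * y) \<partial>stdN) \<partial>stdN) =
      (\<integral>\<^sup>+x. (\<integral>\<^sup>+y. f (- b * y) (b * x) \<partial>stdN) \<partial>stdN)" using True by simp
  also have "\<dots> = (\<integral>\<^sup>+y. (\<integral>\<^sup>+x. f (- b * y) (b * x) \<partial>stdN) \<partial>stdN)"
    by (rule nn_integral_stdN_swap) measurable
  also have "\<dots> = (\<integral>\<^sup>+y. (\<integral>\<^sup>+x. f y x \<partial>stdN) \<partial>stdN)"
    using b
  proof
    assume [simp]: "b = 1"
    show ?thesis using nn_integral_stdN_uminus[of "\<lambda>y. \<integral>\<^sup>+x. f y x \<partial>stdN"] by simp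
  next
    assume [simp]: "b = - 1"
    have "(\<integral>\<^sup>+x. f y (- x) \<partial>stdN) = (\<integral>\<^sup>+x. f y x \<partial>stdN)" for y
      by (rule nn_integral_stdN_uminus) measurable
    then show ?thesis by simp
  qed
  finally show ?thesis .
qed

lemma rotation_to_axis:
  obtains a b c :: real where "a\<^sup>2 + b\<^sup>2 = 1" "0 \<le> c" "c\<^sup>2 = p\<^sup>2 + q\<^sup>2" "p = c * a" "q = c * b"
proof (cases "p\<^sup>2 + q\<^sup>2 = 0")
  case True
  then have "p = 0" "q = 0" by (auto simp: sum_power2_eq_zero_iff)
  then show ?thesis using that[of 1 0 0] by simp
next
  case False
  define c where "c = sqrt (p\<^sup>2 + q\<^sup>2)"
  have c: "0 < c" "c\<^sup>2 = p\<^sup>2 + q\<^sup>2"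
    using False sum_power2_ge_zero[of p q] by (auto simp: c_def less_le)
  have "(p / c)\<^sup>2 + (q / c)\<^sup>2 = 1" using c by (simp add: power_divide add_divide_distrib[symmetric] c(2)[symmetric])
  then show ?thesis using that[of "p / c" "q / c" c] c by simp
qed

text \<open>Two linear forms of a standard Gaussian vector have the law of \<open>(\<alpha> x, \<beta> x + \<gamma> y)\<close>, the parameters being
  the Cholesky factors of their covariance; the induction absorbs one coordinate at a time by plane rotations.\<close>

lemma gauss_two_forms:
  fixes u v :: "'i \<Rightarrow> real"
  assumes "finite J"
  shows "\<exists>\<alpha> \<beta> \<gamma>. 0 \<le> \<alpha> \<and> \<alpha>\<^sup>2 = (\<Sum>j\<in>J. (u j)\<^sup>2) \<and> \<alpha> * \<beta> = (\<Sum>j\<in>J. u j * v j) \<and>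
    \<beta>\<^sup>2 + \<gamma>\<^sup>2 = (\<Sum>j\<in>J. (v j)\<^sup>2) \<and>
    (\<forall>f. (\<lambda>(x,y). f x y) \<in> borel_measurable (borel \<Otimes>\<^sub>M borel) \<longrightarrow>
      (\<integral>\<^sup>+z. f (\<Sum>j\<in>J. u j * z j) (\<Sum>j\<in>J. v j * z j) \<partial>gauss J) =
      (\<integral>\<^sup>+x. (\<integral>\<^sup>+y. f (\<alpha> * x) (\<beta> * x + \<gamma> * y) \<partial>stdN) \<partial>stdN))"
  using assms
proof (induction J rule: finite_induct)
  case empty
  have "(\<integral>\<^sup>+x. c \<partial>stdN) = c" for c
    using prob_space.emeasure_space_1[OF prob_space_std_normal] by simp
  moreover have "(\<integral>\<^sup>+z. c \<partial>gauss ({} :: 'i set)) = c" for c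
    using prob_space.emeasure_space_1[OF prob_space_gauss, of "{} :: 'i set"] by simp
  ultimately show ?case by (intro exI[of _ 0]) simp
next
  case (insert j J)
  obtain \<alpha> \<beta> \<gamma> where IH: "0 \<le> \<alpha>" "\<alpha>\<^sup>2 = (\<Sum>j\<in>J. (u j)\<^sup>2)" "\<alpha> * \<beta> = (\<Sum>j\<in>J. u j * v j)"
    "\<beta>\<^sup>2 + \<gamma>\<^sup>2 = (\<Sum>j\<in>J. (v j)\<^sup>2)"
    and law: "\<And>f. (\<lambda>(x,y). f x y) \<in> borel_measurable (borel \<Otimes>\<^sub>M borel) \<Longrightarrow>
      (\<integral>\<^sup>+z. f (\<Sum>j\<in>J. u j * z j) (\<Sum>j\<in>J. v j * z j) \<partial>gauss J) =
      (\<integral>\<^sup>+x. (\<integral>\<^sup>+y. f (\<alpha> * x) (\<beta> * x + \<gamma> * y) \<partial>stdN) \<partial>stdN)"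
    using insert.IH by blast
  obtain a b \<alpha>' where r1: "a\<^sup>2 + b\<^sup>2 = 1" "0 \<le> \<alpha>'" "\<alpha>'\<^sup>2 = \<alpha>\<^sup>2 + (u j)\<^sup>2" "\<alpha> = \<alpha>' * a" "u j = \<alpha>' * b"
    by (rule rotation_to_axis)
  \<comment> \<open>After the first rotation the first form depends on x alone and the second reads
    \<beta>' x + \<tau> t + \<gamma> y; the second rotation merges t and y into one
    variable.\<close>
  define \<beta>' where "\<beta>' = \<beta> * a + v j * b"
  define \<tau> where "\<tau> = v j * a - \<beta> * b"
  obtain a2 b2 \<gamma>' where r2: "a2\<^sup>2 + b2\<^sup>2 = 1" "0 \<le> \<gamma>'" "\<gamma>'\<^sup>2 = \<tau>\<^sup>2 + \<gamma>\<^sup>2" "\<tau> = \<gamma>' * a2" "\<gamma> = \<gamma>' * b2"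
    by (rule rotation_to_axis)
  have law': "(\<integral>\<^sup>+z. f (\<Sum>j\<in>insert j J. u j * z j) (\<Sum>j\<in>insert j J. v j * z j) \<partial>gauss (insert j J)) =
      (\<integral>\<^sup>+x. (\<integral>\<^sup>+y. f (\<alpha>' * x) (\<beta>' * x + \<gamma>' * y) \<partial>stdN) \<partial>stdN)"
    if f[measurable]: "(\<lambda>(x,y). f x y) \<in> borel_measurable (borel \<Otimes>\<^sub>M borel)" for f
  proof -
    have meas: "(\<lambda>z. f (\<Sum>j\<in>insert j J. u j * z j) (\<Sum>j\<in>insert j J. v j * z j)) \<in> borel_measurable (gauss (insert j J))"
    proof -
      have "(\<lambda>z. (\<Sum>j\<in>insert j J. w j * z j)) \<in> borel_measurable (gauss (insert j J))" for w :: "'i \<Rightarrow> real"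
        by (intro borel_measurable_sum borel_measurable_times borel_measurable_const measurable_gauss_component)
      then show ?thesis by measurable
    qed
    have upd: "(\<Sum>i\<in>insert j J. w i * (z(j := t)) i) = (\<Sum>i\<in>J. w i * z i) + w j * t" for w z t
    proof -
      have "(\<Sum>i\<in>J. w i * (z(j := t)) i) = (\<Sum>i\<in>J. w i * z i)"
        using insert.hyps by (intro sum.cong) auto
      then show ?thesis using insert.hyps by (simp add: add.commute)
    qed
    have "(\<integral>\<^sup>+z. f (\<Sum>j\<in>insert j J. u j * z j) (\<Sum>j\<in>insert j J. v j * z j) \<partial>gauss (insert j J)) =
        (\<integral>\<^sup>+t. (\<integral>\<^sup>+z. f ((\<Sum>j\<in>J. u j * z j) + u j * t) ((\<Sum>j\<in>J. v j * z j) + v j * t) \<partial>gauss J) \<partial>stdN)"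
      by (subst std_normal.product_nn_integral_insert_rev[OF insert.hyps meas]) (simp only: upd)
    also have "\<dots> = (\<integral>\<^sup>+t. (\<integral>\<^sup>+x. (\<integral>\<^sup>+y. f (\<alpha> * x + u j * t) (\<beta> * x + \<gamma> * y + v j * t) \<partial>stdN) \<partial>stdN) \<partial>stdN)"
      by (intro nn_integral_cong law) measurable
    also have "\<dots> = (\<integral>\<^sup>+x. (\<integral>\<^sup>+t. (\<integral>\<^sup>+y. f (\<alpha> * x + u j * t) (\<beta> * x + \<gamma> * y + v j * t) \<partial>stdN) \<partial>stdN) \<partial>stdN)"
      by (rule nn_integral_stdN_swap) measurable
    also have "\<dots> = (\<integral>\<^sup>+x. (\<integral>\<^sup>+t. (\<integral>\<^sup>+y. f (\<alpha> * (a * x - b * t) + u j * (b * x + a * t))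
        (\<beta> * (a * x - b * t) + \<gamma> * y + v j * (b * x + a * t)) \<partial>stdN) \<partial>stdN) \<partial>stdN)"
      by (rule nn_integral_stdN_rotate[OF _ r1(1), symmetric]) measurable
    also have "\<dots> = (\<integral>\<^sup>+x. (\<integral>\<^sup>+t. (\<integral>\<^sup>+y. f (\<alpha>' * x) (\<beta>' * x + (\<tau> * t + \<gamma> * y)) \<partial>stdN) \<partial>stdN) \<partial>stdN)"
    proof -
      have 1: "\<alpha> * (a * x - b * t) + u j * (b * x + a * t) = \<alpha>' * x" for x t
      proof -
        have "\<alpha> * (a * x - b * t) + u j * (b * x + a * t) = \<alpha>' * ((a\<^sup>2 + b\<^sup>2) * x)"
          unfolding r1(4,5) by (simp add: power2_eq_square algebra_simps)
        then show ?thesis using r1(1) by simp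
      qed
      have 2: "\<beta> * (a * x - b * t) + \<gamma> * y + v j * (b * x + a * t) = \<beta>' * x + (\<tau> * t + \<gamma> * y)" for x t y
        by (simp add: \<beta>'_def \<tau>_def algebra_simps)
      show ?thesis unfolding 1 2 ..
    qed
    also have "\<dots> = (\<integral>\<^sup>+x. (\<integral>\<^sup>+t. (\<integral>\<^sup>+y. f (\<alpha>' * x) (\<beta>' * x + (\<tau> * (a2 * t - b2 * y) + \<gamma> * (b2 * t + a2 * y))) \<partial>stdN) \<partial>stdN) \<partial>stdN)"
      by (intro nn_integral_cong nn_integral_stdN_rotate[OF _ r2(1), symmetric]) measurable
    also have "\<dots> = (\<integral>\<^sup>+x. (\<integral>\<^sup>+t. f (\<alpha>' * x) (\<beta>' * x + \<gamma>' * t) \<partial>stdN) \<partial>stdN)"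
    proof -
      have 1: "\<tau> * (a2 * t - b2 * y) + \<gamma> * (b2 * t + a2 * y) = \<gamma>' * t" for t y
      proof -
        have "\<tau> * (a2 * t - b2 * y) + \<gamma> * (b2 * t + a2 * y) = \<gamma>' * ((a2\<^sup>2 + b2\<^sup>2) * t)"
          unfolding r2(4,5) by (simp add: power2_eq_square algebra_simps)
        then show ?thesis using r2(1) by simp
      qed
      have "(\<integral>\<^sup>+y. c \<partial>stdN) = c" for c
        using prob_space.emeasure_space_1[OF prob_space_std_normal] by simp
      then show ?thesis unfolding 1 by simp
    qed
    finally show ?thesis .
  qed
  have e1: "\<alpha>'\<^sup>2 = (\<Sum>i\<in>insert j J. (u i)\<^sup>2)" using r1(3) IH(2) insert.hyps by simp
  have e2: "\<alpha>' * \<beta>' = (\<Sum>i\<in>insert j J. u i * v i)"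
  proof -
    have "\<alpha>' * \<beta>' = (\<alpha>' * a) * \<beta> + (\<alpha>' * b) * v j" by (simp add: \<beta>'_def algebra_simps)
    then show ?thesis using r1(4,5) IH(3) insert.hyps by simp
  qed
  have e3: "\<beta>'\<^sup>2 + \<gamma>'\<^sup>2 = (\<Sum>i\<in>insert j J. (v i)\<^sup>2)"
  proof -
    have "\<beta>'\<^sup>2 + \<tau>\<^sup>2 = (a\<^sup>2 + b\<^sup>2) * (\<beta>\<^sup>2 + (v j)\<^sup>2)"
      by (simp add: \<beta>'_def \<tau>_def power2_eq_square algebra_simps)
    then show ?thesis using r1(1) r2(3) IH(4) insert.hyps by simp
  qed
  show ?case using r1(2) e1 e2 e3 law' by blast
qed

section \<open>Second and fourth moments of linear forms and of projected columns\<close>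

lemma stdN_moment_integrable: "integrable stdN (\<lambda>x. x ^ k)"
proof -
  have "integrable lborel (\<lambda>x. std_normal_density x * x ^ k)"
  proof (cases "even k")
    case True
    then obtain l where "k = 2 * l" by (elim evenE)
    then show ?thesis using std_normal_moment_even[of l] by (auto simp: has_bochner_integral_iff)
  next
    case False
    then obtain l where "k = 2 * l + 1" by (elim oddE)
    then show ?thesis using std_normal_moment_odd[of l] by (auto simp: has_bochner_integral_iff)
  qed
  then show ?thesis by (subst integrable_density) auto
qed

lemma stdN_moments: "(\<integral>x. x \<partial>stdN) = 0" "(\<integral>x. x\<^sup>2 \<partial>stdN) = 1" "(\<integral>x. x ^ 4 \<partial>stdN) = 3"
proof -
  show "(\<integral>x. x \<partial>stdN) = 0" using integral_std_normal_moment_odd[of 0] by (subst integral_density) auto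
  show "(\<integral>x. x\<^sup>2 \<partial>stdN) = 1" using integral_std_normal_moment_even[of 1] by (subst integral_density) auto
  show "(\<integral>x. x ^ 4 \<partial>stdN) = 3" using integral_std_normal_moment_even[of 2]
    by (subst integral_density) (auto simp: fact_numeral)
qed

lemma nn_integral_const_gauss: "(\<integral>\<^sup>+x. c \<partial>gauss I) = c"
  using prob_space.emeasure_space_1[OF prob_space_gauss, of I] by simp

lemma emeasure_stdN: "emeasure stdN UNIV = 1"
  using prob_space.emeasure_space_1[OF prob_space_std_normal] by simp

lemma nn_integral_stdN_sq: "(\<integral>\<^sup>+x. ennreal ((s + \<alpha> * x)\<^sup>2) \<partial>stdN) = ennreal (s\<^sup>2 + \<alpha>\<^sup>2)"
proof -
  interpret prob_space stdN by (rule prob_space_std_normal)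
  have i: "integrable stdN (\<lambda>x. x)" "integrable stdN (\<lambda>x. x\<^sup>2)"
    using stdN_moment_integrable[of 1] stdN_moment_integrable[of 2] by auto
  have eq: "(s + \<alpha> * x)\<^sup>2 = s\<^sup>2 + 2 * s * \<alpha> * x + \<alpha>\<^sup>2 * x\<^sup>2" for x
    by (simp add: power2_eq_square algebra_simps)
  have "integrable stdN (\<lambda>x. s\<^sup>2 + 2 * s * \<alpha> * x + \<alpha>\<^sup>2 * x\<^sup>2)"
    by (intro Bochner_Integration.integrable_add integrable_const integrable_mult_right i)
  then have "(\<integral>\<^sup>+x. ennreal ((s + \<alpha> * x)\<^sup>2) \<partial>stdN) = ennreal (\<integral>x. (s + \<alpha> * x)\<^sup>2 \<partial>stdN)"
    unfolding eq[symmetric] by (rule nn_integral_eq_integral) simp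
  also have "(\<integral>x. (s + \<alpha> * x)\<^sup>2 \<partial>stdN) = s\<^sup>2 + \<alpha>\<^sup>2"
    unfolding eq using i prob_space by (simp add: stdN_moments)
  finally show ?thesis .
qed

lemma gauss_linear_sq:
  assumes "finite J"
  shows "(\<integral>\<^sup>+z. ennreal ((s + (\<Sum>j\<in>J. u j * z j))\<^sup>2) \<partial>gauss J) = ennreal (s\<^sup>2 + (\<Sum>j\<in>J. (u j)\<^sup>2))"
proof -
  obtain \<alpha> \<beta> \<gamma> where a: "\<alpha>\<^sup>2 = (\<Sum>j\<in>J. (u j)\<^sup>2)" and law: "\<And>f. (\<lambda>(x,y). f x y) \<in> borel_measurable (borel \<Otimes>\<^sub>M borel) \<Longrightarrow>
      (\<integral>\<^sup>+z. f (\<Sum>j\<in>J. u j * z j) (\<Sum>j\<in>J. u j * z j) \<partial>gauss J) =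
      (\<integral>\<^sup>+x. (\<integral>\<^sup>+y. f (\<alpha> * x) (\<beta> * x + \<gamma> * y) \<partial>stdN) \<partial>stdN)"
    using gauss_two_forms[OF assms, of u u] by blast
  show ?thesis
    using law[of "\<lambda>x _. ennreal ((s + x)\<^sup>2)"] by (simp add: emeasure_stdN nn_integral_stdN_sq a)
qed

lemma gauss_linear_4:
  assumes "finite J"
  shows "(\<integral>\<^sup>+z. ennreal ((\<Sum>j\<in>J. u j * z j) ^ 4) \<partial>gauss J) = ennreal (3 * (\<Sum>j\<in>J. (u j)\<^sup>2)\<^sup>2)"
proof -
  obtain \<alpha> \<beta> \<gamma> where a: "\<alpha>\<^sup>2 = (\<Sum>j\<in>J. (u j)\<^sup>2)" and law: "\<And>f. (\<lambda>(x,y). f x y) \<in> borel_measurable (borel \<Otimes>\<^sub>M borel) \<Longrightarrow>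
      (\<integral>\<^sup>+z. f (\<Sum>j\<in>J. u j * z j) (\<Sum>j\<in>J. u j * z j) \<partial>gauss J) =
      (\<integral>\<^sup>+x. (\<integral>\<^sup>+y. f (\<alpha> * x) (\<beta> * x + \<gamma> * y) \<partial>stdN) \<partial>stdN)"
    using gauss_two_forms[OF assms, of u u] by blast
  have "(\<integral>\<^sup>+x. ennreal ((\<alpha> * x) ^ 4) \<partial>stdN) = ennreal (\<integral>x. (\<alpha> * x) ^ 4 \<partial>stdN)"
    by (rule nn_integral_eq_integral) (auto simp: power_mult_distrib stdN_moment_integrable)
  also have "(\<integral>x. (\<alpha> * x) ^ 4 \<partial>stdN) = 3 * (\<alpha>\<^sup>2)\<^sup>2"
    by (simp add: power_mult_distrib stdN_moments)
  finally show ?thesis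
    using law[of "\<lambda>x _. ennreal (x ^ 4)"] by (simp add: emeasure_stdN a)
qed

text \<open>Cauchy--Schwarz with weights \<sigma>. Where \<sigma> vanishes the quotient is 0 by
  convention, and z ensures that nothing is lost on the left either.\<close>

lemma sum_sq_weighted_le:
  fixes s \<sigma> :: "nat \<Rightarrow> real"
  assumes \<sigma>: "\<And>i. i < n \<Longrightarrow> 0 \<le> \<sigma> i" and z: "\<And>i. i < n \<Longrightarrow> \<sigma> i = 0 \<Longrightarrow> s i = 0"
  shows "(\<Sum>i<n. (s i)\<^sup>2)\<^sup>2 \<le> (\<Sum>i<n. \<sigma> i) * (\<Sum>i<n. s i ^ 4 / \<sigma> i)"
proof -
  have "(\<Sum>i<n. (s i)\<^sup>2) = (\<Sum>i<n. sqrt (\<sigma> i) * ((s i)\<^sup>2 / sqrt (\<sigma> i)))"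
    using z by (intro sum.cong refl) auto
  then have "(\<Sum>i<n. (s i)\<^sup>2)\<^sup>2 \<le> (\<Sum>i<n. (sqrt (\<sigma> i))\<^sup>2) * (\<Sum>i<n. ((s i)\<^sup>2 / sqrt (\<sigma> i))\<^sup>2)"
    using Cauchy_Schwarz_ineq_sum[of "\<lambda>i. sqrt (\<sigma> i)" "\<lambda>i. (s i)\<^sup>2 / sqrt (\<sigma> i)" "{..<n}"] by simp
  also have "(\<Sum>i<n. (sqrt (\<sigma> i))\<^sup>2) = (\<Sum>i<n. \<sigma> i)" using \<sigma> by (intro sum.cong) auto
  also have "(\<Sum>i<n. ((s i)\<^sup>2 / sqrt (\<sigma> i))\<^sup>2) = (\<Sum>i<n. s i ^ 4 / \<sigma> i)"
    using \<sigma> by (intro sum.cong) (auto simp: power_divide)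
  finally show ?thesis .
qed

lemma projector_entries:
  fixes Q :: "real mat"
  assumes Q: "Q \<in> carrier_mat n n" "transpose_mat Q = Q" "Q * Q = Q"
  shows "(\<Sum>i<n. \<Sum>k<n. (Q $$ (i,k))\<^sup>2) = (\<Sum>i<n. Q $$ (i,i))"
    "\<And>k l. k < n \<Longrightarrow> l < n \<Longrightarrow> (\<Sum>i<n. Q $$ (i,k) * Q $$ (i,l)) = Q $$ (k,l)"
proof -
  have sym: "Q $$ (i,k) = Q $$ (k,i)" if "i < n" "k < n" for i k
    using arg_cong[OF Q(2), of "\<lambda>M. M $$ (i,k)"] Q(1) that by simp
  show *: "(\<Sum>i<n. Q $$ (i,k) * Q $$ (i,l)) = Q $$ (k,l)" if "k < n" "l < n" for k l
  proof -
    have "Q $$ (k,l) = (\<Sum>i<n. Q $$ (k,i) * Q $$ (i,l))"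
      using index_mat_mult[of k Q l Q] Q that by simp
    also have "\<dots> = (\<Sum>i<n. Q $$ (i,k) * Q $$ (i,l))" using sym that by (intro sum.cong) auto
    finally show ?thesis by simp
  qed
  have "(\<Sum>i<n. \<Sum>k<n. (Q $$ (i,k))\<^sup>2) = (\<Sum>k<n. \<Sum>i<n. Q $$ (i,k) * Q $$ (i,k))"
    unfolding power2_eq_square by (rule sum.swap)
  then show "(\<Sum>i<n. \<Sum>k<n. (Q $$ (i,k))\<^sup>2) = (\<Sum>i<n. Q $$ (i,i))" using * by simp
qed

text \<open>The fourth moment of a projected Gaussian column is bounded by Cauchy--Schwarz with weights
  \<open>\<Sum>\<^sub>k Q\<^sub>i\<^sub>k\<^sup>2\<close>, which avoids diagonalising \<open>Q\<close>.\<close>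

lemma nn_integral_proj_form_sq:
  assumes Q: "Q \<in> carrier_mat n n" "transpose_mat Q = Q" "Q * Q = Q"
    and tr: "(\<Sum>i<n. Q $$ (i,i)) \<le> real m" and jl: "j < m" "l < m"
  shows "(\<integral>\<^sup>+a. ennreal ((\<Sum>i<n. (\<Sum>k<n. Q $$ (i,k) * a (k,j)) * (\<Sum>k<n. Q $$ (i,k) * a (k,l)))\<^sup>2)
      \<partial>gauss ({..<n} \<times> {..<m})) \<le> ennreal (if j = l then 3 * (real m)\<^sup>2 else real m)"
proof -
  let ?I = "{..<n} \<times> {..<m}"
  \<comment> \<open>Variance of the i-th entry of a projected standard Gaussian column; by
    idempotence these variances sum to the trace of Q.\<close>
  define \<sigma> where "\<sigma> i = (\<Sum>k<n. (Q $$ (i,k))\<^sup>2)" for i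
  have \<sigma>0: "0 \<le> \<sigma> i" for i by (simp add: \<sigma>_def sum_nonneg)
  have \<sigma>sum: "(\<Sum>i<n. \<sigma> i) = (\<Sum>i<n. Q $$ (i,i))" using projector_entries(1)[OF Q] by (simp add: \<sigma>_def)
  have \<sigma>m: "(\<Sum>i<n. \<sigma> i) \<le> real m" using \<sigma>sum tr by simp
  have \<sigma>s0: "0 \<le> (\<Sum>i<n. \<sigma> i)" using \<sigma>0 by (intro sum_nonneg) auto
  define c where "c i j e = (if snd e = j then Q $$ (i, fst e) else 0)" for i j and e :: "nat \<times> nat"
  have form: "(\<Sum>k<n. Q $$ (i,k) * a (k,j)) = (\<Sum>e\<in>{..<n} \<times> S. c i j e * a e)"
    if "finite S" "j \<in> S" for i j S and a :: "nat \<times> nat \<Rightarrow> real"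
  proof -
    have "(\<Sum>e\<in>{..<n} \<times> S. c i j e * a e) = (\<Sum>k<n. \<Sum>q\<in>S. if q = j then Q $$ (i,k) * a (k,j) else 0)"
      unfolding sum.cartesian_product' by (auto simp: c_def intro!: sum.cong)
    then show ?thesis using that by simp
  qed
  have csq: "(\<Sum>e\<in>{..<n} \<times> S. (c i j e)\<^sup>2) = \<sigma> i" if "finite S" "j \<in> S" for i j S
  proof -
    have "(\<Sum>e\<in>{..<n} \<times> S. (c i j e)\<^sup>2) = (\<Sum>k<n. \<Sum>q\<in>S. if q = j then (Q $$ (i,k))\<^sup>2 else 0)"
      unfolding sum.cartesian_product' by (auto simp: c_def intro!: sum.cong)
    then show ?thesis using that by (simp add: \<sigma>_def)
  qed
  show ?thesis
  proof (cases "j = l")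
    case True
    define s where "s a i = (\<Sum>k<n. Q $$ (i,k) * a (k,l))" for a :: "nat \<times> nat \<Rightarrow> real" and i
    have s: "s a i = (\<Sum>e\<in>?I. c i l e * a e)" for a i unfolding s_def using jl by (intro form) auto
    have sz: "s a i = 0" if "i < n" "\<sigma> i = 0" for a i
    proof -
      have "Q $$ (i,k) = 0" if "k < n" for k
        using \<open>\<sigma> i = 0\<close> that unfolding \<sigma>_def by (subst (asm) sum_nonneg_eq_0_iff) auto
      then show ?thesis by (simp add: s_def)
    qed
    have sm: "(\<lambda>a. s a i) \<in> borel_measurable (gauss ?I)" for i
      unfolding s by (intro borel_measurable_sum borel_measurable_times borel_measurable_const measurable_gauss_component)
    have "(\<integral>\<^sup>+a. ennreal ((\<Sum>i<n. s a i * s a i)\<^sup>2) \<partial>gauss ?I) \<le>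
        (\<integral>\<^sup>+a. (\<Sum>i<n. ennreal ((\<Sum>i<n. \<sigma> i) / \<sigma> i) * ennreal (s a i ^ 4)) \<partial>gauss ?I)"
    proof (rule nn_integral_mono)
      fix a
      have "(\<Sum>i<n. s a i * s a i)\<^sup>2 \<le> (\<Sum>i<n. \<sigma> i) * (\<Sum>i<n. s a i ^ 4 / \<sigma> i)"
        using sum_sq_weighted_le[of n \<sigma> "s a"] \<sigma>0 sz by (simp add: power2_eq_square)
      also have "\<dots> = (\<Sum>i<n. ((\<Sum>i<n. \<sigma> i) / \<sigma> i) * s a i ^ 4)" by (simp add: sum_distrib_left)
      finally have "ennreal ((\<Sum>i<n. s a i * s a i)\<^sup>2) \<le> ennreal (\<Sum>i<n. ((\<Sum>i<n. \<sigma> i) / \<sigma> i) * s a i ^ 4)"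
        by (rule ennreal_leI)
      also have "\<dots> = (\<Sum>i<n. ennreal (((\<Sum>i<n. \<sigma> i) / \<sigma> i) * s a i ^ 4))"
        using \<sigma>0 \<sigma>s0 by (intro sum_ennreal[symmetric]) (auto intro!: mult_nonneg_nonneg divide_nonneg_nonneg)
      also have "\<dots> = (\<Sum>i<n. ennreal ((\<Sum>i<n. \<sigma> i) / \<sigma> i) * ennreal (s a i ^ 4))"
        using \<sigma>0 \<sigma>s0 by (intro sum.cong refl ennreal_mult) auto
      finally show "ennreal ((\<Sum>i<n. s a i * s a i)\<^sup>2) \<le> (\<Sum>i<n. ennreal ((\<Sum>i<n. \<sigma> i) / \<sigma> i) * ennreal (s a i ^ 4))" .
    qed
    also have "\<dots> = (\<Sum>i<n. ennreal ((\<Sum>i<n. \<sigma> i) / \<sigma> i) * (\<integral>\<^sup>+a. ennreal (s a i ^ 4) \<partial>gauss ?I))"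
      using sm by (subst nn_integral_sum) (auto intro!: sum.cong nn_integral_cmult)
    \<comment> \<open>The fourth moment is three times the squared variance; it cancels the weight
      and leaves three times the square of the trace.\<close>
    also have "\<dots> = (\<Sum>i<n. ennreal ((\<Sum>i<n. \<sigma> i) / \<sigma> i) * ennreal (3 * (\<sigma> i)\<^sup>2))"
      unfolding s using jl by (intro sum.cong refl) (simp add: gauss_linear_4 csq)
    also have "\<dots> = (\<Sum>i<n. ennreal ((\<Sum>i<n. \<sigma> i) * (3 * \<sigma> i)))"
      using \<sigma>0 \<sigma>s0 by (intro sum.cong refl) (auto simp: ennreal_mult[symmetric] power2_eq_square)
    also have "\<dots> = ennreal (\<Sum>i<n. (\<Sum>i<n. \<sigma> i) * (3 * \<sigma> i))"
      using \<sigma>0 \<sigma>s0 by (intro sum_ennreal) auto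
    also have "(\<Sum>i<n. (\<Sum>i<n. \<sigma> i) * (3 * \<sigma> i)) = 3 * (\<Sum>i<n. \<sigma> i)\<^sup>2"
      by (simp add: sum_distrib_left[symmetric] power2_eq_square)
    also have "ennreal (3 * (\<Sum>i<n. \<sigma> i)\<^sup>2) \<le> ennreal (3 * (real m)\<^sup>2)"
      using \<sigma>m \<sigma>s0 by (intro ennreal_leI mult_left_mono power_mono) auto
    finally show ?thesis using True by (simp add: s_def)
  next
    case False
    \<comment> \<open>Distinct columns are independent: given the columns in \<open>?K\<close>, the
      expression is a linear form in column j, so its second moment is a sum of squares in which
      only second moments of column l remain.\<close>
    let ?J = "{..<n} \<times> {j}" and ?K = "{..<n} \<times> ({..<m} - {j})"
    have U: "?I = ?K \<union> ?J" using jl by auto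
    define w where "w x i = (\<Sum>k<n. Q $$ (i,k) * x (k,l))" for x :: "nat \<times> nat \<Rightarrow> real" and i
    define d where "d x e = (\<Sum>i<n. w x i * c i j e)" for x e
    have wK: "w x i = (\<Sum>e\<in>?K. c i l e * x e)" for x i unfolding w_def using jl False by (intro form) auto
    have wm: "(\<lambda>x. w x i) \<in> borel_measurable (gauss ?K)" for i
      unfolding wK by (intro borel_measurable_sum borel_measurable_times borel_measurable_const measurable_gauss_component)
    have meas: "(\<lambda>a. ennreal ((\<Sum>i<n. (\<Sum>k<n. Q $$ (i,k) * a (k,j)) * (\<Sum>k<n. Q $$ (i,k) * a (k,l)))\<^sup>2)) \<in> borel_measurable (gauss ?I)"
      using jl by (intro measurable_compose[OF _ measurable_ennreal] borel_measurable_power borel_measurable_sum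
          borel_measurable_times borel_measurable_const measurable_gauss_component) auto
    have pt: "(\<Sum>i<n. (\<Sum>k<n. Q $$ (i,k) * merge ?K ?J (x,y) (k,j)) * (\<Sum>k<n. Q $$ (i,k) * merge ?K ?J (x,y) (k,l))) =
        0 + (\<Sum>e\<in>?J. d x e * y e)" for x y
    proof -
      have 1: "(\<Sum>k<n. Q $$ (i,k) * merge ?K ?J (x,y) (k,j)) = (\<Sum>e\<in>?J. c i j e * y e)" for i
      proof -
        have "(\<Sum>k<n. Q $$ (i,k) * merge ?K ?J (x,y) (k,j)) = (\<Sum>k<n. Q $$ (i,k) * y (k,j))"
          by (intro sum.cong) (auto simp: merge_def)
        then show ?thesis using form[of "{j}" j i y] by simp
      qed
      have 2: "(\<Sum>k<n. Q $$ (i,k) * merge ?K ?J (x,y) (k,l)) = w x i" for i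
        unfolding w_def using jl False by (intro sum.cong) (auto simp: merge_def)
      have "(\<Sum>i<n. (\<Sum>e\<in>?J. c i j e * y e) * w x i) = (\<Sum>i<n. \<Sum>e\<in>?J. w x i * c i j e * y e)"
        by (simp add: sum_distrib_left sum_distrib_right mult_ac)
      also have "\<dots> = (\<Sum>e\<in>?J. d x e * y e)"
        unfolding d_def by (subst sum.swap) (simp add: sum_distrib_right)
      finally show ?thesis unfolding 1 2 by simp
    qed
    have dsq: "(\<Sum>e\<in>?J. (d x e)\<^sup>2) = (\<Sum>i<n. (w x i)\<^sup>2)" for x
    proof -
      \<comment> \<open>Projecting the already projected column once more changes nothing.\<close>
      have dk: "d x (k,j) = w x k" if "k < n" for k
      proof -
        have "d x (k,j) = (\<Sum>i<n. \<Sum>p<n. Q $$ (i,p) * x (p,l) * Q $$ (i,k))"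
          by (simp add: d_def w_def c_def sum_distrib_right)
        also have "\<dots> = (\<Sum>p<n. (\<Sum>i<n. Q $$ (i,k) * Q $$ (i,p)) * x (p,l))"
          by (subst sum.swap) (simp add: sum_distrib_left sum_distrib_right mult_ac)
        also have "\<dots> = w x k" unfolding w_def using projector_entries(2)[OF Q that] by (intro sum.cong) auto
        finally show ?thesis .
      qed
      have "(\<Sum>e\<in>?J. (d x e)\<^sup>2) = (\<Sum>k<n. (d x (k,j))\<^sup>2)"
        unfolding sum.cartesian_product' by simp
      then show ?thesis using dk by simp
    qed
    have "(\<integral>\<^sup>+a. ennreal ((\<Sum>i<n. (\<Sum>k<n. Q $$ (i,k) * a (k,j)) * (\<Sum>k<n. Q $$ (i,k) * a (k,l)))\<^sup>2) \<partial>gauss ?I) =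
        (\<integral>\<^sup>+x. (\<integral>\<^sup>+y. ennreal ((\<Sum>i<n. (\<Sum>k<n. Q $$ (i,k) * merge ?K ?J (x,y) (k,j)) *
          (\<Sum>k<n. Q $$ (i,k) * merge ?K ?J (x,y) (k,l)))\<^sup>2) \<partial>gauss ?J) \<partial>gauss ?K)"
      using meas unfolding U by (intro std_normal.product_nn_integral_fold) auto
    also have "\<dots> = (\<integral>\<^sup>+x. ennreal (\<Sum>i<n. (w x i)\<^sup>2) \<partial>gauss ?K)"
      unfolding pt by (intro nn_integral_cong) (subst gauss_linear_sq, auto simp: dsq)
    also have "\<dots> = (\<integral>\<^sup>+x. (\<Sum>i<n. ennreal ((0 + w x i)\<^sup>2)) \<partial>gauss ?K)"
      by (intro nn_integral_cong) (subst sum_ennreal, auto)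
    also have "\<dots> = (\<Sum>i<n. \<integral>\<^sup>+x. ennreal ((0 + w x i)\<^sup>2) \<partial>gauss ?K)"
      using wm by (intro nn_integral_sum) auto
    also have "\<dots> = (\<Sum>i<n. ennreal (\<sigma> i))"
      unfolding wK using jl False by (intro sum.cong refl) (subst gauss_linear_sq, auto simp: csq)
    also have "\<dots> = ennreal (\<Sum>i<n. \<sigma> i)" using \<sigma>0 by (intro sum_ennreal) auto
    also have "\<dots> \<le> ennreal (real m)" using \<sigma>m by (rule ennreal_leI)
    finally show ?thesis using False by simp
  qed
qed

text \<open>The m diagonal entries contribute 3 m^2 each and the fewer than m^2 others m each when m
  is positive; together at most 3 m^3 + m^3.\<close>

lemma nn_integral_proj_gram:
  assumes Q: "Q \<in> carrier_mat n n" "transpose_mat Q = Q" "Q * Q = Q"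
    and tr: "(\<Sum>i<n. Q $$ (i,i)) \<le> real m"
  shows "(\<integral>\<^sup>+a. ennreal (frob_sq (transpose_mat (Q * mat n m a) * (Q * mat n m a))) \<partial>gauss ({..<n} \<times> {..<m}))
    \<le> ennreal (4 * real m ^ 3)"
proof -
  let ?M = "gauss ({..<n} \<times> {..<m})"
  define h where "h j l a = (\<Sum>i<n. (\<Sum>k<n. Q $$ (i,k) * a (k,j)) * (\<Sum>k<n. Q $$ (i,k) * a (k,l)))"
    for j l and a :: "nat \<times> nat \<Rightarrow> real"
  have QY: "(Q * mat n m a) $$ (i,j) = (\<Sum>k<n. Q $$ (i,k) * a (k,j))" if "i < n" "j < m" for i j a
    using index_mat_mult[of i Q j "mat n m a"] Q(1) that by simp
  have entry: "(transpose_mat (Q * mat n m a) * (Q * mat n m a)) $$ (j,l) = h j l a" if "j < m" "l < m" for j l a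
  proof -
    have "(transpose_mat (Q * mat n m a) * (Q * mat n m a)) $$ (j,l) =
        (\<Sum>i<n. (Q * mat n m a) $$ (i,j) * (Q * mat n m a) $$ (i,l))"
      using index_mat_mult[of j "transpose_mat (Q * mat n m a)" l "Q * mat n m a"] Q(1) that by simp
    then show ?thesis using that by (simp only: h_def) (intro sum.cong refl, simp add: QY del: index_mult_mat)
  qed
  have hm: "(\<lambda>a. ennreal ((h j l a)\<^sup>2)) \<in> borel_measurable ?M" if "j < m" "l < m" for j l
    unfolding h_def using that by (intro measurable_compose[OF _ measurable_ennreal] borel_measurable_power
        borel_measurable_sum borel_measurable_times borel_measurable_const measurable_gauss_component) auto
  have "ennreal (frob_sq (transpose_mat (Q * mat n m a) * (Q * mat n m a))) = (\<Sum>j<m. \<Sum>l<m. ennreal ((h j l a)\<^sup>2))" for a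
  proof -
    have "frob_sq (transpose_mat (Q * mat n m a) * (Q * mat n m a)) = (\<Sum>j<m. \<Sum>l<m. (h j l a)\<^sup>2)"
      unfolding frob_sq_def using entry by (simp del: index_mult_mat(1))
    then show ?thesis by (simp add: sum_ennreal sum_nonneg)
  qed
  then have "(\<integral>\<^sup>+a. ennreal (frob_sq (transpose_mat (Q * mat n m a) * (Q * mat n m a))) \<partial>?M) =
      (\<integral>\<^sup>+a. (\<Sum>j<m. \<Sum>l<m. ennreal ((h j l a)\<^sup>2)) \<partial>?M)" by simp
  also have "\<dots> = (\<Sum>j<m. \<integral>\<^sup>+a. (\<Sum>l<m. ennreal ((h j l a)\<^sup>2)) \<partial>?M)"
    using hm by (intro nn_integral_sum borel_measurable_sum) auto
  also have "\<dots> = (\<Sum>j<m. \<Sum>l<m. \<integral>\<^sup>+a. ennreal ((h j l a)\<^sup>2) \<partial>?M)"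
    using hm by (intro sum.cong refl nn_integral_sum) auto
  also have "\<dots> \<le> (\<Sum>j<m. \<Sum>l<m. ennreal (if j = l then 3 * (real m)\<^sup>2 else real m))"
    unfolding h_def using nn_integral_proj_form_sq[OF Q tr] by (intro sum_mono) auto
  also have "\<dots> = ennreal (\<Sum>j<m. \<Sum>l<m. if j = l then 3 * (real m)\<^sup>2 else real m)"
    by (simp add: sum_ennreal sum_nonneg)
  also have "\<dots> \<le> ennreal (4 * real m ^ 3)"
  proof (rule ennreal_leI)
    have "(\<Sum>j<m. \<Sum>l<m. if j = l then 3 * (real m)\<^sup>2 else real m) \<le> (\<Sum>j<m. \<Sum>l<m. (if j = l then 3 * (real m)\<^sup>2 else 0) + real m)"
      by (intro sum_mono) auto
    also have "\<dots> = 4 * real m ^ 3" by (simp add: sum.distrib power2_eq_square power3_eq_cube)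
    finally show "(\<Sum>j<m. \<Sum>l<m. if j = l then 3 * (real m)\<^sup>2 else real m) \<le> 4 * real m ^ 3" .
  qed
  finally show ?thesis .
qed

section \<open>From the law at one index to the law of whole arrays\<close>

lemma nn_integral_const_prob: "prob_space M \<Longrightarrow> (\<integral>\<^sup>+x. c \<partial>M) = c"
  by (simp add: prob_space.emeasure_space_1)

lemma measurable_PiM_comp:
  "j \<in> J \<Longrightarrow> f \<in> measurable M N \<Longrightarrow> (\<lambda>b. f (b j)) \<in> measurable (PiM J (\<lambda>_. M)) N"
  by (rule measurable_compose[where g = f, OF measurable_component_singleton[of j J "\<lambda>_. M"]])

text \<open>The integrand will couple all indices through projectors and pseudo-inverses, so the
  pair law has to be transferred for arbitrary measurable F; the induction integrates out one index
  at a time.\<close>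

lemma PiM_pair_law:
  fixes F :: "('i \<Rightarrow> real) \<Rightarrow> ('i \<Rightarrow> real) \<Rightarrow> ennreal"
  assumes M: "prob_space M" and p: "p \<in> borel_measurable M" and q: "q \<in> borel_measurable M"
    and law: "\<And>f. (\<lambda>(x,y). f x y) \<in> borel_measurable (borel \<Otimes>\<^sub>M borel) \<Longrightarrow>
      (\<integral>\<^sup>+v. f (p v) (q v) \<partial>M) = (\<integral>\<^sup>+x. (\<integral>\<^sup>+y. f (\<alpha> * x) (\<beta> * x + \<gamma> * y) \<partial>stdN) \<partial>stdN)"
    and I: "finite I"
    and F: "(\<lambda>(X,Y). F X Y) \<in> borel_measurable (PiM I (\<lambda>_. borel) \<Otimes>\<^sub>M PiM I (\<lambda>_. borel))"
  shows "(\<integral>\<^sup>+a. F (\<lambda>i\<in>I. p (a i)) (\<lambda>i\<in>I. q (a i)) \<partial>PiM I (\<lambda>_. M)) =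
    (\<integral>\<^sup>+x. (\<integral>\<^sup>+y. F (\<lambda>i\<in>I. \<alpha> * x i) (\<lambda>i\<in>I. \<beta> * x i + \<gamma> * y i) \<partial>gauss I) \<partial>gauss I)"
  using I F
proof (induction I arbitrary: F rule: finite_induct)
  case empty
  have "prob_space (PiM {} (\<lambda>_::'i. M))" by (intro prob_space_PiM M)
  then show ?case
    unfolding restrict_def by (simp only: nn_integral_const_prob prob_space_gauss empty_iff if_False)
next
  case (insert j I)
  interpret M: product_sigma_finite "\<lambda>_::'i. M"
    by (intro product_sigma_finite.intro prob_space_imp_sigma_finite M)
  let ?B = "PiM I (\<lambda>_. borel :: real measure)"
  interpret gI: sigma_finite_measure "gauss I"
    by (intro prob_space_imp_sigma_finite prob_space_gauss)
  have upd: "(\<lambda>w. F ((f w)(j := h w)) ((g w)(j := k w))) \<in> borel_measurable N"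
    if "f \<in> measurable N ?B" "g \<in> measurable N ?B" "h \<in> borel_measurable N" "k \<in> borel_measurable N"
    for f g h k and N :: "'w measure"
  proof -
    have "(\<lambda>w. ((f w)(j := h w), (g w)(j := k w))) \<in> measurable N (PiM (insert j I) (\<lambda>_. borel) \<Otimes>\<^sub>M PiM (insert j I) (\<lambda>_. borel))"
      using that by (intro measurable_Pair measurable_fun_upd[where J = I]) auto
    from measurable_compose[OF this insert.prems] show ?thesis by simp
  qed
  have lin: "(\<lambda>w. \<lambda>i\<in>I. b * x w i + c * y w i) \<in> measurable N ?B"
    if "x \<in> measurable N (gauss I)" "y \<in> measurable N (gauss I)" for x y b c and N :: "'w measure"
  proof (rule measurable_restrict)
    fix i assume i: "i \<in> I"
    have "(\<lambda>w. x w i) \<in> borel_measurable N" "(\<lambda>w. y w i) \<in> borel_measurable N"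
      using measurable_compose[OF that(1) measurable_gauss_component[OF i]]
        measurable_compose[OF that(2) measurable_gauss_component[OF i]] by auto
    then show "(\<lambda>w. b * x w i + c * y w i) \<in> borel_measurable N" by measurable
  qed
  have lin1: "(\<lambda>w. \<lambda>i\<in>I. b * x w i) \<in> measurable N ?B"
    if "x \<in> measurable N (gauss I)" for x b and N :: "'w measure"
    using lin[OF that that, of b 0] by simp
  have compM: "(\<lambda>a. \<lambda>i\<in>S. r (a i)) \<in> measurable (PiM S (\<lambda>_. M)) (PiM S (\<lambda>_. borel))"
    if "r \<in> borel_measurable M" for r and S :: "'i set"
    by (intro measurable_restrict measurable_PiM_comp that)
  have res: "(\<lambda>i\<in>insert j I. r ((a(j := v)) i)) = (\<lambda>i\<in>I. r (a i))(j := r v)" for r :: "'v \<Rightarrow> real" and a v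
    using insert.hyps by (auto simp: restrict_def fun_eq_iff)
  have res1: "(\<lambda>i\<in>insert j I. \<alpha> * (x(j := s)) i) = (\<lambda>i\<in>I. \<alpha> * x i)(j := \<alpha> * s)" for x s
    using insert.hyps by (auto simp: restrict_def fun_eq_iff)
  have res2: "(\<lambda>i\<in>insert j I. \<beta> * (x(j := s)) i + \<gamma> * (y(j := t)) i) = (\<lambda>i\<in>I. \<beta> * x i + \<gamma> * y i)(j := \<beta> * s + \<gamma> * t)" for x y s t
    using insert.hyps by (auto simp: restrict_def fun_eq_iff)
  \<comment> \<open>The integral over the remaining indices as a function of the pair of values at
    j, which is the shape in which the one-index law applies.\<close>
  define K where "K s t = (\<integral>\<^sup>+x. (\<integral>\<^sup>+y. F ((\<lambda>i\<in>I. \<alpha> * x i)(j := s)) ((\<lambda>i\<in>I. \<beta> * x i + \<gamma> * y i)(j := t)) \<partial>gauss I) \<partial>gauss I)" for s t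
  have Km: "(\<lambda>(s,t). K s t) \<in> borel_measurable (borel \<Otimes>\<^sub>M borel)"
    unfolding K_def case_prod_unfold
    by (intro gI.borel_measurable_nn_integral) (unfold case_prod_unfold, intro gI.borel_measurable_nn_integral,
      unfold case_prod_unfold, intro upd lin lin1, measurable)
  have meas1: "(\<lambda>a. F (\<lambda>i\<in>insert j I. p (a i)) (\<lambda>i\<in>insert j I. q (a i))) \<in> borel_measurable (PiM (insert j I) (\<lambda>_. M))"
    using measurable_compose[OF measurable_Pair[OF compM[OF p] compM[OF q]] insert.prems] by simp
  have "(\<integral>\<^sup>+a. F (\<lambda>i\<in>insert j I. p (a i)) (\<lambda>i\<in>insert j I. q (a i)) \<partial>PiM (insert j I) (\<lambda>_. M)) =
      (\<integral>\<^sup>+v. (\<integral>\<^sup>+a. F ((\<lambda>i\<in>I. p (a i))(j := p v)) ((\<lambda>i\<in>I. q (a i))(j := q v)) \<partial>PiM I (\<lambda>_. M)) \<partial>M)"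
    by (subst M.product_nn_integral_insert_rev[OF insert.hyps meas1]) (simp only: res)
  also have "\<dots> = (\<integral>\<^sup>+v. K (p v) (q v) \<partial>M)"
  proof (intro nn_integral_cong)
    fix v
    show "(\<integral>\<^sup>+a. F ((\<lambda>i\<in>I. p (a i))(j := p v)) ((\<lambda>i\<in>I. q (a i))(j := q v)) \<partial>PiM I (\<lambda>_. M)) = K (p v) (q v)"
      unfolding K_def
      by (rule insert.IH[of "\<lambda>X Y. F (X(j := p v)) (Y(j := q v))"])
        (unfold case_prod_unfold, intro upd, measurable)
  qed
  also have "\<dots> = (\<integral>\<^sup>+s. (\<integral>\<^sup>+t. K (\<alpha> * s) (\<beta> * s + \<gamma> * t) \<partial>stdN) \<partial>stdN)"
    by (rule law[OF Km])
  also have "\<dots> = (\<integral>\<^sup>+s. (\<integral>\<^sup>+x. (\<integral>\<^sup>+t. (\<integral>\<^sup>+y. F ((\<lambda>i\<in>I. \<alpha> * x i)(j := \<alpha> * s))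
      ((\<lambda>i\<in>I. \<beta> * x i + \<gamma> * y i)(j := \<beta> * s + \<gamma> * t)) \<partial>gauss I) \<partial>stdN) \<partial>gauss I) \<partial>stdN)"
  proof (intro nn_integral_cong)
    fix s
    interpret pair_sigma_finite "gauss I" stdN
      by (intro pair_sigma_finite.intro sigma_finite_stdN gI.sigma_finite_measure_axioms)
    show "(\<integral>\<^sup>+t. K (\<alpha> * s) (\<beta> * s + \<gamma> * t) \<partial>stdN) = (\<integral>\<^sup>+x. (\<integral>\<^sup>+t. (\<integral>\<^sup>+y. F ((\<lambda>i\<in>I. \<alpha> * x i)(j := \<alpha> * s))
      ((\<lambda>i\<in>I. \<beta> * x i + \<gamma> * y i)(j := \<beta> * s + \<gamma> * t)) \<partial>gauss I) \<partial>stdN) \<partial>gauss I)"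
      unfolding K_def
      by (rule Fubini') (unfold case_prod_unfold, intro gI.borel_measurable_nn_integral,
        unfold case_prod_unfold, intro upd lin lin1, measurable)
  qed
  also have "\<dots> = (\<integral>\<^sup>+s. (\<integral>\<^sup>+x. (\<integral>\<^sup>+y. F (\<lambda>i\<in>insert j I. \<alpha> * (x(j := s)) i)
      (\<lambda>i\<in>insert j I. \<beta> * (x(j := s)) i + \<gamma> * y i) \<partial>gauss (insert j I)) \<partial>gauss I) \<partial>stdN)"
  proof (intro nn_integral_cong)
    fix s x assume x: "x \<in> space (gauss I)"
    have "(\<lambda>y. \<lambda>i\<in>insert j I. \<beta> * (x(j := s)) i + \<gamma> * y i) \<in> measurable (gauss (insert j I)) (PiM (insert j I) (\<lambda>_. borel))"
    proof (rule measurable_restrict)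
      fix i assume "i \<in> insert j I"
      then have "(\<lambda>y. y i) \<in> borel_measurable (gauss (insert j I))" by (rule measurable_gauss_component)
      then show "(\<lambda>y. \<beta> * (x(j := s)) i + \<gamma> * y i) \<in> borel_measurable (gauss (insert j I))" by measurable
    qed
    note m2 = this
    have m1: "(\<lambda>y. \<lambda>i\<in>insert j I. \<alpha> * (x(j := s)) i) \<in> measurable (gauss (insert j I)) (PiM (insert j I) (\<lambda>_. borel))"
      by (rule measurable_restrict) simp
    have "(\<lambda>y. F (\<lambda>i\<in>insert j I. \<alpha> * (x(j := s)) i) (\<lambda>i\<in>insert j I. \<beta> * (x(j := s)) i + \<gamma> * y i))
        \<in> borel_measurable (gauss (insert j I))"
      using measurable_compose[OF measurable_Pair[OF m1 m2] insert.prems] by simp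
    then show "(\<integral>\<^sup>+t. (\<integral>\<^sup>+y. F ((\<lambda>i\<in>I. \<alpha> * x i)(j := \<alpha> * s)) ((\<lambda>i\<in>I. \<beta> * x i + \<gamma> * y i)(j := \<beta> * s + \<gamma> * t)) \<partial>gauss I) \<partial>stdN) =
        (\<integral>\<^sup>+y. F (\<lambda>i\<in>insert j I. \<alpha> * (x(j := s)) i) (\<lambda>i\<in>insert j I. \<beta> * (x(j := s)) i + \<gamma> * y i) \<partial>gauss (insert j I))"
      by (subst std_normal.product_nn_integral_insert_rev[OF insert.hyps]) (simp_all only: res1 res2)
  qed
  also have "\<dots> = (\<integral>\<^sup>+x. (\<integral>\<^sup>+y. F (\<lambda>i\<in>insert j I. \<alpha> * x i) (\<lambda>i\<in>insert j I. \<beta> * x i + \<gamma> * y i) \<partial>gauss (insert j I)) \<partial>gauss (insert j I))"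
  proof (rule std_normal.product_nn_integral_insert_rev[OF insert.hyps, symmetric])
    interpret gJ: sigma_finite_measure "gauss (insert j I)"
      by (intro prob_space_imp_sigma_finite prob_space_gauss)
    have c: "(\<lambda>w. fst w i) \<in> borel_measurable (gauss (insert j I) \<Otimes>\<^sub>M gauss (insert j I))"
      "(\<lambda>w. snd w i) \<in> borel_measurable (gauss (insert j I) \<Otimes>\<^sub>M gauss (insert j I))" if "i \<in> insert j I" for i
      using measurable_compose[OF measurable_fst measurable_gauss_component[OF that]]
        measurable_compose[OF measurable_snd measurable_gauss_component[OF that]] by auto
    have "(\<lambda>w. \<lambda>i\<in>insert j I. \<alpha> * fst w i) \<in> measurable (gauss (insert j I) \<Otimes>\<^sub>M gauss (insert j I)) (PiM (insert j I) (\<lambda>_. borel))"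
      "(\<lambda>w. \<lambda>i\<in>insert j I. \<beta> * fst w i + \<gamma> * snd w i) \<in> measurable (gauss (insert j I) \<Otimes>\<^sub>M gauss (insert j I)) (PiM (insert j I) (\<lambda>_. borel))"
      by (intro measurable_restrict borel_measurable_times borel_measurable_add borel_measurable_const c; simp)+
    from measurable_compose[OF measurable_Pair[OF this] insert.prems]
    show "(\<lambda>x. \<integral>\<^sup>+y. F (\<lambda>i\<in>insert j I. \<alpha> * x i) (\<lambda>i\<in>insert j I. \<beta> * x i + \<gamma> * y i) \<partial>gauss (insert j I)) \<in> borel_measurable (gauss (insert j I))"
      by (intro gJ.borel_measurable_nn_integral) (simp add: case_prod_unfold)
  qed
  finally show ?case .
qed

section \<open>The law of the task matrices\<close>

lemma prob_space_mvnormal: "prob_space (mvnormal P \<Sigma>)"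
  unfolding mvnormal_def
  by (intro prob_space.prob_space_distr prob_space_gauss measurable_restrict borel_measurable_sum
      borel_measurable_times borel_measurable_const measurable_gauss_component)

lemma sets_mvnormal: "sets (mvnormal P \<Sigma>) = sets (PiM {..<P} (\<lambda>_. borel))"
  by (simp add: mvnormal_def)

lemma measurable_mvnormal_component: "\<kappa> < P \<Longrightarrow> (\<lambda>v. v \<kappa>) \<in> borel_measurable (mvnormal P \<Sigma>)"
  by (subst measurable_cong_sets[OF sets_mvnormal refl]) (simp add: measurable_component_singleton)

lemma nn_integral_mvnormal:
  assumes "f \<in> borel_measurable (PiM {..<P} (\<lambda>_. borel))"
  shows "(\<integral>\<^sup>+v. f v \<partial>mvnormal P \<Sigma>) = (\<integral>\<^sup>+z. f (\<lambda>i\<in>{..<P}. \<Sum>k<P. psd_sqrt \<Sigma> $$ (i,k) * z k) \<partial>gauss {..<P})"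
  unfolding mvnormal_def
proof (rule nn_integral_distr)
  show "(\<lambda>z. \<lambda>i\<in>{..<P}. \<Sum>k<P. psd_sqrt \<Sigma> $$ (i,k) * z k) \<in> measurable (gauss {..<P}) (PiM {..<P} (\<lambda>_. borel))"
    by (intro measurable_restrict borel_measurable_sum borel_measurable_times borel_measurable_const measurable_gauss_component)
qed (use assms in simp)

lemma psd_sqrt_entries:
  assumes S: "\<Sigma> \<in> carrier_mat P P" "psd \<Sigma>" and ij: "i < P" "j < P"
  shows "(\<Sum>k<P. psd_sqrt \<Sigma> $$ (i,k) * psd_sqrt \<Sigma> $$ (j,k)) = \<Sigma> $$ (i,j)"
proof -
  note T = psd_sqrt[OF S]
  have sym: "psd_sqrt \<Sigma> $$ (j,k) = psd_sqrt \<Sigma> $$ (k,j)" if "k < P" for k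
    using arg_cong[of _ _ "\<lambda>M. M $$ (j,k)"] T(1,2) that ij psd_iff[OF T(1)]
    by (metis carrier_matD index_transpose_mat(1))
  have "\<Sigma> $$ (i,j) = (\<Sum>k<P. psd_sqrt \<Sigma> $$ (i,k) * psd_sqrt \<Sigma> $$ (k,j))"
    using index_mat_mult[of i "psd_sqrt \<Sigma>" j "psd_sqrt \<Sigma>"] T ij by simp
  then show ?thesis using sym by simp
qed

text \<open>Both coordinates are linear forms in the i.i.d. normals behind \<open>mvnormal\<close>,
  so \<open>gauss_two_forms\<close> applies, with row products of the square root as covariances.
  Singular \<Sigma> is included.\<close>

lemma mvnormal_pair_law:
  assumes S: "\<Sigma> \<in> carrier_mat P P" "psd \<Sigma>" and kl: "\<kappa> < P" "l < P"
  shows "\<exists>\<alpha> \<beta> \<gamma>. 0 \<le> \<alpha> \<and> \<alpha>\<^sup>2 = \<Sigma> $$ (\<kappa>,\<kappa>) \<and> \<alpha> * \<beta> = \<Sigma> $$ (\<kappa>,l) \<and> \<beta>\<^sup>2 + \<gamma>\<^sup>2 = \<Sigma> $$ (l,l) \<and>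
    (\<forall>f. (\<lambda>(x,y). f x y) \<in> borel_measurable (borel \<Otimes>\<^sub>M borel) \<longrightarrow>
      (\<integral>\<^sup>+v. f (v \<kappa>) (v l) \<partial>mvnormal P \<Sigma>) =
      (\<integral>\<^sup>+x. (\<integral>\<^sup>+y. f (\<alpha> * x) (\<beta> * x + \<gamma> * y) \<partial>stdN) \<partial>stdN))"
proof -
  define T where "T = psd_sqrt \<Sigma>"
  have e: "(\<integral>\<^sup>+v. f (v \<kappa>) (v l) \<partial>mvnormal P \<Sigma>) =
      (\<integral>\<^sup>+z. f (\<Sum>k<P. T $$ (\<kappa>,k) * z k) (\<Sum>k<P. T $$ (l,k) * z k) \<partial>gauss {..<P})"
    if f: "(\<lambda>(x,y). f x y) \<in> borel_measurable (borel \<Otimes>\<^sub>M borel)" for f :: "real \<Rightarrow> real \<Rightarrow> ennreal"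
  proof -
    have "(\<lambda>v. (v \<kappa>, v l)) \<in> measurable (PiM {..<P} (\<lambda>_. borel)) (borel \<Otimes>\<^sub>M (borel :: real measure))"
      using kl by (intro measurable_Pair measurable_component_singleton) auto
    from measurable_compose[OF this f]
    show ?thesis using kl by (subst nn_integral_mvnormal) (auto simp: T_def)
  qed
  have sums: "(\<Sum>k<P. (T $$ (\<kappa>,k))\<^sup>2) = \<Sigma> $$ (\<kappa>,\<kappa>)" "(\<Sum>k<P. T $$ (\<kappa>,k) * T $$ (l,k)) = \<Sigma> $$ (\<kappa>,l)"
    "(\<Sum>k<P. (T $$ (l,k))\<^sup>2) = \<Sigma> $$ (l,l)"
    using psd_sqrt_entries[OF S kl(1) kl(1)] psd_sqrt_entries[OF S kl(1) kl(2)] psd_sqrt_entries[OF S kl(2) kl(2)]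
    by (auto simp: T_def power2_eq_square)
  show ?thesis
    using gauss_two_forms[of "{..<P}" "\<lambda>k. T $$ (\<kappa>,k)" "\<lambda>k. T $$ (l,k)"] e unfolding sums by simp
qed

lemma mvnormal_linear_sq:
  assumes S: "\<Sigma> \<in> carrier_mat P P" "psd \<Sigma>"
  shows "(\<integral>\<^sup>+v. ennreal ((t + (\<Sum>\<nu><P. c \<nu> * v \<nu>))\<^sup>2) \<partial>mvnormal P \<Sigma>) =
    ennreal (t\<^sup>2 + (\<Sum>\<nu><P. \<Sum>\<nu>'<P. c \<nu> * c \<nu>' * \<Sigma> $$ (\<nu>,\<nu>')))"
proof -
  define T where "T = psd_sqrt \<Sigma>"
  define d where "d k = (\<Sum>\<nu><P. c \<nu> * T $$ (\<nu>,k))" for k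
  have "(\<integral>\<^sup>+v. ennreal ((t + (\<Sum>\<nu><P. c \<nu> * v \<nu>))\<^sup>2) \<partial>mvnormal P \<Sigma>) =
      (\<integral>\<^sup>+z. ennreal ((t + (\<Sum>\<nu><P. c \<nu> * (\<Sum>k<P. T $$ (\<nu>,k) * z k)))\<^sup>2) \<partial>gauss {..<P})"
    by (subst nn_integral_mvnormal) (auto simp: T_def intro!: measurable_compose[OF _ measurable_ennreal]
        borel_measurable_power borel_measurable_add borel_measurable_sum borel_measurable_times)
  also have "\<dots> = (\<integral>\<^sup>+z. ennreal ((t + (\<Sum>k<P. d k * z k))\<^sup>2) \<partial>gauss {..<P})"
  proof -
    have "(\<Sum>\<nu><P. c \<nu> * (\<Sum>k<P. T $$ (\<nu>,k) * z k)) = (\<Sum>k<P. d k * z k)" for z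
      unfolding d_def sum_distrib_left sum_distrib_right by (subst sum.swap) (simp add: mult_ac)
    then show ?thesis by simp
  qed
  also have "\<dots> = ennreal (t\<^sup>2 + (\<Sum>k<P. (d k)\<^sup>2))" by (rule gauss_linear_sq) simp
  also have "(\<Sum>k<P. (d k)\<^sup>2) = (\<Sum>\<nu><P. \<Sum>\<nu>'<P. c \<nu> * c \<nu>' * \<Sigma> $$ (\<nu>,\<nu>'))"
  proof -
    have "(\<Sum>k<P. (d k)\<^sup>2) = (\<Sum>k<P. \<Sum>\<nu><P. \<Sum>\<nu>'<P. c \<nu> * c \<nu>' * (T $$ (\<nu>,k) * T $$ (\<nu>',k)))"
      by (simp add: d_def power2_eq_square sum_product mult_ac)
    also have "\<dots> = (\<Sum>\<nu><P. \<Sum>\<nu>'<P. \<Sum>k<P. c \<nu> * c \<nu>' * (T $$ (\<nu>,k) * T $$ (\<nu>',k)))"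
      by (subst sum.swap) (intro sum.cong refl sum.swap)
    also have "\<dots> = (\<Sum>\<nu><P. \<Sum>\<nu>'<P. c \<nu> * c \<nu>' * \<Sigma> $$ (\<nu>,\<nu>'))"
      using psd_sqrt_entries[OF S] by (intro sum.cong refl) (simp add: sum_distrib_left[symmetric] T_def)
    finally show ?thesis .
  qed
  finally show ?thesis .
qed

lemma mvnormal_quad_nonneg:
  assumes S: "\<Sigma> \<in> carrier_mat P P" "psd \<Sigma>"
  shows "0 \<le> (\<Sum>\<nu><P. \<Sum>\<nu>'<P. c \<nu> * c \<nu>' * \<Sigma> $$ (\<nu>,\<nu>'))"
proof -
  have "0 \<le> vec P c \<bullet> (\<Sigma> *\<^sub>v vec P c)" using S psd_iff[OF S(1)] by simp
  then show ?thesis using quad_form[OF S(1), of "vec P c"] by simp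
qed

text \<open>Independence removes the cross terms between indices. The shift t carries the index
  integrated last, which is what makes the induction close.\<close>

lemma PiM_mvnormal_linear_sq:
  assumes S: "\<Sigma> \<in> carrier_mat P P" "psd \<Sigma>" and J: "finite J"
  shows "(\<integral>\<^sup>+b. ennreal ((t + (\<Sum>e\<in>J. \<Sum>\<nu><P. c e \<nu> * b e \<nu>))\<^sup>2) \<partial>PiM J (\<lambda>_. mvnormal P \<Sigma>)) =
    ennreal (t\<^sup>2 + (\<Sum>e\<in>J. \<Sum>\<nu><P. \<Sum>\<nu>'<P. c e \<nu> * c e \<nu>' * \<Sigma> $$ (\<nu>,\<nu>')))"
  using J
proof (induction J arbitrary: t rule: finite_induct)
  case empty
  show ?case
    by (simp only: nn_integral_const_prob prob_space_PiM prob_space_mvnormal sum.empty add_0_right)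
next
  case (insert j J)
  interpret M: product_sigma_finite "\<lambda>_. mvnormal P \<Sigma>"
    by (intro product_sigma_finite.intro prob_space_imp_sigma_finite prob_space_mvnormal)
  let ?q = "\<lambda>e. \<Sum>\<nu><P. \<Sum>\<nu>'<P. c e \<nu> * c e \<nu>' * \<Sigma> $$ (\<nu>,\<nu>')"
  have meas: "(\<lambda>b. ennreal ((t + (\<Sum>e\<in>insert j J. \<Sum>\<nu><P. c e \<nu> * b e \<nu>))\<^sup>2)) \<in> borel_measurable (PiM (insert j J) (\<lambda>_. mvnormal P \<Sigma>))"
    by (intro measurable_compose[OF _ measurable_ennreal] borel_measurable_power borel_measurable_add borel_measurable_sum
        borel_measurable_times borel_measurable_const measurable_PiM_comp measurable_mvnormal_component) auto
  have upd: "(\<Sum>e\<in>insert j J. \<Sum>\<nu><P. c e \<nu> * (b(j := v)) e \<nu>) = (\<Sum>\<nu><P. c j \<nu> * v \<nu>) + (\<Sum>e\<in>J. \<Sum>\<nu><P. c e \<nu> * b e \<nu>)" for b v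
  proof -
    have "(\<Sum>e\<in>J. \<Sum>\<nu><P. c e \<nu> * (b(j := v)) e \<nu>) = (\<Sum>e\<in>J. \<Sum>\<nu><P. c e \<nu> * b e \<nu>)"
      using insert.hyps by (intro sum.cong refl) auto
    then show ?thesis using insert.hyps by simp
  qed
  have qJ: "0 \<le> (\<Sum>e\<in>J. ?q e)" by (intro sum_nonneg mvnormal_quad_nonneg[OF S])
  have "(\<integral>\<^sup>+b. ennreal ((t + (\<Sum>e\<in>insert j J. \<Sum>\<nu><P. c e \<nu> * b e \<nu>))\<^sup>2) \<partial>PiM (insert j J) (\<lambda>_. mvnormal P \<Sigma>)) =
      (\<integral>\<^sup>+v. (\<integral>\<^sup>+b. ennreal (((t + (\<Sum>\<nu><P. c j \<nu> * v \<nu>)) + (\<Sum>e\<in>J. \<Sum>\<nu><P. c e \<nu> * b e \<nu>))\<^sup>2) \<partial>PiM J (\<lambda>_. mvnormal P \<Sigma>)) \<partial>mvnormal P \<Sigma>)"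
    by (subst M.product_nn_integral_insert_rev[OF insert.hyps meas]) (simp only: upd add.assoc)
  also have "\<dots> = (\<integral>\<^sup>+v. ennreal ((t + (\<Sum>\<nu><P. c j \<nu> * v \<nu>))\<^sup>2) + ennreal (\<Sum>e\<in>J. ?q e) \<partial>mvnormal P \<Sigma>)"
    unfolding insert.IH using qJ by (intro nn_integral_cong ennreal_plus) auto
  also have "\<dots> = (\<integral>\<^sup>+v. ennreal ((t + (\<Sum>\<nu><P. c j \<nu> * v \<nu>))\<^sup>2) \<partial>mvnormal P \<Sigma>) + ennreal (\<Sum>e\<in>J. ?q e)"
    using prob_space.emeasure_space_1[OF prob_space_mvnormal, of P \<Sigma>]
    by (subst nn_integral_add) (auto intro!: measurable_compose[OF _ measurable_ennreal] borel_measurable_power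
        borel_measurable_add borel_measurable_sum borel_measurable_times measurable_mvnormal_component)
  also have "\<dots> = ennreal (t\<^sup>2 + (\<Sum>e\<in>insert j J. ?q e))"
    unfolding mvnormal_linear_sq[OF S] using qJ mvnormal_quad_nonneg[OF S, of "c j"] insert.hyps
    by (subst ennreal_plus[symmetric]) (auto simp: add.assoc)
  finally show ?case .
qed

text \<open>One term of the sequence: n and m stand for \<open>Nx\<close> and \<open>Ns\<close>. The
  bounds below are explicit in n and m and depend otherwise on P, \<open>Cin\<close> and
  \<open>Cout\<close> alone.\<close>

locale task_model =
  fixes P Ny n m :: nat and Cin Cout :: "real mat"
  assumes Ny: "1 \<le> Ny" and m: "1 \<le> m"
    and Cin: "Cin \<in> carrier_mat P P" "psd Cin" and Cout: "Cout \<in> carrier_mat P P" "psd Cout"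
    and Cin_diag: "\<And>i. i < P \<Longrightarrow> Cin $$ (i,i) = 1"
begin

definition law_A :: "(nat \<times> nat \<Rightarrow> nat \<Rightarrow> real) measure" where
  "law_A = PiM ({..<n} \<times> {..<m}) (\<lambda>_. mvnormal P ((1 / real m) \<cdot>\<^sub>m Cin))"

definition law_B :: "(nat \<times> nat \<Rightarrow> nat \<Rightarrow> real) measure" where
  "law_B = PiM ({..<Ny} \<times> {..<m}) (\<lambda>_. mvnormal P ((1 / real m) \<cdot>\<^sub>m Cout))"

lemma prob_space_law: "prob_space law_A" "prob_space law_B"
  unfolding law_A_def law_B_def by (intro prob_space_PiM prob_space_mvnormal)+

lemma scaled_cov: "(1 / real m) \<cdot>\<^sub>m Cin \<in> carrier_mat P P" "psd ((1 / real m) \<cdot>\<^sub>m Cin)"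
  "(1 / real m) \<cdot>\<^sub>m Cout \<in> carrier_mat P P" "psd ((1 / real m) \<cdot>\<^sub>m Cout)"
  using Cin Cout by (auto intro!: psd_smult)

lemma meas_mat_task_A: "\<mu> < P \<Longrightarrow> meas_mat law_A n m (\<lambda>a. task_mat n m a \<mu>)"
  by (rule meas_mat_cong_entry[where f = "\<lambda>i j a. a (i,j) \<mu>"])
    (auto simp: task_mat_def law_A_def intro!: measurable_PiM_comp measurable_mvnormal_component)

lemma meas_mat_task_B: "\<mu> < P \<Longrightarrow> meas_mat law_B Ny m (\<lambda>b. task_mat Ny m b \<mu>)"
  by (rule meas_mat_cong_entry[where f = "\<lambda>i j b. b (i,j) \<mu>"])
    (auto simp: task_mat_def law_B_def intro!: measurable_PiM_comp measurable_mvnormal_component)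

lemma task_mat_carrier: "task_mat n m a \<mu> \<in> carrier_mat n m"
  by (simp add: task_mat_def)

definition data_mat :: "(nat \<times> nat \<Rightarrow> real) \<Rightarrow> real mat" where
  "data_mat x = mat n m x"

lemma data_mat_carrier [simp]: "data_mat x \<in> carrier_mat n m"
  by (simp add: data_mat_def)

lemma meas_mat_data_fst: "meas_mat (PiM ({..<n} \<times> {..<m}) (\<lambda>_. borel :: real measure) \<Otimes>\<^sub>M PiM ({..<n} \<times> {..<m}) (\<lambda>_. borel :: real measure)) n m (\<lambda>w. data_mat (fst w))"
proof (rule meas_mat_cong_entry[where f = "\<lambda>i j w. fst w (i,j)"])
  fix i j assume "i < n" "j < m"
  then have "(\<lambda>x. x (i,j)) \<in> measurable (PiM ({..<n} \<times> {..<m}) (\<lambda>_. borel :: real measure)) borel"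
    by (intro measurable_component_singleton) auto
  from measurable_compose[OF measurable_fst this]
  show "(\<lambda>w. fst w (i,j)) \<in> borel_measurable (PiM ({..<n} \<times> {..<m}) (\<lambda>_. borel :: real measure) \<Otimes>\<^sub>M PiM ({..<n} \<times> {..<m}) (\<lambda>_. borel :: real measure))" .
qed (auto simp: data_mat_def)

lemma meas_mat_data_snd: "meas_mat (PiM ({..<n} \<times> {..<m}) (\<lambda>_. borel :: real measure) \<Otimes>\<^sub>M PiM ({..<n} \<times> {..<m}) (\<lambda>_. borel :: real measure)) n m (\<lambda>w. data_mat (snd w))"
proof (rule meas_mat_cong_entry[where f = "\<lambda>i j w. snd w (i,j)"])
  fix i j assume "i < n" "j < m"
  then have "(\<lambda>x. x (i,j)) \<in> measurable (PiM ({..<n} \<times> {..<m}) (\<lambda>_. borel :: real measure)) borel"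
    by (intro measurable_component_singleton) auto
  from measurable_compose[OF measurable_snd this]
  show "(\<lambda>w. snd w (i,j)) \<in> borel_measurable (PiM ({..<n} \<times> {..<m}) (\<lambda>_. borel :: real measure) \<Otimes>\<^sub>M PiM ({..<n} \<times> {..<m}) (\<lambda>_. borel :: real measure))" .
qed (auto simp: data_mat_def)

text \<open>Gaussian regression of task l on task \<kappa>: the unit diagonal makes
  \<open>Cin $$ (\<kappa>,l)\<close> the slope, and the residual \<gamma> y is independent of x,
  hence of the projector of task \<kappa>. F has to be invariant under restriction because the
  product spaces consist of functions that are constant outside the index set.\<close>

lemma two_task_law:
  assumes kl: "\<kappa> < P" "l < P"
  obtains \<gamma> where "\<gamma>\<^sup>2 \<le> Cin $$ (l,l) / real m"
    "\<And>F. (\<lambda>(X,Y). F X Y) \<in> borel_measurable (PiM ({..<n} \<times> {..<m}) (\<lambda>_. borel) \<Otimes>\<^sub>M PiM ({..<n} \<times> {..<m}) (\<lambda>_. borel)) \<Longrightarrow>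
      (\<And>X Y. F (restrict X ({..<n} \<times> {..<m})) (restrict Y ({..<n} \<times> {..<m})) = F X Y) \<Longrightarrow>
      (\<integral>\<^sup>+a. F (\<lambda>e. a e \<kappa>) (\<lambda>e. a e l) \<partial>law_A) =
      (\<integral>\<^sup>+x. (\<integral>\<^sup>+y. F (\<lambda>e. (1 / sqrt (real m)) * x e) (\<lambda>e. Cin $$ (\<kappa>,l) * ((1 / sqrt (real m)) * x e) + \<gamma> * y e)
        \<partial>gauss ({..<n} \<times> {..<m})) \<partial>gauss ({..<n} \<times> {..<m}))"
proof -
  let ?I = "{..<n} \<times> {..<m}"
  let ?M = "mvnormal P ((1 / real m) \<cdot>\<^sub>m Cin)"
  obtain \<alpha> \<beta> \<gamma> where ab: "0 \<le> \<alpha>" "\<alpha>\<^sup>2 = 1 / real m" "\<alpha> * \<beta> = Cin $$ (\<kappa>,l) / real m" "\<beta>\<^sup>2 + \<gamma>\<^sup>2 = Cin $$ (l,l) / real m"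
    and law: "\<And>f. (\<lambda>(x,y). f x y) \<in> borel_measurable (borel \<Otimes>\<^sub>M borel) \<Longrightarrow>
      (\<integral>\<^sup>+v. f (v \<kappa>) (v l) \<partial>?M) = (\<integral>\<^sup>+x. (\<integral>\<^sup>+y. f (\<alpha> * x) (\<beta> * x + \<gamma> * y) \<partial>stdN) \<partial>stdN)"
    using mvnormal_pair_law[OF scaled_cov(1,2) kl] Cin kl Cin_diag by auto
  have \<alpha>: "\<alpha> = 1 / sqrt (real m)"
    using ab(1,2) by (metis real_sqrt_divide real_sqrt_one real_sqrt_unique)
  have "\<alpha> \<noteq> 0" using m by (simp add: \<alpha>)
  moreover have "\<alpha> * \<beta> = \<alpha> * (Cin $$ (\<kappa>,l) * \<alpha>)"
  proof -
    have "\<alpha> * (Cin $$ (\<kappa>,l) * \<alpha>) = Cin $$ (\<kappa>,l) * \<alpha>\<^sup>2" by (simp add: power2_eq_square)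
    then show ?thesis using ab(2,3) by simp
  qed
  ultimately have \<beta>: "\<beta> = Cin $$ (\<kappa>,l) * \<alpha>" by simp
  show ?thesis
  proof (rule that)
    show "\<gamma>\<^sup>2 \<le> Cin $$ (l,l) / real m" using ab(4) zero_le_power2[of \<beta>] by linarith
    fix F :: "(nat \<times> nat \<Rightarrow> real) \<Rightarrow> (nat \<times> nat \<Rightarrow> real) \<Rightarrow> ennreal"
    assume F: "(\<lambda>(X,Y). F X Y) \<in> borel_measurable (PiM ?I (\<lambda>_. borel) \<Otimes>\<^sub>M PiM ?I (\<lambda>_. borel))"
      and res: "\<And>X Y. F (restrict X ?I) (restrict Y ?I) = F X Y"
    have "(\<integral>\<^sup>+a. F (\<lambda>e\<in>?I. a e \<kappa>) (\<lambda>e\<in>?I. a e l) \<partial>law_A) =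
        (\<integral>\<^sup>+x. (\<integral>\<^sup>+y. F (\<lambda>e\<in>?I. \<alpha> * x e) (\<lambda>e\<in>?I. \<beta> * x e + \<gamma> * y e) \<partial>gauss ?I) \<partial>gauss ?I)"
      unfolding law_A_def
      by (rule PiM_pair_law[where p = "\<lambda>v. v \<kappa>" and q = "\<lambda>v. v l"])
        (use kl law F in \<open>auto intro: prob_space_mvnormal measurable_mvnormal_component\<close>)
    then show "(\<integral>\<^sup>+a. F (\<lambda>e. a e \<kappa>) (\<lambda>e. a e l) \<partial>law_A) =
      (\<integral>\<^sup>+x. (\<integral>\<^sup>+y. F (\<lambda>e. (1 / sqrt (real m)) * x e) (\<lambda>e. Cin $$ (\<kappa>,l) * ((1 / sqrt (real m)) * x e) + \<gamma> * y e)
        \<partial>gauss ?I) \<partial>gauss ?I)"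
      unfolding res by (simp add: \<beta> \<alpha> mult.assoc)
  qed
qed

lemma data_mat_restrict: "data_mat (restrict X ({..<n} \<times> {..<m})) = data_mat X"
  by (intro eq_matI) (auto simp: data_mat_def)

lemma task_mat_data: "task_mat n m a \<mu> = data_mat (\<lambda>e. a e \<mu>)"
  by (intro eq_matI) (auto simp: data_mat_def task_mat_def)

lemma data_mat_smult: "data_mat (\<lambda>e. c * x e) = c \<cdot>\<^sub>m data_mat x"
  by (intro eq_matI) (auto simp: data_mat_def)

lemma data_gram: "transpose_mat (data_mat x) * data_mat x = row_gram {..<n} m x"
  by (intro eq_matI) (auto simp: data_mat_def row_gram_def scalar_prod_def atLeast0LessThan)

lemma gram_smult: "A \<in> carrier_mat k l \<Longrightarrow> transpose_mat (c \<cdot>\<^sub>m A) * (c \<cdot>\<^sub>m A) = c\<^sup>2 \<cdot>\<^sub>m (transpose_mat A * A)" for A :: "real mat"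
proof -
  assume A: "A \<in> carrier_mat k l"
  have "transpose_mat (c \<cdot>\<^sub>m A) * (c \<cdot>\<^sub>m A) = c \<cdot>\<^sub>m (c \<cdot>\<^sub>m (transpose_mat A * A))"
    using A by (simp add: transpose_smult mult_smult_assoc_mat[of _ l k _ l] mult_smult_distrib[of _ l k _ l])
  also have "\<dots> = c\<^sup>2 \<cdot>\<^sub>m (transpose_mat A * A)" by (intro eq_matI) (auto simp: power2_eq_square)
  finally show ?thesis .
qed

lemma det_smult_nonzero:
  assumes G: "G \<in> carrier_mat k k" "det G \<noteq> 0" and c: "c \<noteq> (0::real)"
  shows "det (c \<cdot>\<^sub>m G) \<noteq> 0" "mat_inv (c \<cdot>\<^sub>m G) = (1 / c) \<cdot>\<^sub>m mat_inv G"
proof -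
  note X = mat_inv[OF G]
  have "((1 / c) \<cdot>\<^sub>m mat_inv G) * (c \<cdot>\<^sub>m G) = c \<cdot>\<^sub>m ((1 / c) \<cdot>\<^sub>m (mat_inv G * G))"
    using X(1) G by (simp add: mult_smult_assoc_mat[of _ k k _ k] mult_smult_distrib[of _ k k _ k])
  also have "\<dots> = 1\<^sub>m k" unfolding X(3) using c by (intro eq_matI) auto
  finally have one: "((1 / c) \<cdot>\<^sub>m mat_inv G) * (c \<cdot>\<^sub>m G) = 1\<^sub>m k" .
  show "det (c \<cdot>\<^sub>m G) \<noteq> 0" "mat_inv (c \<cdot>\<^sub>m G) = (1 / c) \<cdot>\<^sub>m mat_inv G"
    using mat_inv_unique[OF _ _ one] G(1) X(1) by auto
qed

text \<open>The quantity whose square is the denominator in \<open>wishart_inverse\<close>.\<close>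

definition gap :: real where "gap = real (n div 2) - real m - 1"

text \<open>The indicator of a vanishing Gram determinant is integrated. \<open>two_task_law\<close>
  with both tasks equal to \<nu> moves the question to standard Gaussian data, and the scaling by
  1/sqrt m does not affect singularity.\<close>

lemma AE_full_rank:
  assumes n: "m + 1 < n div 2" and \<nu>: "\<nu> < P"
  shows "AE a in law_A. det (transpose_mat (task_mat n m a \<nu>) * task_mat n m a \<nu>) \<noteq> 0"
proof -
  let ?I = "{..<n} \<times> {..<m}"
  let ?N = "PiM ?I (\<lambda>_. borel :: real measure)"
  define F :: "(nat \<times> nat \<Rightarrow> real) \<Rightarrow> (nat \<times> nat \<Rightarrow> real) \<Rightarrow> ennreal" where
    "F X Y = indicator {0} (det (transpose_mat (data_mat X) * data_mat X))" for X Y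
  have dm: "(\<lambda>w. det (transpose_mat (data_mat (fst w)) * data_mat (fst w))) \<in> borel_measurable (?N \<Otimes>\<^sub>M ?N)"
    by (rule meas_mat_det[of _ m]) (intro meas_mat_mult[of _ m n] meas_mat_transpose meas_mat_data_fst)
  have Fm: "(\<lambda>(X,Y). F X Y) \<in> borel_measurable (?N \<Otimes>\<^sub>M ?N)"
    unfolding F_def case_prod_unfold by (rule measurable_compose[OF dm]) simp
  obtain \<gamma> where law: "\<And>F. (\<lambda>(X,Y). F X Y) \<in> borel_measurable (?N \<Otimes>\<^sub>M ?N) \<Longrightarrow>
      (\<And>X Y. F (restrict X ?I) (restrict Y ?I) = F X Y) \<Longrightarrow>
      (\<integral>\<^sup>+a. F (\<lambda>e. a e \<nu>) (\<lambda>e. a e \<nu>) \<partial>law_A) =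
      (\<integral>\<^sup>+x. (\<integral>\<^sup>+y. F (\<lambda>e. (1 / sqrt (real m)) * x e) (\<lambda>e. Cin $$ (\<nu>,\<nu>) * ((1 / sqrt (real m)) * x e) + \<gamma> * y e) \<partial>gauss ?I) \<partial>gauss ?I)"
    using two_task_law[OF \<nu> \<nu>] by blast
  have c: "1 / sqrt (real m) \<noteq> 0" using m by simp
  have "(\<integral>\<^sup>+a. F (\<lambda>e. a e \<nu>) (\<lambda>e. a e \<nu>) \<partial>law_A) =
      (\<integral>\<^sup>+x. F (\<lambda>e. (1 / sqrt (real m)) * x e) (\<lambda>e. 0) \<partial>gauss ?I)"
    using law[OF Fm] by (simp add: F_def data_mat_restrict nn_integral_const_prob[OF prob_space_gauss] del: nn_integral_const)
  also have "\<dots> = (\<integral>\<^sup>+x. 0 \<partial>gauss ?I)"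
  proof (rule nn_integral_cong_AE)
    show "AE x in gauss ?I. F (\<lambda>e. (1 / sqrt (real m)) * x e) (\<lambda>e. 0) = 0"
      using wishart_inverse(1)[OF n]
    proof eventually_elim
      case (elim x)
      have "det ((1 / sqrt (real m))\<^sup>2 \<cdot>\<^sub>m row_gram {..<n} m x) \<noteq> 0"
        using det_smult_nonzero(1)[OF row_gram_carrier elim, of "(1 / sqrt (real m))\<^sup>2"] c by simp
      then show ?case unfolding F_def data_mat_smult gram_smult[OF data_mat_carrier] data_gram by simp
    qed
  qed
  finally have zero: "(\<integral>\<^sup>+a. F (\<lambda>e. a e \<nu>) (\<lambda>e. a e \<nu>) \<partial>law_A) = 0" by simp
  have "(\<lambda>a. det (transpose_mat (task_mat n m a \<nu>) * task_mat n m a \<nu>)) \<in> borel_measurable law_A"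
    by (rule meas_mat_det[of _ m]) (intro meas_mat_mult[of _ m n] meas_mat_transpose meas_mat_task_A[OF \<nu>])
  then have "(\<lambda>a. F (\<lambda>e. a e \<nu>) (\<lambda>e. a e \<nu>)) \<in> borel_measurable law_A"
    unfolding F_def task_mat_data[symmetric] by (rule measurable_compose) simp
  then have "AE a in law_A. F (\<lambda>e. a e \<nu>) (\<lambda>e. a e \<nu>) = 0"
    using zero by (simp add: nn_integral_0_iff_AE)
  then show ?thesis
    by eventually_elim (auto simp: F_def task_mat_data[symmetric] indicator_def split: if_splits)
qed

definition inv_gram_sq :: "(nat \<times> nat \<Rightarrow> nat \<Rightarrow> real) \<Rightarrow> nat \<Rightarrow> real" where
  "inv_gram_sq a \<nu> = frob_sq (pinv (task_mat n m a \<nu>) * transpose_mat (pinv (task_mat n m a \<nu>)))"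

definition defect :: "(nat \<times> nat \<Rightarrow> nat \<Rightarrow> real) \<Rightarrow> nat \<Rightarrow> nat \<Rightarrow> real mat" where
  "defect a k l = col_proj (task_mat n m a k) * (task_mat n m a l - Cin $$ (k,l) \<cdot>\<^sub>m task_mat n m a k)"

definition defect_sq :: "(nat \<times> nat \<Rightarrow> nat \<Rightarrow> real) \<Rightarrow> nat \<Rightarrow> nat \<Rightarrow> real" where
  "defect_sq a k l = frob_sq (transpose_mat (defect a k l) * defect a k l)"

lemma meas_inv_gram_sq: "\<nu> < P \<Longrightarrow> (\<lambda>a. inv_gram_sq a \<nu>) \<in> borel_measurable law_A"
  unfolding inv_gram_sq_def
  by (rule meas_frob_sq[of _ m m]) (intro meas_mat_mult[of _ m n] meas_mat_transpose meas_mat_pinv meas_mat_task_A)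

lemma meas_defect_sq: "k < P \<Longrightarrow> l < P \<Longrightarrow> (\<lambda>a. defect_sq a k l) \<in> borel_measurable law_A"
proof -
  assume kl: "k < P" "l < P"
  have "meas_mat law_A n m (\<lambda>a. defect a k l)"
    unfolding defect_def by (intro meas_mat_mult[of _ n n] meas_mat_col_proj[of _ n m] meas_mat_minus meas_mat_smult
      borel_measurable_const meas_mat_task_A kl)
  then show ?thesis
    unfolding defect_sq_def by (intro meas_frob_sq[of _ m m] meas_mat_mult[of _ m n] meas_mat_transpose)
qed

text \<open>The data are standard Gaussians divided by sqrt m, so the inverse Gram matrix is m times
  the standard one: m^2 times the bound m/gap^2 of \<open>wishart_inverse\<close>.\<close>

lemma nn_integral_inv_gram_sq:
  assumes n: "m + 1 < n div 2" and \<nu>: "\<nu> < P"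
  shows "(\<integral>\<^sup>+a. ennreal (inv_gram_sq a \<nu>) \<partial>law_A) \<le> ennreal (real m ^ 3 / gap\<^sup>2)"
proof -
  let ?I = "{..<n} \<times> {..<m}"
  let ?N = "PiM ?I (\<lambda>_. borel :: real measure)"
  define F :: "(nat \<times> nat \<Rightarrow> real) \<Rightarrow> (nat \<times> nat \<Rightarrow> real) \<Rightarrow> ennreal" where
    "F X Y = ennreal (frob_sq (pinv (data_mat X) * transpose_mat (pinv (data_mat X))))" for X Y
  have Fm: "(\<lambda>(X,Y). F X Y) \<in> borel_measurable (?N \<Otimes>\<^sub>M ?N)"
    unfolding F_def case_prod_unfold
    by (rule measurable_compose[OF meas_frob_sq[of _ m m] measurable_ennreal])
      (intro meas_mat_mult[of _ m n] meas_mat_transpose meas_mat_pinv meas_mat_data_fst)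
  obtain \<gamma> where law: "\<And>F. (\<lambda>(X,Y). F X Y) \<in> borel_measurable (?N \<Otimes>\<^sub>M ?N) \<Longrightarrow>
      (\<And>X Y. F (restrict X ?I) (restrict Y ?I) = F X Y) \<Longrightarrow>
      (\<integral>\<^sup>+a. F (\<lambda>e. a e \<nu>) (\<lambda>e. a e \<nu>) \<partial>law_A) =
      (\<integral>\<^sup>+x. (\<integral>\<^sup>+y. F (\<lambda>e. (1 / sqrt (real m)) * x e) (\<lambda>e. Cin $$ (\<nu>,\<nu>) * ((1 / sqrt (real m)) * x e) + \<gamma> * y e) \<partial>gauss ?I) \<partial>gauss ?I)"
    using two_task_law[OF \<nu> \<nu>] by blast
  have m0: "real m > 0" using m by simp
  have AE: "AE x in gauss ?I. F (\<lambda>e. (1 / sqrt (real m)) * x e) (\<lambda>e. 0) =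
      ennreal ((real m)\<^sup>2) * ennreal (frob_sq (mat_inv (row_gram {..<n} m x)))"
    using wishart_inverse(1)[OF n]
  proof eventually_elim
    case (elim x)
    have sq: "(1 / sqrt (real m))\<^sup>2 = 1 / real m" using m0 by (simp add: power_divide)
    define A where "A = data_mat (\<lambda>e. (1 / sqrt (real m)) * x e)"
    have A: "A \<in> carrier_mat n m" by (simp add: A_def)
    have gram: "transpose_mat A * A = (1 / real m) \<cdot>\<^sub>m row_gram {..<n} m x"
      unfolding A_def data_mat_smult gram_smult[OF data_mat_carrier] data_gram sq ..
    have c: "1 / real m \<noteq> 0" using m0 by simp
    have inv: "mat_inv (transpose_mat A * A) = real m \<cdot>\<^sub>m mat_inv (row_gram {..<n} m x)"
      unfolding gram using det_smult_nonzero(2)[OF row_gram_carrier elim c] by simp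
    have "pinv A * transpose_mat (pinv A) = mat_inv (transpose_mat A * A)"
      using det_smult_nonzero(1)[OF row_gram_carrier elim c] by (intro pinv_full_rank(2)[OF A]) (simp add: gram)
    then have "frob_sq (pinv A * transpose_mat (pinv A)) = (real m)\<^sup>2 * frob_sq (mat_inv (row_gram {..<n} m x))"
      unfolding inv by (simp add: frob_sq_smult)
    then show ?case unfolding F_def A_def[symmetric] by (simp add: ennreal_mult)
  qed
  have "(\<integral>\<^sup>+a. ennreal (inv_gram_sq a \<nu>) \<partial>law_A) = (\<integral>\<^sup>+a. F (\<lambda>e. a e \<nu>) (\<lambda>e. a e \<nu>) \<partial>law_A)"
    by (simp add: inv_gram_sq_def F_def task_mat_data)
  also have "\<dots> = (\<integral>\<^sup>+x. F (\<lambda>e. (1 / sqrt (real m)) * x e) (\<lambda>e. 0) \<partial>gauss ?I)"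
    using law[OF Fm] by (simp add: F_def data_mat_restrict nn_integral_const_prob[OF prob_space_gauss] del: nn_integral_const)
  also have "\<dots> = ennreal ((real m)\<^sup>2) * (\<integral>\<^sup>+x. ennreal (frob_sq (mat_inv (row_gram {..<n} m x))) \<partial>gauss ?I)"
  proof -
    \<comment> \<open>The constant is pulled out of \<open>?f\<close>, whose measurability is known.
      \<open>mat_inv\<close> is an unspecified description at singular matrices, so the integral
      containing it is reached by almost everywhere equality.\<close>
    let ?f = "\<lambda>x. F (\<lambda>e. (1 / sqrt (real m)) * x e) (\<lambda>e. 0)"
    have inv: "ennreal (1 / (real m)\<^sup>2) * ennreal ((real m)\<^sup>2) = 1"
      using m0 by (simp add: ennreal_mult[symmetric])
    have "meas_mat (gauss ?I) n m (\<lambda>x. data_mat (\<lambda>e. (1 / sqrt (real m)) * x e))"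
      by (rule meas_mat_cong_entry[where f = "\<lambda>i j x. (1 / sqrt (real m)) * x (i,j)"])
        (auto simp: data_mat_def intro!: borel_measurable_times borel_measurable_divide measurable_gauss_component)
    then have fm: "?f \<in> borel_measurable (gauss ?I)"
      unfolding F_def
      by (intro measurable_compose[OF meas_frob_sq[of _ m m] measurable_ennreal] meas_mat_mult[of _ m n] meas_mat_transpose meas_mat_pinv)
    have "(\<integral>\<^sup>+x. ennreal (frob_sq (mat_inv (row_gram {..<n} m x))) \<partial>gauss ?I) = (\<integral>\<^sup>+x. ennreal (1 / (real m)\<^sup>2) * ?f x \<partial>gauss ?I)"
    proof (rule nn_integral_cong_AE)
      show "AE x in gauss ?I. ennreal (frob_sq (mat_inv (row_gram {..<n} m x))) = ennreal (1 / (real m)\<^sup>2) * ?f x"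
        using AE by eventually_elim (simp only: mult.assoc[symmetric] inv mult_1)
    qed
    also have "\<dots> = ennreal (1 / (real m)\<^sup>2) * (\<integral>\<^sup>+x. ?f x \<partial>gauss ?I)" by (rule nn_integral_cmult[OF fm])
    finally have "(\<integral>\<^sup>+x. ennreal (frob_sq (mat_inv (row_gram {..<n} m x))) \<partial>gauss ?I) = ennreal (1 / (real m)\<^sup>2) * (\<integral>\<^sup>+x. ?f x \<partial>gauss ?I)" .
    moreover have "ennreal ((real m)\<^sup>2) * ennreal (1 / (real m)\<^sup>2) = 1" using inv by (simp only: mult.commute)
    ultimately show ?thesis by (simp only: mult.assoc[symmetric] mult_1)
  qed
  also have "\<dots> \<le> ennreal ((real m)\<^sup>2) * ennreal (real m / gap\<^sup>2)"
    unfolding gap_def by (rule mult_left_mono[OF wishart_inverse(2)[OF n]]) simp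
  also have "\<dots> = ennreal (real m ^ 3 / gap\<^sup>2)"
    by (simp add: ennreal_mult[symmetric] power2_eq_square power3_eq_cube)
  finally show ?thesis .
qed

text \<open>Given task k the defect is \<gamma> Q Y, with Q a fixed projector of trace at most m and
  Y standard Gaussian. The factor \<gamma>^4 \<le> 1/m^2 meets the bound 4 m^3 of
  \<open>nn_integral_proj_gram\<close>, and n does not enter.\<close>

lemma nn_integral_defect_sq:
  assumes kl: "k < P" "l < P"
  shows "(\<integral>\<^sup>+a. ennreal (defect_sq a k l) \<partial>law_A) \<le> ennreal (4 * real m)"
proof -
  let ?I = "{..<n} \<times> {..<m}"
  let ?N = "PiM ?I (\<lambda>_. borel :: real measure)"
  define q where "q X Y = col_proj (data_mat X) * (data_mat Y - Cin $$ (k,l) \<cdot>\<^sub>m data_mat X)" for X Y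
  define F :: "(nat \<times> nat \<Rightarrow> real) \<Rightarrow> (nat \<times> nat \<Rightarrow> real) \<Rightarrow> ennreal" where
    "F X Y = ennreal (frob_sq (transpose_mat (q X Y) * q X Y))" for X Y
  have qm: "meas_mat (?N \<Otimes>\<^sub>M ?N) n m (\<lambda>w. q (fst w) (snd w))"
    unfolding q_def by (intro meas_mat_mult[of _ n n] meas_mat_col_proj[of _ n m] meas_mat_minus meas_mat_smult
      borel_measurable_const meas_mat_data_fst meas_mat_data_snd)
  have Fm: "(\<lambda>(X,Y). F X Y) \<in> borel_measurable (?N \<Otimes>\<^sub>M ?N)"
    unfolding F_def case_prod_unfold
    by (rule measurable_compose[OF meas_frob_sq[of _ m m] measurable_ennreal])
      (intro meas_mat_mult[of _ m n] meas_mat_transpose qm)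
  obtain \<gamma> where \<gamma>: "\<gamma>\<^sup>2 \<le> 1 / real m" and law: "\<And>F. (\<lambda>(X,Y). F X Y) \<in> borel_measurable (?N \<Otimes>\<^sub>M ?N) \<Longrightarrow>
      (\<And>X Y. F (restrict X ?I) (restrict Y ?I) = F X Y) \<Longrightarrow>
      (\<integral>\<^sup>+a. F (\<lambda>e. a e k) (\<lambda>e. a e l) \<partial>law_A) =
      (\<integral>\<^sup>+x. (\<integral>\<^sup>+y. F (\<lambda>e. (1 / sqrt (real m)) * x e) (\<lambda>e. Cin $$ (k,l) * ((1 / sqrt (real m)) * x e) + \<gamma> * y e) \<partial>gauss ?I) \<partial>gauss ?I)"
    using two_task_law[OF kl] Cin_diag[OF kl(2)] by auto
  have m0: "real m > 0" using m by simp
  have "(\<integral>\<^sup>+a. ennreal (defect_sq a k l) \<partial>law_A) = (\<integral>\<^sup>+a. F (\<lambda>e. a e k) (\<lambda>e. a e l) \<partial>law_A)"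
    by (simp add: defect_sq_def defect_def F_def q_def task_mat_data)
  also have "\<dots> = (\<integral>\<^sup>+x. (\<integral>\<^sup>+y. F (\<lambda>e. (1 / sqrt (real m)) * x e) (\<lambda>e. Cin $$ (k,l) * ((1 / sqrt (real m)) * x e) + \<gamma> * y e) \<partial>gauss ?I) \<partial>gauss ?I)"
    by (rule law[OF Fm]) (simp add: F_def q_def data_mat_restrict)
  also have "\<dots> \<le> (\<integral>\<^sup>+x. ennreal (4 * real m) \<partial>gauss ?I)"
  proof (rule nn_integral_mono)
    fix x
    define A where "A = data_mat (\<lambda>e. (1 / sqrt (real m)) * x e)"
    define Q where "Q = col_proj A"
    have A: "A \<in> carrier_mat n m" by (simp add: A_def)
    have Q: "Q \<in> carrier_mat n n" "transpose_mat Q = Q" "Q * Q = Q"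
      using col_proj_props[of 1 "\<lambda>_. A" n m 0] A by (auto simp: Q_def)
    have tr: "(\<Sum>i<n. Q $$ (i,i)) \<le> real m" unfolding Q_def by (rule col_proj_trace_le[OF A])
    have "F (\<lambda>e. (1 / sqrt (real m)) * x e) (\<lambda>e. Cin $$ (k,l) * ((1 / sqrt (real m)) * x e) + \<gamma> * y e) =
        ennreal (\<gamma> ^ 4) * ennreal (frob_sq (transpose_mat (Q * mat n m y) * (Q * mat n m y)))" for y
    proof -
      have "data_mat (\<lambda>e. Cin $$ (k,l) * ((1 / sqrt (real m)) * x e) + \<gamma> * y e) - Cin $$ (k,l) \<cdot>\<^sub>m A = \<gamma> \<cdot>\<^sub>m mat n m y"
        by (intro eq_matI) (auto simp: A_def data_mat_def)
      then have "q (\<lambda>e. (1 / sqrt (real m)) * x e) (\<lambda>e. Cin $$ (k,l) * ((1 / sqrt (real m)) * x e) + \<gamma> * y e) = \<gamma> \<cdot>\<^sub>m (Q * mat n m y)"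
        unfolding q_def A_def[symmetric] Q_def[symmetric] using Q(1) by (simp add: mult_smult_distrib[of _ n n _ m])
      then show ?thesis
        unfolding F_def using Q(1) by (simp add: gram_smult[of _ n m] frob_sq_smult ennreal_mult)
    qed
    then have "(\<integral>\<^sup>+y. F (\<lambda>e. (1 / sqrt (real m)) * x e) (\<lambda>e. Cin $$ (k,l) * ((1 / sqrt (real m)) * x e) + \<gamma> * y e) \<partial>gauss ?I) =
        (\<integral>\<^sup>+y. ennreal (\<gamma> ^ 4) * ennreal (frob_sq (transpose_mat (Q * mat n m y) * (Q * mat n m y))) \<partial>gauss ?I)"
      by simp
    also have "\<dots> = ennreal (\<gamma> ^ 4) * (\<integral>\<^sup>+y. ennreal (frob_sq (transpose_mat (Q * mat n m y) * (Q * mat n m y))) \<partial>gauss ?I)"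
    proof (rule nn_integral_cmult)
      have "meas_mat (gauss ?I) n m (\<lambda>y. mat n m y)"
        by (rule meas_mat_cong_entry[where f = "\<lambda>i j y. y (i,j)"]) (auto intro: measurable_gauss_component)
      then have "meas_mat (gauss ?I) n m (\<lambda>y. Q * mat n m y)"
        by (intro meas_mat_mult[of _ n n] meas_mat_const Q(1))
      then show "(\<lambda>y. ennreal (frob_sq (transpose_mat (Q * mat n m y) * (Q * mat n m y)))) \<in> borel_measurable (gauss ?I)"
        by (intro measurable_compose[OF meas_frob_sq[of _ m m] measurable_ennreal] meas_mat_mult[of _ m n] meas_mat_transpose)
    qed
    also have "\<dots> \<le> ennreal (\<gamma> ^ 4) * ennreal (4 * real m ^ 3)"
      by (rule mult_left_mono[OF nn_integral_proj_gram[OF Q tr]]) simp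
    also have "\<dots> = ennreal (\<gamma> ^ 4 * (4 * real m ^ 3))" by (simp add: ennreal_mult)
    also have "\<dots> \<le> ennreal (4 * real m)"
    proof (rule ennreal_leI)
      have "\<gamma> ^ 4 = (\<gamma>\<^sup>2)\<^sup>2" by simp
      also have "\<dots> \<le> (1 / real m)\<^sup>2" using \<gamma> by (intro power_mono) auto
      finally have "\<gamma> ^ 4 * (4 * real m ^ 3) \<le> (1 / real m)\<^sup>2 * (4 * real m ^ 3)" by (intro mult_right_mono) auto
      also have "\<dots> = 4 * real m" using m0 by (simp add: power2_eq_square power3_eq_cube)
      finally show "\<gamma> ^ 4 * (4 * real m ^ 3) \<le> 4 * real m" .
    qed
    finally show "(\<integral>\<^sup>+y. F (\<lambda>e. (1 / sqrt (real m)) * x e) (\<lambda>e. Cin $$ (k,l) * ((1 / sqrt (real m)) * x e) + \<gamma> * y e) \<partial>gauss ?I) \<le> ennreal (4 * real m)" .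
  qed
  also have "\<dots> = ennreal (4 * real m)" by (rule nn_integral_const_gauss)
  finally show ?thesis .
qed

end

section \<open>Convergence of the mean final error\<close>

definition limit_coeff :: "nat \<Rightarrow> real mat \<Rightarrow> nat \<Rightarrow> nat \<Rightarrow> real" where
  "limit_coeff P C \<nu> \<mu> = (1\<^sub>m P - mat_inv (1\<^sub>m P + strict_upper C) * C) $$ (\<nu>,\<mu>)"

definition limit_error :: "nat \<Rightarrow> real mat \<Rightarrow> real mat \<Rightarrow> real" where
  "limit_error P Cin Cout = (\<Sum>\<mu><P. \<Sum>\<nu><P. \<Sum>\<nu>'<P. Cout $$ (\<nu>,\<nu>') * (limit_coeff P Cin \<nu> \<mu> * limit_coeff P Cin \<nu>' \<mu>))"

text \<open>The constant of \<open>resid_limit_bound\<close>, summed over \<mu>.\<close>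

definition perturb_const :: "nat \<Rightarrow> real mat \<Rightarrow> real" where
  "perturb_const P C = (\<Sum>\<mu><P. ((real P + 1) * (1 + (\<Sum>l<P. \<bar>(mat_inv (1\<^sub>m P + strict_upper C) * C) $$ (l,\<mu>)\<bar>)))\<^sup>2)"

text \<open>Weight of the cross terms, which are linear in the deviation of the overlaps from scalar
  matrices; \<open>quad_const\<close> is the weight of the quadratic term.\<close>

definition lin_const :: "nat \<Rightarrow> real mat \<Rightarrow> real mat \<Rightarrow> real" where
  "lin_const P Cin Cout = (\<Sum>\<mu><P. \<Sum>\<nu><P. \<Sum>\<nu>'<P. \<bar>Cout $$ (\<nu>,\<nu>')\<bar> * (\<bar>limit_coeff P Cin \<nu> \<mu>\<bar> + \<bar>limit_coeff P Cin \<nu>' \<mu>\<bar>))"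

definition quad_const :: "nat \<Rightarrow> real mat \<Rightarrow> real" where
  "quad_const P Cout = (\<Sum>\<mu><P. \<Sum>\<nu><P. \<Sum>\<nu>'<P. \<bar>Cout $$ (\<nu>,\<nu>')\<bar>)"

lemma lin_const_nonneg: "0 \<le> lin_const P Cin Cout"
  by (auto simp: lin_const_def intro!: sum_nonneg)

lemma quad_const_nonneg: "0 \<le> quad_const P Cout"
  unfolding quad_const_def by (intro sum_nonneg abs_ge_zero)

text \<open>Both sides are the trace of Y^T \<open>Cout\<close> Y, since the square root is
  symmetric with square \<open>Cout\<close>.\<close>

lemma limit_error_eq:
  assumes P: "1 \<le> P" and Cin: "Cin \<in> carrier_mat P P" and Cout: "Cout \<in> carrier_mat P P" "psd Cout"
  shows "limit_error P Cin Cout =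
    frob_sq (psd_sqrt Cout * (1\<^sub>m P - mat_inv (1\<^sub>m P + strict_upper Cin) * Cin))"
proof -
  define Y where "Y = 1\<^sub>m P - mat_inv (1\<^sub>m P + strict_upper Cin) * Cin"
  have "mat_inv (1\<^sub>m P + strict_upper Cin) * Cin \<in> carrier_mat P P"
    using limit_matrix_rec(1)[OF Cin, of 0 0] P by simp
  then have Y: "Y \<in> carrier_mat P P" by (simp add: Y_def minus_carrier_mat)
  note S = psd_sqrt[OF Cout]
  have St: "transpose_mat (psd_sqrt Cout) = psd_sqrt Cout" using S(1,2) psd_iff by blast
  have CY: "Cout * Y \<in> carrier_mat P P" using Cout Y by simp
  have "frob_sq (psd_sqrt Cout * Y) = fip Y (psd_sqrt Cout * (psd_sqrt Cout * Y))"
    using fip_mult_left[OF S(1) Y, of "psd_sqrt Cout * Y"] S(1) Y St by (simp add: fip_self)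
  also have "psd_sqrt Cout * (psd_sqrt Cout * Y) = Cout * Y"
    using assoc_mult_mat[OF S(1) S(1) Y] S(3) by simp
  also have "fip Y (Cout * Y) = (\<Sum>\<nu><P. \<Sum>\<mu><P. \<Sum>\<nu>'<P. Cout $$ (\<nu>,\<nu>') * (Y $$ (\<nu>,\<mu>) * Y $$ (\<nu>',\<mu>)))"
    unfolding fip_def using Y Cout
    by (intro sum.cong) (auto simp: scalar_prod_def atLeast0LessThan sum_distrib_left mult_ac)
  also have "\<dots> = (\<Sum>\<mu><P. \<Sum>\<nu><P. \<Sum>\<nu>'<P. Cout $$ (\<nu>,\<nu>') * (Y $$ (\<nu>,\<mu>) * Y $$ (\<nu>',\<mu>)))"
    by (rule sum.swap)
  finally show ?thesis by (simp add: limit_error_def limit_coeff_def Y_def)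
qed

lemma ennreal_power2_le_imp_le:
  fixes x y :: ennreal
  assumes "x\<^sup>2 \<le> y\<^sup>2"
  shows "x \<le> y"
proof (cases "y = \<top>")
  case False
  then obtain r where r: "y = ennreal r" "0 \<le> r" by (cases y) auto
  then have "x \<noteq> \<top>" using assms by (auto simp: ennreal_power top_unique)
  then obtain q where q: "x = ennreal q" "0 \<le> q" by (cases x) auto
  have "q\<^sup>2 \<le> r\<^sup>2" using assms r q by (simp add: ennreal_power)
  then have "q \<le> r" using r(2) by (rule power2_le_imp_le)
  then show ?thesis using r q by (simp add: ennreal_leI)
qed simp

context task_model
begin

section \<open>Deviation of the overlaps from scalar matrices\<close>

definition overlap :: "(nat \<times> nat \<Rightarrow> nat \<Rightarrow> real) \<Rightarrow> nat \<Rightarrow> nat \<Rightarrow> real mat" where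
  "overlap a \<nu> \<mu> = resid n m P (task_mat n m a) \<nu> \<mu>"

text \<open>The division by m is the natural scale, as the identity matrix has squared Frobenius
  norm m.\<close>

definition deviation :: "(nat \<times> nat \<Rightarrow> nat \<Rightarrow> real) \<Rightarrow> nat \<Rightarrow> nat \<Rightarrow> real" where
  "deviation a \<nu> \<mu> = frob_sq (overlap a \<nu> \<mu> - limit_coeff P Cin \<nu> \<mu> \<cdot>\<^sub>m 1\<^sub>m m) / real m"

definition total_deviation :: "(nat \<times> nat \<Rightarrow> nat \<Rightarrow> real) \<Rightarrow> real" where
  "total_deviation a = (\<Sum>\<nu><P. \<Sum>\<mu><P. deviation a \<nu> \<mu>)"

definition deviation_bound :: "(nat \<times> nat \<Rightarrow> nat \<Rightarrow> real) \<Rightarrow> real" where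
  "deviation_bound a = perturb_const P Cin / real m *
    (\<Sum>\<nu><P. \<Sum>k<P. \<Sum>l<P. sqrt (inv_gram_sq a \<nu>) * sqrt (defect_sq a k l))"

text \<open>The mean of the final error over the targets \<open>B\<close>, for given inputs.\<close>

definition mean_B_error :: "(nat \<times> nat \<Rightarrow> nat \<Rightarrow> real) \<Rightarrow> real" where
  "mean_B_error a = (1 / real m) *
    (\<Sum>\<mu><P. \<Sum>\<nu><P. \<Sum>\<nu>'<P. Cout $$ (\<nu>,\<nu>') * fip (overlap a \<nu> \<mu>) (overlap a \<nu>' \<mu>))"

lemma overlap_carrier: "\<nu> < P \<Longrightarrow> \<mu> < P \<Longrightarrow> overlap a \<nu> \<mu> \<in> carrier_mat m m"
  unfolding overlap_def by (rule resid_carrier) (auto simp: task_mat_carrier)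

lemma perturb_const_nonneg: "0 \<le> perturb_const P Cin"
  by (simp add: perturb_const_def sum_nonneg)

lemma deviation_nonneg: "0 \<le> deviation a \<nu> \<mu>"
  by (simp add: deviation_def)

lemma total_deviation_le:
  assumes rank: "\<And>\<nu>. \<nu> < P \<Longrightarrow> det (transpose_mat (task_mat n m a \<nu>) * task_mat n m a \<nu>) \<noteq> 0"
  shows "total_deviation a \<le> deviation_bound a"
proof -
  define s where "s = (\<Sum>k<P. \<Sum>l<P. sqrt (defect_sq a k l))"
  define K where "K \<mu> = ((real P + 1) * (1 + (\<Sum>l<P. \<bar>(mat_inv (1\<^sub>m P + strict_upper Cin) * Cin) $$ (l,\<mu>)\<bar>)))\<^sup>2" for \<mu>
  have dev: "deviation a \<nu> \<mu> \<le> K \<mu> * (sqrt (inv_gram_sq a \<nu>) * s) / real m" if "\<nu> < P" "\<mu> < P" for \<nu> \<mu>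
  proof -
    have "frob_sq (overlap a \<nu> \<mu> - limit_coeff P Cin \<nu> \<mu> \<cdot>\<^sub>m 1\<^sub>m m) \<le> K \<mu> * (sqrt (inv_gram_sq a \<nu>) * s)"
      unfolding overlap_def limit_coeff_def K_def s_def defect_sq_def defect_def inv_gram_sq_def
      by (rule resid_limit_bound[where A = "task_mat n m a"])
        (use that Cin rank pinv_full_rank(1)[OF task_mat_carrier] in \<open>auto simp: task_mat_carrier\<close>)
    then show ?thesis unfolding deviation_def by (intro divide_right_mono) auto
  qed
  have "total_deviation a \<le> (\<Sum>\<nu><P. \<Sum>\<mu><P. K \<mu> * (sqrt (inv_gram_sq a \<nu>) * s) / real m)"
    unfolding total_deviation_def using dev by (intro sum_mono) auto
  also have "\<dots> = (\<Sum>\<nu><P. perturb_const P Cin / real m * (sqrt (inv_gram_sq a \<nu>) * s))"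
    by (simp add: perturb_const_def K_def sum_distrib_right sum_divide_distrib)
  also have "\<dots> = deviation_bound a"
    by (simp add: deviation_bound_def s_def sum_distrib_left)
  finally show ?thesis .
qed

lemma meas_deviation_bound: "deviation_bound \<in> borel_measurable law_A"
  unfolding deviation_bound_def
  by (intro borel_measurable_times borel_measurable_const borel_measurable_sum
      measurable_compose[OF meas_inv_gram_sq borel_measurable_sqrt]
      measurable_compose[OF meas_defect_sq borel_measurable_sqrt]) auto

lemma deviation_bound_nonneg: "0 \<le> deviation_bound a"
  using perturb_const_nonneg
  by (auto simp: deviation_bound_def inv_gram_sq_def defect_sq_def intro!: mult_nonneg_nonneg sum_nonneg divide_nonneg_nonneg)

text \<open>Cauchy--Schwarz in expectation turns the moment bounds m^3/gap^2 and 4 m into 2 m^2/gap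
  for each of the P^3 triples of tasks; the prefactor 1/m leaves m/gap.\<close>

lemma nn_integral_deviation_bound:
  assumes n: "m + 1 < n div 2"
  shows "(\<integral>\<^sup>+a. ennreal (deviation_bound a) \<partial>law_A) \<le> ennreal (2 * perturb_const P Cin * real P ^ 3 * (real m / gap))"
proof -
  have g: "0 < gap" using n by (simp add: gap_def)
  have m0: "0 < real m" using m by simp
  define h where "h a \<nu> k l = sqrt (inv_gram_sq a \<nu>) * sqrt (defect_sq a k l)" for a \<nu> k l
  have h0: "0 \<le> h a \<nu> k l" for a \<nu> k l by (simp add: h_def inv_gram_sq_def defect_sq_def)
  have im: "(\<lambda>a. sqrt (inv_gram_sq a \<nu>)) \<in> borel_measurable law_A" if "\<nu> < P" for \<nu>
    by (rule measurable_compose[OF meas_inv_gram_sq[OF that] borel_measurable_sqrt])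
  have dm: "(\<lambda>a. sqrt (defect_sq a k l)) \<in> borel_measurable law_A" if "k < P" "l < P" for k l
    by (rule measurable_compose[OF meas_defect_sq[OF that] borel_measurable_sqrt])
  have hm: "(\<lambda>a. ennreal (h a \<nu> k l)) \<in> borel_measurable law_A" if "\<nu> < P" "k < P" "l < P" for \<nu> k l
    unfolding h_def using im dm that by simp
  have hI: "(\<integral>\<^sup>+a. ennreal (h a \<nu> k l) \<partial>law_A) \<le> ennreal (2 * (real m)\<^sup>2 / gap)" if "\<nu> < P" "k < P" "l < P" for \<nu> k l
  proof -
    have "(\<integral>\<^sup>+a. ennreal (h a \<nu> k l) \<partial>law_A)\<^sup>2 =
        (\<integral>\<^sup>+a. ennreal (sqrt (inv_gram_sq a \<nu>)) * ennreal (sqrt (defect_sq a k l)) \<partial>law_A)\<^sup>2"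
      by (simp add: h_def ennreal_mult inv_gram_sq_def defect_sq_def)
    also have "\<dots> \<le> (\<integral>\<^sup>+a. ennreal (sqrt (inv_gram_sq a \<nu>)) ^ 2 \<partial>law_A) * (\<integral>\<^sup>+a. ennreal (sqrt (defect_sq a k l)) ^ 2 \<partial>law_A)"
      using im dm that by (intro Cauchy_Schwarz_nn_integral) auto
    also have "\<dots> = (\<integral>\<^sup>+a. ennreal (inv_gram_sq a \<nu>) \<partial>law_A) * (\<integral>\<^sup>+a. ennreal (defect_sq a k l) \<partial>law_A)"
      by (simp add: ennreal_power inv_gram_sq_def defect_sq_def)
    also have "\<dots> \<le> ennreal (real m ^ 3 / gap\<^sup>2) * ennreal (4 * real m)"
      using nn_integral_inv_gram_sq[OF n that(1)] nn_integral_defect_sq[OF that(2,3)] by (rule mult_mono) auto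
    also have "\<dots> = ennreal (2 * (real m)\<^sup>2 / gap) ^ 2"
      using g by (simp add: ennreal_mult[symmetric] ennreal_power power_divide power_mult_distrib power2_eq_square power3_eq_cube mult_ac)
    finally show ?thesis by (rule ennreal_power2_le_imp_le)
  qed
  have "ennreal (deviation_bound a) = ennreal (perturb_const P Cin / real m) * (\<Sum>\<nu><P. \<Sum>k<P. \<Sum>l<P. ennreal (h a \<nu> k l))" for a
  proof -
    have "(\<Sum>\<nu><P. \<Sum>k<P. \<Sum>l<P. ennreal (h a \<nu> k l)) = ennreal (\<Sum>\<nu><P. \<Sum>k<P. \<Sum>l<P. h a \<nu> k l)"
      using h0 by (simp add: sum_ennreal sum_nonneg)
    then show ?thesis
      unfolding deviation_bound_def h_def[symmetric]
      using perturb_const_nonneg h0 by (simp only: ennreal_mult divide_nonneg_pos[OF _ m0] sum_nonneg)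
  qed
  then have "(\<integral>\<^sup>+a. ennreal (deviation_bound a) \<partial>law_A) =
      (\<integral>\<^sup>+a. ennreal (perturb_const P Cin / real m) * (\<Sum>\<nu><P. \<Sum>k<P. \<Sum>l<P. ennreal (h a \<nu> k l)) \<partial>law_A)" by simp
  also have "\<dots> = ennreal (perturb_const P Cin / real m) * (\<integral>\<^sup>+a. (\<Sum>\<nu><P. \<Sum>k<P. \<Sum>l<P. ennreal (h a \<nu> k l)) \<partial>law_A)"
    using hm by (intro nn_integral_cmult borel_measurable_sum) auto
  also have "(\<integral>\<^sup>+a. (\<Sum>\<nu><P. \<Sum>k<P. \<Sum>l<P. ennreal (h a \<nu> k l)) \<partial>law_A) =
      (\<Sum>\<nu><P. \<integral>\<^sup>+a. (\<Sum>k<P. \<Sum>l<P. ennreal (h a \<nu> k l)) \<partial>law_A)"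
    using hm by (intro nn_integral_sum borel_measurable_sum) auto
  also have "\<dots> = (\<Sum>\<nu><P. \<Sum>k<P. \<integral>\<^sup>+a. (\<Sum>l<P. ennreal (h a \<nu> k l)) \<partial>law_A)"
    using hm by (intro sum.cong refl nn_integral_sum borel_measurable_sum) auto
  also have "\<dots> = (\<Sum>\<nu><P. \<Sum>k<P. \<Sum>l<P. \<integral>\<^sup>+a. ennreal (h a \<nu> k l) \<partial>law_A)"
    using hm by (intro sum.cong refl nn_integral_sum) auto
  also have "ennreal (perturb_const P Cin / real m) * \<dots> \<le>
      ennreal (perturb_const P Cin / real m) * (\<Sum>\<nu><P. \<Sum>k<P. \<Sum>l<P. ennreal (2 * (real m)\<^sup>2 / gap))"
    using hI by (intro mult_left_mono sum_mono) auto
  also have "(\<Sum>\<nu><P. \<Sum>k<P. \<Sum>l<P. ennreal (2 * (real m)\<^sup>2 / gap)) = ennreal (\<Sum>\<nu><P. \<Sum>k<P. \<Sum>l<P. 2 * (real m)\<^sup>2 / gap)"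
    using g by (simp only: sum_ennreal sum_nonneg divide_nonneg_pos zero_le_mult_iff zero_le_power2 zero_le_numeral simp_thms)
  also have "ennreal (perturb_const P Cin / real m) * ennreal (\<Sum>\<nu><P. \<Sum>k<P. \<Sum>l<P. 2 * (real m)\<^sup>2 / gap) =
      ennreal (perturb_const P Cin / real m * (\<Sum>\<nu><P. \<Sum>k<P. \<Sum>l<P. 2 * (real m)\<^sup>2 / gap))"
    using g perturb_const_nonneg by (intro ennreal_mult[symmetric] sum_nonneg) auto
  also have "perturb_const P Cin / real m * (\<Sum>\<nu><P. \<Sum>k<P. \<Sum>l<P. 2 * (real m)\<^sup>2 / gap) =
      2 * perturb_const P Cin * real P ^ 3 * (real m / gap)"
    using m0 g by (simp add: power2_eq_square power3_eq_cube)
  finally show ?thesis .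
qed

lemma fip_one_bound:
  assumes D: "D \<in> carrier_mat m m"
  shows "\<bar>fip (1\<^sub>m m) D\<bar> / real m \<le> sqrt (frob_sq D / real m)"
proof -
  have m0: "0 < real m" using m by simp
  have "(fip (1\<^sub>m m) D)\<^sup>2 \<le> real m * frob_sq D"
    using fip_Cauchy_Schwarz[OF one_carrier_mat D] fip_one_one[of m] by (simp add: fip_self)
  then have "(fip (1\<^sub>m m) D)\<^sup>2 / (real m)\<^sup>2 \<le> real m * frob_sq D / (real m)\<^sup>2" by (intro divide_right_mono) auto
  then have "(\<bar>fip (1\<^sub>m m) D\<bar> / real m)\<^sup>2 \<le> frob_sq D / real m" using m0 by (simp add: power_divide power2_eq_square)
  then show ?thesis by (rule real_le_rsqrt)
qed

text \<open>Write each overlap as a scalar matrix plus D. Products of the scalars give the limit,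
  cross terms are of order sqrt S and the term quadratic in D of order S, where S is the total
  deviation.\<close>

lemma mean_B_error_close:
  assumes \<eta>: "0 < \<eta>"
  shows "\<bar>mean_B_error a - limit_error P Cin Cout\<bar> \<le>
    lin_const P Cin Cout * \<eta> + (lin_const P Cin Cout / \<eta> + quad_const P Cout) * total_deviation a"
proof -
  let ?d = "limit_coeff P Cin"
  define S where "S = total_deviation a"
  have S0: "0 \<le> S" by (simp add: S_def total_deviation_def sum_nonneg deviation_nonneg)
  have dS: "deviation a \<nu> \<mu> \<le> S" if "\<nu> < P" "\<mu> < P" for \<nu> \<mu>
  proof -
    have "deviation a \<nu> \<mu> \<le> (\<Sum>\<mu><P. deviation a \<nu> \<mu>)"
      using that by (intro member_le_sum) (auto simp: deviation_nonneg)
    also have "\<dots> \<le> S"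
      unfolding S_def total_deviation_def using that
      by (intro member_le_sum[of \<nu> _ "\<lambda>\<nu>. \<Sum>\<mu><P. deviation a \<nu> \<mu>"]) (auto simp: sum_nonneg deviation_nonneg)
    finally show ?thesis .
  qed
  \<comment> \<open>Trades sqrt S for a bound affine in S, so that a bound on the mean of S
    suffices; \<eta> is left free and chosen in the passage to the limit.\<close>
  have sqrtS: "sqrt S \<le> \<eta> + S / \<eta>"
  proof (cases "sqrt S \<le> \<eta>")
    case True
    then show ?thesis using S0 \<eta> by (simp add: add_increasing2)
  next
    case False
    then have "sqrt S * \<eta> \<le> sqrt S * sqrt S" using S0 by (intro mult_left_mono) auto
    then have "sqrt S \<le> S / \<eta>" using \<eta> S0 by (simp add: field_simps)
    then show ?thesis using \<eta> by simp
  qed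
  have m0: "0 < real m" using m by simp
  have entry_close: "\<bar>fip (overlap a \<nu> \<mu>) (overlap a \<nu>' \<mu>) / real m - ?d \<nu> \<mu> * ?d \<nu>' \<mu>\<bar> \<le>
      (\<bar>?d \<nu> \<mu>\<bar> + \<bar>?d \<nu>' \<mu>\<bar>) * sqrt S + S" if idx: "\<nu> < P" "\<nu>' < P" "\<mu> < P" for \<nu> \<nu>' \<mu>
  proof -
    define D where "D = overlap a \<nu> \<mu> - ?d \<nu> \<mu> \<cdot>\<^sub>m 1\<^sub>m m"
    define D' where "D' = overlap a \<nu>' \<mu> - ?d \<nu>' \<mu> \<cdot>\<^sub>m 1\<^sub>m m"
    note oc = overlap_carrier[OF idx(1,3), of a] overlap_carrier[OF idx(2,3), of a]
    have D: "D \<in> carrier_mat m m" and D': "D' \<in> carrier_mat m m"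
      by (auto simp: D_def D'_def intro!: minus_carrier_mat)
    have o: "overlap a \<nu> \<mu> = ?d \<nu> \<mu> \<cdot>\<^sub>m 1\<^sub>m m + D" "overlap a \<nu>' \<mu> = ?d \<nu>' \<mu> \<cdot>\<^sub>m 1\<^sub>m m + D'"
      unfolding D_def D'_def using oc by (auto intro!: eq_matI)
    have "fip (overlap a \<nu> \<mu>) (overlap a \<nu>' \<mu>) =
        ?d \<nu> \<mu> * ?d \<nu>' \<mu> * real m + ?d \<nu> \<mu> * fip (1\<^sub>m m) D' + ?d \<nu>' \<mu> * fip (1\<^sub>m m) D + fip D D'"
      unfolding o using D D'
      by (simp add: fip_add_left[of _ m m] fip_add_right[of _ m m] fip_smult_left fip_smult_right[of _ m m]
          fip_one_one fip_comm[OF D one_carrier_mat] distrib_left)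
    then have "fip (overlap a \<nu> \<mu>) (overlap a \<nu>' \<mu>) / real m - ?d \<nu> \<mu> * ?d \<nu>' \<mu> =
        ?d \<nu> \<mu> * (fip (1\<^sub>m m) D' / real m) + ?d \<nu>' \<mu> * (fip (1\<^sub>m m) D / real m) + fip D D' / real m"
      using m0 by (simp add: field_simps)
    then have "\<bar>fip (overlap a \<nu> \<mu>) (overlap a \<nu>' \<mu>) / real m - ?d \<nu> \<mu> * ?d \<nu>' \<mu>\<bar> \<le>
        \<bar>?d \<nu> \<mu>\<bar> * (\<bar>fip (1\<^sub>m m) D'\<bar> / real m) + \<bar>?d \<nu>' \<mu>\<bar> * (\<bar>fip (1\<^sub>m m) D\<bar> / real m) + \<bar>fip D D'\<bar> / real m"
      using m0 by (auto simp: abs_mult intro!: order_trans[OF abs_triangle_ineq] add_mono)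
    also have "\<dots> \<le> \<bar>?d \<nu> \<mu>\<bar> * sqrt S + \<bar>?d \<nu>' \<mu>\<bar> * sqrt S + S"
    proof (intro add_mono mult_left_mono)
      have DS: "frob_sq D / real m \<le> S" "frob_sq D' / real m \<le> S"
        using dS[OF idx(1,3)] dS[OF idx(2,3)] by (auto simp: deviation_def D_def D'_def)
      show "\<bar>fip (1\<^sub>m m) D'\<bar> / real m \<le> sqrt S"
        using fip_one_bound[OF D'] real_sqrt_le_mono[OF DS(2)] by linarith
      show "\<bar>fip (1\<^sub>m m) D\<bar> / real m \<le> sqrt S"
        using fip_one_bound[OF D] real_sqrt_le_mono[OF DS(1)] by linarith
      have "(fip D D')\<^sup>2 \<le> frob_sq D * frob_sq D'" by (rule fip_Cauchy_Schwarz[OF D D'])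
      also have "\<dots> \<le> (S * real m) * (S * real m)"
        using DS m0 S0 by (intro mult_mono) (auto simp: field_simps)
      finally have "\<bar>fip D D'\<bar>\<^sup>2 \<le> (S * real m)\<^sup>2" by (simp add: power2_eq_square)
      then have "\<bar>fip D D'\<bar> \<le> S * real m" using S0 m0 by (intro power2_le_imp_le[of "\<bar>fip D D'\<bar>"]) auto
      then show "\<bar>fip D D'\<bar> / real m \<le> S" using m0 by (simp add: field_simps)
    qed auto
    finally show ?thesis by (simp add: algebra_simps)
  qed
  have "mean_B_error a - limit_error P Cin Cout =
      (\<Sum>\<mu><P. \<Sum>\<nu><P. \<Sum>\<nu>'<P. Cout $$ (\<nu>,\<nu>') * (fip (overlap a \<nu> \<mu>) (overlap a \<nu>' \<mu>) / real m - ?d \<nu> \<mu> * ?d \<nu>' \<mu>))"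
    by (simp add: mean_B_error_def limit_error_def sum_distrib_left sum_subtractf[symmetric] right_diff_distrib)
  then have "\<bar>mean_B_error a - limit_error P Cin Cout\<bar> \<le>
      (\<Sum>\<mu><P. \<Sum>\<nu><P. \<Sum>\<nu>'<P. \<bar>Cout $$ (\<nu>,\<nu>') * (fip (overlap a \<nu> \<mu>) (overlap a \<nu>' \<mu>) / real m - ?d \<nu> \<mu> * ?d \<nu>' \<mu>)\<bar>)"
    by (auto intro!: order_trans[OF sum_abs] sum_mono)
  also have "\<dots> \<le> (\<Sum>\<mu><P. \<Sum>\<nu><P. \<Sum>\<nu>'<P. \<bar>Cout $$ (\<nu>,\<nu>')\<bar> * ((\<bar>?d \<nu> \<mu>\<bar> + \<bar>?d \<nu>' \<mu>\<bar>) * sqrt S + S))"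
    using entry_close by (intro sum_mono) (auto simp: abs_mult intro!: mult_left_mono)
  also have "\<dots> = lin_const P Cin Cout * sqrt S + quad_const P Cout * S"
    by (simp add: lin_const_def quad_const_def sum_distrib_right sum.distrib distrib_left distrib_right mult.assoc)
  also have "\<dots> \<le> lin_const P Cin Cout * (\<eta> + S / \<eta>) + quad_const P Cout * S"
    using sqrtS lin_const_nonneg by (intro add_right_mono mult_left_mono)
  finally show ?thesis by (simp add: S_def algebra_simps)
qed

text \<open>Each entry of an error matrix is a centred linear form in one row of the targets, so its
  second moment is read off from the covariance \<open>Cout / m\<close>. The value is the same for
  every row, which cancels the average over \<open>Ny\<close>.\<close>

lemma nn_integral_B:
  "(\<integral>\<^sup>+b. ennreal (final_error P Ny n (task_mat n m a) (task_mat Ny m b)) \<partial>law_B) = ennreal (mean_B_error a)"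
  "0 \<le> mean_B_error a"
proof -
  let ?J = "{..<Ny} \<times> {..<m}"
  define c where "c \<mu> i j e \<nu> = (if fst e = i then overlap a \<nu> \<mu> $$ (snd e, j) else 0)" for \<mu> i j \<nu> and e :: "nat \<times> nat"
  define t where "t \<mu> i j b = (\<Sum>e\<in>?J. \<Sum>\<nu><P. c \<mu> i j e \<nu> * b e \<nu>)" for \<mu> i j and b :: "nat \<times> nat \<Rightarrow> nat \<Rightarrow> real"
  define w where "w \<mu> j = (\<Sum>l<m. \<Sum>\<nu><P. \<Sum>\<nu>'<P. overlap a \<nu> \<mu> $$ (l,j) * overlap a \<nu>' \<mu> $$ (l,j) * ((1 / real m) * Cout $$ (\<nu>,\<nu>')))" for \<mu> j
  have fe: "final_error P Ny n (task_mat n m a) (task_mat Ny m b) = (1 / real Ny) * (\<Sum>\<mu><P. \<Sum>i<Ny. \<Sum>j<m. (t \<mu> i j b)\<^sup>2)" for b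
  proof -
    have "(\<Sum>\<nu><P. \<Sum>l<m. task_mat Ny m b \<nu> $$ (i,l) * overlap a \<nu> \<mu> $$ (l,j)) = t \<mu> i j b" if "i < Ny" for \<mu> i j
    proof -
      have "t \<mu> i j b = (\<Sum>k<Ny. \<Sum>l<m. \<Sum>\<nu><P. c \<mu> i j (k,l) \<nu> * b (k,l) \<nu>)"
        unfolding t_def sum.cartesian_product' ..
      also have "\<dots> = (\<Sum>k<Ny. if k = i then (\<Sum>l<m. \<Sum>\<nu><P. overlap a \<nu> \<mu> $$ (l,j) * b (i,l) \<nu>) else 0)"
        by (intro sum.cong refl) (auto simp: c_def)
      also have "\<dots> = (\<Sum>\<nu><P. \<Sum>l<m. overlap a \<nu> \<mu> $$ (l,j) * b (i,l) \<nu>)"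
        using that by (simp, subst sum.swap, simp)
      finally show ?thesis using that by (simp add: task_mat_def mult.commute)
    qed
    then show ?thesis
      using final_error_resid[of P "task_mat n m a" n m "task_mat Ny m b" Ny]
      by (simp add: task_mat_def[of Ny] task_mat_carrier overlap_def cong: sum.cong)
        (simp add: task_mat_def[of Ny])
  qed
  have cquad: "(\<Sum>e\<in>?J. \<Sum>\<nu><P. \<Sum>\<nu>'<P. c \<mu> i j e \<nu> * c \<mu> i j e \<nu>' * ((1 / real m) \<cdot>\<^sub>m Cout) $$ (\<nu>,\<nu>')) = w \<mu> j" if "i < Ny" for \<mu> i j
  proof -
    have "(\<Sum>e\<in>?J. \<Sum>\<nu><P. \<Sum>\<nu>'<P. c \<mu> i j e \<nu> * c \<mu> i j e \<nu>' * ((1 / real m) \<cdot>\<^sub>m Cout) $$ (\<nu>,\<nu>')) =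
        (\<Sum>k<Ny. if k = i then w \<mu> j else 0)"
      unfolding sum.cartesian_product' w_def using Cout(1) by (intro sum.cong refl) (auto simp: c_def intro!: sum.cong)
    then show ?thesis using that by simp
  qed
  have w0: "0 \<le> w \<mu> j" for \<mu> j
  proof -
    \<comment> \<open>Nonnegativity is read off from the quadratic form of row 0, which exists
      because \<open>Ny\<close> is positive.\<close>
    have "0 < Ny" using Ny by simp
    have "0 \<le> (\<Sum>e\<in>?J. \<Sum>\<nu><P. \<Sum>\<nu>'<P. c \<mu> 0 j e \<nu> * c \<mu> 0 j e \<nu>' * ((1 / real m) \<cdot>\<^sub>m Cout) $$ (\<nu>,\<nu>'))"
      by (intro sum_nonneg mvnormal_quad_nonneg[OF scaled_cov(3,4)])
    then show ?thesis unfolding cquad[OF \<open>0 < Ny\<close>] .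
  qed
  have tI: "(\<integral>\<^sup>+b. ennreal ((t \<mu> i j b)\<^sup>2) \<partial>law_B) = ennreal (w \<mu> j)" if "i < Ny" for \<mu> i j
    using PiM_mvnormal_linear_sq[OF scaled_cov(3,4), of ?J 0 "c \<mu> i j"] cquad[OF that]
    by (simp add: law_B_def t_def)
  have tm: "(\<lambda>b. t \<mu> i j b) \<in> borel_measurable law_B" for \<mu> i j
    unfolding t_def law_B_def
    by (intro borel_measurable_sum borel_measurable_times borel_measurable_const measurable_PiM_comp measurable_mvnormal_component) auto
  have tot: "(1 / real Ny) * (\<Sum>\<mu><P. \<Sum>i<Ny. \<Sum>j<m. w \<mu> j) = mean_B_error a"
  proof -
    have "(\<Sum>j<m. w \<mu> j) = (1 / real m) * (\<Sum>\<nu><P. \<Sum>\<nu>'<P. Cout $$ (\<nu>,\<nu>') * fip (overlap a \<nu> \<mu>) (overlap a \<nu>' \<mu>))" if "\<mu> < P" for \<mu>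
    proof -
      have "(\<Sum>j<m. w \<mu> j) = (\<Sum>\<nu><P. \<Sum>\<nu>'<P. \<Sum>l<m. \<Sum>j<m. overlap a \<nu> \<mu> $$ (l,j) * overlap a \<nu>' \<mu> $$ (l,j) * ((1 / real m) * Cout $$ (\<nu>,\<nu>')))"
      proof -
        have "(\<Sum>j<m. w \<mu> j) = (\<Sum>l<m. \<Sum>j<m. \<Sum>\<nu><P. \<Sum>\<nu>'<P. overlap a \<nu> \<mu> $$ (l,j) * overlap a \<nu>' \<mu> $$ (l,j) * ((1 / real m) * Cout $$ (\<nu>,\<nu>')))"
          unfolding w_def by (rule sum.swap)
        also have "\<dots> = (\<Sum>l<m. \<Sum>\<nu><P. \<Sum>j<m. \<Sum>\<nu>'<P. overlap a \<nu> \<mu> $$ (l,j) * overlap a \<nu>' \<mu> $$ (l,j) * ((1 / real m) * Cout $$ (\<nu>,\<nu>')))"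
          by (intro sum.cong refl sum.swap)
        also have "\<dots> = (\<Sum>l<m. \<Sum>\<nu><P. \<Sum>\<nu>'<P. \<Sum>j<m. overlap a \<nu> \<mu> $$ (l,j) * overlap a \<nu>' \<mu> $$ (l,j) * ((1 / real m) * Cout $$ (\<nu>,\<nu>')))"
          by (intro sum.cong refl sum.swap)
        also have "\<dots> = (\<Sum>\<nu><P. \<Sum>l<m. \<Sum>\<nu>'<P. \<Sum>j<m. overlap a \<nu> \<mu> $$ (l,j) * overlap a \<nu>' \<mu> $$ (l,j) * ((1 / real m) * Cout $$ (\<nu>,\<nu>')))"
          by (rule sum.swap)
        also have "\<dots> = (\<Sum>\<nu><P. \<Sum>\<nu>'<P. \<Sum>l<m. \<Sum>j<m. overlap a \<nu> \<mu> $$ (l,j) * overlap a \<nu>' \<mu> $$ (l,j) * ((1 / real m) * Cout $$ (\<nu>,\<nu>')))"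
          by (intro sum.cong refl sum.swap)
        finally show ?thesis .
      qed
      also have "\<dots> = (\<Sum>\<nu><P. \<Sum>\<nu>'<P. (1 / real m) * (Cout $$ (\<nu>,\<nu>') * fip (overlap a \<nu> \<mu>) (overlap a \<nu>' \<mu>)))"
      proof (intro sum.cong refl)
        fix \<nu> \<nu>' assume "\<nu> \<in> {..<P}" "\<nu>' \<in> {..<P}"
        then have "fip (overlap a \<nu> \<mu>) (overlap a \<nu>' \<mu>) = (\<Sum>l<m. \<Sum>j<m. overlap a \<nu> \<mu> $$ (l,j) * overlap a \<nu>' \<mu> $$ (l,j))"
          using overlap_carrier[of \<nu> \<mu> a] that by (simp add: fip_def)
        then show "(\<Sum>l<m. \<Sum>j<m. overlap a \<nu> \<mu> $$ (l,j) * overlap a \<nu>' \<mu> $$ (l,j) * ((1 / real m) * Cout $$ (\<nu>,\<nu>'))) =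
            (1 / real m) * (Cout $$ (\<nu>,\<nu>') * fip (overlap a \<nu> \<mu>) (overlap a \<nu>' \<mu>))"
          by (simp only: sum_distrib_right[symmetric]) (simp only: mult_ac)
      qed
      finally show ?thesis by (simp only: sum_distrib_left)
    qed
    then have "(\<Sum>\<mu><P. \<Sum>i<Ny. \<Sum>j<m. w \<mu> j) = real Ny * mean_B_error a"
      by (simp add: mean_B_error_def sum_distrib_left)
    then show ?thesis using Ny by simp
  qed
  show "0 \<le> mean_B_error a"
    unfolding tot[symmetric] using w0 by (intro mult_nonneg_nonneg sum_nonneg) auto
  have "(\<integral>\<^sup>+b. ennreal (final_error P Ny n (task_mat n m a) (task_mat Ny m b)) \<partial>law_B) =
      (\<integral>\<^sup>+b. ennreal (1 / real Ny) * (\<Sum>\<mu><P. \<Sum>i<Ny. \<Sum>j<m. ennreal ((t \<mu> i j b)\<^sup>2)) \<partial>law_B)"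
    unfolding fe by (subst ennreal_mult) (simp_all add: sum_ennreal sum_nonneg del: times_divide_eq_left)
  also have "\<dots> = ennreal (1 / real Ny) * (\<integral>\<^sup>+b. (\<Sum>\<mu><P. \<Sum>i<Ny. \<Sum>j<m. ennreal ((t \<mu> i j b)\<^sup>2)) \<partial>law_B)"
    using tm by (intro nn_integral_cmult borel_measurable_sum) auto
  also have "(\<integral>\<^sup>+b. (\<Sum>\<mu><P. \<Sum>i<Ny. \<Sum>j<m. ennreal ((t \<mu> i j b)\<^sup>2)) \<partial>law_B) =
      (\<Sum>\<mu><P. \<integral>\<^sup>+b. (\<Sum>i<Ny. \<Sum>j<m. ennreal ((t \<mu> i j b)\<^sup>2)) \<partial>law_B)"
    using tm by (intro nn_integral_sum borel_measurable_sum) auto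
  also have "\<dots> = (\<Sum>\<mu><P. \<Sum>i<Ny. \<integral>\<^sup>+b. (\<Sum>j<m. ennreal ((t \<mu> i j b)\<^sup>2)) \<partial>law_B)"
    using tm by (intro sum.cong refl nn_integral_sum borel_measurable_sum) auto
  also have "\<dots> = (\<Sum>\<mu><P. \<Sum>i<Ny. \<Sum>j<m. ennreal (w \<mu> j))"
    using tm tI by (intro sum.cong refl) (subst nn_integral_sum, auto)
  also have "ennreal (1 / real Ny) * \<dots> = ennreal (mean_B_error a)"
    unfolding tot[symmetric] using w0 by (subst ennreal_mult) (simp_all add: sum_ennreal sum_nonneg del: sum_constant)
  finally show "(\<integral>\<^sup>+b. ennreal (final_error P Ny n (task_mat n m a) (task_mat Ny m b)) \<partial>law_B) = ennreal (mean_B_error a)" .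
qed

lemma meas_mean_B_error: "mean_B_error \<in> borel_measurable law_A"
  unfolding mean_B_error_def overlap_def
  by (intro borel_measurable_times borel_measurable_const borel_measurable_sum meas_fip[of _ m m] meas_mat_resid meas_mat_task_A) auto

text \<open>For nonnegative measurable integrands the Bochner integral is \<open>enn2real\<close> of
  the extended one, so Tonelli can be applied before integrability of the final error is
  known.\<close>

lemma mean_final_error_eq: "mean_final_error P Ny m n Cin Cout = (\<integral>a. mean_B_error a \<partial>law_A)"
proof -
  let ?M = "law_A \<Otimes>\<^sub>M law_B"
  interpret B: prob_space law_B by (rule prob_space_law)
  let ?f = "\<lambda>ab. final_error P Ny n (task_mat n m (fst ab)) (task_mat Ny m (snd ab))"
  have law: "task_law P Ny m n Cin Cout = ?M" by (simp add: task_law_def law_A_def law_B_def)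
  have lift: "meas_mat (M1 \<Otimes>\<^sub>M M2) p q (\<lambda>w. F (fst w))" if "meas_mat M1 p q F"
    for p q F and M1 M2 :: "(nat \<times> nat \<Rightarrow> nat \<Rightarrow> real) measure"
    using that by (auto simp: meas_mat_def space_pair_measure intro!: measurable_compose[OF measurable_fst])
  have lift2: "meas_mat (M1 \<Otimes>\<^sub>M M2) p q (\<lambda>w. F (snd w))" if "meas_mat M2 p q F"
    for p q F and M1 M2 :: "(nat \<times> nat \<Rightarrow> nat \<Rightarrow> real) measure"
    using that by (auto simp: meas_mat_def space_pair_measure intro!: measurable_compose[OF measurable_snd])
  have fm: "?f \<in> borel_measurable ?M"
    by (rule meas_final_error[of _ _ _ m]) (intro lift lift2 meas_mat_task_A meas_mat_task_B; assumption)+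
  have f0: "0 \<le> ?f ab" for ab
    unfolding final_error_def by (intro mult_nonneg_nonneg sum_nonneg) auto
  have "(\<integral>\<^sup>+ab. ennreal (?f ab) \<partial>?M) = (\<integral>\<^sup>+a. (\<integral>\<^sup>+b. ennreal (?f (a,b)) \<partial>law_B) \<partial>law_A)"
    using fm by (intro B.nn_integral_fst[symmetric]) simp
  also have "\<dots> = (\<integral>\<^sup>+a. ennreal (mean_B_error a) \<partial>law_A)" by (simp add: nn_integral_B(1))
  finally have eq: "(\<integral>\<^sup>+ab. ennreal (?f ab) \<partial>?M) = (\<integral>\<^sup>+a. ennreal (mean_B_error a) \<partial>law_A)" .
  have "mean_final_error P Ny m n Cin Cout = enn2real (\<integral>\<^sup>+ab. ennreal (?f ab) \<partial>?M)"
    unfolding mean_final_error_def law using fm f0 by (intro integral_eq_nn_integral) auto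
  also have "\<dots> = (\<integral>a. mean_B_error a \<partial>law_A)"
    unfolding eq using meas_mean_B_error nn_integral_B(2) by (intro integral_eq_nn_integral[symmetric]) auto
  finally show ?thesis .
qed

text \<open>Outside the null set of rank-deficient inputs \<open>deviation_bound\<close> is an
  integrable majorant of the total deviation. It first yields integrability of
  \<open>mean_B_error\<close> and then, integrated, the estimate.\<close>

lemma mean_final_error_close:
  assumes n: "m + 1 < n div 2" and \<eta>: "0 < \<eta>"
  shows "\<bar>mean_final_error P Ny m n Cin Cout - limit_error P Cin Cout\<bar> \<le>
    lin_const P Cin Cout * \<eta> + (lin_const P Cin Cout / \<eta> + quad_const P Cout) *
      (2 * perturb_const P Cin * real P ^ 3 * (real m / gap))"
proof -
  interpret A: prob_space law_A by (rule prob_space_law)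
  define c where "c = lin_const P Cin Cout / \<eta> + quad_const P Cout"
  define e where "e = 2 * perturb_const P Cin * real P ^ 3 * (real m / gap)"
  define L where "L = limit_error P Cin Cout"
  have c0: "0 \<le> c"
    unfolding c_def using \<eta> lin_const_nonneg quad_const_nonneg by (intro add_nonneg_nonneg divide_nonneg_pos)
  have e0: "0 \<le> e" using n perturb_const_nonneg by (auto simp: e_def gap_def)
  have full: "AE a in law_A. \<forall>\<nu>\<in>{..<P}. det (transpose_mat (task_mat n m a \<nu>) * task_mat n m a \<nu>) \<noteq> 0"
    using AE_full_rank[OF n] by (intro AE_finite_allI) auto
  have close: "AE a in law_A. \<bar>mean_B_error a - L\<bar> \<le> lin_const P Cin Cout * \<eta> + c * deviation_bound a"
    using full
  proof eventually_elim
    case (elim a)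
    then have "total_deviation a \<le> deviation_bound a" by (intro total_deviation_le) auto
    then have "c * total_deviation a \<le> c * deviation_bound a" using c0 by (rule mult_left_mono)
    then show ?case using mean_B_error_close[OF \<eta>, of a] by (simp add: c_def L_def)
  qed
  have bI: "integrable law_A deviation_bound"
    using nn_integral_deviation_bound[OF n] meas_deviation_bound deviation_bound_nonneg
    by (intro integrableI_nonneg) (auto simp: top_unique less_top[symmetric])
  have "ennreal (\<integral>a. deviation_bound a \<partial>law_A) \<le> ennreal e"
    using nn_integral_deviation_bound[OF n] nn_integral_eq_integral[OF bI] deviation_bound_nonneg by (simp add: e_def)
  then have be: "(\<integral>a. deviation_bound a \<partial>law_A) \<le> e" using e0 by simp
  have gI: "integrable law_A (\<lambda>a. lin_const P Cin Cout * \<eta> + c * deviation_bound a)" using bI by simp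
  have dI: "integrable law_A (\<lambda>a. mean_B_error a - L)"
    by (rule Bochner_Integration.integrable_bound[OF gI])
      (use close meas_mean_B_error in \<open>auto elim!: eventually_mono\<close>)
  have mI: "integrable law_A mean_B_error"
    using Bochner_Integration.integrable_add[OF dI, of "\<lambda>_. L"] by simp
  have "mean_final_error P Ny m n Cin Cout - L = (\<integral>a. mean_B_error a - L \<partial>law_A)"
    using mI by (simp add: mean_final_error_eq A.prob_space)
  then have "\<bar>mean_final_error P Ny m n Cin Cout - L\<bar> \<le> (\<integral>a. \<bar>mean_B_error a - L\<bar> \<partial>law_A)"
    using integral_norm_bound[of law_A "\<lambda>a. mean_B_error a - L"] by simp
  also have "\<dots> \<le> (\<integral>a. lin_const P Cin Cout * \<eta> + c * deviation_bound a \<partial>law_A)"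
    using dI gI close by (intro integral_mono_AE) auto
  also have "\<dots> = lin_const P Cin Cout * \<eta> + c * (\<integral>a. deviation_bound a \<partial>law_A)"
    using bI by (simp add: A.prob_space)
  also have "\<dots> \<le> lin_const P Cin Cout * \<eta> + c * e"
    using be c0 by (intro add_left_mono mult_left_mono)
  finally show ?thesis by (simp add: c_def e_def L_def)
qed

end

section \<open>Passage to the limit in \<open>Ns / Nx\<close>\<close>

theorem theorem1:
  fixes P Ny :: nat and Cin Cout :: "real mat" and Ns Nx :: "nat \<Rightarrow> nat"
  assumes "P \<ge> 1" and "Ny \<ge> 1"
    and "Cin \<in> carrier_mat P P" and "Cout \<in> carrier_mat P P"
    and "psd Cin" and "psd Cout"
    and "\<forall>i<P. Cin $$ (i,i) = 1" and "\<forall>i<P. Cout $$ (i,i) = 1"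
    and "\<forall>k. 1 \<le> Ns k" and "\<forall>k. Ns k \<le> Nx k"
    and "(\<lambda>k. real (Ns k) / real (Nx k)) \<longlonglongrightarrow> 0"
  shows "(\<lambda>k. mean_final_error P Ny (Ns k) (Nx k) Cin Cout) \<longlonglongrightarrow>
    frob_sq (psd_sqrt Cout * (1\<^sub>m P - mat_inv (1\<^sub>m P + strict_upper Cin) * Cin))"
proof -
  define L where "L = limit_error P Cin Cout"
  define a where "a = lin_const P Cin Cout"
  define b where "b = quad_const P Cout"
  define K where "K = 2 * perturb_const P Cin * real P ^ 3"
  define \<rho> where "\<rho> k = real (Ns k) / real (Nx k)" for k
  have \<rho>0: "0 < \<rho> k" for k
  proof -
    have "1 \<le> Ns k" "Ns k \<le> Nx k" using assms(9,10) by auto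
    then show ?thesis by (simp add: \<rho>_def)
  qed
  \<comment> \<open>Below 1/12 one has \<open>Nx > 12 Ns\<close>, and with \<open>Ns \<ge> 1\<close>
    the margin \<open>Nx div 2 - Ns - 1\<close> is at least \<open>Nx / 4\<close>.\<close>
  have small: "eventually (\<lambda>k. \<rho> k < 1 / 12) sequentially"
    using assms(11) unfolding \<rho>_def[symmetric] by (rule order_tendstoD) simp
  have bound: "eventually (\<lambda>k. \<bar>mean_final_error P Ny (Ns k) (Nx k) Cin Cout - L\<bar> \<le>
      a * sqrt (\<rho> k) + (a / sqrt (\<rho> k) + b) * (K * (4 * \<rho> k))) sequentially"
    using small
  proof eventually_elim
    case (elim k)
    let ?m = "Ns k" and ?n = "Nx k"
    have m1: "1 \<le> real ?m" using assms(9) by simp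
    have n0: "0 < real ?n" using m1 assms(10)[rule_format, of k] by linarith
    have mn: "12 * real ?m < real ?n" using elim n0 by (simp add: \<rho>_def field_simps)
    have "real (?n div 2) \<ge> real ?n / 2 - 1 / 2" by linarith
    then have gap: "real ?n / 4 \<le> real (?n div 2) - real ?m - 1" using mn m1 by linarith
    then have n: "?m + 1 < ?n div 2" using n0 by linarith
    interpret task_model P Ny ?n ?m Cin Cout using assms by unfold_locales auto
    \<comment> \<open>The square root of \<rho> plays the part of \<eta>: it balances \<eta> against
      \<rho> / \<eta>.\<close>
    have s0: "0 < sqrt (\<rho> k)" using \<rho>0 by simp
    have "real ?m / gap \<le> real ?m / (real ?n / 4)"
      unfolding gap_def using gap n0 by (intro divide_left_mono) auto
    then have "real ?m / gap \<le> 4 * \<rho> k" by (simp add: \<rho>_def mult.commute)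
    then have "K * (real ?m / gap) \<le> K * (4 * \<rho> k)"
      using perturb_const_nonneg by (intro mult_left_mono) (auto simp: K_def)
    moreover have "0 \<le> a / sqrt (\<rho> k) + b"
      unfolding a_def b_def using s0 lin_const_nonneg quad_const_nonneg by (intro add_nonneg_nonneg divide_nonneg_pos)
    ultimately have "(a / sqrt (\<rho> k) + b) * (K * (real ?m / gap)) \<le> (a / sqrt (\<rho> k) + b) * (K * (4 * \<rho> k))"
      by (rule mult_left_mono)
    then show ?case
      using mean_final_error_close[OF n s0] by (simp add: L_def a_def b_def K_def)
  qed
  have eq: "a * sqrt (\<rho> k) + (a / sqrt (\<rho> k) + b) * (K * (4 * \<rho> k)) =
      a * sqrt (\<rho> k) + 4 * K * a * sqrt (\<rho> k) + 4 * K * b * \<rho> k" for k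
  proof -
    have "a / sqrt (\<rho> k) * (K * (4 * \<rho> k)) = 4 * K * a * (\<rho> k / sqrt (\<rho> k))" by simp
    also have "\<rho> k / sqrt (\<rho> k) = sqrt (\<rho> k)" using \<rho>0[of k] by (simp add: real_div_sqrt)
    finally show ?thesis by (simp add: algebra_simps)
  qed
  have "\<rho> \<longlonglongrightarrow> 0" using assms(11) by (simp add: \<rho>_def[abs_def])
  then have "(\<lambda>k. a * sqrt (\<rho> k) + 4 * K * a * sqrt (\<rho> k) + 4 * K * b * \<rho> k) \<longlonglongrightarrow>
      a * sqrt 0 + 4 * K * a * sqrt 0 + 4 * K * b * 0"
    by (intro tendsto_intros)
  then have "(\<lambda>k. a * sqrt (\<rho> k) + (a / sqrt (\<rho> k) + b) * (K * (4 * \<rho> k))) \<longlonglongrightarrow> 0"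
    unfolding eq by simp
  then have "(\<lambda>k. mean_final_error P Ny (Ns k) (Nx k) Cin Cout - L) \<longlonglongrightarrow> 0"
    by (rule Lim_null_comparison[rotated]) (use bound in simp)
  then have "(\<lambda>k. mean_final_error P Ny (Ns k) (Nx k) Cin Cout) \<longlonglongrightarrow> L" by (rule LIM_zero_cancel)
  then show ?thesis
    unfolding L_def limit_error_eq[OF assms(1,3,4,6)] .
qed

end
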